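(* Let $\Gamma$ be a finitely generated group and $n\geqslant 1$. The Zariski-tangent space at the trivial character of $\mathrm{Hom}(\Gamma,\mathrm{GL}_n(\mathbb{C}))/\!/\mathrm{GL}_n(\mathbb{C})$ is naturally isomorphic to the space of central functions $f\colon\Gamma\to\mathbb{C}$ satisfying the following equality: $$\forall\gamma_0,\ldots,\gamma_n\in\Gamma,\qquad \sum_{k=1}^{n+1}\ \sum_{\substack{0\leqslant i_1,\ldots,i_k\leqslant n\\ i_1,\ldots,i_k\text{ pairwise distinct}}}\frac{(-1)^k}{k!}f(\gamma_{i_1}\cdots\gamma_{i_k})=0,$$ where a tangent vector $v$ corresponds to the function $f(\gamma)=v(t_\gamma-n)$.
   Context: A function on $\Gamma$ is central if it is invariant by conjugation. $A_n(\Gamma)$ denotes the (possibly non-reduced) $\mathbb{C}$-algebra of regular functions on $\mathrm{Hom}(\Gamma,\mathrm{GL}_n(\mathbb{C}))$ (generated by the entries of the images of generators of $\Gamma$ and the inverses of their determinants, modulo the relations of $\Gamma$). $\mathrm{GL}_n(\mathbb{C})$ acts by conjugation, and $\mathrm{Hom}(\Gamma,\mathrm{GL}_n(\mathbb{C}))/\!/\mathrm{GL}_n(\mathbb{C})$ is the affine scheme with ring of functions $A_n(\Gamma)^{\mathrm{GL}_n(\mathbb{C})}$. This invariant ring is generated by the functions $t_\gamma(\rho)=\mathrm{Tr}\,\rho(\gamma)$. The trivial character corresponds to the maximal ideal $m$ generated by the $t_\gamma-n$, $\gamma\in\Gamma$; the Zariski-tangent space there is the dual of $m/m^2$. *)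

theory Defs
  imports
    "HOL-Analysis.Determinants"
    "HOL-Library.Poly_Mapping"
    "HOL-Algebra.Generated_Groups"
    "HOL-Algebra.QuotRing"
    "HOL-Algebra.Ideal_Product"
    "HOL-Algebra.Algebraic_Closure_Type"
begin

section \<open>The polynomial ring in the matrix entries and the inverse determinants\<close>

text \<open>
  For a generating set \<open>S\<close> of \<open>\<Gamma>\<close>, \<open>Entry s i j\<close> is the coordinate \<open>\<rho>(s)\<^sub>i\<^sub>j\<close> and
  \<open>DetInv s\<close> is the coordinate \<open>det (\<rho>(s))\<^sup>-\<^sup>1\<close>.  The size of the matrices is \<open>n = CARD('n)\<close>,
  which is automatically at least 1.
\<close>

datatype ('g, 'n) coord = Entry 'g 'n 'n | DetInv 'g

type_synonym ('g, 'n) cpoly = "(('g, 'n) coord \<Rightarrow>\<^sub>0 nat) \<Rightarrow>\<^sub>0 complex"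

definition Const :: "complex \<Rightarrow> ('g, 'n) cpoly"
  where "Const c = Poly_Mapping.single 0 c"

definition Var :: "('g, 'n) coord \<Rightarrow> ('g, 'n) cpoly"
  where "Var x = Poly_Mapping.single (Poly_Mapping.single x 1) 1"

definition poly_subst ::
    "(('g, 'n) coord \<Rightarrow> ('g, 'n) cpoly) \<Rightarrow> ('g, 'n) cpoly \<Rightarrow> ('g, 'n) cpoly"
  where "poly_subst \<phi> p =
    (\<Sum>m\<in>Poly_Mapping.keys p. Const (Poly_Mapping.lookup p m) *
       (\<Prod>x\<in>Poly_Mapping.keys m. \<phi> x ^ Poly_Mapping.lookup m x))"

fun coord_gen :: "('g, 'n) coord \<Rightarrow> 'g"
  where
    "coord_gen (Entry s i j) = s"
  | "coord_gen (DetInv s) = s"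

definition poly_ring :: "'g set \<Rightarrow> ('g, 'n) cpoly ring"
  where "poly_ring S = ring_of_type_algebra
    \<lparr>carrier := {p. \<forall>m\<in>Poly_Mapping.keys p. \<forall>x\<in>Poly_Mapping.keys m. coord_gen x \<in> S}\<rparr>"


section \<open>Words in the generators and the generic representation\<close>

text \<open>A letter \<open>(s, False)\<close> stands for \<open>s\<close>, a letter \<open>(s, True)\<close> for \<open>s\<^sup>-\<^sup>1\<close>.\<close>

definition word_val :: "('g, 'z) monoid_scheme \<Rightarrow> ('g \<times> bool) list \<Rightarrow> 'g"
  where "word_val \<Gamma> w =
    foldr (\<lambda>(s, b) x. (if b then inv\<^bsub>\<Gamma>\<^esub> s else s) \<otimes>\<^bsub>\<Gamma>\<^esub> x) w \<one>\<^bsub>\<Gamma>\<^esub>"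

text \<open>
  The \<open>(i, j)\<close> entry of the adjugate is the determinant of the matrix obtained from \<open>A\<close> by
  replacing the \<open>i\<close>-th column by the \<open>j\<close>-th standard basis vector (Cramer's rule).
\<close>

definition adjugate :: "'a::comm_ring_1^'n^'n \<Rightarrow> 'a^'n^'n"
  where "adjugate A =
    (\<chi> i j. det (\<chi> k l. if l = i then (if k = j then 1 else 0) else A $ k $ l))"

definition gen_mat :: "'g \<Rightarrow> ('g, 'n::finite) cpoly^'n^'n"
  where "gen_mat s = (\<chi> i j. Var (Entry s i j))"

definition gen_mat_inv :: "'g \<Rightarrow> ('g, 'n::finite) cpoly^'n^'n"
  where "gen_mat_inv s = (\<chi> i j. Var (DetInv s) * adjugate (gen_mat s) $ i $ j)"

definition word_mat :: "('g \<times> bool) list \<Rightarrow> ('g, 'n::finite) cpoly^'n^'n"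
  where "word_mat w =
    foldr (\<lambda>(s, b) M. (if b then gen_mat_inv s else gen_mat s) ** M) w (mat 1)"


section \<open>The algebra of functions on the representation scheme\<close>

text \<open>
  The relations of \<open>\<Gamma>\<close> are all the words in the generators and their inverses with value \<open>1\<close>.
  No radical is taken, so the quotient may be non-reduced.
\<close>

definition rep_ideal :: "('g, 'z) monoid_scheme \<Rightarrow> 'g set \<Rightarrow> ('g, 'n::finite) cpoly set"
  where "rep_ideal \<Gamma> S = Idl\<^bsub>poly_ring S\<^esub>
    ({Var (DetInv s) * det (gen_mat s :: ('g, 'n) cpoly^'n^'n) - 1 |s. s \<in> S} \<union>
     {(word_mat w :: ('g, 'n) cpoly^'n^'n) $ i $ j - mat 1 $ i $ j |w i j.
        set w \<subseteq> S \<times> UNIV \<and> word_val \<Gamma> w = \<one>\<^bsub>\<Gamma>\<^esub>})"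

definition rep_algebra ::
    "('g, 'z) monoid_scheme \<Rightarrow> 'g set \<Rightarrow> ('g, 'n::finite) cpoly set ring"
  where "rep_algebra \<Gamma> S = poly_ring S Quot rep_ideal \<Gamma> S"

definition rep_class ::
    "('g, 'z) monoid_scheme \<Rightarrow> 'g set \<Rightarrow> ('g, 'n::finite) cpoly \<Rightarrow> ('g, 'n) cpoly set"
  where "rep_class \<Gamma> S p = rep_ideal \<Gamma> S +>\<^bsub>poly_ring S\<^esub> p"

text \<open>
  The chosen word is immaterial: words with the same value in \<open>\<Gamma>\<close> give congruent matrices
  modulo \<open>rep_ideal\<close>.
\<close>

definition trace_fun ::
    "('g, 'z) monoid_scheme \<Rightarrow> 'g set \<Rightarrow> 'g \<Rightarrow> ('g, 'n::finite) cpoly set"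
  where "trace_fun \<Gamma> S \<gamma> = rep_class \<Gamma> S
    (trace (word_mat (SOME w. set w \<subseteq> S \<times> UNIV \<and> word_val \<Gamma> w = \<gamma>) :: ('g, 'n) cpoly^'n^'n))"


section \<open>Conjugation and invariants\<close>

definition const_mat :: "complex^'n^'n \<Rightarrow> ('g, 'n::finite) cpoly^'n^'n"
  where "const_mat g = (\<chi> i j. Const (g $ i $ j))"

text \<open>The action \<open>(g \<cdot> p)(\<rho>) = p (g\<^sup>-\<^sup>1 \<rho> g)\<close>.\<close>

definition conj_poly :: "complex^'n^'n \<Rightarrow> ('g, 'n::finite) cpoly \<Rightarrow> ('g, 'n) cpoly"
  where "conj_poly g = poly_subst (\<lambda>x. case x of
      Entry s i j \<Rightarrow> (const_mat (matrix_inv g) ** gen_mat s ** const_mat g) $ i $ j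
    | DetInv s \<Rightarrow> Var (DetInv s))"

text \<open>
  Conjugation is an automorphism of the polynomial ring that preserves \<open>rep_ideal\<close>, so it acts
  on the quotient by taking images of cosets.
\<close>

definition invariant_ring ::
    "('g, 'z) monoid_scheme \<Rightarrow> 'g set \<Rightarrow> ('g, 'n::finite) cpoly set ring"
  where "invariant_ring \<Gamma> S = rep_algebra \<Gamma> S
    \<lparr>carrier := {a \<in> carrier (rep_algebra \<Gamma> S).
       \<forall>g :: complex^'n^'n. invertible g \<longrightarrow> conj_poly g ` a = a}\<rparr>"


section \<open>The Zariski tangent space at the trivial character\<close>

text \<open>The function \<open>t\<^sub>\<gamma> - n\<close>.\<close>

definition centred_trace ::
    "('g, 'z) monoid_scheme \<Rightarrow> 'g set \<Rightarrow> 'g \<Rightarrow> ('g, 'n::finite) cpoly set"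
  where "centred_trace \<Gamma> S \<gamma> =
    trace_fun \<Gamma> S \<gamma> \<ominus>\<^bsub>invariant_ring \<Gamma> S\<^esub> rep_class \<Gamma> S (Const (of_nat CARD('n)))"

definition trivial_ideal ::
    "('g, 'z) monoid_scheme \<Rightarrow> 'g set \<Rightarrow> ('g, 'n::finite) cpoly set set"
  where "trivial_ideal \<Gamma> S =
    Idl\<^bsub>invariant_ring \<Gamma> S\<^esub> {centred_trace \<Gamma> S \<gamma> |\<gamma>. \<gamma> \<in> carrier \<Gamma>}"

definition trivial_ideal_sq ::
    "('g, 'z) monoid_scheme \<Rightarrow> 'g set \<Rightarrow> ('g, 'n::finite) cpoly set set"
  where "trivial_ideal_sq \<Gamma> S =
    ideal_prod (invariant_ring \<Gamma> S) (trivial_ideal \<Gamma> S) (trivial_ideal \<Gamma> S)"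

text \<open>
  With \<open>B\<close> the invariant ring and \<open>m\<close> the ideal above, \<open>m / m\<^sup>2\<close> is the image of \<open>m\<close> in the
  ring \<open>B / m\<^sup>2\<close>; its addition and its multiplication by scalars are those of that ring.
\<close>

definition square_quotient ::
    "('g, 'z) monoid_scheme \<Rightarrow> 'g set \<Rightarrow> ('g, 'n::finite) cpoly set set ring"
  where "square_quotient \<Gamma> S = invariant_ring \<Gamma> S Quot trivial_ideal_sq \<Gamma> S"

definition square_class ::
    "('g, 'z) monoid_scheme \<Rightarrow> 'g set \<Rightarrow> ('g, 'n::finite) cpoly set \<Rightarrow> ('g, 'n) cpoly set set"
  where "square_class \<Gamma> S a = trivial_ideal_sq \<Gamma> S +>\<^bsub>invariant_ring \<Gamma> S\<^esub> a"

definition cotangent_space ::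
    "('g, 'z) monoid_scheme \<Rightarrow> 'g set \<Rightarrow> ('g, 'n::finite) cpoly set set set"
  where "cotangent_space \<Gamma> S = square_class \<Gamma> S ` trivial_ideal \<Gamma> S"

definition cotangent_scale ::
    "('g, 'z) monoid_scheme \<Rightarrow> 'g set \<Rightarrow> complex \<Rightarrow>
      ('g, 'n::finite) cpoly set set \<Rightarrow> ('g, 'n) cpoly set set"
  where "cotangent_scale \<Gamma> S c x =
    square_class \<Gamma> S (rep_class \<Gamma> S (Const c)) \<otimes>\<^bsub>square_quotient \<Gamma> S\<^esub> x"

text \<open>
  The dual of \<open>m / m\<^sup>2\<close>.  A functional on \<open>m / m\<^sup>2\<close> is represented by its extension by zero to
  the whole type, so that the vector space operations are the pointwise ones; the same convention
  is used for functions on \<open>carrier \<Gamma>\<close> below.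
\<close>

definition tangent_space ::
    "('g, 'z) monoid_scheme \<Rightarrow> 'g set \<Rightarrow> (('g, 'n::finite) cpoly set set \<Rightarrow> complex) set"
  where "tangent_space \<Gamma> S = {v.
    (\<forall>x\<in>cotangent_space \<Gamma> S. \<forall>y\<in>cotangent_space \<Gamma> S.
       v (x \<oplus>\<^bsub>square_quotient \<Gamma> S\<^esub> y) = v x + v y) \<and>
    (\<forall>c. \<forall>x\<in>cotangent_space \<Gamma> S. v (cotangent_scale \<Gamma> S c x) = c * v x) \<and>
    (\<forall>x. x \<notin> cotangent_space \<Gamma> S \<longrightarrow> v x = 0)}"


section \<open>Central functions\<close>

definition central_function :: "('g, 'z) monoid_scheme \<Rightarrow> ('g \<Rightarrow> complex) \<Rightarrow> bool"
  where "central_function \<Gamma> f \<longleftrightarrow>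
    (\<forall>\<gamma>\<in>carrier \<Gamma>. \<forall>\<delta>\<in>carrier \<Gamma>. f (\<delta> \<otimes>\<^bsub>\<Gamma>\<^esub> \<gamma> \<otimes>\<^bsub>\<Gamma>\<^esub> inv\<^bsub>\<Gamma>\<^esub> \<delta>) = f \<gamma>)"

definition central_solutions :: "('g, 'z) monoid_scheme \<Rightarrow> nat \<Rightarrow> ('g \<Rightarrow> complex) set"
  where "central_solutions \<Gamma> n = {f.
    central_function \<Gamma> f \<and>
    (\<forall>\<gamma> :: nat \<Rightarrow> 'g. (\<forall>i\<le>n. \<gamma> i \<in> carrier \<Gamma>) \<longrightarrow>
      (\<Sum>k = 1..n + 1. \<Sum>js\<in>{js. length js = k \<and> set js \<subseteq> {0..n} \<and> distinct js}.
         (-1) ^ k / fact k * f (foldr (\<otimes>\<^bsub>\<Gamma>\<^esub>) (map \<gamma> js) \<one>\<^bsub>\<Gamma>\<^esub>)) = 0) \<and>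
    (\<forall>\<gamma>. \<gamma> \<notin> carrier \<Gamma> \<longrightarrow> f \<gamma> = 0)}"


section \<open>Isomorphisms of spaces of complex functions\<close>

definition function_space :: "('a \<Rightarrow> complex) set \<Rightarrow> bool"
  where "function_space V \<longleftrightarrow>
    (\<lambda>x. 0) \<in> V \<and>
    (\<forall>v\<in>V. \<forall>w\<in>V. (\<lambda>x. v x + w x) \<in> V) \<and>
    (\<forall>c. \<forall>v\<in>V. (\<lambda>x. c * v x) \<in> V)"

definition linear_iso_betw ::
    "(('a \<Rightarrow> complex) \<Rightarrow> ('b \<Rightarrow> complex)) \<Rightarrow> ('a \<Rightarrow> complex) set \<Rightarrow> ('b \<Rightarrow> complex) set \<Rightarrow> bool"
  where "linear_iso_betw \<Phi> V W \<longleftrightarrow>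
    function_space V \<and> function_space W \<and> bij_betw \<Phi> V W \<and>
    (\<forall>v\<in>V. \<forall>w\<in>V. \<Phi> (\<lambda>x. v x + w x) = (\<lambda>y. \<Phi> v y + \<Phi> w y)) \<and>
    (\<forall>c. \<forall>v\<in>V. \<Phi> (\<lambda>x. c * v x) = (\<lambda>y. c * \<Phi> v y))"

end

theory Submission
  imports
    Defs
    "HOL-Combinatorics.Multiset_Permutations"
    "HOL-Combinatorics.Cycles"
begin

text \<open>
  Write \<open>y\<^sub>\<gamma> = \<rho>(\<gamma>) - 1\<close>.  Expanding the products \<open>(\<gamma>\<^sub>0 - 1) \<cdots> (\<gamma>\<^sub>n - 1)\<close> in the group
  algebra, the equation says that \<open>f(1) = 0\<close> and that \<open>f\<close> vanishes on the symmetrized products of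
  \<open>n + 1\<close> elements of the augmentation ideal.  This holds for a tangent vector because the alternating
  sum over \<open>S\<^bsub>n+1\<^esub>\<close> of the traces of \<open>n + 1\<close> matrices \<open>y\<^sub>\<gamma>\<close> along permutations is zero and, modulo
  \<open>m\<^sup>2\<close>, only the full cycles contribute.

  By the first fundamental theorem (invariants are trace polynomials, also modulo the non-radical
  ideal of relations, by a reductivity argument), a tangent vector is determined by \<open>f\<close>.  For the
  converse, a solution \<open>f\<close> defines a function on each symmetric group (the value of \<open>f\<close> along full
  cycles, zero on other permutations) that kills the antisymmetrizers on \<open>n + 1\<close> letters.  By the
  second fundamental theorem it is given by a unique tensor in the span of the permutations of the
  slots.  The entries of these tensors define a linear functional on polynomials in the entries of
  the \<open>y\<^sub>\<gamma>\<close>; uniqueness makes it compatible with the relations of \<open>\<Gamma>\<close>, and it sends a product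
  of \<open>k\<close> traces \<open>tr y\<^sub>\<gamma>\<close> to \<open>f(\<gamma>)\<close> if \<open>k = 1\<close> and to zero otherwise.
\<close>

section \<open>Orthogonal projection for functions on a finite set\<close>

text \<open>The coefficient \<open>1 / k!\<close> is a count: an injective word of length
  \<open>k\<close> is a subsequence of \<open>(n + 1)! / k!\<close> orderings of the
  \<open>n + 1\<close> elements. Up to a global factor the equation is thus the expanded symmetrized
  product with its term \<open>k = 0\<close> missing, and setting all elements to \<open>1\<close>
  recovers \<open>f(1) = 0\<close>. The obstacle is the passage from \<open>f\<close> to a tangent
  vector. The coordinate ring may be non-reduced, so the functional cannot be read off from points;
  it has to kill every polynomial multiple of a relation, not only the invariant ones. Values on
  products of traces are therefore not enough, and values on products of single matrix entries are
  needed. The dual tensors supply them: they exist because \<open>f\<close> kills all linear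
  relations between slot permutations, and they are unique because the trace pairing is
  nondegenerate on the span. No structure theory of semisimple algebras and no integration over a
  compact group is used. Complements, duals and averages all come from orthogonal projection for a
  Hermitian form, together with closure under adjoints.\<close>

text \<open>Gram-Schmidt with one point of \<open>A\<close> at a time. The members of
  \<open>L\<close> vanishing at the new point form a subspace \<open>L'\<close>, and
  \<open>L\<close> exceeds it by at most one dimension. Functions live on the whole type, but only
  their values on \<open>A\<close> enter, so \<open>L\<close> may be any subspace.\<close>

lemma orthogonal_projection:
  fixes L :: "('x \<Rightarrow> complex) set"
  assumes "finite A"
    and "(\<lambda>x. 0) \<in> L"
    and "\<And>u v. u \<in> L \<Longrightarrow> v \<in> L \<Longrightarrow> (\<lambda>x. u x + v x) \<in> L"
    and "\<And>c u. u \<in> L \<Longrightarrow> (\<lambda>x. c * u x) \<in> L"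
  shows "\<exists>u\<in>L. \<forall>l\<in>L. (\<Sum>x\<in>A. (w x - u x) * cnj (l x)) = 0"
  using assms
proof (induction A arbitrary: L w rule: finite_induct)
  case empty
  then show ?case by auto
next
  case (insert a A)
  define L' where "L' = {l \<in> L. l a = 0}"
  have ind: "\<exists>u\<in>L'. \<forall>l\<in>L'. (\<Sum>x\<in>A. (w x - u x) * cnj (l x)) = 0" for w
    by (rule insert.IH) (use insert.prems in \<open>auto simp: L'_def\<close>)
  have sumL': "(\<Sum>x\<in>insert a A. g x * cnj (l x)) = (\<Sum>x\<in>A. g x * cnj (l x))" if "l \<in> L'" for g l
    using that insert.hyps by (simp add: L'_def)
  show ?case
  proof (cases "\<forall>l\<in>L. l a = 0")
    case True
    then have "L' = L" by (auto simp: L'_def)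
    then show ?thesis using ind[of w] sumL' by auto
  next
    case False
    then obtain l0 where l0: "l0 \<in> L" "l0 a \<noteq> 0" by auto
    obtain u0 where u0: "u0 \<in> L'" "\<forall>l\<in>L'. (\<Sum>x\<in>A. (l0 x - u0 x) * cnj (l x)) = 0"
      using ind by blast
    obtain u1 where u1: "u1 \<in> L'" "\<forall>l\<in>L'. (\<Sum>x\<in>A. (w x - u1 x) * cnj (l x)) = 0"
      using ind by blast
    \<comment> \<open>\<open>e\<close> is \<open>l0\<close> made orthogonal to \<open>L'\<close>. It
      keeps the value of \<open>l0\<close> at \<open>a\<close>, so it spans \<open>L\<close> modulo
      \<open>L'\<close>, and the projection of \<open>w\<close> onto \<open>L\<close> is
      \<open>u1\<close> plus the component of \<open>w - u1\<close> along \<open>e\<close>.\<close>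
    define e where "e = (\<lambda>x. l0 x - u0 x)"
    have eL: "e \<in> L"
    proof -
      have "(\<lambda>x. l0 x + (-1) * u0 x) \<in> L"
        using l0 u0 insert.prems(2)[of l0 "\<lambda>x. (-1) * u0 x"] insert.prems(3)[of u0 "-1"]
        by (auto simp: L'_def)
      then show ?thesis by (simp add: e_def)
    qed
    have ea: "e a \<noteq> 0" using l0 u0 by (auto simp: e_def L'_def)
    have eorth: "(\<Sum>x\<in>insert a A. e x * cnj (l x)) = 0" if "l \<in> L'" for l
      using u0 that by (simp only: sumL'[OF that]) (simp add: e_def)
    have eorth': "(\<Sum>x\<in>insert a A. l x * cnj (e x)) = 0" if "l \<in> L'" for l
    proof -
      have "cnj (\<Sum>x\<in>insert a A. e x * cnj (l x)) = 0" using eorth[OF that] by simp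
      then show ?thesis by (simp add: cnj_sum mult.commute del: sum.insert cong: sum.cong)
    qed
    define N where "N = (\<Sum>x\<in>insert a A. e x * cnj (e x))"
    have Nr: "N = complex_of_real (\<Sum>x\<in>insert a A. (cmod (e x))\<^sup>2)"
      by (simp add: N_def complex_norm_square[symmetric] del: sum.insert)
    have "(\<Sum>x\<in>insert a A. (cmod (e x))\<^sup>2) > 0"
      by (rule sum_pos2[of _ a]) (use insert.hyps ea in auto)
    then have N0: "N \<noteq> 0" unfolding Nr of_real_eq_0_iff by simp
    define c where "c = (\<Sum>x\<in>insert a A. (w x - u1 x) * cnj (e x)) / N"
    define u where "u = (\<lambda>x. u1 x + c * e x)"
    have "u \<in> L" unfolding u_def
      using insert.prems(2)[of u1 "\<lambda>x. c * e x"] insert.prems(3)[OF eL] u1 by (auto simp: L'_def)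
    moreover have "(\<Sum>x\<in>insert a A. (w x - u x) * cnj (l x)) = 0" if lL: "l \<in> L" for l
    proof -
      define d where "d = l a / e a"
      define l' where "l' = (\<lambda>x. l x - d * e x)"
      have "(\<lambda>x. l x + (-d) * e x) \<in> L"
        by (rule insert.prems(2)[OF lL insert.prems(3)[OF eL]])
      then have l'L: "l' \<in> L'" using ea by (simp add: L'_def l'_def d_def)
      have leq: "l x = l' x + d * e x" for x by (simp add: l'_def)
      have s1: "(\<Sum>x\<in>insert a A. (w x - u x) * cnj (l' x)) = 0"
      proof -
        have "(\<Sum>x\<in>insert a A. (w x - u x) * cnj (l' x)) =
          (\<Sum>x\<in>insert a A. (w x - u1 x) * cnj (l' x)) - c * (\<Sum>x\<in>insert a A. e x * cnj (l' x))"
          by (simp add: u_def sum_distrib_left sum_subtractf[symmetric] algebra_simps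
              del: sum.insert)
        also have "\<dots> = 0"
          unfolding eorth[OF l'L] sumL'[OF l'L] using u1 l'L by auto
        finally show ?thesis .
      qed
      have s2: "(\<Sum>x\<in>insert a A. (w x - u x) * cnj (e x)) = 0"
      proof -
        have "(\<Sum>x\<in>insert a A. (w x - u x) * cnj (e x)) =
          (\<Sum>x\<in>insert a A. (w x - u1 x) * cnj (e x)) - c * N"
          by (simp add: u_def N_def sum_distrib_left sum_subtractf[symmetric] algebra_simps
              del: sum.insert)
        also have "\<dots> = 0" using N0 by (simp add: c_def del: sum.insert)
        finally show ?thesis .
      qed
      have "(\<Sum>x\<in>insert a A. (w x - u x) * cnj (l x)) =
        (\<Sum>x\<in>insert a A. (w x - u x) * cnj (l' x)) +
        cnj d * (\<Sum>x\<in>insert a A. (w x - u x) * cnj (e x))"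
        by (simp add: leq sum_distrib_left sum.distrib[symmetric] algebra_simps del: sum.insert)
      then show ?thesis by (simp only: s1 s2) simp
    qed
    ultimately show ?thesis by blast
  qed
qed

section \<open>Linear relations between permutations of tensor slots\<close>

section \<open>Index words and permutations of tensor slots\<close>

text \<open>A word is a basis vector of the tensor power of complex n-space with slots
  \<open>K\<close>, and \<open>if i \<circ> \<sigma> = j then 1 else 0\<close> is the matrix of a
  slot permutation. Words are extensional, so that \<open>i \<circ> \<sigma> = j\<close> depends on
  values in \<open>K\<close> only.\<close>

abbreviation Wd :: "'k set \<Rightarrow> ('k \<Rightarrow> 'n::finite) set"
  where "Wd K \<equiv> K \<rightarrow>\<^sub>E UNIV"

lemma finite_Wd [simp]: "finite K \<Longrightarrow> finite (Wd K :: ('k \<Rightarrow> 'n::finite) set)"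
  by (simp add: finite_PiE)

lemma Wd_comp: "i \<in> Wd K \<Longrightarrow> \<sigma> permutes K \<Longrightarrow> i \<circ> \<sigma> \<in> Wd K"
  by (auto simp: PiE_def extensional_def permutes_def)

lemma bij_betw_Wd_comp:
  assumes "\<sigma> permutes K"
  shows "bij_betw (\<lambda>i. i \<circ> \<sigma>) (Wd K) (Wd K)"
proof (rule bij_betw_byWitness[where f' = "\<lambda>i. i \<circ> inv_into UNIV \<sigma>"])
  show "\<forall>i\<in>Wd K. i \<circ> \<sigma> \<circ> inv_into UNIV \<sigma> = i" "\<forall>i\<in>Wd K. i \<circ> inv_into UNIV \<sigma> \<circ> \<sigma> = i"
    by (simp_all add: comp_assoc permutes_inv_o[OF assms])
  show "(\<lambda>i. i \<circ> \<sigma>) ` Wd K \<subseteq> Wd K" "(\<lambda>i. i \<circ> inv_into UNIV \<sigma>) ` Wd K \<subseteq> Wd K"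
    using Wd_comp[OF _ assms] Wd_comp[OF _ permutes_inv[OF assms]] by blast+
qed

lemma sum_Wd_comp:
  assumes "\<sigma> permutes K"
  shows "(\<Sum>i\<in>Wd K. g (i \<circ> \<sigma>)) = (\<Sum>i\<in>Wd K. g i)"
  using sum.reindex_bij_betw[OF bij_betw_Wd_comp[OF assms]] .

lemma sum_Wd_remove:
  assumes "finite K" "q \<in> K"
  shows "(\<Sum>i\<in>(Wd K :: ('k \<Rightarrow> 'n::finite) set). g i) = (\<Sum>i\<in>Wd (K - {q}). \<Sum>l\<in>UNIV. g (i(q := l)))"
proof -
  have "(\<Sum>i\<in>Wd (K - {q}). \<Sum>l\<in>UNIV. g (i(q := l)))
    = (\<Sum>(i, l)\<in>Wd (K - {q}) \<times> (UNIV::'n set). g (i(q := l)))"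
    by (simp add: sum.cartesian_product)
  also have "\<dots> = (\<Sum>i\<in>Wd K. g i)"
    by (rule sum.reindex_bij_witness[where j = "\<lambda>(i, l). i(q := l)" and
          i = "\<lambda>i. (i(q := undefined), i q)"])
      (use assms in \<open>auto simp: PiE_def extensional_def fun_eq_iff\<close>)
  finally show ?thesis by simp
qed

section \<open>Permutations with long decreasing subsequences\<close>

text \<open>Composition with the transposition of \<open>a\<close> and \<open>b\<close> pairs even
  with odd permutations without changing \<open>g\<close>.\<close>

lemma sum_sign_cancel:
  fixes g :: "('k \<Rightarrow> 'k) \<Rightarrow> 'r::comm_ring_1"
  assumes "finite D" "a \<in> D" "b \<in> D" "a \<noteq> b"
    and g: "\<And>\<tau>. \<tau> permutes D \<Longrightarrow> g (Transposition.transpose a b \<circ> \<tau>) = g \<tau>"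
  shows "(\<Sum>\<tau> | \<tau> permutes D. of_int (sign \<tau>) * g \<tau>) = 0"
proof -
  let ?t = "Transposition.transpose a b" and ?P = "{\<tau>. \<tau> permutes D}"
  have t: "?t permutes D" using assms by (simp add: permutes_swap_id)
  have finP: "finite ?P" using assms(1) by (rule finite_permutations)
  have sgn: "sign (?t \<circ> \<tau>) = - sign \<tau>" if "\<tau> permutes D" for \<tau>
    using that t assms by (subst sign_compose) (auto simp: permutation_permutes sign_swap_id)
  have split: "(\<Sum>\<tau>\<in>?P. of_int (sign \<tau>) * g \<tau>) =
    (\<Sum>\<tau>\<in>{\<tau>\<in>?P. sign \<tau> = 1}. g \<tau>) - (\<Sum>\<tau>\<in>{\<tau>\<in>?P. sign \<tau> = -1}. g \<tau>)"
    unfolding sum.inter_filter[OF finP] sum_subtractf[symmetric]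
    by (rule sum.cong) (auto simp: sign_def)
  have "(\<Sum>\<tau>\<in>{\<tau>\<in>?P. sign \<tau> = 1}. g \<tau>) = (\<Sum>\<tau>\<in>{\<tau>\<in>?P. sign \<tau> = -1}. g \<tau>)"
    by (rule sum.reindex_bij_witness[where i = "\<lambda>\<tau>. ?t \<circ> \<tau>" and j = "\<lambda>\<tau>. ?t \<circ> \<tau>"])
      (auto simp: sgn g permutes_compose[OF _ t] comp_assoc[symmetric])
  then show ?thesis unfolding split by simp
qed

text \<open>Everything below the least moved point is fixed, so by injectivity its image cannot lie
  below it. This is what compares \<open>s \<circ> \<pi>\<close> with \<open>s\<close>
  lexicographically.\<close>

lemma least_moved:
  fixes \<pi> :: "nat \<Rightarrow> nat"
  assumes "\<pi> permutes K" "\<pi> \<noteq> id"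
  obtains r where "r \<in> K" "\<pi> r > r" "\<And>q. q < r \<Longrightarrow> \<pi> q = q"
proof -
  define r where "r = (LEAST r. \<pi> r \<noteq> r)"
  have "\<exists>r. \<pi> r \<noteq> r" using assms(2) by auto
  then have r: "\<pi> r \<noteq> r" unfolding r_def by (rule LeastI_ex)
  have q: "\<pi> q = q" if "q < r" for q
    using not_less_Least[of q "\<lambda>r. \<pi> r \<noteq> r"] that by (auto simp: r_def)
  have "\<pi> r > r"
  proof (rule ccontr)
    assume "\<not> \<pi> r > r"
    with r have "\<pi> r < r" by simp
    with q have "\<pi> (\<pi> r) = \<pi> r" by simp
    then show False using permutes_inj[OF assms(1)] r by (auto dest: injD)
  qed
  moreover have "r \<in> K" using r assms(1) by (auto simp: permutes_def)
  ultimately show thesis using that q by blast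
qed

definition lex_less :: "(nat \<Rightarrow> nat) \<Rightarrow> (nat \<Rightarrow> nat) \<Rightarrow> bool"
  where "lex_less \<sigma> \<tau> \<longleftrightarrow> (\<exists>r. \<sigma> r < \<tau> r \<and> (\<forall>q<r. \<sigma> q = \<tau> q))"

lemma lex_less_irrefl: "\<not> lex_less \<sigma> \<sigma>"
  by (simp add: lex_less_def)

lemma lex_less_trans:
  assumes "lex_less \<sigma> \<tau>" "lex_less \<tau> \<rho>"
  shows "lex_less \<sigma> \<rho>"
proof -
  obtain r where r: "\<sigma> r < \<tau> r" "\<forall>q<r. \<sigma> q = \<tau> q" using assms by (auto simp: lex_less_def)
  obtain s where s: "\<tau> s < \<rho> s" "\<forall>q<s. \<tau> q = \<rho> q" using assms by (auto simp: lex_less_def)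
  show ?thesis unfolding lex_less_def
  proof (intro exI conjI)
    show "\<sigma> (min r s) < \<rho> (min r s)"
      using r s by (cases r s rule: linorder_cases) (auto simp: min_def)
    show "\<forall>q<min r s. \<sigma> q = \<rho> q" using r s by auto
  qed
qed

lemma lex_less_total:
  assumes "\<sigma> \<noteq> \<tau>"
  shows "lex_less \<sigma> \<tau> \<or> lex_less \<tau> \<sigma>"
proof -
  define r where "r = (LEAST r. \<sigma> r \<noteq> \<tau> r)"
  have "\<exists>r. \<sigma> r \<noteq> \<tau> r" using assms by auto
  then have "\<sigma> r \<noteq> \<tau> r" unfolding r_def by (rule LeastI_ex)
  moreover have "\<forall>q<r. \<sigma> q = \<tau> q" unfolding r_def using not_less_Least by blast
  ultimately show ?thesis unfolding lex_less_def by (cases "\<sigma> r" "\<tau> r" rule: linorder_cases) force+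
qed

text \<open>The place in the lexicographic order, turned into a number on which
  \<open>second_fundamental_theorem\<close> can induct.\<close>

definition perm_rank :: "nat set \<Rightarrow> (nat \<Rightarrow> nat) \<Rightarrow> nat"
  where "perm_rank K \<sigma> = card {\<tau>. \<tau> permutes K \<and> lex_less \<tau> \<sigma>}"

lemma perm_rank_mono:
  assumes "finite K" "\<sigma> permutes K" "lex_less \<sigma> \<tau>"
  shows "perm_rank K \<sigma> < perm_rank K \<tau>"
  unfolding perm_rank_def
proof (rule psubset_card_mono)
  show "finite {\<rho>. \<rho> permutes K \<and> lex_less \<rho> \<tau>}"
    using finite_permutations[OF assms(1)] by (rule rev_finite_subset) auto
  show "{\<rho>. \<rho> permutes K \<and> lex_less \<rho> \<sigma>} \<subset> {\<rho>. \<rho> permutes K \<and> lex_less \<rho> \<tau>}"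
    using assms lex_less_trans lex_less_irrefl by blast
qed

definition decreasing :: "(nat \<Rightarrow> nat) \<Rightarrow> nat set \<Rightarrow> bool"
  where "decreasing \<sigma> D \<longleftrightarrow> (\<forall>r\<in>D. \<forall>q\<in>D. r < q \<longrightarrow> \<sigma> q < \<sigma> r)"

lemma noninj_word:
  fixes i :: "'k \<Rightarrow> 'n::finite"
  assumes "finite D" "card D > CARD('n)"
  obtains a b where "a \<in> D" "b \<in> D" "a \<noteq> b" "i a = i b"
proof -
  have "\<not> inj_on i D"
  proof
    assume "inj_on i D"
    then have "card D \<le> card (UNIV :: 'n set)" by (rule card_inj_on_le) auto
    with assms show False by simp
  qed
  then show thesis using that by (auto simp: inj_on_def)
qed

text \<open>
  The labels are the lengths of the longest decreasing subsequences ending at each position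
  (patience sorting).
\<close>

lemma good_permutation_labels:
  fixes \<sigma> :: "nat \<Rightarrow> nat"
  assumes "finite K" "\<sigma> permutes K"
    and good: "\<And>D. D \<subseteq> K \<Longrightarrow> decreasing \<sigma> D \<Longrightarrow> card D \<le> n"
  obtains l where "\<And>r. r \<in> K \<Longrightarrow> l r \<in> {1..n}"
    "\<And>r q. r \<in> K \<Longrightarrow> q \<in> K \<Longrightarrow> r < q \<Longrightarrow> l r = l q \<Longrightarrow> \<sigma> r < \<sigma> q"
proof -
  define C where "C r = {card D |D. D \<subseteq> K \<inter> {..r} \<and> r \<in> D \<and> decreasing \<sigma> D}" for r
  define l where "l r = Max (C r)" for r
  have fin: "finite (C r)" for r
  proof (rule finite_subset)
    show "C r \<subseteq> card ` Pow (K \<inter> {..r})" by (auto simp: C_def)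
  qed (use assms in auto)
  have ne: "1 \<in> C r" if "r \<in> K" for r
    using that unfolding C_def by (auto intro!: exI[of _ "{r}"] simp: decreasing_def)
  have "l r \<in> {1..n}" if r: "r \<in> K" for r
  proof -
    have "l r \<in> C r" unfolding l_def by (rule Max_in) (use fin ne[OF r] in auto)
    moreover have "1 \<le> l r" unfolding l_def by (rule Max_ge) (use fin ne[OF r] in auto)
    ultimately show ?thesis using good by (auto simp: C_def)
  qed
  moreover have "\<sigma> r < \<sigma> q" if rq: "r \<in> K" "q \<in> K" "r < q" "l r = l q" for r q
  proof (rule ccontr)
    assume "\<not> \<sigma> r < \<sigma> q"
    moreover have "\<sigma> r \<noteq> \<sigma> q" using permutes_inj[OF assms(2)] rq by (auto dest: injD)
    ultimately have less: "\<sigma> q < \<sigma> r" by simp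
    have "l r \<in> C r" unfolding l_def by (rule Max_in) (use fin ne[OF rq(1)] in auto)
    then obtain D where D: "D \<subseteq> K \<inter> {..r}" "r \<in> D" "decreasing \<sigma> D" "l r = card D"
      by (auto simp: C_def)
    have "finite D" using D assms(1) by (meson finite_Int finite_subset)
    have "q \<notin> D" using D rq by auto
    \<comment> \<open>A longest decreasing set ending at \<open>r\<close>, extended by
      \<open>q\<close>, would make the label of \<open>q\<close> exceed that of
      \<open>r\<close>.\<close>
    have "decreasing \<sigma> (insert q D)" unfolding decreasing_def
    proof (intro ballI impI)
      fix x y assume xy: "x \<in> insert q D" "y \<in> insert q D" "x < y"
      have le: "\<sigma> r \<le> \<sigma> x" if "x \<in> D" for x
        using D that unfolding decreasing_def by (metis IntE atMost_iff le_eq_less_or_eq less_imp_le subsetD)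
      show "\<sigma> y < \<sigma> x"
        using xy D rq less le[of x] by (auto simp: decreasing_def)
    qed
    then have "card (insert q D) \<in> C q" using D rq unfolding C_def by force
    then have "card (insert q D) \<le> l q" unfolding l_def using fin by simp
    then show False using \<open>finite D\<close> \<open>q \<notin> D\<close> D rq by simp
  qed
  ultimately show thesis using that by blast
qed

section \<open>Relations between permutations of tensors\<close>

text \<open>
  Second fundamental theorem: multiplying a permutation that is decreasing on a set of
  \<open>CARD('n) + 1\<close> slots with the antisymmetrizer of these slots yields lexicographically smaller
  permutations, while permutations without such a set act linearly independently on tensors.
\<close>

theorem second_fundamental_theorem:
  fixes a F :: "(nat \<Rightarrow> nat) \<Rightarrow> complex"
  assumes fin: "finite K"
    and ker: "\<And>(i :: nat \<Rightarrow> 'n::finite) j. i \<in> Wd K \<Longrightarrow> j \<in> Wd K \<Longrightarrow>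
      (\<Sum>\<sigma> | \<sigma> permutes K. if i \<circ> \<sigma> = j then a \<sigma> else 0) = 0"
    and alt: "\<And>D \<beta>. D \<subseteq> K \<Longrightarrow> card D = CARD('n) + 1 \<Longrightarrow> \<beta> permutes K \<Longrightarrow>
      (\<Sum>\<tau> | \<tau> permutes D. of_int (sign \<tau>) * F (\<beta> \<circ> \<tau>)) = 0"
  shows "(\<Sum>\<sigma> | \<sigma> permutes K. a \<sigma> * F \<sigma>) = 0"
proof -
  have finP: "finite {\<sigma>. \<sigma> permutes K}" by (rule finite_permutations[OF fin])
  \<comment> \<open>Induction on a bound for the ranks of the permutations with nonzero coefficient.
    Below, \<open>s\<close> is the leading permutation.\<close>
  have main: "\<lbrakk>\<And>(i :: nat \<Rightarrow> 'n) j. i \<in> Wd K \<Longrightarrow> j \<in> Wd K \<Longrightarrow>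
      (\<Sum>\<sigma> | \<sigma> permutes K. if i \<circ> \<sigma> = j then a \<sigma> else 0) = 0;
      \<And>\<sigma>. \<sigma> permutes K \<Longrightarrow> a \<sigma> \<noteq> 0 \<Longrightarrow> perm_rank K \<sigma> < N\<rbrakk> \<Longrightarrow>
    (\<Sum>\<sigma> | \<sigma> permutes K. a \<sigma> * F \<sigma>) = 0" for N and a :: "(nat \<Rightarrow> nat) \<Rightarrow> complex"
  proof (induction N arbitrary: a)
    case 0
    then have "a \<sigma> = 0" if "\<sigma> permutes K" for \<sigma> using that by blast
    then show ?case by simp
  next
    case (Suc N)
    show ?case
    proof (cases "\<exists>\<sigma>. \<sigma> permutes K \<and> a \<sigma> \<noteq> 0 \<and> perm_rank K \<sigma> = N")
      case False
      show ?thesis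
      proof (rule Suc.IH[OF Suc.prems(1)])
        fix \<sigma> assume "\<sigma> permutes K" "a \<sigma> \<noteq> 0"
        then show "perm_rank K \<sigma> < N" using False Suc.prems(2)[of \<sigma>] by (auto simp: less_Suc_eq)
      qed
    next
      case True
      then obtain s where s: "s permutes K" "a s \<noteq> 0" "perm_rank K s = N" by blast
      have small: "perm_rank K \<sigma> < N" if "\<sigma> permutes K" "a \<sigma> \<noteq> 0" "\<sigma> \<noteq> s" for \<sigma>
        using lex_less_total[OF that(3)] perm_rank_mono[OF fin] that s Suc.prems(2)[of \<sigma>]
        by (metis less_Suc_eq not_less_eq)
      show ?thesis
      proof (cases "\<exists>D\<subseteq>K. decreasing s D \<and> card D = CARD('n) + 1")
        case True
        then obtain D where D: "D \<subseteq> K" "decreasing s D" "card D = CARD('n) + 1" by blast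
        have finD: "finite D" using D fin finite_subset by blast
        \<comment> \<open>The coefficients of \<open>a s\<close> times the product of
          \<open>s\<close> with the antisymmetrizer of \<open>D\<close>. Subtracting them removes
          \<open>s\<close>, preserves the kernel condition, and leaves the sum against
          \<open>F\<close> unchanged by \<open>alt\<close>.\<close>
        define c where "c \<sigma> = (if inv_into UNIV s \<circ> \<sigma> permutes D
          then a s * of_int (sign (inv_into UNIV s \<circ> \<sigma>)) else 0)" for \<sigma>
        have csum: "(\<Sum>\<sigma> | \<sigma> permutes K. c \<sigma> * G \<sigma>) =
            a s * (\<Sum>\<tau> | \<tau> permutes D. of_int (sign \<tau>) * G (s \<circ> \<tau>))" for G :: "(nat \<Rightarrow> nat) \<Rightarrow> complex"
        proof -
          have "(\<Sum>\<sigma> | \<sigma> permutes K. c \<sigma> * G \<sigma>) =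
            (\<Sum>\<sigma> | \<sigma> permutes K. c (s \<circ> \<sigma>) * G (s \<circ> \<sigma>))"
            by (rule setum_permutations_compose_left[OF s(1)])
          also have "\<dots> = (\<Sum>\<tau> | \<tau> permutes K. if \<tau> permutes D then a s * of_int (sign \<tau>) * G (s \<circ> \<tau>) else 0)"
            by (rule sum.cong) (auto simp: c_def comp_assoc[symmetric] permutes_inv_o[OF s(1)])
          also have "\<dots> = (\<Sum>\<tau> | \<tau> permutes D. a s * of_int (sign \<tau>) * G (s \<circ> \<tau>))"
            by (rule sum.mono_neutral_cong_right[OF finP])
              (use permutes_subset[OF _ D(1)] in auto)
          finally show ?thesis by (simp add: sum_distrib_left mult.assoc)
        qed
        define a' where "a' \<sigma> = a \<sigma> - c \<sigma>" for \<sigma>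
        have "(\<Sum>\<sigma> | \<sigma> permutes K. a' \<sigma> * F \<sigma>) = 0"
        proof (rule Suc.IH)
          fix i j :: "nat \<Rightarrow> 'n" assume ij: "i \<in> Wd K" "j \<in> Wd K"
          \<comment> \<open>Two of the \<open>CARD('n) + 1\<close> slots in \<open>D\<close> carry
            the same letter, so the antisymmetrizer kills every word.\<close>
          obtain x y where xy: "x \<in> D" "y \<in> D" "x \<noteq> y" "(i \<circ> s) x = (i \<circ> s) y"
            using noninj_word[OF finD, of "i \<circ> s"] D(3) by auto
          have eq: "i \<circ> s \<circ> (Transposition.transpose x y \<circ> \<tau>) = i \<circ> s \<circ> \<tau>" for \<tau>
            using xy by (auto simp: fun_eq_iff Transposition.transpose_def)
          have "(\<Sum>\<sigma> | \<sigma> permutes K. if i \<circ> \<sigma> = j then a' \<sigma> else 0)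
            = (\<Sum>\<sigma> | \<sigma> permutes K. if i \<circ> \<sigma> = j then a \<sigma> else 0)
              - (\<Sum>\<sigma> | \<sigma> permutes K. c \<sigma> * (if i \<circ> \<sigma> = j then 1 else 0))"
            by (subst sum_subtractf[symmetric], rule sum.cong) (auto simp: a'_def)
          also have "(\<Sum>\<sigma> | \<sigma> permutes K. c \<sigma> * (if i \<circ> \<sigma> = j then 1 else 0)) = 0"
            unfolding csum comp_assoc[symmetric]
            by (subst sum_sign_cancel[OF finD xy(1-3)]) (simp_all only: eq mult_zero_right)
          finally show "(\<Sum>\<sigma> | \<sigma> permutes K. if i \<circ> \<sigma> = j then a' \<sigma> else 0) = 0"
            by (simp only: Suc.prems(1)[OF ij] diff_zero)
        next
          fix \<sigma> assume \<sigma>: "\<sigma> permutes K" "a' \<sigma> \<noteq> 0"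
          have "a' s = 0" by (simp add: a'_def c_def permutes_inv_o[OF s(1)] sign_id permutes_id)
          with \<sigma> have ne: "\<sigma> \<noteq> s" by auto
          show "perm_rank K \<sigma> < N"
          proof (cases "a \<sigma> = 0")
            case False
            then show ?thesis using small \<sigma> ne by blast
          next
            case True
            define \<tau> where "\<tau> = inv_into UNIV s \<circ> \<sigma>"
            have \<tau>: "\<tau> permutes D" using True \<sigma> by (auto simp: a'_def c_def \<tau>_def split: if_splits)
            have eq: "\<sigma> = s \<circ> \<tau>" by (simp add: \<tau>_def comp_assoc[symmetric] permutes_inv_o[OF s(1)])
            have "\<tau> \<noteq> id" using eq ne by auto
            then obtain r where r: "r \<in> D" "\<tau> r > r" "\<And>q. q < r \<Longrightarrow> \<tau> q = q"
              using least_moved[OF \<tau>] by blast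
            have "\<tau> r \<in> D" using \<tau> r by (simp add: permutes_in_image)
            \<comment> \<open>The least slot \<open>r\<close> moved by \<open>\<tau>\<close> goes to
              a later slot of \<open>D\<close>, where the decreasing \<open>s\<close> takes a
              smaller value.\<close>
            then have "lex_less \<sigma> s" unfolding lex_less_def eq
              using r D(2) by (intro exI[of _ r]) (auto simp: decreasing_def)
            then show ?thesis using perm_rank_mono[OF fin \<sigma>(1)] s by metis
          qed
        qed
        then have "(\<Sum>\<sigma> | \<sigma> permutes K. a \<sigma> * F \<sigma>) = (\<Sum>\<sigma> | \<sigma> permutes K. c \<sigma> * F \<sigma>)"
          by (simp add: a'_def left_diff_distrib sum_subtractf)
        also have "\<dots> = 0" using alt[OF D(1,3) s(1)] by (simp add: csum)
        finally show ?thesis .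
      next
        case False
        have good: "card D \<le> CARD('n)" if "D \<subseteq> K" "decreasing s D" for D
        proof (rule ccontr)
          assume "\<not> card D \<le> CARD('n)"
          then obtain D' where D': "D' \<subseteq> D" "card D' = CARD('n) + 1"
            using obtain_subset_with_card_n[of "CARD('n) + 1" D] by auto
          moreover have "decreasing s D'" using that D' by (auto simp: decreasing_def)
          ultimately show False using False that by (metis order_trans)
        qed
        obtain l where l: "\<And>r. r \<in> K \<Longrightarrow> l r \<in> {1..CARD('n)}"
            "\<And>r q. r \<in> K \<Longrightarrow> q \<in> K \<Longrightarrow> r < q \<Longrightarrow> l r = l q \<Longrightarrow> s r < s q"
          using good_permutation_labels[OF fin s(1) good] by blast
        obtain b :: "nat \<Rightarrow> 'n" where b: "bij_betw b {1..CARD('n)} UNIV"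
          using finite_same_card_bij[of "{1..CARD('n)}" "UNIV :: 'n set"] by auto
        \<comment> \<open>The labels become letters, and \<open>i\<close> is chosen such that
          \<open>i \<circ> s = j\<close>. Since \<open>s\<close> increases along slots with the same
          letter, every other \<open>\<sigma>\<close> with \<open>i \<circ> \<sigma> = j\<close> is
          lexicographically larger and has coefficient zero. The kernel condition at
          \<open>(i, j)\<close> then reads \<open>a s = 0\<close>, a contradiction.\<close>
        define j where "j = restrict (b \<circ> l) K"
        define i where "i = j \<circ> inv_into UNIV s"
        have jW: "j \<in> Wd K" by (simp add: j_def)
        have iW: "i \<in> Wd K" unfolding i_def by (rule Wd_comp[OF jW permutes_inv[OF s(1)]])
        have isj: "i \<circ> s = j" by (simp add: i_def comp_assoc permutes_inv_o[OF s(1)])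
        have "a \<sigma> = 0" if \<sigma>: "\<sigma> permutes K" "i \<circ> \<sigma> = j" "\<sigma> \<noteq> s" for \<sigma>
        proof (rule ccontr)
          assume a: "a \<sigma> \<noteq> 0"
          define \<pi> where "\<pi> = inv_into UNIV s \<circ> \<sigma>"
          have \<pi>: "\<pi> permutes K" unfolding \<pi>_def
            by (rule permutes_compose[OF \<sigma>(1) permutes_inv[OF s(1)]])
          have eq: "\<sigma> = s \<circ> \<pi>" by (simp add: \<pi>_def comp_assoc[symmetric] permutes_inv_o[OF s(1)])
          have j\<pi>: "j \<circ> \<pi> = j" using \<sigma>(2) by (simp add: \<pi>_def i_def comp_assoc)
          have "\<pi> \<noteq> id" using eq \<sigma> by auto
          then obtain r where r: "r \<in> K" "\<pi> r > r" "\<And>q. q < r \<Longrightarrow> \<pi> q = q"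
            using least_moved[OF \<pi>] by blast
          have rK: "\<pi> r \<in> K" using \<pi> r by (simp add: permutes_in_image)
          have "j (\<pi> r) = j r" using j\<pi> by (metis comp_apply)
          then have "b (l r) = b (l (\<pi> r))" using rK r(1) by (simp add: j_def)
          then have "l r = l (\<pi> r)"
            by (rule inj_onD[OF bij_betw_imp_inj_on[OF b]]) (rule l(1)[OF r(1)], rule l(1)[OF rK])
          then have "s r < s (\<pi> r)" by (rule l(2)[OF r(1) rK r(2)])
          then have "lex_less s \<sigma>" unfolding lex_less_def eq
            using r by (intro exI[of _ r]) auto
          then show False using perm_rank_mono[OF fin s(1)] small[OF \<sigma>(1) a \<sigma>(3)] s by fastforce
        qed
        then have "(\<Sum>\<sigma> | \<sigma> permutes K. if i \<circ> \<sigma> = j then a \<sigma> else 0)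
            = (\<Sum>\<sigma> | \<sigma> permutes K. if \<sigma> = s then a s else 0)"
          using isj by (intro sum.cong) auto
        also have "\<dots> = a s" using finP s by (simp add: sum.delta)
        finally show ?thesis using Suc.prems(1)[OF iW jW] s by simp
      qed
    qed
  qed
  show ?thesis
  proof (rule main[OF ker])
    fix \<sigma> assume \<sigma>: "\<sigma> permutes K"
    show "perm_rank K \<sigma> < Suc (Max (perm_rank K ` {\<sigma>. \<sigma> permutes K}))"
      unfolding less_Suc_eq_le by (rule Max_ge) (use finP \<sigma> in simp_all)
  qed
qed

section \<open>Full cycles, and values and traces along permutations\<close>

section \<open>Full cycles\<close>

text \<open>A full cycle is presented by its orbit in cyclic order. Excluding \<open>[]\<close>
  leaves the empty set without full cycles, which later gives the empty product of traces the value
  zero.\<close>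

definition cycle_list :: "'k set \<Rightarrow> ('k \<Rightarrow> 'k) \<Rightarrow> 'k list \<Rightarrow> bool"
  where "cycle_list K \<sigma> ls \<longleftrightarrow> ls \<noteq> [] \<and> distinct ls \<and> set ls = K \<and> map \<sigma> ls = rotate1 ls"

lemma cycle_list_rotate1: "cycle_list K \<sigma> ls \<Longrightarrow> cycle_list K \<sigma> (rotate1 ls)"
  by (auto simp: cycle_list_def rotate1_map[symmetric])

lemma cycle_list_rotate: "cycle_list K \<sigma> ls \<Longrightarrow> cycle_list K \<sigma> (rotate t ls)"
  by (induction t) (auto intro: cycle_list_rotate1)

lemma cycle_list_length: "cycle_list K \<sigma> ls \<Longrightarrow> length ls = card K"
  by (auto simp: cycle_list_def distinct_card)

lemma cycle_list_nth:
  assumes "cycle_list K \<sigma> ls" "t < length ls"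
  shows "ls ! t = (\<sigma> ^^ t) (hd ls)"
  using assms(2)
proof (induction t)
  case 0
  then show ?case by (simp add: hd_conv_nth)
next
  case (Suc t)
  have "ls ! Suc t = rotate1 ls ! t" using Suc.prems by (simp add: nth_rotate1)
  also have "\<dots> = map \<sigma> ls ! t" using assms by (simp add: cycle_list_def)
  finally show ?case using Suc by simp
qed

lemma cycle_list_unique:
  assumes "cycle_list K \<sigma> ls" "cycle_list K \<sigma> ls'" "hd ls = hd ls'"
  shows "ls = ls'"
  using assms by (intro nth_equalityI) (auto simp: cycle_list_length cycle_list_nth)

lemma cycle_list_hd:
  assumes "cycle_list K \<sigma> ls" "x \<in> K"
  obtains t where "t < card K" "hd (rotate t ls) = x" "cycle_list K \<sigma> (rotate t ls)"
proof -
  obtain t where "t < length ls" "ls ! t = x"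
    using assms by (auto simp: cycle_list_def in_set_conv_nth)
  moreover from this have "hd (rotate t ls) = x"
    by (subst hd_rotate_conv_nth) (auto simp del: length_greater_0_conv)
  ultimately show thesis
    using that cycle_list_rotate[OF assms(1)] cycle_list_length[OF assms(1)] by metis
qed

lemma cycle_list_start:
  assumes "cycle_list K \<sigma> ls" "x \<in> K"
  obtains ls' where "cycle_list K \<sigma> (x # ls')"
proof -
  obtain t where t: "hd (rotate t ls) = x" "cycle_list K \<sigma> (rotate t ls)"
    using cycle_list_hd[OF assms] .
  then have "rotate t ls = x # tl (rotate t ls)" by (metis cycle_list_def list.exhaust_sel)
  then show thesis using t that by metis
qed

text \<open>A presentation is determined by its head, and rotation brings any element to the front.
  So a full cycle has exactly \<open>card K\<close> presentations, the factor in
  \<open>sum_sign_cyc_val\<close>.\<close>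

lemma cycle_lists_conv_rotate:
  assumes "cycle_list K \<sigma> ls"
  shows "bij_betw (\<lambda>t. rotate t ls) {..<card K} {ls. cycle_list K \<sigma> ls}"
proof (rule bij_betwI')
  fix t u assume "t \<in> {..<card K}" "u \<in> {..<card K}"
  then have tu: "t < length ls" "u < length ls" using cycle_list_length[OF assms] by auto
  show "(rotate t ls = rotate u ls) = (t = u)"
  proof
    assume "rotate t ls = rotate u ls"
    then have "ls ! t = ls ! u" using tu by (metis hd_rotate_conv_nth length_0_conv less_nat_zero_code mod_less)
    then show "t = u" using tu assms by (simp add: cycle_list_def nth_eq_iff_index_eq)
  qed simp
next
  fix t show "rotate t ls \<in> {ls. cycle_list K \<sigma> ls}" using cycle_list_rotate[OF assms] by simp
next
  fix ls' assume ls': "ls' \<in> {ls. cycle_list K \<sigma> ls}"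
  then have "hd ls' \<in> K" by (auto simp: cycle_list_def)
  then obtain t where t: "t < card K" "hd (rotate t ls) = hd ls'" "cycle_list K \<sigma> (rotate t ls)"
    using cycle_list_hd[OF assms] by blast
  then show "\<exists>t\<in>{..<card K}. ls' = rotate t ls"
    using cycle_list_unique[OF t(3), of ls'] ls' by auto
qed

lemma cycle_list_map:
  assumes "cycle_list K \<sigma> ls" "\<pi> permutes K" "\<pi> \<circ> \<sigma> = \<sigma>' \<circ> \<pi>"
  shows "cycle_list K \<sigma>' (map \<pi> ls)"
proof -
  have "map \<sigma>' (map \<pi> ls) = map \<pi> (map \<sigma> ls)" using assms(3) by (auto simp: fun_eq_iff)
  also have "\<dots> = rotate1 (map \<pi> ls)" using assms(1) by (simp add: cycle_list_def rotate1_map)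
  finally have "map \<sigma>' (map \<pi> ls) = rotate1 (map \<pi> ls)" .
  moreover have "set (map \<pi> ls) = K"
    using assms(1,2) by (simp add: cycle_list_def permutes_image)
  moreover have "inj_on \<pi> K" using assms(2) by (simp add: permutes_inj_on)
  ultimately show ?thesis
    using assms(1) by (auto simp: cycle_list_def distinct_map)
qed

text \<open>Because \<open>\<sigma> p = q\<close>, composing with the transposition fixes
  \<open>q\<close> and sends \<open>p\<close> to \<open>\<sigma> q\<close>: the slot
  \<open>q\<close> is cut out of the cycle. Signs, \<open>cyc_val\<close>, \<open>perm_trace\<close>
  and the dual tensors are all treated by this way of removing a slot.\<close>

lemma cycle_list_contract:
  assumes "cycle_list K \<sigma> (p # ls)" "\<sigma> p = q" "p \<noteq> q"
  obtains ls' where "ls = q # ls'" "cycle_list (K - {q}) (\<sigma> \<circ> Transposition.transpose p q) (p # ls')"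
proof -
  from assms obtain ls' where ls: "ls = q # ls'" by (cases ls) (auto simp: cycle_list_def)
  have d: "distinct (p # q # ls')" and s: "\<sigma> q # map \<sigma> ls' = ls' @ [p]"
    using assms(1) by (auto simp: cycle_list_def ls)
  have "map (\<sigma> \<circ> Transposition.transpose p q) ls' = map \<sigma> ls'"
    using d by (auto simp: Transposition.transpose_def)
  then have "map (\<sigma> \<circ> Transposition.transpose p q) (p # ls') = \<sigma> q # map \<sigma> ls'" by simp
  also have "\<dots> = rotate1 (p # ls')" using s by simp
  finally have m: "map (\<sigma> \<circ> Transposition.transpose p q) (p # ls') = rotate1 (p # ls')" .
  have "K = set (p # q # ls')" using assms(1) by (simp only: cycle_list_def ls)
  then have "set (p # ls') = K - {q}" using d by auto
  with m d have "cycle_list (K - {q}) (\<sigma> \<circ> Transposition.transpose p q) (p # ls')"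
    by (simp only: cycle_list_def distinct.simps set_simps) auto
  then show thesis using that ls by blast
qed

lemma cycle_list_expand:
  assumes "cycle_list (K - {q}) (\<sigma> \<circ> Transposition.transpose p q) (p # ls)" "\<sigma> p = q" "q \<in> K"
  shows "cycle_list K \<sigma> (p # q # ls)"
proof -
  have d: "distinct (p # ls)" "set (p # ls) = K - {q}" using assms by (auto simp: cycle_list_def)
  then have m: "map (\<sigma> \<circ> Transposition.transpose p q) ls = map \<sigma> ls"
    by (auto simp: Transposition.transpose_def)
  have "\<sigma> q # map (\<sigma> \<circ> Transposition.transpose p q) ls = ls @ [p]"
    using assms(1) by (auto simp: cycle_list_def)
  then have "map \<sigma> (p # q # ls) = rotate1 (p # q # ls)"
    unfolding m using assms(2) by simp
  then show ?thesis using d assms(3) by (auto simp: cycle_list_def)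
qed

lemma permutes_contract:
  assumes "\<sigma> permutes K" "\<sigma> p = q" "p \<in> K"
  shows "\<sigma> \<circ> Transposition.transpose p q permutes (K - {q})"
proof -
  have q: "q \<in> K" using assms by (metis permutes_in_image)
  have "\<sigma> \<circ> Transposition.transpose p q permutes K"
    by (rule permutes_compose[OF permutes_swap_id assms(1)]) (use assms q in auto)
  then show ?thesis
    by (rule permutes_superset) (use assms(2) in auto)
qed

lemma sign_contract:
  assumes "finite K" "\<sigma> permutes K" "p \<noteq> q"
  shows "sign (\<sigma> \<circ> Transposition.transpose p q) = - sign \<sigma>"
proof -
  have "permutation \<sigma>" using assms permutation_permutes by blast
  then show ?thesis using assms by (simp add: sign_compose permutation_swap_id sign_swap_id)
qed

lemma sign_cycle_list:
  assumes "finite K" "\<sigma> permutes K" "cycle_list K \<sigma> ls"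
  shows "sign \<sigma> = (-1) ^ (card K - 1)"
  using assms
proof (induction "card K" arbitrary: K \<sigma> ls rule: less_induct)
  case less
  obtain p ls' where p: "ls = p # ls'" using less.prems by (cases ls) (auto simp: cycle_list_def)
  show ?case
  proof (cases "\<sigma> p = p")
    case True
    then have "ls' = []"
      using less.prems(3) by (cases ls') (auto simp: p cycle_list_def)
    then have K: "K = {p}" using less.prems(3) by (auto simp: p cycle_list_def)
    then have "\<sigma> = id" using less.prems(2) True by (auto simp: permutes_def fun_eq_iff)
    then show ?thesis by (simp add: K)
  next
    case False
    define q where "q = \<sigma> p"
    have pK: "p \<in> K" using less.prems(3) by (auto simp: p cycle_list_def)
    have qK: "q \<in> K" using less.prems(2) pK by (simp add: q_def permutes_in_image)
    obtain ls'' where c: "cycle_list (K - {q}) (\<sigma> \<circ> Transposition.transpose p q) (p # ls'')"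
      using cycle_list_contract[of K \<sigma> p ls' q] less.prems(3) False by (auto simp: p q_def)
    have "sign (\<sigma> \<circ> Transposition.transpose p q) = (-1) ^ (card (K - {q}) - 1)"
      by (rule less.hyps[OF _ _ permutes_contract[OF less.prems(2) q_def[symmetric] pK] c])
        (use less.prems(1) qK card_Diff1_less[OF less.prems(1) qK] in auto)
    moreover have "card K - 1 = Suc (card (K - {q}) - 1)"
      using less.prems(1) qK pK False card_gt_0_iff[of "K - {q}"] by (auto simp: q_def)
    ultimately show ?thesis
      using sign_contract[OF less.prems(1,2), of p q] False by (simp add: q_def)
  qed
qed

lemma ex1_cycle_perm:
  assumes "finite K" "K \<noteq> {}" "ls \<in> permutations_of_set K"
  shows "\<exists>!\<sigma>. \<sigma> permutes K \<and> cycle_list K \<sigma> ls"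
proof -
  have ls: "distinct ls" "set ls = K" using assms by (auto simp: permutations_of_set_def)
  have "map (cycle_of_list ls) ls = rotate1 ls" using cyclic_rotation[OF ls(1), of 1] by simp
  then have ex: "cycle_of_list ls permutes K \<and> cycle_list K (cycle_of_list ls) ls"
    using cycle_permutes[of ls] ls assms by (auto simp: cycle_list_def)
  show ?thesis
  proof (rule ex1I[of _ "cycle_of_list ls"])
    fix \<sigma> assume \<sigma>: "\<sigma> permutes K \<and> cycle_list K \<sigma> ls"
    show "\<sigma> = cycle_of_list ls"
    proof
      fix x
      show "\<sigma> x = cycle_of_list ls x"
      proof (cases "x \<in> K")
        case True
        have "map \<sigma> ls = map (cycle_of_list ls) ls" using \<sigma> ex by (simp add: cycle_list_def)
        then show ?thesis using True ls by (simp add: map_eq_conv)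
      next
        case False
        then show ?thesis using \<sigma> ex by (metis permutes_not_in)
      qed
    qed
  qed (rule ex)
qed

section \<open>Cyclic evaluation of a trace form\<close>

locale trace_form =
  fixes \<phi> :: "'a list \<Rightarrow> complex"
  assumes rot: "\<phi> (a @ b) = \<phi> (b @ a)"
begin

text \<open>The choice of the list is immaterial by \<open>rot\<close>. The value zero off the full
  cycles mirrors the fact that a product of at least two centred traces lies in
  \<open>m\<^sup>2\<close>.\<close>

definition cyc_val :: "'k set \<Rightarrow> ('k \<Rightarrow> 'a list) \<Rightarrow> ('k \<Rightarrow> 'k) \<Rightarrow> complex"
  where "cyc_val K w \<sigma> = (if \<exists>ls. cycle_list K \<sigma> ls
    then \<phi> (concat (map w (SOME ls. cycle_list K \<sigma> ls))) else 0)"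

lemma phi_rotate1: "\<phi> (concat (map w (rotate1 ls))) = \<phi> (concat (map w ls))"
  by (cases ls) (auto simp: rot)

lemma phi_rotate: "\<phi> (concat (map w (rotate t ls))) = \<phi> (concat (map w ls))"
  by (induction t) (simp_all add: phi_rotate1)

lemma cyc_val_eq:
  assumes "cycle_list K \<sigma> ls"
  shows "cyc_val K w \<sigma> = \<phi> (concat (map w ls))"
proof -
  have "cycle_list K \<sigma> (SOME ls. cycle_list K \<sigma> ls)" using assms by (rule someI)
  then have "(SOME ls. cycle_list K \<sigma> ls) \<in> (\<lambda>t. rotate t ls) ` {..<card K}"
    using bij_betw_imp_surj_on[OF cycle_lists_conv_rotate[OF assms]] by blast
  then show ?thesis using assms by (auto simp: cyc_val_def phi_rotate)
qed

lemma cyc_val_0: "(\<And>ls. \<not> cycle_list K \<sigma> ls) \<Longrightarrow> cyc_val K w \<sigma> = 0"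
  by (simp add: cyc_val_def)

lemma cyc_val_cong:
  assumes "\<And>r. r \<in> K \<Longrightarrow> w r = w' r"
  shows "cyc_val K w \<sigma> = cyc_val K w' \<sigma>"
proof (cases "\<exists>ls. cycle_list K \<sigma> ls")
  case True
  then obtain ls where ls: "cycle_list K \<sigma> ls" by blast
  then have "map w ls = map w' ls" using assms by (auto simp: cycle_list_def)
  then show ?thesis by (simp only: cyc_val_eq[OF ls])
qed (simp add: cyc_val_def)

lemma cyc_val_empty [simp]: "cyc_val {} w \<sigma> = 0"
  by (rule cyc_val_0) (auto simp: cycle_list_def)

lemma cyc_val_conj:
  assumes "\<pi> permutes K" "\<pi> \<circ> \<sigma> = \<sigma>' \<circ> \<pi>"
  shows "cyc_val K w \<sigma>' = cyc_val K (w \<circ> \<pi>) \<sigma>"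
proof (cases "\<exists>ls. cycle_list K \<sigma> ls")
  case True
  then obtain ls where ls: "cycle_list K \<sigma> ls" by blast
  show ?thesis using cyc_val_eq[OF ls] cyc_val_eq[OF cycle_list_map[OF ls assms]]
    by simp
next
  case False
  have "inv_into UNIV \<pi> \<circ> \<sigma>' = inv_into UNIV \<pi> \<circ> (\<sigma>' \<circ> \<pi>) \<circ> inv_into UNIV \<pi>"
    by (simp add: comp_assoc permutes_inv_o[OF assms(1)])
  also have "\<dots> = inv_into UNIV \<pi> \<circ> (\<pi> \<circ> \<sigma>) \<circ> inv_into UNIV \<pi>" by (simp only: assms(2))
  also have "\<dots> = \<sigma> \<circ> inv_into UNIV \<pi>"
    by (simp add: comp_assoc[symmetric] permutes_inv_o[OF assms(1)])
  finally have "\<not> cycle_list K \<sigma>' ls" for ls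
    using cycle_list_map[OF _ permutes_inv[OF assms(1)]] False by blast
  then show ?thesis using False by (simp add: cyc_val_def)
qed

text \<open>The word of \<open>q\<close> directly follows that of \<open>p\<close> along the cycle.
  Appending it to the word of \<open>p\<close> and cutting out \<open>q\<close> leaves the
  concatenation unchanged.\<close>

lemma cyc_val_contract:
  assumes "\<sigma> p = q" "p \<noteq> q" "p \<in> K" "q \<in> K"
  shows "cyc_val K w \<sigma> =
    cyc_val (K - {q}) (w(p := w p @ w q)) (\<sigma> \<circ> Transposition.transpose p q)"
proof -
  have eq: ?thesis if c: "cycle_list K \<sigma> (p # q # ls)"
    "cycle_list (K - {q}) (\<sigma> \<circ> Transposition.transpose p q) (p # ls)" for ls
  proof -
    have "p \<notin> set ls" using c by (auto simp: cycle_list_def)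
    then have m: "map (w(p := w p @ w q)) ls = map w ls" by auto
    have "concat (map (w(p := w p @ w q)) (p # ls)) = (w p @ w q) @ concat (map (w(p := w p @ w q)) ls)"
      by simp
    also have "\<dots> = concat (map w (p # q # ls))" unfolding m by simp
    finally show ?thesis by (simp only: cyc_val_eq[OF c(1)] cyc_val_eq[OF c(2)])
  qed
  show ?thesis
  proof (cases "\<exists>ls. cycle_list K \<sigma> ls")
    case True
    then obtain ls where ls: "cycle_list K \<sigma> (p # ls)" using cycle_list_start assms(3) by metis
    then show ?thesis using cycle_list_contract[OF ls assms(1,2)] eq by metis
  next
    case False
    have "\<not> cycle_list (K - {q}) (\<sigma> \<circ> Transposition.transpose p q) ls" for ls
    proof
      assume "cycle_list (K - {q}) (\<sigma> \<circ> Transposition.transpose p q) ls"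
      then obtain ls' where "cycle_list (K - {q}) (\<sigma> \<circ> Transposition.transpose p q) (p # ls')"
        using cycle_list_start assms by (metis DiffI singletonD)
      from cycle_list_expand[OF this assms(1,4)] False show False by blast
    qed
    then show ?thesis using False by (simp add: cyc_val_def)
  qed
qed

lemma cyc_val_fixed:
  assumes "\<sigma> q = q" "q \<in> K" "K \<noteq> {q}"
  shows "cyc_val K w \<sigma> = 0"
proof (rule cyc_val_0)
  fix ls show "\<not> cycle_list K \<sigma> ls"
  proof
    assume "cycle_list K \<sigma> ls"
    then obtain ls' where ls': "cycle_list K \<sigma> (q # ls')" using cycle_list_start assms(2) by metis
    then show False using assms by (cases ls') (auto simp: cycle_list_def)
  qed
qed

lemma cyc_val_single: "\<sigma> q = q \<Longrightarrow> cyc_val {q} w \<sigma> = \<phi> (w q)"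
  using cyc_val_eq[of "{q}" \<sigma> "[q]" w] by (simp add: cycle_list_def)

text \<open>Double counting of pairs of a full cycle and a presentation: each ordering of
  \<open>K\<close> presents one cycle, each cycle has \<open>card K\<close> presentations, and all
  full cycles have the sign \<open>(-1) ^ (card K - 1)\<close>. It links antisymmetrizers to
  symmetrized products in both directions of the theorem.\<close>

lemma sum_sign_cyc_val:
  assumes "finite K" "K \<noteq> {}"
  shows "(\<Sum>\<sigma> | \<sigma> permutes K. of_int (sign \<sigma>) * cyc_val K w \<sigma>) * of_nat (card K) =
    (-1) ^ (card K - 1) * (\<Sum>ls\<in>permutations_of_set K. \<phi> (concat (map w ls)))"
proof -
  let ?P = "{\<sigma>. \<sigma> permutes K}"
  have finP: "finite ?P" using assms(1) by (rule finite_permutations)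
  have finL: "finite (permutations_of_set K)" by simp
  have lists: "{ls \<in> permutations_of_set K. cycle_list K \<sigma> ls} = {ls. cycle_list K \<sigma> ls}" for \<sigma>
    by (auto simp: permutations_of_set_def cycle_list_def)
  have one: "(\<Sum>\<sigma>\<in>?P. if cycle_list K \<sigma> ls then x else 0) = x"
    if ls: "ls \<in> permutations_of_set K" for ls and x :: complex
  proof -
    obtain s where s: "s permutes K" "cycle_list K s ls"
      and u: "\<And>\<sigma>. \<sigma> permutes K \<Longrightarrow> cycle_list K \<sigma> ls \<Longrightarrow> \<sigma> = s"
      using ex1_cycle_perm[OF assms ls] by blast
    have "(\<Sum>\<sigma>\<in>?P. if cycle_list K \<sigma> ls then x else 0) = (\<Sum>\<sigma>\<in>?P. if \<sigma> = s then x else 0)"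
      by (rule sum.cong[OF refl]) (metis mem_Collect_eq s u)
    then show ?thesis using s finP by simp
  qed
  have inner: "(\<Sum>ls\<in>permutations_of_set K. if cycle_list K \<sigma> ls then \<phi> (concat (map w ls)) else 0)
      = of_nat (card K) * cyc_val K w \<sigma>" for \<sigma>
  proof -
    have "(\<Sum>ls\<in>permutations_of_set K. if cycle_list K \<sigma> ls then \<phi> (concat (map w ls)) else 0)
      = (\<Sum>ls\<in>{ls. cycle_list K \<sigma> ls}. cyc_val K w \<sigma>)"
      unfolding sum.inter_filter[OF finL, symmetric] lists
      by (rule sum.cong) (auto simp: cyc_val_eq)
    also have "\<dots> = of_nat (card {ls. cycle_list K \<sigma> ls}) * cyc_val K w \<sigma>" by simp
    also have "\<dots> = of_nat (card K) * cyc_val K w \<sigma>"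
    proof (cases "\<exists>ls. cycle_list K \<sigma> ls")
      case True
      then obtain ls where "cycle_list K \<sigma> ls" by blast
      from bij_betw_same_card[OF cycle_lists_conv_rotate[OF this]] show ?thesis by simp
    qed (simp add: cyc_val_def)
    finally show ?thesis .
  qed
  have "(-1) ^ (card K - 1) * (\<Sum>ls\<in>permutations_of_set K. \<phi> (concat (map w ls))) =
    (-1) ^ (card K - 1) * (\<Sum>ls\<in>permutations_of_set K. \<Sum>\<sigma>\<in>?P.
      if cycle_list K \<sigma> ls then \<phi> (concat (map w ls)) else 0)"
    by (simp add: one)
  also have "\<dots> = (\<Sum>\<sigma>\<in>?P. (-1) ^ (card K - 1) * (of_nat (card K) * cyc_val K w \<sigma>))"
    by (subst sum.swap) (simp add: inner sum_distrib_left)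
  also have "\<dots> = (\<Sum>\<sigma>\<in>?P. of_int (sign \<sigma>) * cyc_val K w \<sigma> * of_nat (card K))"
  proof (rule sum.cong[OF refl])
    fix \<sigma> assume \<sigma>: "\<sigma> \<in> ?P"
    show "(-1) ^ (card K - 1) * (of_nat (card K) * cyc_val K w \<sigma>) =
      of_int (sign \<sigma>) * cyc_val K w \<sigma> * of_nat (card K)"
    proof (cases "\<exists>ls. cycle_list K \<sigma> ls")
      case True
      then show ?thesis using sign_cycle_list[OF assms(1)] \<sigma> by auto
    qed (simp add: cyc_val_def)
  qed
  finally show ?thesis by (simp add: sum_distrib_right)
qed

context
  fixes n :: nat
  assumes nil: "\<And>(D :: 'k set) w. finite D \<Longrightarrow> card D = n + 1 \<Longrightarrow> (\<And>r. r \<in> D \<Longrightarrow> w r \<noteq> []) \<Longrightarrow>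
    (\<Sum>ls\<in>permutations_of_set D. \<phi> (concat (map w ls))) = 0"
begin

text \<open>For \<open>D = K\<close> this is \<open>sum_sign_cyc_val\<close>. A slot
  \<open>q\<close> outside \<open>D\<close> is fixed by all \<open>\<tau>\<close>, so it can be cut
  out of all \<open>\<tau> \<circ> \<beta>\<close> simultaneously, its word being appended to that
  of its preimage \<open>p\<close> under \<open>\<beta>\<close>. These mergers are why
  \<open>nil\<close> is required for words and not just for single letters.\<close>

lemma cyc_val_alternating_left:
  assumes "finite K" "D \<subseteq> (K :: 'k set)" "card D = n + 1" "\<beta> permutes K" "\<And>r. r \<in> K \<Longrightarrow> w r \<noteq> []"
  shows "(\<Sum>\<tau> | \<tau> permutes D. of_int (sign \<tau>) * cyc_val K w (\<tau> \<circ> \<beta>)) = 0"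
  using assms
proof (induction "card K" arbitrary: K w \<beta> rule: less_induct)
  case less
  have D: "finite D" "D \<noteq> {}" using less.prems finite_subset by (auto simp: card_gt_0_iff)
  show ?case
  proof (cases "D = K")
    case True
    have \<beta>: "permutation \<beta>" "permutation (inv_into UNIV \<beta>)"
      using less.prems permutes_inv permutation_permutes by blast+
    have "(\<Sum>\<tau> | \<tau> permutes D. of_int (sign \<tau>) * cyc_val K w (\<tau> \<circ> \<beta>)) =
      (\<Sum>\<tau> | \<tau> permutes D. of_int (sign (\<tau> \<circ> inv_into UNIV \<beta>)) * cyc_val K w (\<tau> \<circ> inv_into UNIV \<beta> \<circ> \<beta>))"
      by (rule sum_permutations_compose_right) (use less.prems True permutes_inv in blast)
    also have "\<dots> = (\<Sum>\<tau> | \<tau> permutes D. of_int (sign \<beta>) * (of_int (sign \<tau>) * cyc_val K w \<tau>))"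
    proof (rule sum.cong[OF refl], clarsimp)
      fix \<tau> assume "\<tau> permutes D"
      then have "permutation \<tau>" using D permutation_permutes by blast
      then show "of_int (sign (\<tau> \<circ> inv_into UNIV \<beta>)) * cyc_val K w (\<tau> \<circ> inv_into UNIV \<beta> \<circ> \<beta>) =
          of_int (sign \<beta>) * (of_int (sign \<tau>) * cyc_val K w \<tau>)"
        using \<beta> by (simp add: sign_compose sign_inverse comp_assoc permutes_inv_o[OF less.prems(4)])
    qed
    also have "\<dots> = of_int (sign \<beta>) * (\<Sum>\<tau> | \<tau> permutes D. of_int (sign \<tau>) * cyc_val K w \<tau>)"
      by (simp add: sum_distrib_left)
    also have "(\<Sum>\<tau> | \<tau> permutes D. of_int (sign \<tau>) * cyc_val K w \<tau>) = 0"
    proof -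
      have "(\<Sum>ls\<in>permutations_of_set K. \<phi> (concat (map w ls))) = 0"
        by (rule nil) (use less.prems True in auto)
      then show ?thesis
        using sum_sign_cyc_val[of K w] less.prems(1) D True by auto
    qed
    finally show ?thesis by (simp only: mult_zero_right)
  next
    case False
    then obtain q where q: "q \<in> K" "q \<notin> D" using less.prems by blast
    have fixq: "\<tau> q = q" if "\<tau> permutes D" for \<tau> using that q by (simp add: permutes_def)
    show ?thesis
    proof (cases "\<beta> q = q")
      case True
      have "cyc_val K w (\<tau> \<circ> \<beta>) = 0" if "\<tau> permutes D" for \<tau>
        by (rule cyc_val_fixed[of _ q]) (use True fixq[OF that] q D less.prems in auto)
      then show ?thesis by simp
    next
      case False
      define p where "p = inv_into UNIV \<beta> q"
      have p: "\<beta> p = q" using less.prems(4) by (simp add: p_def permutes_inverses)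
      have pq: "p \<noteq> q" using p False by auto
      have pK: "p \<in> K" using p q less.prems(4) by (metis permutes_in_image)
      have "(\<Sum>\<tau> | \<tau> permutes D. of_int (sign \<tau>) * cyc_val K w (\<tau> \<circ> \<beta>)) =
        (\<Sum>\<tau> | \<tau> permutes D. of_int (sign \<tau>) *
          cyc_val (K - {q}) (w(p := w p @ w q)) (\<tau> \<circ> (\<beta> \<circ> Transposition.transpose p q)))"
      proof (rule sum.cong[OF refl], clarsimp)
        fix \<tau> assume "\<tau> permutes D"
        then show "cyc_val K w (\<tau> \<circ> \<beta>) =
            cyc_val (K - {q}) (w(p := w p @ w q)) (\<tau> \<circ> (\<beta> \<circ> Transposition.transpose p q))"
          using cyc_val_contract[of "\<tau> \<circ> \<beta>" p q K w] p pq pK q fixq by (simp add: comp_assoc)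
      qed
      also have "\<dots> = 0"
        by (rule less.hyps[OF _ _ _ _ permutes_contract[OF less.prems(4) p pK]])
          (use less.prems q card_Diff1_less[OF less.prems(1) q(1)] pK in auto)
      finally show ?thesis .
    qed
  qed
qed

text \<open>Conjugation by \<open>\<beta>\<close> exchanges \<open>\<beta> \<circ> \<tau>\<close>
  for \<open>\<tau> \<circ> \<beta>\<close> at the price of permuting the words.\<close>

lemma cyc_val_alternating:
  assumes "finite K" "D \<subseteq> (K :: 'k set)" "card D = n + 1" "\<beta> permutes K" "\<And>r. r \<in> K \<Longrightarrow> w r \<noteq> []"
  shows "(\<Sum>\<tau> | \<tau> permutes D. of_int (sign \<tau>) * cyc_val K w (\<beta> \<circ> \<tau>)) = 0"
proof -
  have "cyc_val K w (\<beta> \<circ> \<tau>) = cyc_val K (w \<circ> \<beta>) (\<tau> \<circ> \<beta>)" for \<tau>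
    by (rule cyc_val_conj[OF assms(4)]) (simp add: comp_assoc)
  then show ?thesis
    using cyc_val_alternating_left[OF assms(1-4), of "w \<circ> \<beta>"] assms(4,5)
    by (simp add: permutes_in_image)
qed

end

end

section \<open>Traces along permutations\<close>

text \<open>The trace of the tensor product of the matrices composed with a slot permutation. It is
  the product, over the cycles of \<open>\<sigma>\<close>, of the traces of the matrix products
  along the cycle.\<close>

definition perm_trace :: "'k set \<Rightarrow> ('k \<Rightarrow> 'r::comm_ring_1^'n^'n) \<Rightarrow> ('k \<Rightarrow> 'k) \<Rightarrow> 'r"
  where "perm_trace K M \<sigma> = (\<Sum>i\<in>Wd K. \<Prod>r\<in>K. M r $ i r $ i (\<sigma> r))"

lemma perm_trace_empty [simp]: "perm_trace {} M \<sigma> = 1"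
  by (simp add: perm_trace_def)

lemma perm_trace_fixed:
  assumes "finite K" "q \<in> K" "\<sigma> q = q" "\<sigma> permutes K"
  shows "perm_trace K M \<sigma> = trace (M q) * perm_trace (K - {q}) M \<sigma>"
proof -
  have "(\<Prod>r\<in>K. M r $ (i(q := l)) r $ (i(q := l)) (\<sigma> r)) =
    M q $ l $ l * (\<Prod>r\<in>K - {q}. M r $ i r $ i (\<sigma> r))" for i l
  proof -
    have "\<sigma> r \<noteq> q" if "r \<noteq> q" for r
      using that assms(3) permutes_inj[OF assms(4)] by (metis injD)
    then have "(\<Prod>r\<in>K - {q}. M r $ (i(q := l)) r $ (i(q := l)) (\<sigma> r)) =
      (\<Prod>r\<in>K - {q}. M r $ i r $ i (\<sigma> r))"
      by (intro prod.cong) auto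
    then show ?thesis using assms by (simp add: prod.remove[of K q])
  qed
  then show ?thesis
    by (simp add: perm_trace_def sum_Wd_remove[OF assms(1,2)] trace_def sum_distrib_left
        sum_distrib_right sum.swap[of _ "UNIV"] cong: sum.cong)
qed

text \<open>The index of slot \<open>q\<close> occurs only in the factors of \<open>p\<close> and
  \<open>q\<close>, and summing over it multiplies these two matrices.\<close>

lemma perm_trace_contract:
  assumes "finite K" "p \<in> K" "\<sigma> p = q" "p \<noteq> q" "\<sigma> permutes K"
  shows "perm_trace K M \<sigma> =
    perm_trace (K - {q}) (M(p := M p ** M q)) (\<sigma> \<circ> Transposition.transpose p q)"
proof -
  have q: "q \<in> K" using assms by (metis permutes_in_image)
  have inj: "\<sigma> r = \<sigma> s \<Longrightarrow> r = s" for r s using permutes_inj[OF assms(5)] by (metis injD)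
  have "(\<Sum>l\<in>UNIV. \<Prod>r\<in>K. M r $ (i(q := l)) r $ (i(q := l)) (\<sigma> r)) =
    (\<Prod>r\<in>K - {q}. (M(p := M p ** M q)) r $ i r $ i ((\<sigma> \<circ> Transposition.transpose p q) r))" for i
  proof -
    have 1: "(\<Prod>r\<in>K. M r $ (i(q := l)) r $ (i(q := l)) (\<sigma> r)) =
      (M p $ i p $ l * M q $ l $ i (\<sigma> q)) * (\<Prod>r\<in>K - {q} - {p}. M r $ i r $ i (\<sigma> r))" for l
    proof -
      have "\<sigma> r \<noteq> q" if "r \<noteq> p" for r using that assms(3) inj by blast
      then have "(\<Prod>r\<in>K - {q} - {p}. M r $ (i(q := l)) r $ (i(q := l)) (\<sigma> r)) =
        (\<Prod>r\<in>K - {q} - {p}. M r $ i r $ i (\<sigma> r))"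
        by (intro prod.cong) auto
      moreover have "\<sigma> q \<noteq> q" using inj[of p q] assms by auto
      ultimately show ?thesis
        using assms q by (simp add: prod.remove[of K q] prod.remove[of "K - {q}" p] ac_simps)
    qed
    have 2: "(\<Prod>r\<in>K - {q} - {p}. (M(p := M p ** M q)) r $ i r $ i ((\<sigma> \<circ> Transposition.transpose p q) r))
      = (\<Prod>r\<in>K - {q} - {p}. M r $ i r $ i (\<sigma> r))"
      by (rule prod.cong) (auto simp: Transposition.transpose_def)
    have 3: "(M p ** M q) $ i p $ i (\<sigma> q) = (\<Sum>l\<in>UNIV. M p $ i p $ l * M q $ l $ i (\<sigma> q))"
      by (simp add: matrix_matrix_mult_def)
    show ?thesis
      unfolding 1 sum_distrib_right[symmetric]
      using assms by (simp add: prod.remove[of "K - {q}" p] 2[unfolded o_def] 3)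
  qed
  then show ?thesis by (simp add: perm_trace_def sum_Wd_remove[OF assms(1) q])
qed

text \<open>A word with more slots than letters repeats a letter, and the transposition of the two
  slots cancels its contribution. This is the fundamental trace identity.\<close>

lemma perm_trace_alternating:
  fixes M :: "'k \<Rightarrow> 'r::comm_ring_1^'n^'n"
  assumes "finite K" "card K > CARD('n)"
  shows "(\<Sum>\<sigma> | \<sigma> permutes K. of_int (sign \<sigma>) * perm_trace K M \<sigma>) = 0"
proof -
  have "(\<Sum>\<sigma> | \<sigma> permutes K. of_int (sign \<sigma>) * perm_trace K M \<sigma>) =
    (\<Sum>i\<in>Wd K. \<Sum>\<sigma> | \<sigma> permutes K. of_int (sign \<sigma>) * (\<Prod>r\<in>K. M r $ i r $ i (\<sigma> r)))"
    unfolding perm_trace_def sum_distrib_left by (rule sum.swap)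
  also have "\<dots> = 0"
  proof (rule sum.neutral, rule ballI)
    fix i :: "'k \<Rightarrow> 'n"
    obtain a b where ab: "a \<in> K" "b \<in> K" "a \<noteq> b" "i a = i b" using noninj_word[OF assms] .
    then have "i (Transposition.transpose a b x) = i x" for x
      by (simp add: Transposition.transpose_def)
    then show "(\<Sum>\<sigma> | \<sigma> permutes K. of_int (sign \<sigma>) * (\<Prod>r\<in>K. M r $ i r $ i (\<sigma> r))) = 0"
      by (intro sum_sign_cancel[OF assms(1) ab(1-3)]) simp
  qed
  finally show ?thesis .
qed

text \<open>Only bijective words contribute, and each contributes \<open>det M\<close>, since the
  signs of its row and column permutations cancel. In characteristic zero this expresses the
  determinant by traces, as \<open>det_trace_polys\<close> needs for the inverse
  determinants.\<close>

lemma sum_sign_perm_trace: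
  fixes M :: "'r::comm_ring_1^'n^'n"
  shows "(\<Sum>\<sigma> | \<sigma> permutes (UNIV :: 'n set). of_int (sign \<sigma>) * perm_trace UNIV (\<lambda>_. M) \<sigma>)
    = of_nat (fact CARD('n)) * det M"
proof -
  have "(\<Sum>\<sigma> | \<sigma> permutes (UNIV :: 'n set). of_int (sign \<sigma>) * perm_trace UNIV (\<lambda>_. M) \<sigma>) =
    (\<Sum>i\<in>Wd UNIV. \<Sum>\<sigma> | \<sigma> permutes (UNIV :: 'n set). of_int (sign \<sigma>) * (\<Prod>r\<in>UNIV. M $ i r $ i (\<sigma> r)))"
    unfolding perm_trace_def sum_distrib_left by (rule sum.swap)
  also have "\<dots> = (\<Sum>i\<in>Wd UNIV. if i permutes (UNIV :: 'n set) then det M else 0)"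
  proof (rule sum.cong[OF refl])
    fix i :: "'n \<Rightarrow> 'n"
    have "(\<Sum>\<sigma> | \<sigma> permutes (UNIV :: 'n set). of_int (sign \<sigma>) * (\<Prod>r\<in>UNIV. M $ i r $ i (\<sigma> r)))
      = det (\<chi> r s. M $ i r $ i s)"
      by (simp add: det_def)
    also have "\<dots> = (if i permutes UNIV then det M else 0)"
    proof (cases "inj i")
      case True
      then have i: "i permutes UNIV" 
        by (intro bij_imp_permutes) (simp_all add: bij_def finite_UNIV_inj_surj)
      have "det (\<chi> r s. M $ i r $ i s) = of_int (sign i) * det (\<chi> r. M $ i r)"
        using det_permute_columns[OF i, of "\<chi> r. M $ i r"] by simp
      also have "\<dots> = of_int (sign i * sign i) * det M"
        by (simp only: det_permute_rows[OF i, of M] of_int_mult mult.assoc)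
      finally show ?thesis using i by (simp add: sign_idempotent)
    next
      case False
      then obtain a b where ab: "i a = i b" "a \<noteq> b" by (auto simp: inj_on_def)
      have "det (\<chi> r s. M $ i r $ i s) = 0"
        by (rule det_identical_rows[OF ab(2)]) (simp add: row_def ab(1))
      moreover have "\<not> i permutes UNIV" using False permutes_inj by blast
      ultimately show ?thesis by simp
    qed
    finally show "(\<Sum>\<sigma> | \<sigma> permutes (UNIV :: 'n set). of_int (sign \<sigma>) * (\<Prod>r\<in>UNIV. M $ i r $ i (\<sigma> r)))
      = (if i permutes UNIV then det M else 0)" .
  qed
  also have "\<dots> = of_nat (card {i. i permutes (UNIV :: 'n set)}) * det M"
    by (subst sum.inter_filter[symmetric]) (simp_all add: PiE_UNIV_domain)
  also have "card {i. i permutes (UNIV :: 'n set)} = fact CARD('n)"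
    by (rule card_permutations) simp_all
  finally show ?thesis .
qed

section \<open>The equation as a symmetrized product in the augmentation ideal\<close>

section \<open>Alternating sums over sublists\<close>

text \<open>Each factor \<open>x - 1\<close> of a product is either kept as \<open>x\<close> or
  replaced by \<open>-1\<close>; hence the sum runs over the sublists, with a sign for each dropped
  letter.\<close>

primrec alt_sum :: "('a list \<Rightarrow> complex) \<Rightarrow> 'a list \<Rightarrow> complex" where
  "alt_sum g [] = g []"
| "alt_sum g (x # xs) = alt_sum (\<lambda>ys. g (x # ys)) xs - alt_sum g xs"

lemma alt_sum_cong:
  assumes "\<And>ys. set ys \<subseteq> set xs \<Longrightarrow> g ys = h ys"
  shows "alt_sum g xs = alt_sum h xs"
  using assms
proof (induction xs arbitrary: g h)
  case (Cons x xs)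
  have "alt_sum (\<lambda>ys. g (x # ys)) xs = alt_sum (\<lambda>ys. h (x # ys)) xs"
    by (rule Cons.IH, rule Cons.prems) auto
  moreover have "alt_sum g xs = alt_sum h xs"
    by (rule Cons.IH, rule Cons.prems) auto
  ultimately show ?case by simp
qed simp

lemma alt_sum_diff: "alt_sum (\<lambda>ys. g ys - h ys) xs = alt_sum g xs - alt_sum h xs"
  by (induction xs arbitrary: g h) auto

lemma alt_sum_append: "alt_sum g (xs @ ys) = alt_sum (\<lambda>us. alt_sum (\<lambda>vs. g (us @ vs)) ys) xs"
  by (induction xs arbitrary: g) auto

lemma alt_sum_swap:
  "alt_sum (\<lambda>us. alt_sum (\<lambda>vs. g us vs) ys) xs = alt_sum (\<lambda>vs. alt_sum (\<lambda>us. g us vs) xs) ys"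
  by (induction xs arbitrary: g) (auto simp: alt_sum_diff)

lemma alt_sum_map: "alt_sum g (map h xs) = alt_sum (\<lambda>ys. g (map h ys)) xs"
  by (induction xs arbitrary: g) auto

definition injective_words :: "nat \<Rightarrow> 'a set \<Rightarrow> 'a list set"
  where "injective_words k K = {js. length js = k \<and> set js \<subseteq> K \<and> distinct js}"

lemma finite_injective_words [simp]: "finite K \<Longrightarrow> finite (injective_words k K)"
  by (rule finite_subset[of _ "{js. set js \<subseteq> K \<and> length js = k}"])
    (auto simp: injective_words_def finite_lists_length_eq)

lemma sum_injective_words_Suc:
  assumes "finite K"
  shows "(\<Sum>x\<in>K. \<Sum>js\<in>injective_words k (K - {x}). g (x # js)) = (\<Sum>js\<in>injective_words (Suc k) K. g js)"
proof -
  have "(\<Sum>x\<in>K. \<Sum>js\<in>injective_words k (K - {x}). g (x # js)) =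
    (\<Sum>(x, js)\<in>(SIGMA x:K. injective_words k (K - {x})). g (x # js))"
    using assms by (subst sum.Sigma) auto
  also have "\<dots> = (\<Sum>js\<in>injective_words (Suc k) K. g js)"
    by (rule sum.reindex_bij_witness[where j = "\<lambda>(x, js). x # js" and i = "\<lambda>js. (hd js, tl js)"])
      (auto simp: injective_words_def length_Suc_conv)
  finally show ?thesis .
qed

text \<open>An injective word of length \<open>k\<close> avoids exactly \<open>card K - k\<close>
  letters of \<open>K\<close>.\<close>

lemma sum_injective_words_remove:
  fixes g :: "'a list \<Rightarrow> complex"
  assumes "finite K"
  shows "(\<Sum>x\<in>K. \<Sum>js\<in>injective_words k (K - {x}). g js) =
    (of_nat (card K) - of_nat k) * (\<Sum>js\<in>injective_words k K. g js)"
proof -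
  have "(\<Sum>x\<in>K. \<Sum>js\<in>injective_words k (K - {x}). g js) =
    (\<Sum>x\<in>K. \<Sum>js\<in>injective_words k K. if x \<notin> set js then g js else 0)"
  proof (rule sum.cong[OF refl])
    fix x
    have "injective_words k (K - {x}) = {js \<in> injective_words k K. x \<notin> set js}"
      by (auto simp: injective_words_def)
    then show "(\<Sum>js\<in>injective_words k (K - {x}). g js) =
        (\<Sum>js\<in>injective_words k K. if x \<notin> set js then g js else 0)"
      using assms by (simp add: sum.inter_filter)
  qed
  also have "\<dots> = (\<Sum>js\<in>injective_words k K. \<Sum>x\<in>K. if x \<notin> set js then g js else 0)"
    by (rule sum.swap)
  also have "\<dots> = (\<Sum>js\<in>injective_words k K. (of_nat (card K) - of_nat k) * g js)"
  proof (rule sum.cong[OF refl])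
    fix js assume js: "js \<in> injective_words k K"
    have "(\<Sum>x\<in>K. if x \<notin> set js then g js else 0) = of_nat (card (K - set js)) * g js"
      using assms by (subst sum.inter_filter[symmetric]) (auto simp: set_diff_eq)
    also have "card (K - set js) = card K - k"
      using js by (subst card_Diff_subset) (auto simp: injective_words_def distinct_card)
    also have "k \<le> card K"
      using js assms card_mono[of K "set js"] by (auto simp: injective_words_def distinct_card)
    then have "(of_nat (card K - k) :: complex) = of_nat (card K) - of_nat k"
      by (rule of_nat_diff)
    finally show "(\<Sum>x\<in>K. if x \<notin> set js then g js else 0) = (of_nat (card K) - of_nat k) * g js" .
  qed
  finally show ?thesis by (simp add: sum_distrib_left)
qed

text \<open>The origin of \<open>1 / fact k\<close>: an injective word of length \<open>k\<close> is
  a subsequence of \<open>fact (card K) / fact k\<close> orderings of \<open>K\<close>, and it drops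
  \<open>card K - k\<close> letters. The induction splits off the first letter \<open>x\<close> of
  the ordering: kept, it starts the word; dropped, the word avoids it.\<close>

lemma sum_alt_sum_permutations:
  assumes "finite K"
  shows "(\<Sum>ls\<in>permutations_of_set K. alt_sum g ls) =
    (-1) ^ card K * fact (card K) *
      (\<Sum>k\<le>card K. (-1) ^ k / fact k * (\<Sum>js\<in>injective_words k K. g js))"
  using assms
proof (induction "card K" arbitrary: K g)
  case 0
  then have "K = {}" by simp
  moreover have "injective_words 0 {} = {[] :: 'a list}" by (auto simp: injective_words_def)
  ultimately show ?case by simp
next
  case (Suc N)
  let ?S = "\<lambda>k. \<Sum>js\<in>injective_words k K. g js"
  have K: "K \<noteq> {}" using Suc by auto
  have "(\<Sum>ls\<in>permutations_of_set K. alt_sum g ls) =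
    (\<Sum>x\<in>K. \<Sum>ls\<in>permutations_of_set (K - {x}). alt_sum g (x # ls))"
    using Suc.prems K
    by (simp add: permutations_of_set_nonempty, subst sum.UNION_disjoint)
      (auto simp: sum.reindex inj_on_def)
  also have "\<dots> = (\<Sum>x\<in>K. (-1) ^ N * fact N * (\<Sum>k\<le>N. (-1) ^ k / fact k *
      ((\<Sum>js\<in>injective_words k (K - {x}). g (x # js)) - (\<Sum>js\<in>injective_words k (K - {x}). g js))))"
  proof (rule sum.cong[OF refl])
    fix x assume x: "x \<in> K"
    have c: "N = card (K - {x})" "finite (K - {x})" using Suc x by auto
    show "(\<Sum>ls\<in>permutations_of_set (K - {x}). alt_sum g (x # ls)) =
      (-1) ^ N * fact N * (\<Sum>k\<le>N. (-1) ^ k / fact k *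
      ((\<Sum>js\<in>injective_words k (K - {x}). g (x # js)) - (\<Sum>js\<in>injective_words k (K - {x}). g js)))"
      using Suc.hyps(1)[OF c, of "\<lambda>ys. g (x # ys)"] Suc.hyps(1)[OF c, of g]
      by (simp add: sum_subtractf c(1)[symmetric] right_diff_distrib)
  qed
  also have "\<dots> = (-1) ^ N * fact N * (\<Sum>k\<le>N. (-1) ^ k / fact k *
      (?S (Suc k) - (of_nat (Suc N) - of_nat k) * ?S k))"
    by (subst sum_distrib_left[symmetric], subst sum.swap)
      (simp only: sum_distrib_left[symmetric] sum_subtractf sum_injective_words_Suc[OF Suc.prems]
        sum_injective_words_remove[OF Suc.prems] Suc.hyps(2)[symmetric])
  also have "(\<Sum>k\<le>N. (-1) ^ k / fact k * (?S (Suc k) - (of_nat (Suc N) - of_nat k) * ?S k)) =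
    (\<Sum>k\<le>N. (-1) ^ k / fact k * ?S (Suc k)) -
    (\<Sum>k\<le>Suc N. (-1) ^ k / fact k * (of_nat (Suc N) - of_nat k) * ?S k)"
    by (simp add: sum_subtractf[symmetric] right_diff_distrib mult.assoc del: of_nat_Suc)
      (simp add: diff_divide_distrib left_diff_distrib right_diff_distrib mult.assoc del: of_nat_Suc)
  \<comment> \<open>An index shift, whose new term at \<open>k = 0\<close> vanishes because of the
    factor \<open>k\<close>. The other sum was extended to \<open>Suc N\<close>, where its factor
    \<open>of_nat (Suc N) - of_nat k\<close> is zero; the two now combine termwise.\<close>
  also have "(\<Sum>k\<le>N. (-1) ^ k / fact k * ?S (Suc k)) =
    (\<Sum>k\<le>Suc N. - ((-1) ^ k / fact k * of_nat k * ?S k))"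
  proof -
    have "- ((-1) ^ Suc k / fact (Suc k) * of_nat (Suc k) * x) = (-1) ^ k / fact k * x"
      for k and x :: complex
    proof -
      have "(of_nat (Suc k) :: complex) \<noteq> 0" using of_nat_eq_0_iff by blast
      then show ?thesis by (simp add: fact_Suc del: of_nat_Suc)
    qed
    then show ?thesis unfolding sum.atMost_Suc_shift by (simp del: of_nat_Suc fact_Suc)
  qed
  also have "(\<Sum>k\<le>Suc N. - ((-1) ^ k / fact k * of_nat k * ?S k)) -
      (\<Sum>k\<le>Suc N. (-1) ^ k / fact k * (of_nat (Suc N) - of_nat k) * ?S k) =
    (\<Sum>k\<le>Suc N. - of_nat (Suc N) * ((-1) ^ k / fact k * ?S k))"
  proof -
    have "- (a * k * b) - a * (m - k) * b = - m * (a * b)" for a b k m :: complex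
      by (simp add: algebra_simps)
    then show ?thesis unfolding sum_subtractf[symmetric] by (simp only:)
  qed
  also have "\<dots> = - of_nat (Suc N) * (\<Sum>k\<le>Suc N. (-1) ^ k / fact k * ?S k)"
    by (simp only: sum_distrib_left)
  finally show ?case
    by (simp add: Suc.hyps(2)[symmetric] fact_Suc mult.assoc del: of_nat_Suc sum.atMost_Suc)
qed

section \<open>The form on words in the augmentation ideal\<close>

text \<open>
  The value of the linear extension of \<open>f\<close> to the group algebra at the product
  \<open>(g\<^sub>1 - 1) \<cdots> (g\<^sub>k - 1)\<close>.
\<close>

definition aug_form :: "('g, 'z) monoid_scheme \<Rightarrow> ('g \<Rightarrow> complex) \<Rightarrow> 'g list \<Rightarrow> complex"
  where "aug_form \<Gamma> f ls = (if set ls \<subseteq> carrier \<Gamma>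
    then alt_sum (\<lambda>ys. f (foldr (\<otimes>\<^bsub>\<Gamma>\<^esub>) ys \<one>\<^bsub>\<Gamma>\<^esub>)) ls else 0)"

lemma (in group) foldr_mult_closed:
  "set ys \<subseteq> carrier G \<Longrightarrow> foldr (\<otimes>) ys \<one> \<in> carrier G"
  by (induction ys) auto

lemma (in group) foldr_mult_append:
  assumes "set xs \<subseteq> carrier G" "set ys \<subseteq> carrier G"
  shows "foldr (\<otimes>) (xs @ ys) \<one> = foldr (\<otimes>) xs \<one> \<otimes> foldr (\<otimes>) ys \<one>"
  using assms(1)
proof (induction xs)
  case Nil
  then show ?case using foldr_mult_closed[OF assms(2)] by simp
next
  case (Cons x xs)
  then show ?case
    using foldr_mult_closed[OF assms(2)] foldr_mult_closed[of xs] by (simp add: m_assoc)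
qed

lemma (in group) central_function_swap:
  assumes "central_function G f" "x \<in> carrier G" "y \<in> carrier G"
  shows "f (x \<otimes> y) = f (y \<otimes> x)"
proof -
  have "f (x \<otimes> (y \<otimes> x) \<otimes> inv x) = f (y \<otimes> x)"
    using assms by (simp add: central_function_def)
  moreover have "x \<otimes> (y \<otimes> x) \<otimes> inv x = x \<otimes> y" using assms by (simp add: m_assoc)
  ultimately show ?thesis by simp
qed

text \<open>A sublist of \<open>a @ b\<close> is a sublist of \<open>a\<close> followed by one of
  \<open>b\<close>, and a central function does not distinguish the two orders of their
  products.\<close>

lemma (in group) trace_form_aug_form:
  assumes "central_function G f"
  shows "trace_form (aug_form G f)"
proof
  fix a b
  let ?g = "\<lambda>ys. f (foldr (\<otimes>) ys \<one>)"
  have "alt_sum ?g (a @ b) = alt_sum ?g (b @ a)" if "set a \<subseteq> carrier G" "set b \<subseteq> carrier G"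
  proof -
    have "alt_sum ?g (a @ b) = alt_sum (\<lambda>us. alt_sum (\<lambda>vs. ?g (vs @ us)) b) a"
      unfolding alt_sum_append
    proof (intro alt_sum_cong)
      fix us vs assume "set us \<subseteq> set a" "set vs \<subseteq> set b"
      then have c: "set us \<subseteq> carrier G" "set vs \<subseteq> carrier G" using that by auto
      show "?g (us @ vs) = ?g (vs @ us)"
        unfolding foldr_mult_append[OF c] foldr_mult_append[OF c(2,1)]
        by (rule central_function_swap[OF assms c[THEN foldr_mult_closed]])
    qed
    then show ?thesis by (simp add: alt_sum_swap[of _ b a] alt_sum_append)
  qed
  then show "aug_form G f (a @ b) = aug_form G f (b @ a)" by (auto simp: aug_form_def)
qed

text \<open>The identity \<open>(x - 1)(y - 1) = (xy - 1) - (x - 1) - (y - 1)\<close> of the group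
  algebra.\<close>

lemma (in group) aug_form_mult:
  assumes "x \<in> carrier G" "y \<in> carrier G"
  shows "aug_form G f (x # y # zs) =
    aug_form G f (x \<otimes> y # zs) - aug_form G f (x # zs) - aug_form G f (y # zs)"
proof -
  have "alt_sum (\<lambda>ys. f (x \<otimes> (y \<otimes> foldr (\<otimes>) ys \<one>))) zs =
    alt_sum (\<lambda>ys. f (x \<otimes> y \<otimes> foldr (\<otimes>) ys \<one>)) zs" if "set zs \<subseteq> carrier G"
    by (rule alt_sum_cong) (use that assms in \<open>simp add: m_assoc foldr_mult_closed subset_trans\<close>)
  then show ?thesis using assms by (auto simp: aug_form_def)
qed

lemma (in group) aug_form_one: "aug_form G f (\<one> # zs) = 0"
proof -
  have "alt_sum (\<lambda>ys. f (\<one> \<otimes> foldr (\<otimes>) ys \<one>)) zs = alt_sum (\<lambda>ys. f (foldr (\<otimes>) ys \<one>)) zs"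
    if "set zs \<subseteq> carrier G"
    by (rule alt_sum_cong) (use that in \<open>simp add: foldr_mult_closed subset_trans\<close>)
  then show ?thesis by (auto simp: aug_form_def)
qed

definition central_sum :: "('g, 'z) monoid_scheme \<Rightarrow> nat \<Rightarrow> ('g \<Rightarrow> complex) \<Rightarrow> (nat \<Rightarrow> 'g) \<Rightarrow> complex"
  where "central_sum \<Gamma> n f \<gamma> =
    (\<Sum>k = 1..n + 1. \<Sum>js\<in>{js. length js = k \<and> set js \<subseteq> {0..n} \<and> distinct js}.
       (-1) ^ k / fact k * f (foldr (\<otimes>\<^bsub>\<Gamma>\<^esub>) (map \<gamma> js) \<one>\<^bsub>\<Gamma>\<^esub>))"

text \<open>In \<open>sum_alt_sum_permutations\<close> the term \<open>k = 0\<close> belongs to the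
  empty word and equals \<open>f \<one>\<close>; the equation does not contain it.\<close>

lemma sum_aug_form_permutations:
  assumes "\<And>i. i \<le> n \<Longrightarrow> \<gamma> i \<in> carrier \<Gamma>"
  shows "(\<Sum>ls\<in>permutations_of_set {0..n}. aug_form \<Gamma> f (map \<gamma> ls)) =
    (-1) ^ (n + 1) * fact (n + 1) * (f \<one>\<^bsub>\<Gamma>\<^esub> + central_sum \<Gamma> n f \<gamma>)"
proof -
  let ?g = "\<lambda>ys. f (foldr (\<otimes>\<^bsub>\<Gamma>\<^esub>) (map \<gamma> ys) \<one>\<^bsub>\<Gamma>\<^esub>)"
  have "(\<Sum>ls\<in>permutations_of_set {0..n}. aug_form \<Gamma> f (map \<gamma> ls)) =
    (\<Sum>ls\<in>permutations_of_set {0..n}. alt_sum ?g ls)"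
    by (rule sum.cong) (use assms in \<open>auto simp: aug_form_def alt_sum_map permutations_of_set_def\<close>)
  also have "\<dots> = (-1) ^ (n + 1) * fact (n + 1) *
      (\<Sum>k\<le>n + 1. (-1) ^ k / fact k * (\<Sum>js\<in>injective_words k {0..n}. ?g js))"
    by (subst sum_alt_sum_permutations) auto
  also have "(\<Sum>k\<le>n + 1. (-1) ^ k / fact k * (\<Sum>js\<in>injective_words k {0..n}. ?g js)) =
    (\<Sum>js\<in>injective_words 0 {0..n}. ?g js) +
    (\<Sum>k = 1..n + 1. (-1) ^ k / fact k * (\<Sum>js\<in>injective_words k {0..n}. ?g js))"
    by (simp add: atMost_atLeast0 sum.atLeast_Suc_atMost[of 0] del: sum.cl_ivl_Suc)
  also have "injective_words 0 {0..n} = {[]}" by (auto simp: injective_words_def)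
  finally show ?thesis
    by (simp add: central_sum_def injective_words_def sum_distrib_left del: sum.cl_ivl_Suc fact_Suc)
qed

locale central_solution = group \<Gamma> for \<Gamma> :: "('g, 'z) monoid_scheme" (structure) +
  fixes f :: "'g \<Rightarrow> complex" and n :: nat
  assumes solution: "f \<in> central_solutions \<Gamma> n"
begin

lemma central: "central_function \<Gamma> f"
  using solution by (simp add: central_solutions_def)

lemma solution_outside: "\<gamma> \<notin> carrier \<Gamma> \<Longrightarrow> f \<gamma> = 0"
  using solution by (simp add: central_solutions_def)

lemma central_sum_0: "(\<And>i. i \<le> n \<Longrightarrow> \<gamma> i \<in> carrier \<Gamma>) \<Longrightarrow> central_sum \<Gamma> n f \<gamma> = 0"
  using solution by (simp add: central_solutions_def central_sum_def)

text \<open>Substituting \<open>1\<close> for all group elements in the equation kills every alternating sum.\<close>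

lemma solution_one: "f \<one> = 0"
proof -
  have "aug_form \<Gamma> f (map (\<lambda>_. \<one>) ls) = 0" if "ls \<in> permutations_of_set {0..n}" for ls
    using that aug_form_one by (cases ls) (auto simp: permutations_of_set_def)
  then have "(\<Sum>ls\<in>permutations_of_set {0..n}. aug_form \<Gamma> f (map (\<lambda>_. \<one>) ls)) = 0" by simp
  then show ?thesis
    by (subst (asm) sum_aug_form_permutations) (simp_all add: central_sum_0 del: fact_Suc)
qed

sublocale trace_form "aug_form \<Gamma> f"
  by (rule trace_form_aug_form[OF central])

lemma aug_form_single: "aug_form \<Gamma> f [x] = f x"
  by (auto simp: aug_form_def solution_one solution_outside)

text \<open>A slot that occurs once in the cyclic order can be rotated to the front, which reduces
  statements about it to the head of a list.\<close>

lemma aug_form_slot: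
  assumes "distinct ls" "r \<in> set ls"
  obtains rest where "\<And>u. aug_form \<Gamma> f (concat (map (w(r := u)) ls)) = aug_form \<Gamma> f (u @ rest)"
proof -
  obtain a b where ls: "ls = a @ r # b" using assms(2) by (meson split_list)
  then have "map (w(r := u)) a = map w a" "map (w(r := u)) b = map w b" for u
    using assms(1) by auto
  then have "aug_form \<Gamma> f (concat (map (w(r := u)) ls)) =
    aug_form \<Gamma> f (u @ (concat (map w b) @ concat (map w a)))" for u
    using rot[of "concat (map w a)" "u @ concat (map w b)"] by (simp add: ls del: map_eq_conv)
  then show thesis using that by blast
qed

text \<open>The equation concerns slots that carry one factor \<open>g - 1\<close>. A longer word is
  a combination of shorter nonempty ones by \<open>aug_form_mult\<close>, so induction on the total
  length covers all nonempty words, as \<open>cyc_val_alternating\<close> demands.\<close>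

lemma sum_aug_form_words:
  assumes "finite (D :: nat set)" "card D = n + 1" "\<And>r. r \<in> D \<Longrightarrow> w r \<noteq> []"
  shows "(\<Sum>ls\<in>permutations_of_set D. aug_form \<Gamma> f (concat (map w ls))) = 0"
  using assms(3)
proof (induction "\<Sum>r\<in>D. length (w r)" arbitrary: w rule: less_induct)
  case less
  show ?case
  proof (cases "\<exists>r\<in>D. \<exists>x y v. w r = x # y # v")
    case False
    define \<gamma> where "\<gamma> r = hd (w r)" for r
    have w: "w r = [\<gamma> r]" if "r \<in> D" for r
    proof (cases "w r")
      case (Cons x v)
      then show ?thesis using False that by (cases v) (auto simp: \<gamma>_def)
    qed (use less.prems that in simp)
    obtain b where b: "bij_betw b {0..n} D"
      using finite_same_card_bij[of "{0..n}" D] assms(1,2) by auto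
    have img: "b ` {0..n} = D" "inj_on b {0..n}" using b by (auto simp: bij_betw_def)
    have inj: "inj_on (map b) (permutations_of_set {0..n})"
      by (rule inj_on_mapI, rule inj_on_subset[OF img(2)]) (auto simp: permutations_of_set_def)
    have "(\<Sum>ls\<in>permutations_of_set D. aug_form \<Gamma> f (concat (map w ls))) =
      (\<Sum>ls\<in>permutations_of_set D. aug_form \<Gamma> f (map \<gamma> ls))"
    proof (rule sum.cong[OF refl])
      fix ls assume "ls \<in> permutations_of_set D"
      then have "map w ls = map (\<lambda>r. [\<gamma> r]) ls" using w by (auto simp: permutations_of_set_def)
      moreover have "concat (map (\<lambda>r. [\<gamma> r]) ls) = map \<gamma> ls" by (induction ls) auto
      ultimately show "aug_form \<Gamma> f (concat (map w ls)) = aug_form \<Gamma> f (map \<gamma> ls)"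
        by (simp only:)
    qed
    also have "\<dots> = (\<Sum>ls\<in>permutations_of_set {0..n}. aug_form \<Gamma> f (map (\<gamma> \<circ> b) ls))"
      unfolding img(1)[symmetric] permutations_of_set_image_inj[OF img(2)]
      by (subst sum.reindex[OF inj]) simp
    also have "\<dots> = 0"
    proof (cases "\<forall>i\<le>n. (\<gamma> \<circ> b) i \<in> carrier \<Gamma>")
      case True
      then show ?thesis by (subst sum_aug_form_permutations) (simp_all add: solution_one central_sum_0)
    next
      case False
      then obtain i where i: "i \<le> n" "\<gamma> (b i) \<notin> carrier \<Gamma>" by auto
      have "aug_form \<Gamma> f (map (\<gamma> \<circ> b) ls) = 0" if "ls \<in> permutations_of_set {0..n}" for ls
        using that i by (auto simp: aug_form_def permutations_of_set_def image_subset_iff)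
      then show ?thesis by simp
    qed
    finally show ?thesis .
  next
    case True
    then obtain r x y v where r: "r \<in> D" "w r = x # y # v" by blast
    have rls: "distinct ls \<and> r \<in> set ls" if "ls \<in> permutations_of_set D" for ls
      using that r by (auto simp: permutations_of_set_def)
    show ?thesis
    proof (cases "x \<in> carrier \<Gamma> \<and> y \<in> carrier \<Gamma>")
      case False
      have "aug_form \<Gamma> f (concat (map w ls)) = 0" if "ls \<in> permutations_of_set D" for ls
      proof -
        have "set (w r) \<subseteq> set (concat (map w ls))" using rls[OF that] by auto
        then have "\<not> set (concat (map w ls)) \<subseteq> carrier \<Gamma>"
          using False r(2) by (metis list.set_intros subsetD)
        then show ?thesis by (simp only: aug_form_def if_False)
      qed
      then show ?thesis by simp
    next
      case True
      let ?W = "\<lambda>u. \<Sum>ls\<in>permutations_of_set D. aug_form \<Gamma> f (concat (map (w(r := u)) ls))"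
      have W: "?W u = 0" if "length u < length (x # y # v)" "u \<noteq> []" for u
      proof (rule less.hyps)
        show "(\<Sum>r'\<in>D. length ((w(r := u)) r')) < (\<Sum>r\<in>D. length (w r))"
          by (rule sum_strict_mono_ex1) (use assms(1) r that in auto)
      qed (use that less.prems in auto)
      have "(\<Sum>ls\<in>permutations_of_set D. aug_form \<Gamma> f (concat (map w ls))) =
        ?W ((x \<otimes> y) # v) - ?W (x # v) - ?W (y # v)"
        unfolding sum_subtractf[symmetric]
      proof (rule sum.cong[OF refl])
        fix ls assume "ls \<in> permutations_of_set D"
        then obtain rest where
          rest: "\<And>u. aug_form \<Gamma> f (concat (map (w(r := u)) ls)) = aug_form \<Gamma> f (u @ rest)"
          using aug_form_slot rls by metis
        have "aug_form \<Gamma> f (concat (map w ls)) = aug_form \<Gamma> f (w r @ rest)"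
          using rest[of "w r"] by (simp only: fun_upd_triv)
        then show "aug_form \<Gamma> f (concat (map w ls)) =
          aug_form \<Gamma> f (concat (map (w(r := (x \<otimes> y) # v)) ls)) -
          aug_form \<Gamma> f (concat (map (w(r := x # v)) ls)) -
          aug_form \<Gamma> f (concat (map (w(r := y # v)) ls))"
          unfolding rest using aug_form_mult True r(2) by simp
      qed
      also have "\<dots> = 0" using W[of "(x \<otimes> y) # v"] W[of "x # v"] W[of "y # v"] by simp
      finally show ?thesis .
    qed
  qed
qed

text \<open>As a function of the word in one slot, \<open>cyc_val\<close> is the form with a fixed
  tail or identically zero. It thereby inherits the identities of \<open>aug_form\<close>.\<close>

lemma cyc_val_slot:
  assumes "p \<in> K"
  shows "(\<exists>rest. \<forall>u. cyc_val K (w(p := u)) \<sigma> = aug_form \<Gamma> f (u @ rest)) \<or>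
    (\<forall>u. cyc_val K (w(p := u)) \<sigma> = 0)"
proof (cases "\<exists>ls. cycle_list K \<sigma> ls")
  case True
  then obtain ls where ls: "cycle_list K \<sigma> ls" by blast
  then obtain rest where "\<And>u. aug_form \<Gamma> f (concat (map (w(p := u)) ls)) = aug_form \<Gamma> f (u @ rest)"
    using aug_form_slot[of ls p w] assms by (auto simp: cycle_list_def)
  then show ?thesis using cyc_val_eq[OF ls] by auto
qed (simp add: cyc_val_def)

lemma cyc_val_mult:
  assumes "p \<in> K" "x \<in> carrier \<Gamma>" "y \<in> carrier \<Gamma>"
  shows "cyc_val K (w(p := [x, y])) \<sigma> =
    cyc_val K (w(p := [x \<otimes> y])) \<sigma> - cyc_val K (w(p := [x])) \<sigma> - cyc_val K (w(p := [y])) \<sigma>"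
  using cyc_val_slot[OF assms(1), of w \<sigma>] aug_form_mult[OF assms(2,3)] by force

lemma cyc_val_one:
  assumes "p \<in> K"
  shows "cyc_val K (w(p := [\<one>])) \<sigma> = 0"
  using cyc_val_slot[OF assms(1), of w \<sigma>] aug_form_one by force

end

section \<open>Dual tensors in the span of the slot permutations\<close>

section \<open>The span of the permutations of tensor slots\<close>

text \<open>Only the entries at words over \<open>K\<close> are constrained. The coefficients
  \<open>x\<close> are not unique once \<open>card K\<close> exceeds the number of letters; the
  tensors themselves carry the information.\<close>

definition slot_span :: "'k set \<Rightarrow> (('k \<Rightarrow> 'n::finite) \<Rightarrow> ('k \<Rightarrow> 'n) \<Rightarrow> complex) set"
  where "slot_span K = {Z. \<exists>x. \<forall>i\<in>Wd K. \<forall>j\<in>Wd K.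
    Z i j = (\<Sum>\<rho> | \<rho> permutes K. if i \<circ> \<rho> = j then x \<rho> else 0)}"

lemma slot_spanE:
  assumes "Z \<in> slot_span K"
  obtains x where "\<And>i j. i \<in> Wd K \<Longrightarrow> j \<in> Wd K \<Longrightarrow>
    Z i j = (\<Sum>\<rho> | \<rho> permutes K. if i \<circ> \<rho> = j then x \<rho> else 0)"
  using assms unfolding slot_span_def by auto

text \<open>\<open>\<kappa>\<close> may be non-injective, as happens when slots are contracted: the
  coefficients of equal permutations are added up.\<close>

lemma slot_span_sumI:
  assumes "finite K" "finite P" "\<And>\<rho>. \<rho> \<in> P \<Longrightarrow> \<kappa> \<rho> permutes K"
    and "\<And>i j. i \<in> Wd K \<Longrightarrow> j \<in> Wd K \<Longrightarrow> Z i j = (\<Sum>\<rho>\<in>P. if i \<circ> \<kappa> \<rho> = j then c \<rho> else 0)"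
  shows "Z \<in> slot_span K"
proof -
  have "Z i j = (\<Sum>\<pi> | \<pi> permutes K. if i \<circ> \<pi> = j then (\<Sum>\<rho>\<in>P. if \<kappa> \<rho> = \<pi> then c \<rho> else 0) else 0)"
    if "i \<in> Wd K" "j \<in> Wd K" for i j
  proof -
    have "(\<Sum>\<pi> | \<pi> permutes K. if i \<circ> \<pi> = j then (\<Sum>\<rho>\<in>P. if \<kappa> \<rho> = \<pi> then c \<rho> else 0) else 0)
      = (\<Sum>\<pi> | \<pi> permutes K. \<Sum>\<rho>\<in>P. if \<pi> = \<kappa> \<rho> then if i \<circ> \<kappa> \<rho> = j then c \<rho> else 0 else 0)"
      by (intro sum.cong[OF refl]) (auto intro!: sum.cong sum.neutral)
    also have "\<dots> = (\<Sum>\<rho>\<in>P. \<Sum>\<pi> | \<pi> permutes K. if \<pi> = \<kappa> \<rho> then if i \<circ> \<kappa> \<rho> = j then c \<rho> else 0 else 0)"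
      by (rule sum.swap)
    also have "\<dots> = (\<Sum>\<rho>\<in>P. if i \<circ> \<kappa> \<rho> = j then c \<rho> else 0)"
      by (rule sum.cong[OF refl]) (simp add: finite_permutations[OF assms(1)] assms(3))
    finally show ?thesis using assms(4)[OF that] by simp
  qed
  note Z = this
  show ?thesis unfolding slot_span_def by (intro CollectI exI ballI) (rule Z)
qed

lemma slot_span_diff:
  assumes "Z \<in> slot_span K" "Z' \<in> slot_span K"
  shows "(\<lambda>i j. Z i j - Z' i j) \<in> slot_span K"
proof -
  obtain x x' where
    "\<forall>i\<in>Wd K. \<forall>j\<in>Wd K. Z i j = (\<Sum>\<rho> | \<rho> permutes K. if i \<circ> \<rho> = j then x \<rho> else 0)"
    "\<forall>i\<in>Wd K. \<forall>j\<in>Wd K. Z' i j = (\<Sum>\<rho> | \<rho> permutes K. if i \<circ> \<rho> = j then x' \<rho> else 0)"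
    using assms unfolding slot_span_def by blast
  then show ?thesis unfolding slot_span_def
    by (intro CollectI exI[of _ "\<lambda>\<rho>. x \<rho> - x' \<rho>"])
      (auto simp: sum_subtractf[symmetric] intro!: sum.cong)
qed

lemma slot_span_cmult:
  assumes "Z \<in> slot_span K"
  shows "(\<lambda>i j. c * Z i j) \<in> slot_span K"
proof -
  obtain x where
    "\<forall>i\<in>Wd K. \<forall>j\<in>Wd K. Z i j = (\<Sum>\<rho> | \<rho> permutes K. if i \<circ> \<rho> = j then x \<rho> else 0)"
    using assms unfolding slot_span_def by blast
  then show ?thesis unfolding slot_span_def
    by (intro CollectI exI[of _ "\<lambda>\<rho>. c * x \<rho>"])
      (auto simp: sum_distrib_left intro!: sum.cong)
qed

lemma slot_span_zero: "(\<lambda>i j. 0) \<in> slot_span K"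
  unfolding slot_span_def by (auto intro!: exI[of _ "\<lambda>_. 0"])

lemma slot_span_add:
  assumes "Z \<in> slot_span K" "Z' \<in> slot_span K"
  shows "(\<lambda>i j. Z i j + Z' i j) \<in> slot_span K"
  using slot_span_diff[OF assms(1) slot_span_cmult[OF assms(2), of "-1"]] by simp

lemma slot_span_perm:
  assumes "finite K" "\<rho> permutes K"
  shows "(\<lambda>i j. if i \<circ> \<rho> = j then 1 else 0) \<in> slot_span K"
  by (rule slot_span_sumI[where P = "{\<rho>}" and \<kappa> = id and c = "\<lambda>_. 1"]) (use assms in auto)

lemma sum_norm_square_zero:
  assumes "finite A" "(\<Sum>x\<in>A. g x * cnj (g x)) = 0" "x \<in> A"
  shows "g x = 0"
proof -
  have "(\<Sum>x\<in>A. g x * cnj (g x)) = complex_of_real (\<Sum>x\<in>A. (cmod (g x))\<^sup>2)"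
    by (simp add: complex_norm_square[symmetric])
  then have "(\<Sum>x\<in>A. (cmod (g x))\<^sup>2) = 0" using assms(2) by (metis of_real_eq_0_iff)
  then show ?thesis using assms by (simp add: sum_nonneg_eq_0_iff)
qed

text \<open>The trace form is nondegenerate on the span, because the span is closed under adjoints.\<close>

lemma slot_span_eq_0:
  fixes Z :: "('k \<Rightarrow> 'n::finite) \<Rightarrow> ('k \<Rightarrow> 'n) \<Rightarrow> complex"
  assumes "finite K" "Z \<in> slot_span K"
    and "\<And>\<sigma>. \<sigma> permutes K \<Longrightarrow> (\<Sum>i\<in>Wd K. Z i (i \<circ> \<sigma>)) = 0"
    and "i \<in> Wd K" "j \<in> Wd K"
  shows "Z i j = 0"
proof -
  obtain x where x: "\<And>i j. i \<in> Wd K \<Longrightarrow> j \<in> Wd K \<Longrightarrow>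
    Z i j = (\<Sum>\<rho> | \<rho> permutes K. if i \<circ> \<rho> = j then x \<rho> else 0)"
    using assms(2) unfolding slot_span_def by blast
  have "(\<Sum>(i, j)\<in>Wd K \<times> Wd K. Z i j * cnj (Z i j)) = (\<Sum>i\<in>Wd K. \<Sum>j\<in>Wd K. Z i j * cnj (Z i j))"
    by (simp add: sum.cartesian_product)
  also have "\<dots> = (\<Sum>i\<in>Wd K. \<Sum>j\<in>Wd K. \<Sum>\<rho> | \<rho> permutes K. if j = i \<circ> \<rho> then Z i j * cnj (x \<rho>) else 0)"
    by (intro sum.cong refl) (auto simp: x cnj_sum sum_distrib_left intro!: sum.cong)
  also have "\<dots> = (\<Sum>i\<in>Wd K. \<Sum>\<rho> | \<rho> permutes K. Z i (i \<circ> \<rho>) * cnj (x \<rho>))"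
  proof (rule sum.cong[OF refl])
    fix i :: "'k \<Rightarrow> 'n" assume i: "i \<in> Wd K"
    have "(\<Sum>j\<in>Wd K. if j = i \<circ> \<rho> then Z i j * cnj (x \<rho>) else 0) = Z i (i \<circ> \<rho>) * cnj (x \<rho>)"
      if "\<rho> permutes K" for \<rho>
      using Wd_comp[OF i that] assms(1) by (simp add: sum.delta)
    then show "(\<Sum>j\<in>Wd K. \<Sum>\<rho> | \<rho> permutes K. if j = i \<circ> \<rho> then Z i j * cnj (x \<rho>) else 0) =
      (\<Sum>\<rho> | \<rho> permutes K. Z i (i \<circ> \<rho>) * cnj (x \<rho>))"
      by (subst sum.swap) simp
  qed
  also have "\<dots> = (\<Sum>\<rho> | \<rho> permutes K. (\<Sum>i\<in>Wd K. Z i (i \<circ> \<rho>)) * cnj (x \<rho>))"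
    by (subst sum.swap) (simp add: sum_distrib_right)
  also have "\<dots> = 0" using assms(3) by simp
  finally have "(\<Sum>p\<in>Wd K \<times> Wd K. (case p of (i, j) \<Rightarrow> Z i j) * cnj (case p of (i, j) \<Rightarrow> Z i j)) = 0"
    by (simp add: case_prod_unfold)
  from sum_norm_square_zero[OF _ this, of "(i, j)"] show ?thesis using assms by simp
qed

text \<open>A linear system for the Gram matrix \<open>Gr\<close> of the slot permutations. The
  residue \<open>F1\<close> of \<open>F\<close> after projection to its range is orthogonal to all
  rows, so the tensor \<open>t\<close> with coefficients \<open>F1\<close> pairs to zero with every
  permutation and vanishes. Thus \<open>F1\<close> is a relation between slot permutations. As
  \<open>F\<close> kills relations, \<open>F1\<close> is orthogonal to \<open>F\<close> and to
  \<open>app x\<close>, hence to itself.\<close>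

lemma slot_span_dual:
  fixes F :: "(nat \<Rightarrow> nat) \<Rightarrow> complex"
  assumes fin: "finite K"
    and alt: "\<And>D \<beta>. D \<subseteq> K \<Longrightarrow> card D = CARD('n) + 1 \<Longrightarrow> \<beta> permutes K \<Longrightarrow>
      (\<Sum>\<tau> | \<tau> permutes D. of_int (sign \<tau>) * F (\<beta> \<circ> \<tau>)) = 0"
  shows "\<exists>Z \<in> (slot_span K :: ((nat \<Rightarrow> 'n::finite) \<Rightarrow> _ \<Rightarrow> _) set).
    \<forall>\<sigma>. \<sigma> permutes K \<longrightarrow> (\<Sum>i\<in>Wd K. Z i (i \<circ> \<sigma>)) = F \<sigma>"
proof -
  let ?P = "{\<sigma>. \<sigma> permutes K}"
  have finP: "finite ?P" by (rule finite_permutations[OF fin])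
  define Gr :: "(nat \<Rightarrow> nat) \<Rightarrow> (nat \<Rightarrow> nat) \<Rightarrow> complex"
    where "Gr \<rho> \<sigma> = (\<Sum>i\<in>(Wd K :: (nat \<Rightarrow> 'n) set). if i \<circ> \<rho> = i \<circ> \<sigma> then 1 else 0)" for \<rho> \<sigma>
  have cnjGr: "cnj (Gr \<rho> \<sigma>) = Gr \<rho> \<sigma>" for \<rho> \<sigma>
    by (auto simp: Gr_def cnj_sum intro!: sum.cong)
  define app where "app x \<sigma> = (\<Sum>\<rho>\<in>?P. x \<rho> * Gr \<rho> \<sigma>)" for x \<sigma>
  define L where "L = range app"
  have "\<exists>u\<in>L. \<forall>l\<in>L. (\<Sum>\<sigma>\<in>?P. (F \<sigma> - u \<sigma>) * cnj (l \<sigma>)) = 0"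
  proof (rule orthogonal_projection[OF finP])
    have "(\<lambda>\<sigma>. 0) = app (\<lambda>_. 0)" by (simp add: app_def fun_eq_iff)
    then show "(\<lambda>\<sigma>. 0) \<in> L" by (simp add: L_def)
  next
    fix u v assume "u \<in> L" "v \<in> L"
    then obtain x y where "u = app x" "v = app y" by (auto simp: L_def)
    then have "(\<lambda>\<sigma>. u \<sigma> + v \<sigma>) = app (\<lambda>\<rho>. x \<rho> + y \<rho>)"
      by (simp add: app_def distrib_right sum.distrib fun_eq_iff)
    then show "(\<lambda>\<sigma>. u \<sigma> + v \<sigma>) \<in> L" by (simp add: L_def)
  next
    fix c u assume "u \<in> L"
    then obtain x where "u = app x" by (auto simp: L_def)
    then have "(\<lambda>\<sigma>. c * u \<sigma>) = app (\<lambda>\<rho>. c * x \<rho>)"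
      by (simp add: app_def sum_distrib_left mult.assoc fun_eq_iff)
    then show "(\<lambda>\<sigma>. c * u \<sigma>) \<in> L" by (simp add: L_def)
  qed
  then obtain x where orth: "\<And>l. l \<in> L \<Longrightarrow> (\<Sum>\<sigma>\<in>?P. (F \<sigma> - app x \<sigma>) * cnj (l \<sigma>)) = 0"
    by (auto simp: L_def)
  define F1 where "F1 \<sigma> = F \<sigma> - app x \<sigma>" for \<sigma>
  define t where "t i j = (\<Sum>\<sigma>\<in>?P. if i \<circ> \<sigma> = j then F1 \<sigma> else 0)" for i j :: "nat \<Rightarrow> 'n"
  have GrF1: "(\<Sum>\<sigma>\<in>?P. F1 \<sigma> * Gr \<rho> \<sigma>) = 0" if \<rho>: "\<rho> \<in> ?P" for \<rho>
  proof -
    have "Gr \<rho> = app (\<lambda>\<pi>. if \<pi> = \<rho> then 1 else 0)"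
    proof
      fix \<sigma>
      show "Gr \<rho> \<sigma> = app (\<lambda>\<pi>. if \<pi> = \<rho> then 1 else 0) \<sigma>"
        using finP \<rho> by (simp add: app_def if_distrib[of "\<lambda>c. c * _"] cong: if_cong)
    qed
    then have "Gr \<rho> \<in> L" by (simp add: L_def)
    from orth[OF this] show ?thesis by (simp add: F1_def cnjGr)
  qed
  have t0: "t i j = 0" if "i \<in> Wd K" "j \<in> Wd K" for i j
  proof (rule slot_span_eq_0[OF fin _ _ that])
    show "t \<in> slot_span K" unfolding slot_span_def t_def by blast
    fix \<rho> assume \<rho>: "\<rho> permutes K"
    have "(\<Sum>i\<in>Wd K. t i (i \<circ> \<rho>)) = (\<Sum>\<sigma>\<in>?P. F1 \<sigma> * Gr \<rho> \<sigma>)"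
      unfolding t_def Gr_def sum_distrib_left
      by (subst sum.swap) (auto intro!: sum.cong)
    then show "(\<Sum>i\<in>Wd K. t i (i \<circ> \<rho>)) = 0" using GrF1 \<rho> by simp
  qed
  \<comment> \<open>The conjugated coefficients are again a relation, because the matrices of slot
    permutations are real.\<close>
  have s1: "(\<Sum>\<sigma>\<in>?P. cnj (F1 \<sigma>) * F \<sigma>) = 0"
  proof (rule second_fundamental_theorem[OF fin _ alt])
    fix i j :: "nat \<Rightarrow> 'n" assume ij: "i \<in> Wd K" "j \<in> Wd K"
    have "(\<Sum>\<sigma>\<in>?P. if i \<circ> \<sigma> = j then cnj (F1 \<sigma>) else 0) = cnj (t i j)"
      by (auto simp: t_def cnj_sum intro!: sum.cong)
    then show "(\<Sum>\<sigma>\<in>?P. if i \<circ> \<sigma> = j then cnj (F1 \<sigma>) else 0) = 0" using t0[OF ij] by simp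
  qed
  have "(\<Sum>\<sigma>\<in>?P. F1 \<sigma> * cnj (app x \<sigma>)) = 0" using orth[of "app x"] by (simp add: L_def F1_def)
  moreover have "cnj (\<Sum>\<sigma>\<in>?P. cnj (F1 \<sigma>) * F \<sigma>) = (\<Sum>\<sigma>\<in>?P. F1 \<sigma> * cnj (F \<sigma>))"
    by (simp add: cnj_sum)
  ultimately have "(\<Sum>\<sigma>\<in>?P. F1 \<sigma> * cnj (F1 \<sigma>)) = 0"
    unfolding s1 by (simp add: F1_def right_diff_distrib sum_subtractf)
  then have F1: "F1 \<sigma> = 0" if "\<sigma> permutes K" for \<sigma>
    using sum_norm_square_zero[OF finP] that by blast
  define Z where "Z i j = (\<Sum>\<rho>\<in>?P. if i \<circ> \<rho> = j then x \<rho> else 0)" for i j :: "nat \<Rightarrow> 'n"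
  have "(\<Sum>i\<in>Wd K. Z i (i \<circ> \<sigma>)) = app x \<sigma>" for \<sigma>
    unfolding Z_def app_def Gr_def sum_distrib_left
    by (subst sum.swap) (auto intro!: sum.cong)
  then have "\<forall>\<sigma>. \<sigma> permutes K \<longrightarrow> (\<Sum>i\<in>Wd K. Z i (i \<circ> \<sigma>)) = F \<sigma>"
    using F1 by (simp add: F1_def)
  moreover have "Z \<in> slot_span K" unfolding slot_span_def Z_def by blast
  ultimately show ?thesis by blast
qed

section \<open>Contraction of two slots\<close>

text \<open>The column index of slot \<open>p\<close> is joined to the row index of slot
  \<open>q\<close>; the merged slot keeps the name \<open>p\<close> and takes over the column index
  of \<open>q\<close>. On a tensor product of matrices this multiplies the matrices at
  \<open>p\<close> and \<open>q\<close>.\<close>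

definition contract_slots ::
    "'k \<Rightarrow> 'k \<Rightarrow> (('k \<Rightarrow> 'n::finite) \<Rightarrow> ('k \<Rightarrow> 'n) \<Rightarrow> complex) \<Rightarrow> ('k \<Rightarrow> 'n) \<Rightarrow> ('k \<Rightarrow> 'n) \<Rightarrow> complex"
  where "contract_slots p q Z i j = (\<Sum>l\<in>UNIV. Z (i(q := l)) (j(p := l, q := j p)))"

text \<open>After composition with the transposition, both joined indices sit in slot
  \<open>q\<close>, so this is a partial trace. If \<open>\<pi>\<close> fixes \<open>q\<close>, the
  index \<open>l\<close> is free and contributes the factor \<open>CARD('n)\<close>; otherwise it is
  determined, and \<open>q\<close> is cut out of its cycle with factor 1.\<close>

lemma contract_perm:
  assumes "\<rho> permutes K" "p \<in> K" "q \<in> K" "p \<noteq> q"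
  shows "\<exists>\<kappa> c. \<kappa> permutes (K - {q}) \<and> (\<forall>i\<in>Wd (K - {q}). \<forall>j\<in>Wd (K - {q}).
    (\<Sum>l\<in>(UNIV :: 'n::finite set). if (i(q := l)) \<circ> \<rho> = j(p := l, q := j p) then 1 else 0 :: complex)
    = (if i \<circ> \<kappa> = j then c else 0))"
proof -
  define \<pi> where "\<pi> = \<rho> \<circ> Transposition.transpose p q"
  have \<pi>: "\<pi> permutes K"
    unfolding \<pi>_def by (rule permutes_compose[OF permutes_swap_id assms(1)]) (use assms in auto)
  have inj: "\<pi> x = \<pi> y \<Longrightarrow> x = y" for x y using permutes_inj[OF \<pi>] by (metis injD)
  have eq: "(i(q := l)) \<circ> \<rho> = j(p := l, q := j p) \<longleftrightarrow> (i(q := l)) \<circ> \<pi> = j(q := l)"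
    for i j :: "'a \<Rightarrow> 'n" and l
  proof -
    have "(i(q := l)) \<circ> \<rho> = j(p := l, q := j p) \<longleftrightarrow>
      (i(q := l)) \<circ> \<rho> \<circ> Transposition.transpose p q = j(p := l, q := j p) \<circ> Transposition.transpose p q"
      by (metis comp_assoc comp_id transpose_comp_involutory)
    moreover have "j(p := l, q := j p) \<circ> Transposition.transpose p q = j(q := l)"
      using assms(4) by (auto simp: fun_eq_iff Transposition.transpose_def)
    ultimately show ?thesis by (simp only: \<pi>_def comp_assoc)
  qed
  show ?thesis
  proof (cases "\<pi> q = q")
    case True
    then have \<pi>': "\<pi> permutes (K - {q})"
      by (intro permutes_superset[OF \<pi>]) auto
    have ne: "\<pi> x \<noteq> q" if "x \<noteq> q" for x using inj[of x q] True that by auto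
    have "(i(q := l)) \<circ> \<pi> = j(q := l) \<longleftrightarrow> i \<circ> \<pi> = j"
      if "i \<in> Wd (K - {q})" "j \<in> Wd (K - {q})" for i j :: "'a \<Rightarrow> 'n" and l
    proof -
      have "(i \<circ> \<pi>) q = j q" using that True by (simp add: PiE_def extensional_def)
      then show ?thesis using True ne by (auto simp: fun_eq_iff) metis
    qed
    then show ?thesis unfolding eq
      by (intro exI[of _ \<pi>] exI[of _ "of_nat CARD('n)"]) (auto simp: \<pi>')
  next
    case False
    define b where "b = inv_into UNIV \<pi> q"
    have b: "\<pi> b = q" by (simp add: b_def permutes_inverses[OF \<pi>])
    have bq: "b \<noteq> q" using b False by auto
    have bK: "b \<in> K" using b assms(3) by (metis permutes_in_image[OF \<pi>])
    define \<kappa> where "\<kappa> = \<pi> \<circ> Transposition.transpose b q"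
    have \<kappa>: "\<kappa> permutes (K - {q})" unfolding \<kappa>_def by (rule permutes_contract[OF \<pi> b bK])
    have ne: "\<pi> x \<noteq> q" if "x \<noteq> b" for x using inj[of x b] b that by auto
    have "(i(q := l)) \<circ> \<pi> = j(q := l) \<longleftrightarrow> l = i (\<pi> q) \<and> i \<circ> \<kappa> = j"
      if ij: "i \<in> Wd (K - {q})" "j \<in> Wd (K - {q})" for i j :: "'a \<Rightarrow> 'n" and l
    proof
      assume h: "(i(q := l)) \<circ> \<pi> = j(q := l)"
      have l: "l = i (\<pi> q)" using fun_cong[OF h, of q] False by simp
      have jb: "j b = l" using fun_cong[OF h, of b] b bq by simp
      have "(i \<circ> \<kappa>) x = j x" for x
      proof (cases "x = b \<or> x = q")
        case True
        then show ?thesis using l jb b ij bq by (auto simp: \<kappa>_def PiE_def extensional_def)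
      next
        case False
        then show ?thesis using fun_cong[OF h, of x] ne[of x] by (simp add: \<kappa>_def)
      qed
      then show "l = i (\<pi> q) \<and> i \<circ> \<kappa> = j" using l by (auto simp: fun_eq_iff)
    next
      assume h: "l = i (\<pi> q) \<and> i \<circ> \<kappa> = j"
      show "(i(q := l)) \<circ> \<pi> = j(q := l)"
      proof
        fix x
        have jx: "j x = i (\<pi> (Transposition.transpose b q x))" using h by (auto simp: \<kappa>_def)
        consider "x = q" | "x = b" | "x \<noteq> q" "x \<noteq> b" by blast
        then show "((i(q := l)) \<circ> \<pi>) x = (j(q := l)) x"
        proof cases
          case 1
          then show ?thesis using h False by simp
        next
          case 2
          then show ?thesis using h jx b bq by simp
        next
          case 3
          then show ?thesis using jx ne[of x] by simp
        qed
      qed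
    qed
    then show ?thesis unfolding eq
      by (intro exI[of _ \<kappa>] exI[of _ 1]) (auto simp: \<kappa> sum.delta)
  qed
qed

lemma slot_span_contract:
  fixes Z :: "('k \<Rightarrow> 'n::finite) \<Rightarrow> ('k \<Rightarrow> 'n) \<Rightarrow> complex"
  assumes "finite K" "p \<in> K" "q \<in> K" "p \<noteq> q" "Z \<in> slot_span K"
  shows "contract_slots p q Z \<in> slot_span (K - {q})"
proof -
  obtain x where x: "\<And>i j. i \<in> Wd K \<Longrightarrow> j \<in> Wd K \<Longrightarrow>
    Z i j = (\<Sum>\<rho> | \<rho> permutes K. if i \<circ> \<rho> = j then x \<rho> else 0)"
    using assms(5) unfolding slot_span_def by blast
  have "\<forall>\<rho>. \<exists>\<kappa> c. \<rho> permutes K \<longrightarrow> \<kappa> permutes (K - {q}) \<and>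
    (\<forall>i\<in>Wd (K - {q}). \<forall>j\<in>Wd (K - {q}).
      (\<Sum>l\<in>(UNIV :: 'n set). if (i(q := l)) \<circ> \<rho> = j(p := l, q := j p) then 1 else 0 :: complex)
      = (if i \<circ> \<kappa> = j then c else 0))"
    using contract_perm[OF _ assms(2-4), where 'n = 'n] by blast
  then obtain \<kappa> c where kc0: "\<forall>\<rho>. \<rho> permutes K \<longrightarrow> \<kappa> \<rho> permutes (K - {q}) \<and>
    (\<forall>i\<in>Wd (K - {q}). \<forall>j\<in>Wd (K - {q}).
      (\<Sum>l\<in>(UNIV :: 'n set). if (i(q := l)) \<circ> \<rho> = j(p := l, q := j p) then 1 else 0 :: complex)
      = (if i \<circ> \<kappa> \<rho> = j then c \<rho> else 0))"
    unfolding choice_iff by (elim exE)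
  then have kc: "\<And>\<rho>. \<rho> permutes K \<Longrightarrow> \<kappa> \<rho> permutes (K - {q})"
    "\<And>\<rho> i j. \<rho> permutes K \<Longrightarrow> i \<in> Wd (K - {q}) \<Longrightarrow> j \<in> Wd (K - {q}) \<Longrightarrow>
      (\<Sum>l\<in>(UNIV :: 'n set). if (i(q := l)) \<circ> \<rho> = j(p := l, q := j p) then 1 else 0 :: complex)
      = (if i \<circ> \<kappa> \<rho> = j then c \<rho> else 0)"
    by blast+
  show ?thesis
  proof (rule slot_span_sumI[where P = "{\<rho>. \<rho> permutes K}" and \<kappa> = \<kappa> and c = "\<lambda>\<rho>. x \<rho> * c \<rho>"])
    fix i j :: "'k \<Rightarrow> 'n" assume ij: "i \<in> Wd (K - {q})" "j \<in> Wd (K - {q})"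
    have W: "i(q := l) \<in> Wd K" "j(p := l, q := j p) \<in> Wd K" for l
      using ij assms(2,3) by (auto simp: PiE_def extensional_def)
    have "contract_slots p q Z i j = (\<Sum>l\<in>UNIV. \<Sum>\<rho> | \<rho> permutes K.
      if (i(q := l)) \<circ> \<rho> = j(p := l, q := j p) then x \<rho> else 0)"
      unfolding contract_slots_def by (intro sum.cong refl x W)
    also have "\<dots> = (\<Sum>\<rho> | \<rho> permutes K. x \<rho> * (\<Sum>l\<in>UNIV.
      if (i(q := l)) \<circ> \<rho> = j(p := l, q := j p) then 1 else 0))"
      unfolding sum_distrib_left by (subst sum.swap) (auto intro!: sum.cong)
    also have "\<dots> = (\<Sum>\<rho> | \<rho> permutes K. if i \<circ> \<kappa> \<rho> = j then x \<rho> * c \<rho> else 0)"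
      by (rule sum.cong) (auto simp: kc(2) ij)
    finally show "contract_slots p q Z i j =
      (\<Sum>\<rho> | \<rho> permutes K. if i \<circ> \<kappa> \<rho> = j then x \<rho> * c \<rho> else 0)" .
  qed (use assms finite_permutations kc in auto)
qed

lemma sum_contract_slots:
  assumes "finite K" "p \<in> K" "q \<in> K" "p \<noteq> q" "\<sigma> permutes (K - {q})"
  shows "(\<Sum>i\<in>Wd (K - {q}). contract_slots p q Z i (i \<circ> \<sigma>)) =
    (\<Sum>i\<in>Wd K. Z i (i \<circ> (\<sigma> \<circ> Transposition.transpose p q)))"
proof -
  have "(i \<circ> \<sigma>)(p := l, q := (i \<circ> \<sigma>) p) = i(q := l) \<circ> (\<sigma> \<circ> Transposition.transpose p q)"
    if "i \<in> Wd (K - {q})" for i :: "'a \<Rightarrow> 'b" and l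
  proof -
    have q: "\<sigma> q = q" using assms(5) by (simp add: permutes_def)
    then have "\<sigma> x \<noteq> q" if "x \<noteq> q" for x using that permutes_inj[OF assms(5)] by (metis injD)
    then show ?thesis using q assms(4) by (auto simp: fun_eq_iff Transposition.transpose_def)
  qed
  then show ?thesis
    by (auto simp: contract_slots_def sum_Wd_remove[OF assms(1,3)] intro!: sum.cong)
qed

section \<open>The tensors dual to a central solution\<close>

context central_solution
begin

definition tens :: "nat set \<Rightarrow> (nat \<Rightarrow> 'g list) \<Rightarrow> (nat \<Rightarrow> 'n::finite) \<Rightarrow> (nat \<Rightarrow> 'n) \<Rightarrow> complex"
  where "tens K w = (SOME Z. Z \<in> slot_span K \<and>
    (\<forall>\<sigma>. \<sigma> permutes K \<longrightarrow> (\<Sum>i\<in>Wd K. Z i (i \<circ> \<sigma>)) = cyc_val K w \<sigma>))"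

text \<open>A triple \<open>(g, i, j)\<close> stands for the \<open>(i, j)\<close> entry of the
  matrix \<open>y\<close> of \<open>g\<close>; \<open>psi\<close> is the intended value of the
  functional on the product of the listed entries.\<close>

definition psi :: "('g \<times> 'n::finite \<times> 'n) list \<Rightarrow> complex"
  where "psi xs = tens {..<length xs} (\<lambda>r. [fst (xs ! r)])
    (\<lambda>r\<in>{..<length xs}. fst (snd (xs ! r))) (\<lambda>r\<in>{..<length xs}. snd (snd (xs ! r)))"

context
  assumes n: "n = CARD('n::finite)"
begin

lemma tens:
  assumes "finite K" "\<And>r. r \<in> K \<Longrightarrow> w r \<noteq> []"
  shows "(tens K w :: (nat \<Rightarrow> 'n) \<Rightarrow> _) \<in> slot_span K"
    and "\<sigma> permutes K \<Longrightarrow> (\<Sum>i\<in>(Wd K :: (nat \<Rightarrow> 'n) set). tens K w i (i \<circ> \<sigma>)) = cyc_val K w \<sigma>"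
proof -
  have "\<exists>Z \<in> (slot_span K :: ((nat \<Rightarrow> 'n) \<Rightarrow> _ \<Rightarrow> _) set).
    \<forall>\<sigma>. \<sigma> permutes K \<longrightarrow> (\<Sum>i\<in>Wd K. Z i (i \<circ> \<sigma>)) = cyc_val K w \<sigma>"
    by (rule slot_span_dual[OF assms(1)], rule cyc_val_alternating[OF sum_aug_form_words assms(1)])
      (use assms n in auto)
  then have "\<exists>Z :: (nat \<Rightarrow> 'n) \<Rightarrow> _. Z \<in> slot_span K \<and>
    (\<forall>\<sigma>. \<sigma> permutes K \<longrightarrow> (\<Sum>i\<in>Wd K. Z i (i \<circ> \<sigma>)) = cyc_val K w \<sigma>)" by blast
  note t = someI_ex[OF this, folded tens_def]
  show "(tens K w :: (nat \<Rightarrow> 'n) \<Rightarrow> _) \<in> slot_span K" using t by blast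
  show "\<sigma> permutes K \<Longrightarrow> (\<Sum>i\<in>(Wd K :: (nat \<Rightarrow> 'n) set). tens K w i (i \<circ> \<sigma>)) = cyc_val K w \<sigma>"
    using t by blast
qed

text \<open>Nondegeneracy of the pairing. Each identity below between dual tensors is obtained by
  exhibiting an element of the span with the right pairings, that is, from an identity for
  \<open>cyc_val\<close>.\<close>

lemma tens_unique:
  fixes Z :: "(nat \<Rightarrow> 'n) \<Rightarrow> (nat \<Rightarrow> 'n) \<Rightarrow> complex"
  assumes "finite K" "\<And>r. r \<in> K \<Longrightarrow> w r \<noteq> []" "Z \<in> slot_span K"
    and "\<And>\<sigma>. \<sigma> permutes K \<Longrightarrow> (\<Sum>i\<in>Wd K. Z i (i \<circ> \<sigma>)) = cyc_val K w \<sigma>"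
    and "i \<in> Wd K" "j \<in> Wd K"
  shows "tens K w i j = Z i j"
proof -
  have "tens K w i j - Z i j = 0"
    by (rule slot_span_eq_0[OF assms(1) slot_span_diff[OF tens(1)[OF assms(1,2)] assms(3)] _ assms(5,6)])
      (simp_all add: sum_subtractf tens(2)[OF assms(1,2)] assms(4))
  then show ?thesis by simp
qed

lemma tens_cong:
  fixes i j :: "nat \<Rightarrow> 'n"
  assumes "finite K" "\<And>r. r \<in> K \<Longrightarrow> w r \<noteq> []" "\<And>r. r \<in> K \<Longrightarrow> w r = w' r" "i \<in> Wd K" "j \<in> Wd K"
  shows "tens K w i j = tens K w' i j"
proof (rule tens_unique[OF assms(1,2) _ _ assms(4,5)])
  have w': "\<And>r. r \<in> K \<Longrightarrow> w' r \<noteq> []" using assms by auto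
  show "(tens K w' :: (nat \<Rightarrow> 'n) \<Rightarrow> _) \<in> slot_span K" by (rule tens(1)[OF assms(1) w'])
  show "(\<Sum>i\<in>(Wd K :: (nat \<Rightarrow> 'n) set). tens K w' i (i \<circ> \<sigma>)) = cyc_val K w \<sigma>" if "\<sigma> permutes K" for \<sigma>
    using tens(2)[OF assms(1) w' that] cyc_val_cong[of K w w'] assms(3) by simp
qed

text \<open>Renaming the slots conjugates the permutations in the span and in the pairings alike.
  Hence \<open>psi\<close> does not see the order of the factors of a monomial.\<close>

lemma tens_permute:
  fixes i j :: "nat \<Rightarrow> 'n"
  assumes "finite K" "\<And>r. r \<in> K \<Longrightarrow> w r \<noteq> []" "\<pi> permutes K" "i \<in> Wd K" "j \<in> Wd K"
  shows "tens K w i j = tens K (w \<circ> \<pi>) (i \<circ> \<pi>) (j \<circ> \<pi>)"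
proof (rule tens_unique[OF assms(1,2) _ _ assms(4,5)])
  let ?\<pi>' = "inv_into UNIV \<pi>"
  let ?T = "tens K (w \<circ> \<pi>) :: (nat \<Rightarrow> 'n) \<Rightarrow> (nat \<Rightarrow> 'n) \<Rightarrow> complex"
  note o = permutes_inv_o[OF assms(3)]
  have w: "\<And>r. r \<in> K \<Longrightarrow> (w \<circ> \<pi>) r \<noteq> []" using assms(2,3) by (simp add: permutes_in_image)
  obtain x where x: "\<And>i j. i \<in> Wd K \<Longrightarrow> j \<in> Wd K \<Longrightarrow>
    ?T i j = (\<Sum>\<rho> | \<rho> permutes K. if i \<circ> \<rho> = j then x \<rho> else 0)"
  proof (rule slot_spanE[OF tens(1)[OF assms(1) w]])
    fix x
    assume "\<And>i j. i \<in> Wd K \<Longrightarrow> j \<in> Wd K \<Longrightarrow>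
      ?T i j = (\<Sum>\<rho> | \<rho> permutes K. if i \<circ> \<rho> = j then x \<rho> else 0)"
    then show thesis by (rule that)
  qed
  show "(\<lambda>i j. ?T (i \<circ> \<pi>) (j \<circ> \<pi>)) \<in> slot_span K"
  proof (rule slot_span_sumI[OF assms(1), where P = "{\<rho>. \<rho> permutes K}" and
        \<kappa> = "\<lambda>\<rho>. \<pi> \<circ> \<rho> \<circ> ?\<pi>'" and c = x])
    fix i j :: "nat \<Rightarrow> 'n" assume ij: "i \<in> Wd K" "j \<in> Wd K"
    have eq: "i \<circ> \<pi> \<circ> \<rho> = j \<circ> \<pi> \<longleftrightarrow> i \<circ> (\<pi> \<circ> \<rho> \<circ> ?\<pi>') = j" for \<rho>
    proof
      assume "i \<circ> \<pi> \<circ> \<rho> = j \<circ> \<pi>"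
      then have "i \<circ> \<pi> \<circ> \<rho> \<circ> ?\<pi>' = j \<circ> \<pi> \<circ> ?\<pi>'" by simp
      then show "i \<circ> (\<pi> \<circ> \<rho> \<circ> ?\<pi>') = j" using o by (simp add: comp_assoc)
    next
      assume "i \<circ> (\<pi> \<circ> \<rho> \<circ> ?\<pi>') = j"
      then have "i \<circ> (\<pi> \<circ> \<rho> \<circ> ?\<pi>') \<circ> \<pi> = j \<circ> \<pi>" by simp
      then show "i \<circ> \<pi> \<circ> \<rho> = j \<circ> \<pi>" using o by (simp add: comp_assoc)
    qed
    show "?T (i \<circ> \<pi>) (j \<circ> \<pi>) =
      (\<Sum>\<rho> | \<rho> permutes K. if i \<circ> (\<pi> \<circ> \<rho> \<circ> ?\<pi>') = j then x \<rho> else 0)"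
      unfolding x[OF Wd_comp[OF ij(1) assms(3)] Wd_comp[OF ij(2) assms(3)]] eq ..
  qed (auto intro: finite_permutations[OF assms(1)]
      permutes_compose[OF permutes_inv[OF assms(3)] permutes_compose[OF _ assms(3)]])
  fix \<sigma> assume \<sigma>: "\<sigma> permutes K"
  define \<sigma>' where "\<sigma>' = ?\<pi>' \<circ> \<sigma> \<circ> \<pi>"
  have \<sigma>': "\<sigma>' permutes K" unfolding \<sigma>'_def
    by (intro permutes_compose[OF assms(3)] permutes_compose[OF \<sigma>] permutes_inv assms(3))
  have c: "\<pi> \<circ> \<sigma>' = \<sigma> \<circ> \<pi>" using o by (simp add: \<sigma>'_def comp_assoc[symmetric])
  have "(\<Sum>i\<in>Wd K. ?T (i \<circ> \<pi>) (i \<circ> \<sigma> \<circ> \<pi>)) = (\<Sum>i\<in>Wd K. ?T (i \<circ> \<pi>) (i \<circ> \<pi> \<circ> \<sigma>'))"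
    by (simp only: comp_assoc c)
  also have "\<dots> = (\<Sum>i\<in>Wd K. ?T i (i \<circ> \<sigma>'))" by (rule sum_Wd_comp[OF assms(3)])
  also have "\<dots> = cyc_val K (w \<circ> \<pi>) \<sigma>'" by (rule tens(2)[OF assms(1) w \<sigma>'])
  also have "\<dots> = cyc_val K w \<sigma>" by (rule cyc_val_conj[OF assms(3) c, symmetric])
  finally show "(\<Sum>i\<in>Wd K. ?T (i \<circ> \<pi>) (i \<circ> \<sigma> \<circ> \<pi>)) = cyc_val K w \<sigma>" .
qed

text \<open>Contraction of tensors composes the pairing permutation with a transposition
  (\<open>sum_contract_slots\<close>), and \<open>cyc_val_contract\<close> undoes this by
  concatenating the two words.\<close>

lemma tens_contract:
  fixes i j :: "nat \<Rightarrow> 'n"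
  assumes "finite K" "\<And>r. r \<in> K \<Longrightarrow> w r \<noteq> []" "p \<in> K" "q \<in> K" "p \<noteq> q"
    "i \<in> Wd (K - {q})" "j \<in> Wd (K - {q})"
  shows "(\<Sum>l\<in>UNIV. tens K w (i(q := l)) (j(p := l, q := j p))) =
    tens (K - {q}) (w(p := w p @ w q)) i j"
proof -
  have "tens (K - {q}) (w(p := w p @ w q)) i j = contract_slots p q (tens K w) i j"
  proof (rule tens_unique[OF _ _ _ _ assms(6,7)])
    show "contract_slots p q (tens K w :: (nat \<Rightarrow> 'n) \<Rightarrow> _) \<in> slot_span (K - {q})"
      by (rule slot_span_contract[OF assms(1,3,4,5) tens(1)[OF assms(1,2)]])
    fix \<sigma> assume \<sigma>: "\<sigma> permutes (K - {q})"
    let ?\<tau> = "\<sigma> \<circ> Transposition.transpose p q"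
    have \<tau>: "?\<tau> permutes K"
      by (rule permutes_compose[OF permutes_swap_id permutes_subset[OF \<sigma>]]) (use assms in auto)
    have "(\<Sum>i\<in>(Wd (K - {q}) :: (nat \<Rightarrow> 'n) set). contract_slots p q (tens K w) i (i \<circ> \<sigma>)) =
      (\<Sum>i\<in>(Wd K :: (nat \<Rightarrow> 'n) set). tens K w i (i \<circ> ?\<tau>))"
      by (rule sum_contract_slots[OF assms(1,3,4,5) \<sigma>])
    also have "\<dots> = cyc_val K w ?\<tau>" by (rule tens(2)[OF assms(1,2) \<tau>])
    also have "\<dots> = cyc_val (K - {q}) (w(p := w p @ w q)) (?\<tau> \<circ> Transposition.transpose p q)"
      by (rule cyc_val_contract) (use assms \<sigma> in \<open>auto simp: permutes_def\<close>)
    also have "?\<tau> \<circ> Transposition.transpose p q = \<sigma>" by (simp add: comp_assoc)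
    finally show "(\<Sum>i\<in>(Wd (K - {q}) :: (nat \<Rightarrow> 'n) set). contract_slots p q (tens K w) i (i \<circ> \<sigma>)) =
      cyc_val (K - {q}) (w(p := w p @ w q)) \<sigma>" .
  qed (use assms in auto)
  then show ?thesis by (simp add: contract_slots_def)
qed

lemma tens_mult:
  fixes i j :: "nat \<Rightarrow> 'n"
  assumes "finite K" "\<And>r. r \<in> K \<Longrightarrow> w r \<noteq> []" "p \<in> K" "x \<in> carrier \<Gamma>" "y \<in> carrier \<Gamma>"
    "i \<in> Wd K" "j \<in> Wd K"
  shows "tens K (w(p := [x, y])) i j =
    tens K (w(p := [x \<otimes> y])) i j - tens K (w(p := [x])) i j - tens K (w(p := [y])) i j"
proof (rule tens_unique[OF assms(1) _ _ _ assms(6,7)])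
  have ne: "\<And>r. r \<in> K \<Longrightarrow> (w(p := u # us)) r \<noteq> []" for u us using assms(2) by simp
  show "(\<lambda>i j :: nat \<Rightarrow> 'n. tens K (w(p := [x \<otimes> y])) i j - tens K (w(p := [x])) i j -
    tens K (w(p := [y])) i j) \<in> slot_span K"
    by (intro slot_span_diff tens(1)[OF assms(1) ne])
  fix \<sigma> assume \<sigma>: "\<sigma> permutes K"
  show "(\<Sum>i\<in>(Wd K :: (nat \<Rightarrow> 'n) set). tens K (w(p := [x \<otimes> y])) i (i \<circ> \<sigma>) -
    tens K (w(p := [x])) i (i \<circ> \<sigma>) - tens K (w(p := [y])) i (i \<circ> \<sigma>)) = cyc_val K (w(p := [x, y])) \<sigma>"
    by (simp only: sum_subtractf tens(2)[OF assms(1) ne \<sigma>] cyc_val_mult[OF assms(3-5)])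
qed (use assms in auto)

lemma tens_one:
  fixes i j :: "nat \<Rightarrow> 'n"
  assumes "finite K" "\<And>r. r \<in> K \<Longrightarrow> w r \<noteq> []" "p \<in> K" "i \<in> Wd K" "j \<in> Wd K"
  shows "tens K (w(p := [\<one>])) i j = 0"
  by (rule tens_unique[OF assms(1) _ slot_span_zero _ assms(4,5)])
    (use assms in \<open>auto simp: cyc_val_one\<close>)

lemma psi_mset:
  assumes "mset xs = mset (ys :: ('g \<times> 'n \<times> 'n) list)"
  shows "psi xs = psi ys"
proof -
  obtain \<pi> where \<pi>: "\<pi> permutes {..<length ys}" "permute_list \<pi> ys = xs"
    using mset_eq_permutation[OF assms] by blast
  have len: "length xs = length ys" using assms by (rule mset_eq_length)
  have nth: "xs ! r = ys ! \<pi> r" if "r < length ys" for r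
    using that \<pi> permute_list_nth by blast
  let ?K = "{..<length ys}"
  let ?i = "\<lambda>r\<in>?K. fst (snd (ys ! r))" and ?j = "\<lambda>r\<in>?K. snd (snd (ys ! r))"
  have W: "?i \<in> Wd ?K" "?j \<in> Wd ?K" by auto
  have in_K: "\<pi> r < length ys \<longleftrightarrow> r < length ys" for r using permutes_in_image[OF \<pi>(1), of r] by simp
  have "psi ys = tens ?K ((\<lambda>r. [fst (ys ! r)]) \<circ> \<pi>) (?i \<circ> \<pi>) (?j \<circ> \<pi>)"
    unfolding psi_def by (rule tens_permute[OF _ _ \<pi>(1) W]) auto
  also have "?i \<circ> \<pi> = (\<lambda>r\<in>?K. fst (snd (xs ! r)))"
    by (auto simp: fun_eq_iff nth in_K)
  also have "?j \<circ> \<pi> = (\<lambda>r\<in>?K. snd (snd (xs ! r)))"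
    by (auto simp: fun_eq_iff nth in_K)
  also have "tens ?K ((\<lambda>r. [fst (ys ! r)]) \<circ> \<pi>) (\<lambda>r\<in>?K. fst (snd (xs ! r))) (\<lambda>r\<in>?K. snd (snd (xs ! r)))
    = psi xs"
    unfolding psi_def len by (rule tens_cong) (auto simp: nth)
  finally show ?thesis ..
qed

lemma psi_snoc:
  fixes L :: "('g \<times> 'n \<times> 'n) list"
  shows "psi (L @ [(x, i, j)]) =
    tens {..<Suc (length L)} ((\<lambda>r. [fst (L ! r)])(length L := [x]))
      ((\<lambda>r\<in>{..<length L}. fst (snd (L ! r)))(length L := i))
      ((\<lambda>r\<in>{..<length L}. snd (snd (L ! r)))(length L := j))"
proof -
  have "(\<lambda>r\<in>{..<Suc (length L)}. fst (snd ((L @ [(x, i, j)]) ! r))) =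
    (\<lambda>r\<in>{..<length L}. fst (snd (L ! r)))(length L := i)"
    "(\<lambda>r\<in>{..<Suc (length L)}. snd (snd ((L @ [(x, i, j)]) ! r))) =
    (\<lambda>r\<in>{..<length L}. snd (snd (L ! r)))(length L := j)"
    by (auto simp: fun_eq_iff nth_append less_Suc_eq)
  note e = this
  show ?thesis unfolding psi_def length_append_singleton e
    by (rule tens_cong) (auto simp: nth_append less_Suc_eq PiE_def extensional_def)
qed

text \<open>Entrywise form of \<open>(1 + y\<^sub>x)(1 + y\<^sub>y) = 1 + y\<^sub>x\<^sub>y\<close>
  under the functional, in the presence of arbitrary further factors \<open>L\<close>. The matrix
  product becomes a contraction of the last two slots, and the resulting word \<open>[x, y]\<close>
  is resolved by \<open>tens_mult\<close>.\<close>

lemma psi_mult: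
  fixes L :: "('g \<times> 'n \<times> 'n) list"
  assumes "x \<in> carrier \<Gamma>" "y \<in> carrier \<Gamma>"
  shows "(\<Sum>l\<in>UNIV. psi (L @ [(x, i, l), (y, l, j)])) =
    psi (L @ [(x \<otimes> y, i, j)]) - psi (L @ [(x, i, j)]) - psi (L @ [(y, i, j)])"
proof -
  let ?k = "length L"
  let ?K = "{..<Suc (Suc ?k)}"
  let ?w = "\<lambda>r. [fst (L ! r)]"
  let ?i = "(\<lambda>r\<in>{..<?k}. fst (snd (L ! r)))(?k := i)" and ?j = "(\<lambda>r\<in>{..<?k}. snd (snd (L ! r)))(?k := j)"
  have W: "?i \<in> Wd {..<Suc ?k}" "?j \<in> Wd {..<Suc ?k}" by (auto simp: PiE_def extensional_def)
  have K: "?K - {Suc ?k} = {..<Suc ?k}" by auto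
  have "psi (L @ [(x, i, l), (y, l, j)]) =
    tens ?K (?w(?k := [x], Suc ?k := [y])) (?i(Suc ?k := l)) (?j(?k := l, Suc ?k := ?j ?k))" for l
  proof -
    have e: "(\<lambda>r\<in>{..<length (L @ [(x, i, l)])}. fst (snd ((L @ [(x, i, l)]) ! r))) = ?i"
      "(\<lambda>r\<in>{..<length (L @ [(x, i, l)])}. snd (snd ((L @ [(x, i, l)]) ! r))) = ?j(?k := l)"
      by (auto simp: fun_eq_iff nth_append less_Suc_eq)
    have "psi ((L @ [(x, i, l)]) @ [(y, l, j)]) =
      tens ?K ((\<lambda>r. [fst ((L @ [(x, i, l)]) ! r)])(Suc ?k := [y])) (?i(Suc ?k := l))
        (?j(?k := l, Suc ?k := ?j ?k))"
      unfolding psi_snoc e by (simp add: fun_upd_twist)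
    also have "\<dots> = tens ?K (?w(?k := [x], Suc ?k := [y])) (?i(Suc ?k := l))
        (?j(?k := l, Suc ?k := ?j ?k))"
      by (rule tens_cong) (auto simp: nth_append less_Suc_eq PiE_def extensional_def)
    finally show ?thesis by simp
  qed
  then have "(\<Sum>l\<in>UNIV. psi (L @ [(x, i, l), (y, l, j)])) =
    (\<Sum>l\<in>UNIV. tens ?K (?w(?k := [x], Suc ?k := [y])) (?i(Suc ?k := l)) (?j(?k := l, Suc ?k := ?j ?k)))"
    by simp
  also have "\<dots> = tens {..<Suc ?k}
      ((?w(?k := [x], Suc ?k := [y]))(?k := (?w(?k := [x], Suc ?k := [y])) ?k @ (?w(?k := [x], Suc ?k := [y])) (Suc ?k))) ?i ?j"
    unfolding K[symmetric] by (rule tens_contract) (use W K in auto)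
  also have "\<dots> = tens {..<Suc ?k} (?w(?k := [x, y])) ?i ?j"
    by (rule tens_cong) (use W in auto)
  also have "\<dots> = tens {..<Suc ?k} (?w(?k := [x \<otimes> y])) ?i ?j -
    tens {..<Suc ?k} (?w(?k := [x])) ?i ?j - tens {..<Suc ?k} (?w(?k := [y])) ?i ?j"
    by (rule tens_mult) (use W assms in auto)
  finally show ?thesis unfolding psi_snoc .
qed

lemma psi_one:
  fixes L :: "('g \<times> 'n \<times> 'n) list"
  shows "psi (L @ [(\<one>, i, j)]) = 0"
  unfolding psi_snoc by (rule tens_one) (auto simp: PiE_def extensional_def)

text \<open>Summing over equal row and column indices pairs the tensor with the identity
  permutation, which is a full cycle of \<open>k\<close> slots only for \<open>k = 1\<close>. For
  \<open>k = 0\<close> the value is zero as well: the functional kills constants.\<close>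

lemma psi_traces:
  "(\<Sum>i\<in>(Wd {..<k} :: (nat \<Rightarrow> 'n) set). psi (map (\<lambda>r. (\<gamma> r, i r, i r)) [0..<k])) =
    (if k = 1 then f (\<gamma> 0) else 0)"
proof -
  have "psi (map (\<lambda>r. (\<gamma> r, i r, i r)) [0..<k]) = tens {..<k} (\<lambda>r. [\<gamma> r]) i (i \<circ> id)"
    if "i \<in> Wd {..<k}" for i :: "nat \<Rightarrow> 'n"
  proof -
    have "(\<lambda>r\<in>{..<k}. i r) = i" using that by (rule PiE_restrict)
    moreover have "(\<lambda>r\<in>{..<k}. fst (snd (map (\<lambda>r. (\<gamma> r, i r, i r)) [0..<k] ! r))) = (\<lambda>r\<in>{..<k}. i r)"
      "(\<lambda>r\<in>{..<k}. snd (snd (map (\<lambda>r. (\<gamma> r, i r, i r)) [0..<k] ! r))) = (\<lambda>r\<in>{..<k}. i r)"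
      by auto
    ultimately show ?thesis unfolding psi_def length_map length_upt diff_zero
      by (simp only: comp_id) (rule tens_cong; use that in simp)
  qed
  then have "(\<Sum>i\<in>(Wd {..<k} :: (nat \<Rightarrow> 'n) set). psi (map (\<lambda>r. (\<gamma> r, i r, i r)) [0..<k])) =
    (\<Sum>i\<in>(Wd {..<k} :: (nat \<Rightarrow> 'n) set). tens {..<k} (\<lambda>r. [\<gamma> r]) i (i \<circ> id))"
    by (rule sum.cong[OF refl])
  also have "\<dots> = cyc_val {..<k} (\<lambda>r. [\<gamma> r]) id" by (rule tens(2)) (auto simp: permutes_id)
  also have "\<dots> = (if k = 1 then f (\<gamma> 0) else 0)"
  proof (cases "k = 0")
    case False
    have s: "{..<Suc 0} = {0::nat}" by auto
    show ?thesis
    proof (cases "k = 1")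
      case True
      then show ?thesis using cyc_val_single[of id "0::nat" "\<lambda>r. [\<gamma> r]"] by (simp add: s aug_form_single)
    next
      case False
      then have "{..<k} \<noteq> {0}" by (metis card_lessThan card_1_singleton_iff One_nat_def)
      then show ?thesis using cyc_val_fixed[of id 0 "{..<k}"] \<open>k \<noteq> 0\<close> False by simp
    qed
  qed (simp add: lessThan_empty_iff)
  finally show ?thesis .
qed

end

end

section \<open>The functional on polynomials and its compatibility with the relations\<close>

section \<open>Polynomials and substitution\<close>

lemma Const_add: "Const (a + b) = Const a + Const b"
  by (simp add: Const_def single_add)

lemma Const_mult: "Const (a * b) = Const a * Const b"
  by (simp add: Const_def mult_single)

lemma Const_0 [simp]: "Const 0 = 0"
  by (simp add: Const_def)

lemma Const_1 [simp]: "Const 1 = 1"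
  by (simp add: Const_def)

lemma Const_uminus: "Const (- a) = - Const a"
  by (simp add: Const_def single_uminus)

lemma Const_of_nat: "Const (of_nat k) = of_nat k"
  by (simp add: Const_def)

lemma Const_sum: "Const (sum g A) = (\<Sum>x\<in>A. Const (g x))"
  by (induction A rule: infinite_finite_induct) (simp_all add: Const_add)

lemma Const_prod: "Const (prod g A) = (\<Prod>x\<in>A. Const (g x))"
  by (induction A rule: infinite_finite_induct) (simp_all add: Const_mult)

definition monomial :: "(('g, 'n) coord \<Rightarrow>\<^sub>0 nat) \<Rightarrow> ('g, 'n) cpoly"
  where "monomial m = Poly_Mapping.single m 1"

lemma monomial_0 [simp]: "monomial 0 = 1"
  by (simp add: monomial_def)

lemma monomial_add: "monomial (m + m') = monomial m * monomial m'"
  by (simp add: monomial_def mult_single)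

lemma monomial_sum: "monomial (sum g A) = (\<Prod>x\<in>A. monomial (g x))"
  by (induction A rule: infinite_finite_induct) (simp_all add: monomial_add)

lemma Var_monomial: "Var x = monomial (Poly_Mapping.single x 1)"
  by (simp add: Var_def monomial_def)

lemma Var_power: "Var x ^ k = monomial (Poly_Mapping.single x k)"
  by (induction k) (simp_all add: Var_monomial monomial_add[symmetric] single_add[symmetric])

lemma single_eq_Const_mult: "Poly_Mapping.single m c = Const c * monomial m"
  by (simp add: Const_def monomial_def mult_single)

lemma poly_mapping_sum_single:
  "p = (\<Sum>m\<in>Poly_Mapping.keys p. Poly_Mapping.single m (Poly_Mapping.lookup p m))"
proof (rule poly_mapping_eqI)
  fix k
  show "Poly_Mapping.lookup p k =
    Poly_Mapping.lookup (\<Sum>m\<in>Poly_Mapping.keys p. Poly_Mapping.single m (Poly_Mapping.lookup p m)) k"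
    by (simp add: lookup_sum lookup_single when_def in_keys_iff)
qed

lemma monomial_eq_prod_Var:
  "monomial m = (\<Prod>x\<in>Poly_Mapping.keys m. Var x ^ Poly_Mapping.lookup m x)"
  unfolding Var_power monomial_sum[symmetric] poly_mapping_sum_single[symmetric] ..

lemma cpoly_eq_sum_monomials:
  "p = (\<Sum>m\<in>Poly_Mapping.keys p. Const (Poly_Mapping.lookup p m) * monomial m)"
  unfolding single_eq_Const_mult[symmetric] by (rule poly_mapping_sum_single)

definition vars_in :: "('g, 'n) coord set \<Rightarrow> ('g, 'n) cpoly set"
  where "vars_in V = {p. \<forall>m\<in>Poly_Mapping.keys p. \<forall>x\<in>Poly_Mapping.keys m. x \<in> V}"

lemma vars_in_zero: "0 \<in> vars_in V"
  by (simp add: vars_in_def)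

lemma vars_in_Const: "Const c \<in> vars_in V"
  by (simp add: vars_in_def Const_def)

lemma vars_in_one: "1 \<in> vars_in V"
  using vars_in_Const[of 1] by simp

lemma vars_in_Var: "x \<in> V \<Longrightarrow> Var x \<in> vars_in V"
  by (simp add: vars_in_def Var_def)

lemma vars_in_add: "p \<in> vars_in V \<Longrightarrow> q \<in> vars_in V \<Longrightarrow> p + q \<in> vars_in V"
  using keys_add[of p q] unfolding vars_in_def by blast

lemma vars_in_mult:
  assumes "p \<in> vars_in V" "q \<in> vars_in V"
  shows "p * q \<in> vars_in V"
  unfolding vars_in_def
proof (intro CollectI ballI)
  fix m x assume m: "m \<in> Poly_Mapping.keys (p * q)" and x: "x \<in> Poly_Mapping.keys m"
  obtain a b where ab: "a \<in> Poly_Mapping.keys p" "b \<in> Poly_Mapping.keys q" "m = a + b"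
    using keys_mult[of p q] m by blast
  then have "x \<in> Poly_Mapping.keys a \<union> Poly_Mapping.keys b" using x keys_add[of a b] by blast
  then show "x \<in> V" using ab assms by (auto simp: vars_in_def)
qed

lemma vars_in_uminus: "p \<in> vars_in V \<Longrightarrow> - p \<in> vars_in V"
  using vars_in_mult[OF vars_in_Const[of "-1"]] by (simp add: Const_uminus)

lemma vars_in_induct [consumes 1, case_names Const Var add mult]:
  assumes "p \<in> vars_in V"
    and C: "\<And>c. P (Const c)"
    and V: "\<And>x. x \<in> V \<Longrightarrow> P (Var x)"
    and A: "\<And>p q. P p \<Longrightarrow> P q \<Longrightarrow> P (p + q)"
    and M: "\<And>p q. P p \<Longrightarrow> P q \<Longrightarrow> P (p * q)"
  shows "P p"
proof -
  have prod: "P (prod g B)" if "\<And>x. x \<in> B \<Longrightarrow> P (g x)" for B and g :: "('a, 'b) coord \<Rightarrow> _"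
    using that by (induction B rule: infinite_finite_induct) (use C[of 1] M in auto)
  have power: "P (q ^ k)" if "P q" for q k
    using that by (induction k) (use C[of 1] M in auto)
  have "P (\<Sum>m\<in>B. Const (Poly_Mapping.lookup p m) * monomial m)" if "B \<subseteq> Poly_Mapping.keys p" for B
    using that
  proof (induction B rule: infinite_finite_induct)
    case (insert m B)
    have "P (monomial m)" unfolding monomial_eq_prod_Var
      by (intro prod power V) (use insert.prems assms(1) in \<open>auto simp: vars_in_def\<close>)
    then show ?case using insert A M C by simp
  qed (use C[of 0] in auto)
  then show ?thesis by (subst cpoly_eq_sum_monomials) simp
qed

lemma cpoly_induct [case_names Const Var add mult]:
  assumes "\<And>c. P (Const c)" "\<And>x. P (Var x)"
    and "\<And>p q. P p \<Longrightarrow> P q \<Longrightarrow> P (p + q)" "\<And>p q. P p \<Longrightarrow> P q \<Longrightarrow> P (p * q)"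
  shows "P p"
  by (rule vars_in_induct[of p UNIV]) (use assms in \<open>auto simp: vars_in_def\<close>)

definition monomial_subst :: "(('g, 'n) coord \<Rightarrow> ('g, 'n) cpoly) \<Rightarrow> (('g, 'n) coord \<Rightarrow>\<^sub>0 nat) \<Rightarrow> ('g, 'n) cpoly"
  where "monomial_subst \<phi> m = (\<Prod>x\<in>Poly_Mapping.keys m. \<phi> x ^ Poly_Mapping.lookup m x)"

lemma monomial_subst_superset:
  assumes "finite B" "Poly_Mapping.keys m \<subseteq> B"
  shows "monomial_subst \<phi> m = (\<Prod>x\<in>B. \<phi> x ^ Poly_Mapping.lookup m x)"
  unfolding monomial_subst_def
  by (rule prod.mono_neutral_left) (use assms in \<open>auto simp: in_keys_iff\<close>)

lemma monomial_subst_add: "monomial_subst \<phi> (m + m') = monomial_subst \<phi> m * monomial_subst \<phi> m'"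
proof -
  let ?B = "Poly_Mapping.keys m \<union> Poly_Mapping.keys m'"
  have "monomial_subst \<phi> (m + m') = (\<Prod>x\<in>?B. \<phi> x ^ Poly_Mapping.lookup (m + m') x)"
    by (rule monomial_subst_superset) (use keys_add[of m m'] in auto)
  also have "\<dots> = (\<Prod>x\<in>?B. \<phi> x ^ Poly_Mapping.lookup m x) * (\<Prod>x\<in>?B. \<phi> x ^ Poly_Mapping.lookup m' x)"
    by (simp add: lookup_add power_add prod.distrib)
  finally show ?thesis by (simp add: monomial_subst_superset[of ?B, symmetric])
qed

lemma poly_subst_superset:
  assumes "finite B" "Poly_Mapping.keys p \<subseteq> B"
  shows "poly_subst \<phi> p = (\<Sum>m\<in>B. Const (Poly_Mapping.lookup p m) * monomial_subst \<phi> m)"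
  unfolding poly_subst_def monomial_subst_def[symmetric]
  by (rule sum.mono_neutral_left) (use assms in \<open>auto simp: in_keys_iff\<close>)

lemma poly_subst_add: "poly_subst \<phi> (p + q) = poly_subst \<phi> p + poly_subst \<phi> q"
proof -
  let ?B = "Poly_Mapping.keys p \<union> Poly_Mapping.keys q"
  have "poly_subst \<phi> (p + q) = (\<Sum>m\<in>?B. Const (Poly_Mapping.lookup (p + q) m) * monomial_subst \<phi> m)"
    by (rule poly_subst_superset) (use keys_add[of p q] in auto)
  then show ?thesis
    by (simp add: lookup_add Const_add distrib_right sum.distrib poly_subst_superset[of ?B, symmetric])
qed

lemma poly_subst_0 [simp]: "poly_subst \<phi> 0 = 0"
  by (simp add: poly_subst_def)

lemma poly_subst_single: "poly_subst \<phi> (Const c * monomial m) = Const c * monomial_subst \<phi> m"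
  unfolding single_eq_Const_mult[symmetric]
  by (subst poly_subst_superset[of "{m}"]) auto

lemma poly_subst_sum: "poly_subst \<phi> (sum g A) = (\<Sum>x\<in>A. poly_subst \<phi> (g x))"
  by (induction A rule: infinite_finite_induct) (simp_all add: poly_subst_add)

lemma poly_subst_mult: "poly_subst \<phi> (p * q) = poly_subst \<phi> p * poly_subst \<phi> q"
proof -
  let ?p = "\<lambda>m. Const (Poly_Mapping.lookup p m)" and ?q = "\<lambda>m. Const (Poly_Mapping.lookup q m)"
  have "p * q = (\<Sum>m\<in>Poly_Mapping.keys p. \<Sum>m'\<in>Poly_Mapping.keys q.
      Const (Poly_Mapping.lookup p m * Poly_Mapping.lookup q m') * monomial (m + m'))"
    by (subst cpoly_eq_sum_monomials[of p], subst cpoly_eq_sum_monomials[of q])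
      (simp add: sum_product Const_mult monomial_add ac_simps)
  note pq = this
  have "poly_subst \<phi> (p * q) = (\<Sum>m\<in>Poly_Mapping.keys p. \<Sum>m'\<in>Poly_Mapping.keys q.
      (?p m * monomial_subst \<phi> m) * (?q m' * monomial_subst \<phi> m'))"
    unfolding pq poly_subst_sum poly_subst_single
    by (simp add: Const_mult monomial_subst_add ac_simps)
  also have "\<dots> = poly_subst \<phi> p * poly_subst \<phi> q"
    unfolding poly_subst_def monomial_subst_def[symmetric] by (simp add: sum_product)
  finally show ?thesis .
qed

lemma poly_subst_Const [simp]: "poly_subst \<phi> (Const c) = Const c"
  using poly_subst_single[of \<phi> c 0] by (simp add: monomial_subst_def)

lemma poly_subst_1 [simp]: "poly_subst \<phi> 1 = 1"
  using poly_subst_Const[of \<phi> 1] by simp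

lemma poly_subst_Var [simp]: "poly_subst \<phi> (Var x) = \<phi> x"
  using poly_subst_single[of \<phi> 1 "Poly_Mapping.single x 1"]
  by (simp add: monomial_subst_def Var_monomial)

lemma poly_subst_uminus: "poly_subst \<phi> (- p) = - poly_subst \<phi> p"
  using poly_subst_add[of \<phi> p "- p"] by (simp add: eq_neg_iff_add_eq_0 add.commute)

lemma poly_subst_diff: "poly_subst \<phi> (p - q) = poly_subst \<phi> p - poly_subst \<phi> q"
  using poly_subst_add[of \<phi> p "- q"] by (simp add: poly_subst_uminus)

lemma poly_subst_prod: "poly_subst \<phi> (prod g A) = (\<Prod>x\<in>A. poly_subst \<phi> (g x))"
  by (induction A rule: infinite_finite_induct) (simp_all add: poly_subst_mult)

lemma poly_subst_of_int: "poly_subst \<phi> (of_int k) = of_int k"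
proof -
  have "(of_int k :: ('a, 'b) cpoly) = Const (of_int k)" by (simp add: Const_def)
  then show ?thesis by simp
qed

lemma map_matrix_subst_mult:
  "map_matrix (poly_subst \<phi>) (A ** B) = map_matrix (poly_subst \<phi>) A ** map_matrix (poly_subst \<phi>) B"
  by (simp add: map_matrix_def matrix_matrix_mult_def poly_subst_sum poly_subst_mult)

lemma map_matrix_subst_one: "map_matrix (poly_subst \<phi>) (mat 1) = mat 1"
  by (auto simp: map_matrix_def mat_def vec_eq_iff)

lemma poly_subst_det: "poly_subst \<phi> (det A) = det (map_matrix (poly_subst \<phi>) A)"
  by (simp add: det_def poly_subst_sum poly_subst_mult poly_subst_prod poly_subst_of_int)

lemma poly_subst_trace: "poly_subst \<phi> (trace A) = trace (map_matrix (poly_subst \<phi>) A)"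
  by (simp add: trace_def poly_subst_sum)

lemma map_matrix_subst_adjugate:
  "map_matrix (poly_subst \<phi>) (adjugate A) = adjugate (map_matrix (poly_subst \<phi>) A)"
proof -
  have "map_matrix (poly_subst \<phi>) (\<chi> k l. if l = i then if k = j then 1 else 0 else A $ k $ l) =
    (\<chi> k l. if l = i then if k = j then 1 else 0 else map_matrix (poly_subst \<phi>) A $ k $ l)" for i j
    by (auto simp: vec_eq_iff)
  note m = this
  show ?thesis unfolding vec_eq_iff by (simp add: adjugate_def poly_subst_det m)
qed

text \<open>By linearity in column \<open>i\<close>, the \<open>(i, j)\<close> entry of the product
  is the determinant of \<open>A\<close> with column \<open>i\<close> replaced by column
  \<open>j\<close>, and this matrix has two equal columns unless \<open>i = j\<close>. The auxiliary
  \<open>D\<close> works with the transpose, whose rows are these columns.\<close>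

lemma adjugate_mult: "adjugate A ** A = mat (det (A :: 'a::comm_ring_1^'n^'n))"
proof -
  define D where "D i v = det (\<chi> l. if l = i then v else column l A)" for i and v :: "'a^'n"
  have adj: "adjugate A $ i $ k = D i (axis k 1)" for i k
  proof -
    have t: "transpose (\<chi> a l. if l = i then (if a = k then 1 else 0) else A $ a $ l) =
      (\<chi> l. if l = i then axis k 1 else column l A)"
      by (auto simp: vec_eq_iff transpose_def axis_def column_def)
    have "adjugate A $ i $ k = det (\<chi> a l. if l = i then (if a = k then 1 else 0) else A $ a $ l)"
      by (simp add: adjugate_def)
    also have "\<dots> = D i (axis k 1)" unfolding D_def t[symmetric] by (rule det_transpose[symmetric])
    finally show ?thesis .
  qed
  have "(\<Sum>k\<in>UNIV. D i (axis k 1) * A $ k $ j) = D i (column j A)" for i j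
  proof -
    have "column j A = (\<Sum>k\<in>UNIV. A $ k $ j *s axis k 1)"
      by (simp add: vec_eq_iff column_def sum_component axis_def if_distrib[of "\<lambda>x. _ * x"] cong: if_cong)
    then have "D i (column j A) = D i (\<Sum>k\<in>UNIV. A $ k $ j *s axis k 1)" by (rule arg_cong)
    also have "\<dots> = (\<Sum>k\<in>UNIV. D i (A $ k $ j *s axis k 1))"
      unfolding D_def by (rule det_linear_row_sum) simp
    also have "\<dots> = (\<Sum>k\<in>UNIV. A $ k $ j * D i (axis k 1))"
      unfolding D_def det_row_mul ..
    finally show ?thesis by (simp add: mult.commute)
  qed
  moreover have "D i (column j A) = (if i = j then det A else 0)" for i j
  proof (cases "i = j")
    case True
    then have "(\<chi> l. if l = i then column j A else column l A) = transpose A"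
      by (auto simp: vec_eq_iff transpose_def column_def)
    then show ?thesis using True by (simp add: D_def)
  next
    case False
    then show ?thesis unfolding D_def
      by (simp, intro det_identical_rows[OF False]) (auto simp: row_def vec_eq_iff column_def)
  qed
  ultimately show ?thesis
    by (simp add: vec_eq_iff matrix_matrix_mult_def adj mat_def)
qed

section \<open>Congruences of matrices\<close>

text \<open>\<open>I\<close> absorbs multiplication by \<open>R\<close> only, since the ideals that
  occur belong to polynomials in restricted sets of variables inside one ambient type. Instances are
  \<open>rep_ideal\<close>, the annihilator \<open>ann\<close> of a functional, and
  \<open>{0}\<close> for mere membership statements about matrices.\<close>

locale subring_ideal =
  fixes R I :: "'r::comm_ring_1 set"
  assumes R_one: "1 \<in> R" and R_uminus_one: "- 1 \<in> R"
    and R_add: "p \<in> R \<Longrightarrow> q \<in> R \<Longrightarrow> p + q \<in> R"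
    and R_mult: "p \<in> R \<Longrightarrow> q \<in> R \<Longrightarrow> p * q \<in> R"
    and I_zero: "0 \<in> I"
    and I_add: "x \<in> I \<Longrightarrow> y \<in> I \<Longrightarrow> x + y \<in> I"
    and I_mult: "p \<in> R \<Longrightarrow> x \<in> I \<Longrightarrow> p * x \<in> I"
begin

lemma R_zero: "0 \<in> R"
  using R_add[OF R_one R_uminus_one] by simp

lemma R_uminus: "p \<in> R \<Longrightarrow> - p \<in> R"
  using R_mult[OF R_uminus_one] by simp

lemma R_diff: "p \<in> R \<Longrightarrow> q \<in> R \<Longrightarrow> p - q \<in> R"
  using R_add[OF _ R_uminus] by fastforce

lemma R_sum: "(\<And>x. x \<in> A \<Longrightarrow> g x \<in> R) \<Longrightarrow> sum g A \<in> R"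
  by (induction A rule: infinite_finite_induct) (simp_all add: R_zero R_add)

lemma R_prod: "(\<And>x. x \<in> A \<Longrightarrow> g x \<in> R) \<Longrightarrow> prod g A \<in> R"
  by (induction A rule: infinite_finite_induct) (simp_all add: R_one R_mult)

lemma R_sign: "of_int (sign \<sigma>) \<in> R"
  by (simp add: sign_def R_one R_uminus_one)

lemma I_uminus: "x \<in> I \<Longrightarrow> - x \<in> I"
  using I_mult[OF R_uminus_one] by simp

lemma I_diff: "x \<in> I \<Longrightarrow> y \<in> I \<Longrightarrow> x - y \<in> I"
  using I_add[OF _ I_uminus] by fastforce

definition eqv :: "'r \<Rightarrow> 'r \<Rightarrow> bool" (infix "\<approx>" 50)
  where "p \<approx> q \<longleftrightarrow> p - q \<in> I"

lemma eqv_refl [simp]: "p \<approx> p"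
  by (simp add: eqv_def I_zero)

lemma eqv_sym: "p \<approx> q \<Longrightarrow> q \<approx> p"
  using I_uminus by (fastforce simp: eqv_def)

lemma eqv_trans [trans]: "p \<approx> q \<Longrightarrow> q \<approx> r \<Longrightarrow> p \<approx> r"
  using I_add[of "p - q" "q - r"] by (simp add: eqv_def)

lemma eqv_add: "p \<approx> p' \<Longrightarrow> q \<approx> q' \<Longrightarrow> p + q \<approx> p' + q'"
  using I_add[of "p - p'" "q - q'"] by (simp add: eqv_def algebra_simps)

lemma eqv_diff: "p \<approx> p' \<Longrightarrow> q \<approx> q' \<Longrightarrow> p - q \<approx> p' - q'"
  using I_diff[of "p - p'" "q - q'"] by (simp add: eqv_def algebra_simps)

lemma eqv_mult:
  assumes "p \<approx> p'" "q \<approx> q'" "p \<in> R" "q' \<in> R"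
  shows "p * q \<approx> p' * q'"
proof -
  have "p * q - p' * q' = p * (q - q') + q' * (p - p')" by (simp add: algebra_simps)
  then show ?thesis using assms I_add I_mult by (simp add: eqv_def)
qed

lemma eqv_sum: "(\<And>x. x \<in> A \<Longrightarrow> g x \<approx> h x) \<Longrightarrow> sum g A \<approx> sum h A"
  by (induction A rule: infinite_finite_induct) (auto intro: eqv_add)

lemma eqv_prod:
  "(\<And>x. x \<in> A \<Longrightarrow> g x \<approx> h x) \<Longrightarrow> (\<And>x. x \<in> A \<Longrightarrow> g x \<in> R) \<Longrightarrow> (\<And>x. x \<in> A \<Longrightarrow> h x \<in> R)
    \<Longrightarrow> prod g A \<approx> prod h A"
proof (induction A rule: infinite_finite_induct)
  case (insert x F)
  have "g x * prod g F \<approx> h x * prod h F"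
    by (intro eqv_mult R_prod) (use insert in auto)
  then show ?case using insert.hyps by simp
qed auto

definition mat_in :: "'r^'n^'m \<Rightarrow> bool"
  where "mat_in A \<longleftrightarrow> (\<forall>i j. A $ i $ j \<in> R)"

definition mat_eqv :: "'r^'n^'m \<Rightarrow> 'r^'n^'m \<Rightarrow> bool" (infix "\<approx>\<approx>" 50)
  where "A \<approx>\<approx> B \<longleftrightarrow> (\<forall>i j. A $ i $ j \<approx> B $ i $ j)"

lemma mat_in_mult: "mat_in A \<Longrightarrow> mat_in B \<Longrightarrow> mat_in (A ** B)"
  by (auto simp: mat_in_def matrix_matrix_mult_def intro!: R_sum R_mult)

lemma mat_in_one: "mat_in (mat 1)"
  by (auto simp: mat_in_def mat_def R_one R_zero)

lemma mat_in_det: "mat_in A \<Longrightarrow> det A \<in> R"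
  by (auto simp: mat_in_def det_def intro!: R_sum R_mult R_prod R_sign)

lemma mat_in_trace: "mat_in A \<Longrightarrow> trace A \<in> R"
  by (auto simp: mat_in_def trace_def intro!: R_sum)

lemma mat_in_adjugate: "mat_in A \<Longrightarrow> mat_in (adjugate A)"
  unfolding mat_in_def[of "adjugate A"] adjugate_def
  by (auto intro!: mat_in_det simp: mat_in_def R_one R_zero)

lemma mat_eqv_refl [simp]: "A \<approx>\<approx> A"
  by (simp add: mat_eqv_def)

lemma mat_eqv_sym: "A \<approx>\<approx> B \<Longrightarrow> B \<approx>\<approx> A"
  by (auto simp: mat_eqv_def intro: eqv_sym)

lemma mat_eqv_trans [trans]: "A \<approx>\<approx> B \<Longrightarrow> B \<approx>\<approx> C \<Longrightarrow> A \<approx>\<approx> C"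
  unfolding mat_eqv_def using eqv_trans by blast

lemma mat_eqv_mult:
  assumes "A \<approx>\<approx> A'" "B \<approx>\<approx> B'" "mat_in A" "mat_in B'"
  shows "A ** B \<approx>\<approx> A' ** B'"
  using assms by (auto simp: mat_eqv_def mat_in_def matrix_matrix_mult_def intro!: eqv_sum eqv_mult)

lemma mat_eqv_det: "A \<approx>\<approx> B \<Longrightarrow> mat_in A \<Longrightarrow> mat_in B \<Longrightarrow> det A \<approx> det B"
  by (auto simp: mat_eqv_def mat_in_def det_def intro!: eqv_sum eqv_mult eqv_prod R_prod R_sign)

lemma mat_eqv_trace: "A \<approx>\<approx> B \<Longrightarrow> trace A \<approx> trace B"
  by (auto simp: mat_eqv_def trace_def intro!: eqv_sum)

end

lemma subring_ideal_vars_in: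
  assumes "0 \<in> I" "\<And>x y. x \<in> I \<Longrightarrow> y \<in> I \<Longrightarrow> x + y \<in> I"
    and "\<And>p x. p \<in> vars_in V \<Longrightarrow> x \<in> I \<Longrightarrow> p * x \<in> I"
  shows "subring_ideal (vars_in V) I"
  using assms
  by unfold_locales (auto intro: vars_in_one vars_in_uminus vars_in_add vars_in_mult)

section \<open>A functional on the coordinate ring\<close>

text \<open>On the side of the functional, \<open>Entry g i j\<close> is reinterpreted as an entry
  of the image of \<open>g\<close> minus the identity, and \<open>g\<close> is not restricted to
  generators.\<close>

definition entry_vars :: "('g, 'n) coord set"
  where "entry_vars = {x. \<exists>g i j. x = Entry g i j}"

lemma Entry_in_entry_vars [simp]: "Entry g i j \<in> entry_vars"
  by (simp add: entry_vars_def)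

definition entry_monomial :: "('g \<times> 'n \<times> 'n) list \<Rightarrow> (('g, 'n) coord \<Rightarrow>\<^sub>0 nat)"
  where "entry_monomial xs = (\<Sum>(g, i, j)\<leftarrow>xs. Poly_Mapping.single (Entry g i j) 1)"

lemma lookup_entry_monomial:
  "Poly_Mapping.lookup (entry_monomial xs) (Entry g i j) = count (mset xs) (g, i, j)"
proof (induction xs)
  case (Cons x xs)
  then show ?case
    by (cases x) (auto simp: entry_monomial_def lookup_add lookup_single when_def)
qed (simp add: entry_monomial_def)

lemma entry_monomial_eqD:
  assumes "entry_monomial xs = entry_monomial ys"
  shows "mset xs = mset ys"
proof (rule multiset_eqI)
  fix x :: "'a \<times> 'b \<times> 'b"
  obtain g i j where x: "x = (g, i, j)" by (cases x)
  show "count (mset xs) x = count (mset ys) x"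
    unfolding x lookup_entry_monomial[symmetric] assms ..
qed

lemma entry_monomial_append: "entry_monomial (xs @ ys) = entry_monomial xs + entry_monomial ys"
  by (simp add: entry_monomial_def)

lemma monomial_entry_monomial:
  "monomial (entry_monomial xs) = (\<Prod>(g, i, j)\<leftarrow>xs. Var (Entry g i j))"
proof (induction xs)
  case (Cons x xs)
  then show ?case
    by (cases x) (simp add: entry_monomial_def monomial_add Var_monomial)
qed (simp add: entry_monomial_def)

lemma entry_monomial_exists:
  assumes "Poly_Mapping.keys m \<subseteq> entry_vars"
  shows "\<exists>xs. entry_monomial xs = m"
proof -
  have "\<exists>xs. entry_monomial xs = (\<Sum>x\<in>B. Poly_Mapping.single x (Poly_Mapping.lookup m x))"
    if "B \<subseteq> Poly_Mapping.keys m" for B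
    using that
  proof (induction B rule: infinite_finite_induct)
    case (insert x B)
    then obtain xs where xs: "entry_monomial xs = (\<Sum>x\<in>B. Poly_Mapping.single x (Poly_Mapping.lookup m x))"
      by blast
    obtain g i j where x: "x = Entry g i j" using insert.prems assms by (auto simp: entry_vars_def)
    have "entry_monomial (replicate k (g, i, j)) = Poly_Mapping.single x k" for k
      by (induction k) (simp_all add: entry_monomial_def x single_add[symmetric])
    then have "entry_monomial (replicate (Poly_Mapping.lookup m x) (g, i, j) @ xs) =
      (\<Sum>x\<in>insert x B. Poly_Mapping.single x (Poly_Mapping.lookup m x))"
      using insert.hyps by (simp add: entry_monomial_append xs)
    then show ?case by blast
  qed (auto intro!: exI[of _ "[]"] simp: entry_monomial_def)
  from this[OF order_refl] show ?thesis by (simp add: poly_mapping_sum_single[symmetric])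
qed

lemma poly_subst_vars_in:
  assumes "\<And>x. \<phi> x \<in> vars_in V"
  shows "poly_subst \<phi> p \<in> vars_in V"
  by (induction p rule: cpoly_induct)
    (auto simp: assms poly_subst_add poly_subst_mult intro: vars_in_Const vars_in_add vars_in_mult)

lemma poly_subst_of_nat [simp]: "poly_subst \<phi> (of_nat k) = of_nat k"
  using poly_subst_Const[of \<phi> "of_nat k"] by (simp add: Const_of_nat)

lemma matrix_add_rdistrib:
  "((B :: 'r::semiring_1^'n^'m) + C) ** A = B ** A + C ** A"
  by (vector matrix_matrix_mult_def sum.distrib[symmetric] field_simps)

lemma trace_add: "trace (A + B) = trace A + trace B"
  by (simp add: trace_def sum.distrib)

lemma trace_mat_one: "trace (mat 1 :: 'r::comm_ring_1^'n^'n) = of_nat CARD('n)"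
  by (simp add: trace_def mat_def)

lemma (in group) word_val_closed:
  assumes "set w \<subseteq> carrier G \<times> UNIV"
  shows "word_val G w \<in> carrier G"
  using assms by (induction w) (auto simp: word_val_def)

context central_solution
begin

text \<open>The linear extension of \<open>psi\<close>; the list chosen for a monomial is immaterial
  by \<open>psi_mset\<close>. Monomials containing some \<open>DetInv\<close> come from no list and
  get an arbitrary value; \<open>lift\<close> produces none of them.\<close>

definition Psi :: "('g, 'n::finite) cpoly \<Rightarrow> complex"
  where "Psi p = (\<Sum>m\<in>Poly_Mapping.keys p.
    Poly_Mapping.lookup p m * psi (SOME xs. entry_monomial xs = m))"

lemma Psi_superset:
  assumes "finite B" "Poly_Mapping.keys p \<subseteq> B"
  shows "Psi p = (\<Sum>m\<in>B. Poly_Mapping.lookup p m * psi (SOME xs. entry_monomial xs = m))"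
  unfolding Psi_def by (rule sum.mono_neutral_left) (use assms in \<open>auto simp: in_keys_iff\<close>)

lemma Psi_add: "Psi (p + q) = Psi p + Psi q"
proof -
  let ?B = "Poly_Mapping.keys p \<union> Poly_Mapping.keys q"
  have "Psi (p + q) = (\<Sum>m\<in>?B. Poly_Mapping.lookup (p + q) m * psi (SOME xs. entry_monomial xs = m))"
    by (rule Psi_superset) (use keys_add[of p q] in auto)
  then show ?thesis
    by (simp add: lookup_add distrib_right sum.distrib Psi_superset[of ?B, symmetric])
qed

lemma Psi_0 [simp]: "Psi 0 = 0"
  by (simp add: Psi_def)

lemma Psi_Const_monomial: "Psi (Const c * monomial m) = c * psi (SOME xs. entry_monomial xs = m)"
  unfolding single_eq_Const_mult[symmetric] by (subst Psi_superset[of "{m}"]) auto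

lemma Psi_sum: "Psi (sum g A) = (\<Sum>x\<in>A. Psi (g x))"
  by (induction A rule: infinite_finite_induct) (simp_all add: Psi_add)

lemma Psi_cmult: "Psi (Const c * p) = c * Psi p"
proof -
  have "Psi (Const c * p) = Psi (\<Sum>m\<in>Poly_Mapping.keys p.
      Const (c * Poly_Mapping.lookup p m) * monomial m)"
    by (subst cpoly_eq_sum_monomials[of p]) (simp add: sum_distrib_left Const_mult mult.assoc)
  also have "\<dots> = c * Psi p"
    unfolding Psi_sum Psi_Const_monomial by (simp add: Psi_def sum_distrib_left mult.assoc)
  finally show ?thesis .
qed

lemma Psi_diff: "Psi (p - q) = Psi p - Psi q"
  using Psi_add[of p "Const (-1) * q"] Psi_cmult[of "-1" q] by (simp add: Const_uminus)

text \<open>The largest part of the kernel of \<open>Psi\<close> that is stable under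
  multiplication. Identities that hold under \<open>Psi\<close> with any further factors thus become
  congruences of matrices.\<close>

definition ann :: "('g, 'n::finite) cpoly set"
  where "ann = {p. \<forall>q\<in>vars_in entry_vars. Psi (q * p) = 0}"

lemma Psi_ann: "p \<in> ann \<Longrightarrow> Psi p = 0"
  using vars_in_one[of entry_vars] by (force simp: ann_def)

sublocale ann: subring_ideal "vars_in entry_vars" ann
  by (rule subring_ideal_vars_in)
    (auto simp: ann_def distrib_left Psi_add vars_in_mult mult.assoc[symmetric])

lemma Psi_eqv: "ann.eqv p q \<Longrightarrow> Psi p = Psi q"
  using Psi_ann[of "p - q"] Psi_diff[of p q] by (simp add: ann.eqv_def)

definition unip :: "'g \<Rightarrow> ('g, 'n::finite) cpoly^'n^'n"
  where "unip g = mat 1 + gen_mat g"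

text \<open>The inverse determinant of \<open>s\<close> is sent to the determinant of the image of
  the inverse of \<open>s\<close>, which is polynomial in the entries and inverse to the right
  determinant modulo \<open>ann\<close>.\<close>

definition lift_coord :: "('g, 'n::finite) coord \<Rightarrow> ('g, 'n) cpoly"
  where "lift_coord x = (case x of Entry s i j \<Rightarrow> unip s $ i $ j | DetInv s \<Rightarrow> det (unip (inv s)))"

abbreviation "lift \<equiv> poly_subst lift_coord"

lemma unip_in: "ann.mat_in (unip g)"
  by (auto simp: ann.mat_in_def unip_def mat_def gen_mat_def
      intro!: vars_in_add vars_in_one vars_in_zero vars_in_Var)

lemma lift_in: "lift p \<in> vars_in entry_vars"
  by (rule poly_subst_vars_in)
    (use unip_in in \<open>auto simp: lift_coord_def ann.mat_in_def split: coord.split intro!: ann.mat_in_det[OF unip_in]\<close>)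

context
  assumes n: "n = CARD('n::finite)"
begin

lemma Psi_entry_monomial: "Psi (monomial (entry_monomial xs) :: ('g, 'n) cpoly) = psi xs"
proof -
  have "entry_monomial (SOME ys. entry_monomial ys = entry_monomial xs) = entry_monomial xs"
    by (rule someI) (rule refl)
  then have "psi (SOME ys. entry_monomial ys = entry_monomial xs) = psi xs"
    using psi_mset[OF n] entry_monomial_eqD by blast
  then show ?thesis using Psi_Const_monomial[of 1 "entry_monomial xs"] by simp
qed

lemma annI:
  assumes "\<And>xs. Psi (monomial (entry_monomial xs) * p) = 0"
  shows "(p :: ('g, 'n) cpoly) \<in> ann"
  unfolding ann_def
proof (intro CollectI ballI)
  fix q :: "('g, 'n) cpoly" assume q: "q \<in> vars_in entry_vars"
  have "Psi (q * p) = (\<Sum>m\<in>Poly_Mapping.keys q. Poly_Mapping.lookup q m * Psi (monomial m * p))"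
    by (subst cpoly_eq_sum_monomials[of q])
      (simp add: sum_distrib_right Psi_sum mult.assoc Psi_cmult)
  also have "\<dots> = 0"
  proof (rule sum.neutral, rule ballI)
    fix m assume "m \<in> Poly_Mapping.keys q"
    then have "Poly_Mapping.keys m \<subseteq> entry_vars" using q by (auto simp: vars_in_def)
    then show "Poly_Mapping.lookup q m * Psi (monomial m * p) = 0"
      using entry_monomial_exists[of m] assms by force
  qed
  finally show "Psi (q * p) = 0" .
qed

text \<open>\<open>psi_mult\<close> as a congruence: together with \<open>unip_one\<close>, the map
  \<open>unip\<close> is a matrix representation of the group modulo \<open>ann\<close>.\<close>

lemma unip_mult:
  assumes "x \<in> carrier \<Gamma>" "y \<in> carrier \<Gamma>"
  shows "ann.mat_eqv (unip x ** unip y :: ('g, 'n) cpoly^'n^'n) (unip (x \<otimes> y))"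
proof -
  have "(unip x ** unip y) $ i $ j - (unip (x \<otimes> y)) $ i $ j =
    (\<Sum>l\<in>UNIV. Var (Entry x i l) * Var (Entry y l j)) + Var (Entry x i j) + Var (Entry y i j)
      - Var (Entry (x \<otimes> y) i j)" for i j :: 'n
  proof -
    have "unip x ** unip y = mat 1 + gen_mat x + (gen_mat y + gen_mat x ** gen_mat y :: ('g, 'n) cpoly^'n^'n)"
      by (simp add: unip_def matrix_add_ldistrib matrix_add_rdistrib add.assoc)
    then show ?thesis by (simp add: unip_def gen_mat_def matrix_matrix_mult_def)
  qed
  moreover have "(\<Sum>l\<in>UNIV. Var (Entry x i l) * Var (Entry y l j)) + Var (Entry x i j) +
    Var (Entry y i j) - Var (Entry (x \<otimes> y) i j) \<in> ann" for i j :: 'n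
  proof (rule annI)
    fix L :: "('g \<times> 'n \<times> 'n) list"
    let ?m = "monomial (entry_monomial L)"
    have 1: "?m * Var (Entry g i j) = monomial (entry_monomial (L @ [(g, i, j)]))" for g and i j :: 'n
      by (simp add: monomial_entry_monomial)
    have 2: "?m * (Var (Entry x i l) * Var (Entry y l j)) =
        monomial (entry_monomial (L @ [(x, i, l), (y, l, j)]))" for l
      by (simp add: monomial_entry_monomial mult.assoc)
    show "Psi (?m * ((\<Sum>l\<in>UNIV. Var (Entry x i l) * Var (Entry y l j)) + Var (Entry x i j) +
      Var (Entry y i j) - Var (Entry (x \<otimes> y) i j))) = 0"
      unfolding right_diff_distrib distrib_left sum_distrib_left 1 2
      by (simp add: Psi_add Psi_diff Psi_sum Psi_entry_monomial psi_mult[OF n assms])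
  qed
  ultimately show ?thesis by (simp add: ann.mat_eqv_def ann.eqv_def)
qed

lemma unip_one: "ann.mat_eqv (unip \<one> :: ('g, 'n) cpoly^'n^'n) (mat 1)"
proof -
  have "Var (Entry \<one> i j) \<in> ann" for i j :: 'n
  proof (rule annI)
    fix L :: "('g \<times> 'n \<times> 'n) list"
    have "monomial (entry_monomial L) * Var (Entry \<one> i j) = monomial (entry_monomial (L @ [(\<one>, i, j)]))"
      by (simp add: monomial_entry_monomial)
    then show "Psi (monomial (entry_monomial L) * Var (Entry \<one> i j)) = 0"
      by (simp add: Psi_entry_monomial psi_one[OF n])
  qed
  then show ?thesis by (simp add: ann.mat_eqv_def ann.eqv_def unip_def gen_mat_def)
qed

lemma unip_inv:
  assumes "s \<in> carrier \<Gamma>"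
  shows "ann.mat_eqv (unip s ** unip (inv s) :: ('g, 'n) cpoly^'n^'n) (mat 1)"
    and "ann.mat_eqv (unip (inv s) ** unip s :: ('g, 'n) cpoly^'n^'n) (mat 1)"
  using unip_mult[of s "inv s"] unip_mult[of "inv s" s] unip_one assms
  by (auto intro: ann.mat_eqv_trans)

lemma det_unip_inv:
  assumes "s \<in> carrier \<Gamma>"
  shows "ann.eqv (det (unip (inv s)) * det (unip s :: ('g, 'n) cpoly^'n^'n)) 1"
  using ann.mat_eqv_det[OF unip_inv(2)[OF assms] ann.mat_in_mult[OF unip_in unip_in] ann.mat_in_one]
  by (simp add: det_mul)

lemma lift_gen_mat: "map_matrix lift (gen_mat s) = (unip s :: ('g, 'n) cpoly^'n^'n)"
  by (simp add: vec_eq_iff gen_mat_def lift_coord_def)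

text \<open>Multiplying \<open>adjugate_mult\<close> by the inverse matrix shows that the adjugate
  is congruent to the determinant times the inverse; the image of \<open>DetInv s\<close> cancels
  the determinant.\<close>

lemma lift_gen_mat_inv:
  assumes "s \<in> carrier \<Gamma>"
  shows "ann.mat_eqv (map_matrix lift (gen_mat_inv s :: ('g, 'n) cpoly^'n^'n)) (unip (inv s))"
proof -
  let ?U = "unip s :: ('g, 'n) cpoly^'n^'n" and ?V = "unip (inv s) :: ('g, 'n) cpoly^'n^'n"
  have l: "map_matrix lift (gen_mat_inv s) $ i $ j = det ?V * adjugate ?U $ i $ j" for i j
  proof -
    have "map_matrix lift (adjugate (gen_mat s)) $ i $ j = adjugate ?U $ i $ j"
      by (simp only: map_matrix_subst_adjugate lift_gen_mat)
    then show ?thesis by (simp add: gen_mat_inv_def poly_subst_mult lift_coord_def)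
  qed
  have "ann.mat_eqv (adjugate ?U ** (?U ** ?V)) (adjugate ?U ** mat 1)"
    by (intro ann.mat_eqv_mult ann.mat_eqv_refl unip_inv assms ann.mat_in_adjugate unip_in ann.mat_in_one)
  then have "ann.mat_eqv (adjugate ?U) (mat (det ?U) ** ?V)"
    by (intro ann.mat_eqv_sym[of "mat (det ?U) ** ?V"]) (simp add: matrix_mul_assoc adjugate_mult)
  moreover have "(mat (det ?U) ** ?V) $ i $ j = det ?U * ?V $ i $ j" for i j
    by (simp add: matrix_matrix_mult_def mat_def if_distrib[of "\<lambda>x. x * _"] cong: if_cong)
  ultimately have adj: "ann.eqv (adjugate ?U $ i $ j) (det ?U * ?V $ i $ j)" for i j
    by (simp add: ann.mat_eqv_def)
  have R: "det ?U \<in> vars_in entry_vars" "det ?V \<in> vars_in entry_vars" "?V $ i $ j \<in> vars_in entry_vars" for i j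
    using unip_in[of "inv s"] by (auto simp: ann.mat_in_def[of "unip (inv s)"] intro: ann.mat_in_det[OF unip_in])
  have "ann.eqv (det ?V * adjugate ?U $ i $ j) (det ?V * (det ?U * ?V $ i $ j))" for i j
    by (intro ann.eqv_mult ann.eqv_refl adj ann.R_mult R)
  moreover have "ann.eqv (det ?V * det ?U * ?V $ i $ j) (1 * ?V $ i $ j)" for i j
    by (intro ann.eqv_mult ann.eqv_refl det_unip_inv assms ann.R_mult R)
  ultimately have "ann.eqv (det ?V * adjugate ?U $ i $ j) (?V $ i $ j)" for i j
    unfolding mult.assoc mult_1 by (rule ann.eqv_trans)
  then show ?thesis by (simp add: ann.mat_eqv_def l del: nth_map_matrix)
qed

lemma lift_word_mat:
  assumes "set w \<subseteq> carrier \<Gamma> \<times> UNIV"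
  shows "ann.mat_eqv (map_matrix lift (word_mat w :: ('g, 'n) cpoly^'n^'n)) (unip (word_val \<Gamma> w))"
  using assms
proof (induction w)
  case Nil
  then show ?case
    using ann.mat_eqv_sym[OF unip_one] by (simp add: word_mat_def word_val_def map_matrix_subst_one)
next
  case (Cons sb w)
  obtain s b where sb: "sb = (s, b)" by (cases sb)
  have s: "s \<in> carrier \<Gamma>" and w: "word_val \<Gamma> w \<in> carrier \<Gamma>"
    using Cons.prems word_val_closed by (auto simp: sb)
  let ?A = "if b then gen_mat_inv s else gen_mat s :: ('g, 'n) cpoly^'n^'n"
  let ?g = "if b then inv s else s"
  have "map_matrix lift (word_mat (sb # w)) = map_matrix lift ?A ** map_matrix lift (word_mat w)"
    by (simp add: word_mat_def sb map_matrix_subst_mult)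
  also have "ann.mat_eqv \<dots> (unip ?g ** unip (word_val \<Gamma> w))"
  proof (rule ann.mat_eqv_mult)
    show "ann.mat_eqv (map_matrix lift ?A) (unip ?g)"
      using lift_gen_mat_inv[OF s] lift_gen_mat[of s] by simp
    show "ann.mat_in (map_matrix lift ?A)" by (simp add: ann.mat_in_def lift_in)
  qed (use Cons unip_in in auto)
  also have "ann.mat_eqv \<dots> (unip (?g \<otimes> word_val \<Gamma> w))" by (rule unip_mult) (use s w in auto)
  also have "?g \<otimes> word_val \<Gamma> w = word_val \<Gamma> (sb # w)" by (simp add: word_val_def sb)
  finally show ?case .
qed

text \<open>The constant \<open>CARD('n)\<close> cancels the trace of the identity in
  \<open>unip\<close>, so each factor is congruent to the trace of the matrix \<open>y\<close> of
  its group element. Expanding the product of these traces leads to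
  \<open>psi_traces\<close>.\<close>

lemma Psi_lift_traces:
  fixes k :: nat
  assumes "\<And>r. r < k \<Longrightarrow> set (w r) \<subseteq> carrier \<Gamma> \<times> UNIV"
  shows "Psi (lift (\<Prod>r<k. trace (word_mat (w r) :: ('g, 'n) cpoly^'n^'n) - Const (of_nat CARD('n)))) =
    (if k = 1 then f (word_val \<Gamma> (w 0)) else 0)"
proof -
  let ?g = "\<lambda>r. word_val \<Gamma> (w r)"
  have tr_in: "trace (gen_mat g :: ('g, 'n) cpoly^'n^'n) \<in> vars_in entry_vars" for g
    by (rule ann.mat_in_trace) (auto simp: ann.mat_in_def gen_mat_def intro!: vars_in_Var)
  have "ann.eqv (lift (trace (word_mat (w r) :: ('g, 'n) cpoly^'n^'n) - Const (of_nat CARD('n))))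
    (trace (gen_mat (?g r)))" if "r < k" for r
  proof -
    have "ann.eqv (trace (map_matrix lift (word_mat (w r) :: ('g, 'n) cpoly^'n^'n))) (trace (unip (?g r)))"
      by (rule ann.mat_eqv_trace[OF lift_word_mat[OF assms[OF that]]])
    then show ?thesis
      by (simp add: ann.eqv_def poly_subst_diff poly_subst_trace unip_def trace_add trace_mat_one
          Const_of_nat algebra_simps)
  qed
  then have "ann.eqv (lift (\<Prod>r<k. trace (word_mat (w r) :: ('g, 'n) cpoly^'n^'n) - Const (of_nat CARD('n))))
    (\<Prod>r<k. trace (gen_mat (?g r)))"
    unfolding poly_subst_prod by (intro ann.eqv_prod lift_in tr_in) auto
  then have "Psi (lift (\<Prod>r<k. trace (word_mat (w r) :: ('g, 'n) cpoly^'n^'n) - Const (of_nat CARD('n)))) =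
    Psi (\<Prod>r<k. trace (gen_mat (?g r) :: ('g, 'n) cpoly^'n^'n))"
    by (rule Psi_eqv)
  also have "(\<Prod>r<k. trace (gen_mat (?g r) :: ('g, 'n) cpoly^'n^'n)) =
    (\<Sum>i\<in>Wd {..<k}. \<Prod>r<k. Var (Entry (?g r) (i r) (i r)))"
    unfolding trace_def gen_mat_def by (subst prod_sum_PiE) simp_all
  also have "\<dots> = (\<Sum>i\<in>Wd {..<k}. monomial (entry_monomial (map (\<lambda>r. (?g r, i r, i r)) [0..<k])))"
  proof (rule sum.cong[OF refl])
    fix i :: "nat \<Rightarrow> 'n"
    show "(\<Prod>r<k. Var (Entry (?g r) (i r) (i r))) =
      monomial (entry_monomial (map (\<lambda>r. (?g r, i r, i r)) [0..<k]))"
      using prod.distinct_set_conv_list[of "[0..<k]" "\<lambda>r. Var (Entry (?g r) (i r) (i r))"]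
      by (simp add: monomial_entry_monomial o_def atLeast0LessThan)
  qed
  also have "Psi \<dots> = (if k = 1 then f (?g 0) else 0)"
    by (simp add: Psi_sum Psi_entry_monomial psi_traces[OF n])
  finally show ?thesis .
qed

end

end

section \<open>First fundamental theorem for tensors\<close>

section \<open>Tensors commuting with all invertible matrices\<close>

text \<open>A scalar exceeding the sum of all absolute values of all entries makes each matrix
  strictly diagonally dominant; a kernel vector is refuted at a coordinate of maximal
  modulus.\<close>

lemma ex_invertible_shift:
  fixes A :: "'t \<Rightarrow> complex^'n^'n"
  assumes "finite T"
  shows "\<exists>l. \<forall>t\<in>T. invertible (mat l + A t)"
proof -
  define b where "b = 1 + (\<Sum>t\<in>T. \<Sum>i\<in>UNIV. \<Sum>j\<in>UNIV. cmod (A t $ i $ j))"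
  have "invertible (mat (of_real b) + A t)" if t: "t \<in> T" for t
  proof -
    have "x = 0" if x: "(mat (of_real b) + A t) *v x = 0" for x :: "complex^'n"
    proof (rule ccontr)
      assume "x \<noteq> 0"
      then obtain k where k: "x $ k \<noteq> 0" by (auto simp: vec_eq_iff)
      obtain i where i: "\<And>j. cmod (x $ j) \<le> cmod (x $ i)"
      proof -
        have "Max (range (\<lambda>j. cmod (x $ j))) \<in> range (\<lambda>j. cmod (x $ j))" by (rule Max_in) auto
        then obtain i where "Max (range (\<lambda>j. cmod (x $ j))) = cmod (x $ i)" by blast
        moreover have "cmod (x $ j) \<le> Max (range (\<lambda>j. cmod (x $ j)))" for j
          by (rule Max_ge) auto
        ultimately have "\<And>j. cmod (x $ j) \<le> cmod (x $ i)" by simp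
        then show thesis by (rule that)
      qed
      have pos: "cmod (x $ i) > 0" using i[of k] k by (meson less_le_trans zero_less_norm_iff)
      have "((mat (of_real b) + A t) *v x) $ i = of_real b * x $ i + (\<Sum>j\<in>UNIV. A t $ i $ j * x $ j)"
        by (simp add: matrix_vector_mult_def mat_def distrib_right sum.distrib
            if_distrib[of "\<lambda>y. y * _"] cong: if_cong)
      then have "of_real b * x $ i = - (\<Sum>j\<in>UNIV. A t $ i $ j * x $ j)"
        using x by (simp add: eq_neg_iff_add_eq_0)
      then have "cmod (of_real b * x $ i) \<le> (\<Sum>j\<in>UNIV. cmod (A t $ i $ j) * cmod (x $ j))"
        by (simp add: norm_mult[symmetric] norm_sum)
      also have "\<dots> \<le> (\<Sum>j\<in>UNIV. cmod (A t $ i $ j) * cmod (x $ i))"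
        by (intro sum_mono mult_left_mono i) auto
      also have "\<dots> = (\<Sum>j\<in>UNIV. cmod (A t $ i $ j)) * cmod (x $ i)"
        by (simp add: sum_distrib_right)
      also have "(\<Sum>j\<in>UNIV. cmod (A t $ i $ j)) \<le> (\<Sum>i\<in>UNIV. \<Sum>j\<in>UNIV. cmod (A t $ i $ j))"
        by (rule member_le_sum) (auto intro: sum_nonneg)
      also have "\<dots> \<le> (\<Sum>t\<in>T. \<Sum>i\<in>UNIV. \<Sum>j\<in>UNIV. cmod (A t $ i $ j))"
        by (rule member_le_sum[OF t]) (auto intro!: sum_nonneg simp: assms)
      also have "\<dots> = b - 1" by (simp add: b_def)
      finally have "cmod (of_real b * x $ i) \<le> (b - 1) * cmod (x $ i)"
        using pos by (simp add: mult_right_mono)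
      moreover have "b \<ge> 1" by (simp add: b_def sum_nonneg)
      ultimately show False using pos by (simp add: norm_mult algebra_simps)
    qed
    then obtain B where "B ** (mat (of_real b) + A t) = mat 1"
      using matrix_left_invertible_ker by blast
    then show ?thesis unfolding invertible_def using matrix_left_right_inverse by blast
  qed
  then show ?thesis by blast
qed

text \<open>Expand the product over \<open>K\<close> of the factors \<open>1 + 0\<close> at points
  of \<open>U\<close> and \<open>1 + (-1)\<close> elsewhere.\<close>

lemma sum_supersets_alternating:
  assumes "finite K" "U \<subseteq> K"
  shows "(\<Sum>T\<in>Pow K. if U \<subseteq> T then (-1) ^ card (K - T) else 0 :: complex) = (if U = K then 1 else 0)"
proof -
  have fin: "finite T" if "T \<in> Pow K" for T using that assms(1) finite_subset by auto
  have "(\<Prod>a\<in>K. 1 + (if a \<in> U then 0 else -1 :: complex)) =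
    (\<Sum>T\<in>Pow K. (\<Prod>a\<in>T. 1) * (\<Prod>a\<in>K - T. if a \<in> U then 0 else -1))"
    by (rule prod_add[OF assms(1)])
  also have "\<dots> = (\<Sum>T\<in>Pow K. if U \<subseteq> T then (-1) ^ card (K - T) else 0)"
  proof (rule sum.cong[OF refl])
    fix T assume T: "T \<in> Pow K"
    have "(\<Prod>a\<in>K - T. if a \<in> U then 0 else -1 :: complex) = (if U \<subseteq> T then (-1) ^ card (K - T) else 0)"
    proof (cases "U \<subseteq> T")
      case True
      then have "(\<Prod>a\<in>K - T. if a \<in> U then 0 else -1 :: complex) = (\<Prod>a\<in>K - T. -1)"
        by (intro prod.cong) auto
      then show ?thesis using True by simp
    next
      case False
      then have "\<exists>a\<in>K - T. (if a \<in> U then 0 else -1 :: complex) = 0" using assms(2) by auto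
      then show ?thesis using False assms(1) by (simp add: prod_zero)
    qed
    then show "(\<Prod>a\<in>T. 1) * (\<Prod>a\<in>K - T. if a \<in> U then 0 else -1 :: complex) =
      (if U \<subseteq> T then (-1) ^ card (K - T) else 0)" by simp
  qed
  also have "(\<Prod>a\<in>K. 1 + (if a \<in> U then 0 else -1 :: complex)) = (if U = K then 1 else 0)"
  proof (cases "U = K")
    case False
    then have "\<exists>a\<in>K. 1 + (if a \<in> U then 0 else -1 :: complex) = 0" using assms(2) by auto
    then show ?thesis using False assms(1) by (simp add: prod_zero)
  qed (auto intro: prod.neutral)
  finally show ?thesis by simp
qed

text \<open>The constants \<open>g r\<close> cancel in the alternating sum.\<close>

lemma ryser:
  fixes g :: "'k \<Rightarrow> complex"
  assumes "finite K"
  shows "(\<Sum>T\<in>Pow K. (-1) ^ card (K - T) * (\<Prod>r\<in>K. g r + (\<Sum>t\<in>T. x r t))) =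
    (\<Sum>\<sigma> | \<sigma> permutes K. \<Prod>r\<in>K. x r (\<sigma> r))"
proof -
  \<comment> \<open>Expanding a product chooses in each factor either the constant
    (\<open>None\<close>) or some \<open>x r t\<close>. The alternating sum retains the choices that
    use every \<open>t\<close> in \<open>K\<close>; by counting these never take a constant and are
    permutations.\<close>
  define y where "y r u = (case u of None \<Rightarrow> g r | Some t \<Rightarrow> x r t)" for r u
  define \<Omega> where "\<Omega> = (PiE K (\<lambda>_. insert None (Some ` K)) :: ('k \<Rightarrow> 'k option) set)"
  define U where "U \<phi> = {t. Some t \<in> \<phi> ` K}" for \<phi> :: "'k \<Rightarrow> 'k option"
  have fin\<Omega>: "finite \<Omega>" unfolding \<Omega>_def using assms by (intro finite_PiE) auto
  have U: "U \<phi> \<subseteq> K" if "\<phi> \<in> \<Omega>" for \<phi> using that by (auto simp: U_def \<Omega>_def PiE_def Pi_def)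
  have expand: "(\<Prod>r\<in>K. g r + (\<Sum>t\<in>T. x r t)) = (\<Sum>\<phi>\<in>\<Omega>. if U \<phi> \<subseteq> T then (\<Prod>r\<in>K. y r (\<phi> r)) else 0)"
    if T: "T \<in> Pow K" for T
  proof -
    have finT: "finite T" using T assms finite_subset by auto
    have "(\<Prod>r\<in>K. g r + (\<Sum>t\<in>T. x r t)) = (\<Prod>r\<in>K. \<Sum>u\<in>insert None (Some ` T). y r u)"
      using finT by (simp add: y_def sum.reindex)
    also have "\<dots> = (\<Sum>\<phi>\<in>PiE K (\<lambda>_. insert None (Some ` T)). \<Prod>r\<in>K. y r (\<phi> r))"
      using finT assms by (intro prod_sum_PiE) auto
    also have "PiE K (\<lambda>_. insert None (Some ` T)) = {\<phi> \<in> \<Omega>. U \<phi> \<subseteq> T}"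
    proof (intro equalityI subsetI)
      fix \<phi> assume \<phi>: "\<phi> \<in> PiE K (\<lambda>_. insert None (Some ` T))"
      have "\<phi> r \<in> insert None (Some ` K)" if "r \<in> K" for r using PiE_mem[OF \<phi> that] T by auto
      then have "\<phi> \<in> \<Omega>" using \<phi> unfolding \<Omega>_def by (simp add: PiE_iff)
      moreover have "t \<in> T" if tU: "t \<in> U \<phi>" for t
      proof -
        obtain r where "r \<in> K" "Some t = \<phi> r" using tU unfolding U_def by blast
        then show ?thesis using PiE_mem[OF \<phi>, of r] by auto
      qed
      ultimately show "\<phi> \<in> {\<phi> \<in> \<Omega>. U \<phi> \<subseteq> T}" by blast
    next
      fix \<phi> assume \<phi>: "\<phi> \<in> {\<phi> \<in> \<Omega>. U \<phi> \<subseteq> T}"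
      have "\<phi> r \<in> insert None (Some ` T)" if "r \<in> K" for r
      proof (cases "\<phi> r")
        case (Some t)
        then have "t \<in> U \<phi>" using that by (force simp: U_def)
        then show ?thesis using \<phi> Some by auto
      qed simp
      then show "\<phi> \<in> PiE K (\<lambda>_. insert None (Some ` T))" using \<phi> by (auto simp: \<Omega>_def PiE_iff)
    qed
    finally show ?thesis using fin\<Omega> by (simp add: sum.inter_filter)
  qed
  have "(\<Sum>T\<in>Pow K. (-1) ^ card (K - T) * (\<Prod>r\<in>K. g r + (\<Sum>t\<in>T. x r t))) =
    (\<Sum>T\<in>Pow K. \<Sum>\<phi>\<in>\<Omega>. (if U \<phi> \<subseteq> T then (-1) ^ card (K - T) else 0) * (\<Prod>r\<in>K. y r (\<phi> r)))"
    by (rule sum.cong[OF refl]) (auto simp: expand sum_distrib_left intro!: sum.cong)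
  also have "\<dots> = (\<Sum>\<phi>\<in>\<Omega>. (\<Sum>T\<in>Pow K. if U \<phi> \<subseteq> T then (-1) ^ card (K - T) else 0) *
      (\<Prod>r\<in>K. y r (\<phi> r)))"
    by (subst sum.swap) (simp add: sum_distrib_right)
  also have "\<dots> = (\<Sum>\<phi>\<in>\<Omega>. if U \<phi> = K then (\<Prod>r\<in>K. y r (\<phi> r)) else 0)"
    by (rule sum.cong[OF refl]) (simp add: sum_supersets_alternating[OF assms U])
  also have "\<dots> = (\<Sum>\<phi>\<in>{\<phi> \<in> \<Omega>. U \<phi> = K}. \<Prod>r\<in>K. y r (\<phi> r))"
    using fin\<Omega> by (simp add: sum.inter_filter)
  also have "\<dots> = (\<Sum>\<sigma> | \<sigma> permutes K. \<Prod>r\<in>K. x r (\<sigma> r))"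
  proof (rule sum.reindex_bij_witness[where i = "\<lambda>\<sigma>. \<lambda>r\<in>K. Some (\<sigma> r)" and
        j = "\<lambda>\<phi> r. if r \<in> K then the (\<phi> r) else r"])
    fix \<phi> assume "\<phi> \<in> {\<phi> \<in> \<Omega>. U \<phi> = K}"
    then have \<phi>: "\<phi> \<in> \<Omega>" "U \<phi> = K" by auto
    have "Some ` K \<subseteq> \<phi> ` K" using \<phi>(2) by (auto simp: U_def)
    moreover have "card (\<phi> ` K) \<le> card (Some ` K)"
      using card_image_le[OF assms, of \<phi>] by (simp add: card_image)
    ultimately have img: "Some ` K = \<phi> ` K" using assms by (intro card_seteq) auto
    then have some: "\<phi> r = Some (the (\<phi> r))" if "r \<in> K" for r
      using that by (metis imageE image_eqI option.sel)
    let ?\<sigma> = "\<lambda>r. if r \<in> K then the (\<phi> r) else r"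
    have imgK: "?\<sigma> ` K = K"
    proof -
      have "?\<sigma> ` K = the ` (\<phi> ` K)" by auto
      also have "\<dots> = K" unfolding img[symmetric] by (simp add: image_image)
      finally show ?thesis .
    qed
    then have "bij_betw ?\<sigma> K K"
      using assms by (simp add: bij_betw_def finite_surj_inj)
    then show "?\<sigma> \<in> {\<sigma>. \<sigma> permutes K}" by (auto intro: bij_imp_permutes)
    show "(\<lambda>r\<in>K. Some (?\<sigma> r)) = \<phi>"
      using \<phi>(1) some by (auto simp: \<Omega>_def PiE_def extensional_def restrict_def fun_eq_iff)
    show "(\<Prod>r\<in>K. x r (?\<sigma> r)) = (\<Prod>r\<in>K. y r (\<phi> r))"
      by (rule prod.cong[OF refl]) (simp add: y_def split: option.split, metis some option.distinct(1) option.sel)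
  next
    fix \<sigma> assume "\<sigma> \<in> {\<sigma>. \<sigma> permutes K}"
    then have \<sigma>: "\<sigma> permutes K" by simp
    show "(\<lambda>r. if r \<in> K then the ((\<lambda>r\<in>K. Some (\<sigma> r)) r) else r) = \<sigma>"
      using \<sigma> by (auto simp: permutes_def)
    have "U (\<lambda>r\<in>K. Some (\<sigma> r)) = \<sigma> ` K" by (auto simp: U_def)
    then show "(\<lambda>r\<in>K. Some (\<sigma> r)) \<in> {\<phi> \<in> \<Omega>. U \<phi> = K}"
      using \<sigma> by (auto simp: \<Omega>_def permutes_image permutes_in_image)
  qed
  finally show ?thesis .
qed

definition tensor_power :: "'k set \<Rightarrow> complex^'n^'n \<Rightarrow> ('k \<Rightarrow> 'n) \<Rightarrow> ('k \<Rightarrow> 'n) \<Rightarrow> complex"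
  where "tensor_power K B a b = (\<Prod>r\<in>K. B $ a r $ b r)"

text \<open>The two sides are the entries of the two products of the transpose of \<open>Z\<close>
  with the symmetrized tensor product of the matrix units with rows \<open>c r\<close> and columns
  \<open>d r\<close>.\<close>

definition commutes_symmetrized :: "'k set \<Rightarrow> (('k \<Rightarrow> 'n::finite) \<Rightarrow> ('k \<Rightarrow> 'n) \<Rightarrow> complex) \<Rightarrow> bool"
  where "commutes_symmetrized K Z \<longleftrightarrow> (\<forall>c\<in>Wd K. \<forall>d\<in>Wd K. \<forall>i\<in>Wd K. \<forall>j\<in>Wd K.
    (\<Sum>\<sigma> | \<sigma> permutes K. if j = c \<circ> \<sigma> then Z i (d \<circ> \<sigma>) else 0) =
    (\<Sum>\<sigma> | \<sigma> permutes K. if i = d \<circ> \<sigma> then Z (c \<circ> \<sigma>) j else 0))"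

text \<open>
  Polarization: the symmetrized products of matrix units are linear combinations of tensor powers
  of invertible matrices.
\<close>

lemma commutes_symmetrizedI:
  fixes Z :: "('k \<Rightarrow> 'n::finite) \<Rightarrow> ('k \<Rightarrow> 'n) \<Rightarrow> complex"
  assumes fin: "finite K"
    and comm: "\<And>B i j. invertible B \<Longrightarrow> i \<in> Wd K \<Longrightarrow> j \<in> Wd K \<Longrightarrow>
      (\<Sum>a\<in>Wd K. tensor_power K B j a * Z i a) = (\<Sum>a\<in>Wd K. Z a j * tensor_power K B a i)"
  shows "commutes_symmetrized K Z"
  unfolding commutes_symmetrized_def
proof (intro ballI)
  fix c d i j :: "'k \<Rightarrow> 'n"
  assume W: "c \<in> Wd K" "d \<in> Wd K" "i \<in> Wd K" "j \<in> Wd K"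
  define A :: "'k set \<Rightarrow> complex^'n^'n"
    where "A T = (\<chi> p q. \<Sum>t\<in>T. if p = c t \<and> q = d t then 1 else 0)" for T
  \<comment> \<open>One scalar for all subsets \<open>T\<close>: in \<open>ryser\<close> the summand
    \<open>mat l\<close> plays the part of the constants, which cancel, while it makes
    \<open>comm\<close> applicable to every term.\<close>
  obtain l where l: "\<And>T. T \<in> Pow K \<Longrightarrow> invertible (mat l + A T)"
    using ex_invertible_shift[of "Pow K" A] fin by auto
  define S where "S a b = (\<Sum>\<sigma> | \<sigma> permutes K. if a = c \<circ> \<sigma> \<and> b = d \<circ> \<sigma> then 1 else 0 :: complex)"
    for a b
  have pol: "(\<Sum>T\<in>Pow K. (-1) ^ card (K - T) * tensor_power K (mat l + A T) a b) = S a b"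
    if ab: "a \<in> Wd K" "b \<in> Wd K" for a b
  proof -
    have "(\<Sum>T\<in>Pow K. (-1) ^ card (K - T) * tensor_power K (mat l + A T) a b) =
      (\<Sum>T\<in>Pow K. (-1) ^ card (K - T) * (\<Prod>r\<in>K. mat l $ a r $ b r +
        (\<Sum>t\<in>T. if a r = c t \<and> b r = d t then 1 else 0)))"
      by (simp add: tensor_power_def A_def)
    also have "\<dots> = (\<Sum>\<sigma> | \<sigma> permutes K. \<Prod>r\<in>K. if a r = c (\<sigma> r) \<and> b r = d (\<sigma> r) then 1 else 0)"
      by (rule ryser[OF fin])
    also have "\<dots> = S a b" unfolding S_def
    proof (rule sum.cong[OF refl])
      fix \<sigma> assume "\<sigma> \<in> {\<sigma>. \<sigma> permutes K}"
      then have cd: "c \<circ> \<sigma> \<in> Wd K" "d \<circ> \<sigma> \<in> Wd K" using Wd_comp W by auto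
      have "(a = c \<circ> \<sigma> \<and> b = d \<circ> \<sigma>) \<longleftrightarrow> (\<forall>r\<in>K. a r = c (\<sigma> r) \<and> b r = d (\<sigma> r))"
        using PiE_ext[OF ab(1) cd(1)] PiE_ext[OF ab(2) cd(2)] by auto
      then show "(\<Prod>r\<in>K. if a r = c (\<sigma> r) \<and> b r = d (\<sigma> r) then 1 else 0) =
        (if a = c \<circ> \<sigma> \<and> b = d \<circ> \<sigma> then 1 else 0 :: complex)"
        using fin by (auto intro: prod_zero prod.neutral)
    qed
    finally show ?thesis .
  qed
  have "(\<Sum>a\<in>Wd K. S j a * Z i a) = (\<Sum>a\<in>Wd K. \<Sum>T\<in>Pow K.
      (-1) ^ card (K - T) * tensor_power K (mat l + A T) j a * Z i a)"
    by (rule sum.cong[OF refl]) (simp add: pol[OF W(4), symmetric] sum_distrib_right)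
  also have "\<dots> = (\<Sum>T\<in>Pow K. (-1) ^ card (K - T) *
      (\<Sum>a\<in>Wd K. tensor_power K (mat l + A T) j a * Z i a))"
    by (subst sum.swap) (simp add: sum_distrib_left mult.assoc)
  also have "\<dots> = (\<Sum>T\<in>Pow K. (-1) ^ card (K - T) *
      (\<Sum>a\<in>Wd K. Z a j * tensor_power K (mat l + A T) a i))"
    by (simp add: comm[OF l W(3,4)])
  also have "\<dots> = (\<Sum>a\<in>Wd K. \<Sum>T\<in>Pow K.
      Z a j * ((-1) ^ card (K - T) * tensor_power K (mat l + A T) a i))"
    by (subst sum.swap) (simp add: sum_distrib_left ac_simps)
  also have "\<dots> = (\<Sum>a\<in>Wd K. Z a j * S a i)"
    by (rule sum.cong[OF refl]) (simp add: pol[OF _ W(3), symmetric] sum_distrib_left)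
  finally have SZ: "(\<Sum>a\<in>Wd K. S j a * Z i a) = (\<Sum>a\<in>Wd K. Z a j * S a i)" .
  have delta: "(\<Sum>a\<in>Wd K. if a = b then y else 0) = y" if "b \<in> Wd K"
    for b :: "'k \<Rightarrow> 'n" and y :: complex
    using fin that by (simp add: sum.delta)
  have "(\<Sum>a\<in>Wd K. S j a * Z i a) = (\<Sum>\<sigma> | \<sigma> permutes K. \<Sum>a\<in>Wd K.
      if a = d \<circ> \<sigma> then if j = c \<circ> \<sigma> then Z i (d \<circ> \<sigma>) else 0 else 0)"
    unfolding S_def sum_distrib_right by (subst sum.swap) (auto intro!: sum.cong)
  also have "\<dots> = (\<Sum>\<sigma> | \<sigma> permutes K. if j = c \<circ> \<sigma> then Z i (d \<circ> \<sigma>) else 0)"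
    by (rule sum.cong[OF refl], rule delta) (use Wd_comp[OF W(2)] in blast)
  finally have 1: "(\<Sum>a\<in>Wd K. S j a * Z i a) =
    (\<Sum>\<sigma> | \<sigma> permutes K. if j = c \<circ> \<sigma> then Z i (d \<circ> \<sigma>) else 0)" .
  have "(\<Sum>a\<in>Wd K. Z a j * S a i) = (\<Sum>\<sigma> | \<sigma> permutes K. \<Sum>a\<in>Wd K.
      if a = c \<circ> \<sigma> then if i = d \<circ> \<sigma> then Z (c \<circ> \<sigma>) j else 0 else 0)"
    unfolding S_def sum_distrib_left by (subst sum.swap) (auto intro!: sum.cong)
  also have "\<dots> = (\<Sum>\<sigma> | \<sigma> permutes K. if i = d \<circ> \<sigma> then Z (c \<circ> \<sigma>) j else 0)"
    by (rule sum.cong[OF refl], rule delta) (use Wd_comp[OF W(1)] in blast)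
  finally show "(\<Sum>\<sigma> | \<sigma> permutes K. if j = c \<circ> \<sigma> then Z i (d \<circ> \<sigma>) else 0) =
    (\<Sum>\<sigma> | \<sigma> permutes K. if i = d \<circ> \<sigma> then Z (c \<circ> \<sigma>) j else 0)"
    using 1 SZ by simp
qed

text \<open>
  Contracting the commutation relation shows that \<open>Z\<close> is annihilated by
  \<open>\<Sum>\<sigma>. tr \<sigma> \<cdot> \<sigma>\<^sup>-\<^sup>1\<close>, which is a positive definite operator: it is a sum of multiples of
  the projections onto the invariants of the stabilizers of the words.
\<close>

lemma commutes_symmetrized_eq_0:
  fixes Z :: "('k \<Rightarrow> 'n::finite) \<Rightarrow> ('k \<Rightarrow> 'n) \<Rightarrow> complex"
  assumes fin: "finite K" and comm: "commutes_symmetrized K Z"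
    and tr: "\<And>\<sigma>. \<sigma> permutes K \<Longrightarrow> (\<Sum>i\<in>Wd K. Z i (i \<circ> \<sigma>)) = 0"
    and c: "c \<in> Wd K" and j: "j \<in> Wd K"
  shows "Z c j = 0"
proof -
  define H where "H i = {\<sigma>. \<sigma> permutes K \<and> i = i \<circ> \<sigma>}" for i :: "'k \<Rightarrow> 'n"
  have finH: "finite (H i)" for i
    by (rule finite_subset[OF _ finite_permutations[OF fin]]) (auto simp: H_def)
  have idH: "id \<in> H i" for i by (simp add: H_def permutes_id)
  then have cardH: "card (H i) > 0" for i using finH by (auto simp: card_gt_0_iff)
  define v where "v a = Z a j" for a
  define h where "h i a = (\<Sum>\<sigma>\<in>H i. v (a \<circ> \<sigma>))" for i a
  \<comment> \<open>The commutation relation with \<open>d = i\<close>: after summation over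
    \<open>i\<close>, one side consists of the pairings of \<open>Z\<close> with permutations, which
    vanish by \<open>tr\<close>.\<close>
  have sum_h: "(\<Sum>i\<in>Wd K. h i a) = 0" if a: "a \<in> Wd K" for a
  proof -
    have "(\<Sum>i\<in>Wd K. h i a) =
      (\<Sum>i\<in>(Wd K :: ('k \<Rightarrow> 'n) set). \<Sum>\<sigma> | \<sigma> permutes K. if i = i \<circ> \<sigma> then Z (a \<circ> \<sigma>) j else 0)"
    proof -
      have "H i = {\<sigma> \<in> {\<sigma>. \<sigma> permutes K}. i = i \<circ> \<sigma>}" for i by (simp add: H_def)
      then show ?thesis
        unfolding h_def v_def by (simp only: sum.inter_filter[OF finite_permutations[OF fin]])
    qed
    also have "\<dots> = (\<Sum>i\<in>Wd K. \<Sum>\<sigma> | \<sigma> permutes K. if j = a \<circ> \<sigma> then Z i (i \<circ> \<sigma>) else 0)"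
    proof (rule sum.cong[OF refl])
      fix i :: "'k \<Rightarrow> 'n" assume iW: "i \<in> Wd K"
      show "(\<Sum>\<sigma> | \<sigma> permutes K. if i = i \<circ> \<sigma> then Z (a \<circ> \<sigma>) j else 0) =
        (\<Sum>\<sigma> | \<sigma> permutes K. if j = a \<circ> \<sigma> then Z i (i \<circ> \<sigma>) else 0)"
        by (rule comm[unfolded commutes_symmetrized_def, THEN bspec, THEN bspec, THEN bspec, THEN bspec,
              symmetric, OF a iW iW j])
    qed
    also have "\<dots> = (\<Sum>\<sigma> | \<sigma> permutes K. if j = a \<circ> \<sigma> then \<Sum>i\<in>Wd K. Z i (i \<circ> \<sigma>) else 0)"
      by (subst sum.swap) (auto intro!: sum.cong)
    also have "\<dots> = 0" by (rule sum.neutral) (use tr in simp)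
    finally show ?thesis .
  qed
  have h_inv: "h i (a \<circ> \<tau>) = h i a" if \<tau>: "\<tau> \<in> H i" for i a \<tau>
  proof -
    have p: "\<tau> permutes K" and i: "i = i \<circ> \<tau>" using \<tau> by (auto simp: H_def)
    have i': "i = i \<circ> inv_into UNIV \<tau>"
      using arg_cong[OF i, of "\<lambda>f. f \<circ> inv_into UNIV \<tau>"] permutes_inv_o[OF p] by (simp add: comp_assoc)
    show ?thesis unfolding h_def
    proof (rule sum.reindex_bij_witness[where i = "\<lambda>\<sigma>. inv_into UNIV \<tau> \<circ> \<sigma>" and j = "\<lambda>\<sigma>. \<tau> \<circ> \<sigma>"])
      fix \<sigma> assume s: "\<sigma> \<in> H i"
      then have sp: "\<sigma> permutes K" and si: "i = i \<circ> \<sigma>" by (auto simp: H_def)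
      show "inv_into UNIV \<tau> \<circ> (\<tau> \<circ> \<sigma>) = \<sigma>" "\<tau> \<circ> (inv_into UNIV \<tau> \<circ> \<sigma>) = \<sigma>"
        by (simp_all add: comp_assoc[symmetric] permutes_inv_o[OF p])
      show "\<tau> \<circ> \<sigma> \<in> H i"
        using permutes_compose[OF sp p] i si by (simp add: H_def comp_assoc[symmetric])
      show "inv_into UNIV \<tau> \<circ> \<sigma> \<in> H i"
        using permutes_compose[OF sp permutes_inv[OF p]] i' si by (simp add: H_def comp_assoc[symmetric])
      show "v (a \<circ> (\<tau> \<circ> \<sigma>)) = v (a \<circ> \<tau> \<circ> \<sigma>)" by (simp only: comp_assoc)
    qed
  qed
  have norm_h: "(\<Sum>a\<in>Wd K. h i a * cnj (h i a)) = of_nat (card (H i)) * (\<Sum>a\<in>Wd K. h i a * cnj (v a))" for i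
  proof -
    have "(\<Sum>a\<in>Wd K. h i a * cnj (h i a)) = (\<Sum>\<tau>\<in>H i. \<Sum>a\<in>Wd K. h i a * cnj (v (a \<circ> \<tau>)))"
      by (subst (2) h_def) (simp add: cnj_sum sum_distrib_left, subst sum.swap, rule refl)
    also have "\<dots> = (\<Sum>\<tau>\<in>H i. \<Sum>a\<in>Wd K. h i a * cnj (v a))"
    proof (rule sum.cong[OF refl])
      fix \<tau> assume \<tau>: "\<tau> \<in> H i"
      have "(\<Sum>a\<in>Wd K. h i a * cnj (v (a \<circ> \<tau>))) = (\<Sum>a\<in>Wd K. h i (a \<circ> \<tau>) * cnj (v (a \<circ> \<tau>)))"
        by (simp add: h_inv[OF \<tau>])
      also have "\<dots> = (\<Sum>a\<in>Wd K. h i a * cnj (v a))"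
        by (rule sum_Wd_comp) (use \<tau> in \<open>simp add: H_def\<close>)
      finally show "(\<Sum>a\<in>Wd K. h i a * cnj (v (a \<circ> \<tau>))) = (\<Sum>a\<in>Wd K. h i a * cnj (v a))" .
    qed
    finally show ?thesis by simp
  qed
  \<comment> \<open>By \<open>norm_h\<close>, the pairing of \<open>h i\<close> with
    \<open>v\<close> is the squared norm of \<open>h i\<close> divided by \<open>card (H i)\<close>.
    The normalization turns the sum over \<open>i\<close> into a sum of squares; it is zero by
    \<open>sum_h\<close>, so every \<open>h i\<close> vanishes.\<close>
  define k where "k i a = h i a / of_real (sqrt (card (H i)))" for i a
  have kk: "k i a * cnj (k i a) = h i a * cnj (h i a) / of_nat (card (H i))" for i a
  proof -
    have "complex_of_real (sqrt (card (H i))) * complex_of_real (sqrt (card (H i))) = of_nat (card (H i))"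
      by (simp flip: of_real_mult)
    then show ?thesis by (simp add: k_def)
  qed
  have "(\<Sum>(i, a)\<in>Wd K \<times> Wd K. k i a * cnj (k i a)) =
    (\<Sum>i\<in>Wd K. (\<Sum>a\<in>Wd K. h i a * cnj (h i a)) / of_nat (card (H i)))"
    by (simp add: sum.cartesian_product[symmetric] kk sum_divide_distrib)
  also have "\<dots> = (\<Sum>i\<in>Wd K. \<Sum>a\<in>Wd K. h i a * cnj (v a))"
    using cardH by (simp add: norm_h)
  also have "\<dots> = (\<Sum>a\<in>Wd K. (\<Sum>i\<in>Wd K. h i a) * cnj (v a))"
    by (subst sum.swap) (simp add: sum_distrib_right)
  also have "\<dots> = 0" by (simp add: sum_h)
  finally have "(\<Sum>p\<in>Wd K \<times> Wd K. (case p of (i, a) \<Rightarrow> k i a) * cnj (case p of (i, a) \<Rightarrow> k i a)) = 0"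
    by (simp add: case_prod_unfold)
  from sum_norm_square_zero[OF _ this, of "(c, c)"] have "k c c = 0" using fin c by simp
  then have "h c c = 0" using cardH[of c] by (simp add: k_def)
  \<comment> \<open>Every permutation in the stabilizer \<open>H c\<close> fixes the word
    \<open>c\<close>, so all summands equal \<open>v c\<close>.\<close>
  moreover have "h c c = (\<Sum>\<sigma>\<in>H c. v c)" unfolding h_def
    by (rule sum.cong[OF refl]) (simp add: H_def)
  ultimately show ?thesis using cardH[of c] by (simp add: v_def)
qed

text \<open>Substituting \<open>\<sigma> \<circ> \<rho>\<close> for \<open>\<sigma>\<close> moves a
  slot permutation \<open>\<rho>\<close> from one side of the symmetrized product to the
  other.\<close>

lemma commutes_symmetrized_slot_span:
  fixes Z :: "('k \<Rightarrow> 'n::finite) \<Rightarrow> ('k \<Rightarrow> 'n) \<Rightarrow> complex"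
  assumes fin: "finite K" and Z: "Z \<in> slot_span K"
  shows "commutes_symmetrized K Z"
proof -
  obtain x where x: "\<forall>i\<in>Wd K. \<forall>j\<in>Wd K. Z i j = (\<Sum>\<rho> | \<rho> permutes K. if i \<circ> \<rho> = j then x \<rho> else 0)"
    using Z unfolding slot_span_def by blast
  show ?thesis unfolding commutes_symmetrized_def
  proof (intro ballI)
    fix c d i j :: "'k \<Rightarrow> 'n"
    assume W: "c \<in> Wd K" "d \<in> Wd K" "i \<in> Wd K" "j \<in> Wd K"
    let ?P = "{\<sigma>. \<sigma> permutes K}"
    have "(\<Sum>\<sigma>\<in>?P. if j = c \<circ> \<sigma> then Z i (d \<circ> \<sigma>) else 0) =
      (\<Sum>\<sigma>\<in>?P. \<Sum>\<rho>\<in>?P. if j = c \<circ> \<sigma> \<and> i \<circ> \<rho> = d \<circ> \<sigma> then x \<rho> else 0)"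
      by (rule sum.cong[OF refl]) (use x W(3) Wd_comp[OF W(2)] in simp)
    also have "\<dots> = (\<Sum>\<rho>\<in>?P. \<Sum>\<sigma>\<in>?P. if j = c \<circ> \<sigma> \<and> i \<circ> \<rho> = d \<circ> \<sigma> then x \<rho> else 0)"
      by (rule sum.swap)
    also have "\<dots> = (\<Sum>\<rho>\<in>?P. \<Sum>\<sigma>\<in>?P. if i = d \<circ> \<sigma> \<and> c \<circ> \<sigma> \<circ> \<rho> = j then x \<rho> else 0)"
    proof (rule sum.cong[OF refl])
      fix \<rho> assume "\<rho> \<in> ?P"
      then have \<rho>: "\<rho> permutes K" by simp
      have eq: "i \<circ> \<rho> = d \<circ> \<sigma> \<circ> \<rho> \<longleftrightarrow> i = d \<circ> \<sigma>" for \<sigma>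
      proof
        assume "i \<circ> \<rho> = d \<circ> \<sigma> \<circ> \<rho>"
        then have "i \<circ> \<rho> \<circ> inv_into UNIV \<rho> = d \<circ> \<sigma> \<circ> \<rho> \<circ> inv_into UNIV \<rho>" by simp
        then show "i = d \<circ> \<sigma>" by (simp add: comp_assoc permutes_inv_o[OF \<rho>])
      qed simp
      have "(\<Sum>\<sigma>\<in>?P. if j = c \<circ> \<sigma> \<and> i \<circ> \<rho> = d \<circ> \<sigma> then x \<rho> else 0) =
        (\<Sum>\<sigma>\<in>?P. if j = c \<circ> (\<sigma> \<circ> \<rho>) \<and> i \<circ> \<rho> = d \<circ> (\<sigma> \<circ> \<rho>) then x \<rho> else 0)"
        by (rule sum_permutations_compose_right[OF \<rho>])
      then show "(\<Sum>\<sigma>\<in>?P. if j = c \<circ> \<sigma> \<and> i \<circ> \<rho> = d \<circ> \<sigma> then x \<rho> else 0) =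
        (\<Sum>\<sigma>\<in>?P. if i = d \<circ> \<sigma> \<and> c \<circ> \<sigma> \<circ> \<rho> = j then x \<rho> else 0)"
        unfolding comp_assoc[symmetric] eq by (auto intro!: sum.cong)
    qed
    also have "\<dots> = (\<Sum>\<sigma>\<in>?P. \<Sum>\<rho>\<in>?P. if i = d \<circ> \<sigma> \<and> c \<circ> \<sigma> \<circ> \<rho> = j then x \<rho> else 0)"
      by (rule sum.swap)
    also have "\<dots> = (\<Sum>\<sigma>\<in>?P. if i = d \<circ> \<sigma> then Z (c \<circ> \<sigma>) j else 0)"
      by (rule sum.cong[OF refl]) (use x W(4) Wd_comp[OF W(1)] in simp)
    finally show "(\<Sum>\<sigma>\<in>?P. if j = c \<circ> \<sigma> then Z i (d \<circ> \<sigma>) else 0) =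
      (\<Sum>\<sigma>\<in>?P. if i = d \<circ> \<sigma> then Z (c \<circ> \<sigma>) j else 0)" .
  qed
qed

text \<open>The difference of \<open>Z\<close> and its projection to the span still satisfies the
  commutation relation, and being orthogonal to the span it pairs to zero with all permutations. By
  \<open>commutes_symmetrized_eq_0\<close> it vanishes. This replaces the double centralizer theorem
  in Schur-Weyl duality.\<close>

theorem first_fundamental_theorem_tensors:
  fixes Z :: "('k \<Rightarrow> 'n::finite) \<Rightarrow> ('k \<Rightarrow> 'n) \<Rightarrow> complex"
  assumes fin: "finite K" and comm: "commutes_symmetrized K Z"
  shows "Z \<in> slot_span K"
proof -
  let ?A = "Wd K \<times> Wd K :: (('k \<Rightarrow> 'n) \<times> ('k \<Rightarrow> 'n)) set"
  define L where "L = case_prod ` (slot_span K :: (('k \<Rightarrow> 'n) \<Rightarrow> ('k \<Rightarrow> 'n) \<Rightarrow> complex) set)"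
  have "\<exists>u\<in>L. \<forall>l\<in>L. (\<Sum>p\<in>?A. (case_prod Z p - u p) * cnj (l p)) = 0"
  proof (rule orthogonal_projection)
    show "finite ?A" using fin by simp
    show "(\<lambda>x. 0) \<in> L" unfolding L_def
      by (rule image_eqI[OF _ slot_span_zero]) auto
    fix u v assume "u \<in> L" "v \<in> L"
    then obtain U V where "U \<in> slot_span K" "V \<in> slot_span K" "u = case_prod U" "v = case_prod V"
      by (auto simp: L_def)
    then show "(\<lambda>x. u x + v x) \<in> L" unfolding L_def
      by (intro image_eqI[where x = "\<lambda>i j. U i j + V i j"] slot_span_add) (auto simp: fun_eq_iff)
  next
    fix c u assume "u \<in> L"
    then obtain U where "U \<in> slot_span K" "u = case_prod U" by (auto simp: L_def)
    then show "(\<lambda>x. c * u x) \<in> L" unfolding L_def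
      by (intro image_eqI[where x = "\<lambda>i j. c * U i j"] slot_span_cmult) (auto simp: fun_eq_iff)
  qed
  then obtain Y where Y: "Y \<in> slot_span K"
    "\<And>V. V \<in> slot_span K \<Longrightarrow> (\<Sum>p\<in>?A. (case_prod Z p - case_prod Y p) * cnj (case_prod V p)) = 0"
    unfolding L_def by blast
  define D where "D i j = Z i j - Y i j" for i j
  have "D i j = 0" if "i \<in> Wd K" "j \<in> Wd K" for i j
  proof (rule commutes_symmetrized_eq_0[OF fin _ _ that])
    show "commutes_symmetrized K D"
    proof -
      have "(if P then x - y else 0) = (if P then x else 0) - (if P then y else 0)"
        for P and x y :: complex by simp
      then show ?thesis
        using comm commutes_symmetrized_slot_span[OF fin Y(1)]
        unfolding commutes_symmetrized_def D_def by (simp only: sum_subtractf) simp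
    qed
    fix \<sigma> assume \<sigma>: "\<sigma> permutes K"
    have "(\<Sum>i\<in>Wd K. D i (i \<circ> \<sigma>)) = (\<Sum>i\<in>Wd K. \<Sum>j\<in>Wd K. if j = i \<circ> \<sigma> then D i j else 0)"
    proof (rule sum.cong[OF refl])
      fix i :: "'k \<Rightarrow> 'n" assume "i \<in> Wd K"
      from Wd_comp[OF this \<sigma>] show "D i (i \<circ> \<sigma>) = (\<Sum>j\<in>Wd K. if j = i \<circ> \<sigma> then D i j else 0)"
        using fin by (simp add: sum.delta)
    qed
    also have "\<dots> = (\<Sum>i\<in>Wd K. \<Sum>j\<in>Wd K. (Z i j - Y i j) * cnj (if i \<circ> \<sigma> = j then 1 else 0))"
      by (intro sum.cong refl) (auto simp: D_def)
    also have "\<dots> = 0"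
      using Y(2)[OF slot_span_perm[OF fin \<sigma>]] by (simp add: sum.cartesian_product case_prod_unfold)
    finally show "(\<Sum>i\<in>Wd K. D i (i \<circ> \<sigma>)) = 0" .
  qed
  then have "Z i j = Y i j" if "i \<in> Wd K" "j \<in> Wd K" for i j using that by (simp add: D_def)
  then show ?thesis using Y(1) by (simp add: slot_span_def)
qed

section \<open>The representation scheme, conjugation, and invariants modulo the relations\<close>

section \<open>The coordinate ring of the representation scheme\<close>

lemma (in cring) idealI_closed:
  assumes "J \<subseteq> carrier R" "\<zero> \<in> J" "\<And>a b. a \<in> J \<Longrightarrow> b \<in> J \<Longrightarrow> a \<oplus> b \<in> J"
    and "\<And>a x. x \<in> carrier R \<Longrightarrow> a \<in> J \<Longrightarrow> x \<otimes> a \<in> J"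
  shows "ideal J R"
proof (rule idealI)
  show "ring R" by (rule ring_axioms)
  show "subgroup J (add_monoid R)"
  proof (rule add.subgroupI)
    fix a assume a: "a \<in> J"
    then have "\<ominus> a = (\<ominus> \<one>) \<otimes> a" using assms(1) l_minus[of \<one> a] by auto
    then show "\<ominus> a \<in> J" using assms(4)[of "\<ominus> \<one>" a] a by simp
  qed (use assms in auto)
  show "a \<otimes> x \<in> J" if "a \<in> J" "x \<in> carrier R" for a x
    using assms(1) assms(4)[OF that(2,1)] that m_comm[of a x] by auto
qed (use assms(4) in auto)

abbreviation gen_vars :: "'g set \<Rightarrow> ('g, 'n) coord set"
  where "gen_vars S \<equiv> {x. coord_gen x \<in> S}"

lemma carrier_poly_ring [simp]: "carrier (poly_ring S) = vars_in (gen_vars S)"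
  by (simp add: poly_ring_def vars_in_def)

lemma poly_ring_simps [simp]:
  "x \<otimes>\<^bsub>poly_ring S\<^esub> y = x * y" "x \<oplus>\<^bsub>poly_ring S\<^esub> y = x + y"
  "\<zero>\<^bsub>poly_ring S\<^esub> = 0" "\<one>\<^bsub>poly_ring S\<^esub> = 1"
  by (simp_all add: poly_ring_def ring_of_type_algebra_def)

lemma cring_poly_ring: "cring (poly_ring S)"
proof (rule cringI)
  show "abelian_group (poly_ring S)"
  proof (rule abelian_groupI)
    fix x assume "x \<in> carrier (poly_ring S)"
    then show "\<exists>y\<in>carrier (poly_ring S). y \<oplus>\<^bsub>poly_ring S\<^esub> x = \<zero>\<^bsub>poly_ring S\<^esub>"
      by (intro bexI[of _ "- x"]) (auto simp: vars_in_uminus)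
  qed (auto simp: vars_in_add vars_in_zero add.assoc add.commute)
  show "Group.comm_monoid (poly_ring S)"
    by (rule comm_monoidI) (auto simp: vars_in_mult vars_in_one mult.assoc mult.commute)
qed (auto simp: distrib_right)

lemma word_mat_Nil [simp]: "word_mat [] = mat 1"
  by (simp add: word_mat_def)

lemma word_mat_Cons: "word_mat ((s, b) # w) = (if b then gen_mat_inv s else gen_mat s) ** word_mat w"
  by (simp add: word_mat_def)

lemma word_mat_append: "word_mat (v @ w) = word_mat v ** word_mat w"
  by (induction v) (auto simp: word_mat_Cons matrix_mul_assoc split: prod.split)

lemma (in group) word_val_append:
  assumes "set v \<subseteq> carrier G \<times> UNIV" "set w \<subseteq> carrier G \<times> UNIV"
  shows "word_val G (v @ w) = word_val G v \<otimes> word_val G w"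
  using assms(1)
proof (induction v)
  case Nil
  then show ?case using word_val_closed[OF assms(2)] by (simp add: word_val_def)
next
  case (Cons sb v)
  have "word_val G v \<in> carrier G" using Cons.prems word_val_closed by simp
  then show ?case
    using Cons word_val_closed[OF assms(2)]
    by (cases sb) (auto simp: word_val_def m_assoc)
qed

locale representation_scheme = group \<Gamma> for \<Gamma> :: "('g, 'z) monoid_scheme" (structure) +
  fixes S :: "'g set"
  assumes S_sub: "S \<subseteq> carrier \<Gamma>" and S_gen: "generate \<Gamma> S = carrier \<Gamma>"
begin

abbreviation word_over :: "('g \<times> bool) list \<Rightarrow> bool"
  where "word_over w \<equiv> set w \<subseteq> S \<times> UNIV"

lemma word_over_carrier: "word_over w \<Longrightarrow> set w \<subseteq> carrier \<Gamma> \<times> UNIV"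
  using S_sub by auto

lemma word_exists:
  assumes "\<gamma> \<in> carrier \<Gamma>"
  shows "\<exists>w. word_over w \<and> word_val \<Gamma> w = \<gamma>"
  using assms unfolding S_gen[symmetric]
proof (induction rule: generate.induct)
  case one
  then show ?case by (intro exI[of _ "[]"]) (simp add: word_val_def)
next
  case (incl h)
  then show ?case using S_sub by (intro exI[of _ "[(h, False)]"]) (auto simp: word_val_def)
next
  case (inv h)
  then show ?case using S_sub by (intro exI[of _ "[(h, True)]"]) (auto simp: word_val_def)
next
  case (eng h1 h2)
  then obtain v w where vw: "word_over v" "word_val \<Gamma> v = h1" "word_over w" "word_val \<Gamma> w = h2" by blast
  then have "word_val \<Gamma> (v @ w) = h1 \<otimes> h2"
    using word_val_append[of v w] S_sub by auto
  then show ?case using vw by (intro exI[of _ "v @ w"]) auto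
qed

definition word_of :: "'g \<Rightarrow> ('g \<times> bool) list"
  where "word_of \<gamma> = (SOME w. word_over w \<and> word_val \<Gamma> w = \<gamma>)"

lemma word_of:
  assumes "\<gamma> \<in> carrier \<Gamma>"
  shows "word_over (word_of \<gamma>)" "word_val \<Gamma> (word_of \<gamma>) = \<gamma>"
  using someI_ex[OF word_exists[OF assms]] by (simp_all add: word_of_def)

abbreviation Pol :: "('g, 'n) cpoly set"
  where "Pol \<equiv> vars_in (gen_vars S)"

definition relators :: "('g, 'n::finite) cpoly set"
  where "relators =
    {Var (DetInv s) * det (gen_mat s :: ('g, 'n) cpoly^'n^'n) - 1 |s. s \<in> S} \<union>
    {(word_mat w :: ('g, 'n) cpoly^'n^'n) $ i $ j - mat 1 $ i $ j |w i j.
       word_over w \<and> word_val \<Gamma> w = \<one>}"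

lemma rep_ideal_eq: "rep_ideal \<Gamma> S = Idl\<^bsub>poly_ring S\<^esub> relators"
  by (simp add: rep_ideal_def relators_def)

end

lemma matrix_inv_mult:
  assumes "invertible (g :: complex^'n^'n)"
  shows "g ** matrix_inv g = mat 1" "matrix_inv g ** g = mat 1"
  using someI_ex[OF assms[unfolded invertible_def]] by (auto simp: matrix_inv_def)

lemma Pol_subring: "subring_ideal (vars_in V) {0 :: ('g, 'n) cpoly}"
  by (rule subring_ideal_vars_in) auto

lemma gen_mat_in:
  "s \<in> S \<Longrightarrow> subring_ideal.mat_in (vars_in (gen_vars S)) (gen_mat s :: ('g, 'n::finite) cpoly^'n^'n)"
  by (auto simp: subring_ideal.mat_in_def[OF Pol_subring] gen_mat_def intro!: vars_in_Var)

lemma gen_mat_inv_in: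
  assumes "s \<in> S"
  shows "subring_ideal.mat_in (vars_in (gen_vars S)) (gen_mat_inv s :: ('g, 'n::finite) cpoly^'n^'n)"
  using subring_ideal.mat_in_adjugate[OF Pol_subring gen_mat_in[OF assms]] assms
  unfolding subring_ideal.mat_in_def[OF Pol_subring]
  by (auto simp: gen_mat_inv_def intro!: vars_in_mult vars_in_Var)

lemma word_mat_in:
  assumes "set w \<subseteq> S \<times> UNIV"
  shows "subring_ideal.mat_in (vars_in (gen_vars S)) (word_mat w :: ('g, 'n::finite) cpoly^'n^'n)"
  using assms
proof (induction w)
  case Nil
  then show ?case by (simp add: subring_ideal.mat_in_one[OF Pol_subring])
next
  case (Cons sb w)
  then show ?case
    by (cases sb) (auto simp: word_mat_Cons gen_mat_in gen_mat_inv_in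
        intro!: subring_ideal.mat_in_mult[OF Pol_subring])
qed

context representation_scheme
begin

lemma relators_sub: "relators \<subseteq> Pol"
proof -
  interpret Z: subring_ideal Pol "{0 :: ('g, 'n) cpoly}" by (rule Pol_subring)
  have "Var (DetInv s) * det (gen_mat s) - 1 \<in> Pol" if "s \<in> S" for s
    by (intro Z.R_diff Z.R_mult Z.R_one Z.mat_in_det gen_mat_in that vars_in_Var) (use that in auto)
  moreover have "word_mat w $ i $ j - mat 1 $ i $ j \<in> Pol" if "word_over w" for w i j
    using word_mat_in[OF that] Z.mat_in_one by (auto simp: Z.mat_in_def intro!: Z.R_diff)
  ultimately show ?thesis by (auto simp: relators_def)
qed

lemma ideal_rep_ideal: "ideal (rep_ideal \<Gamma> S) (poly_ring S)"
  unfolding rep_ideal_eq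
  by (rule ring.genideal_ideal[OF cring.axioms(1)[OF cring_poly_ring]]) (simp add: relators_sub)

lemma relators_in: "relators \<subseteq> rep_ideal \<Gamma> S"
  unfolding rep_ideal_eq
  by (rule ring.genideal_self[OF cring.axioms(1)[OF cring_poly_ring]]) (simp add: relators_sub)

sublocale I: subring_ideal Pol "rep_ideal \<Gamma> S :: ('g, 'n::finite) cpoly set"
proof (rule subring_ideal_vars_in)
  let ?I = "rep_ideal \<Gamma> S :: ('g, 'n) cpoly set"
  have J: "ideal ?I (poly_ring S)" by (rule ideal_rep_ideal)
  show "0 \<in> ?I" using additive_subgroup.zero_closed[OF ideal.axioms(1)[OF J]] by simp
  show "x + y \<in> ?I" if "x \<in> ?I" "y \<in> ?I" for x y
    using additive_subgroup.a_closed[OF ideal.axioms(1)[OF J] that] by simp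
  show "p * x \<in> ?I" if "p \<in> Pol" "x \<in> ?I" for p x
    using ideal.I_l_closed[OF J that(2), of p] that(1) by simp
qed

lemma rep_ideal_induct:
  assumes "x \<in> rep_ideal \<Gamma> S" "relators \<subseteq> T" "0 \<in> T"
    and "\<And>a b. a \<in> T \<Longrightarrow> b \<in> T \<Longrightarrow> a + b \<in> T"
    and "\<And>p a. p \<in> Pol \<Longrightarrow> a \<in> T \<Longrightarrow> p * a \<in> T"
  shows "x \<in> T"
proof -
  have "ideal (T \<inter> Pol) (poly_ring S)"
    by (rule cring.idealI_closed[OF cring_poly_ring])
      (use assms vars_in_zero vars_in_add vars_in_mult in auto)
  then have "rep_ideal \<Gamma> S \<subseteq> T \<inter> Pol"
    unfolding rep_ideal_eq
    by (rule ring.genideal_minimal[OF cring.axioms(1)[OF cring_poly_ring]])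
      (use assms relators_sub in auto)
  then show ?thesis using assms(1) by auto
qed

lemma word_mat_one:
  assumes "word_over w" "word_val \<Gamma> w = \<one>"
  shows "I.mat_eqv (word_mat w :: ('g, 'n::finite) cpoly^'n^'n) (mat 1)"
proof -
  have "(word_mat w :: ('g, 'n) cpoly^'n^'n) $ i $ j - mat 1 $ i $ j \<in> rep_ideal \<Gamma> S" for i j
    by (rule subsetD[OF relators_in]) (use assms in \<open>auto simp: relators_def\<close>)
  then show ?thesis by (simp add: I.mat_eqv_def I.eqv_def)
qed

text \<open>With a word \<open>u\<close> for the inverse of the common value, the matrix of
  \<open>v @ u @ w\<close> is congruent both to that of \<open>v\<close> and to that of
  \<open>w\<close>, since \<open>u @ w\<close> and \<open>v @ u\<close> are relations. This makes
  the word chosen in \<open>trace_fun\<close> immaterial.\<close>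

lemma word_mat_cong:
  assumes v: "word_over v" and w: "word_over w" and eq: "word_val \<Gamma> v = word_val \<Gamma> w"
  shows "I.mat_eqv (word_mat v :: ('g, 'n::finite) cpoly^'n^'n) (word_mat w)"
proof -
  note c = word_over_carrier[OF v, THEN word_val_closed]
  define u where "u = word_of (inv (word_val \<Gamma> v))"
  have u: "word_over u" "word_val \<Gamma> u = inv (word_val \<Gamma> v)"
    using word_of c by (auto simp: u_def)
  have vu: "I.mat_eqv (word_mat (v @ u) :: ('g, 'n) cpoly^'n^'n) (mat 1)"
    by (rule word_mat_one) (use u v c word_over_carrier in \<open>auto simp: word_val_append\<close>)
  have uw: "I.mat_eqv (word_mat (u @ w) :: ('g, 'n) cpoly^'n^'n) (mat 1)"
    by (rule word_mat_one) (use u w c eq word_over_carrier in \<open>auto simp: word_val_append\<close>)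
  have "I.mat_eqv (word_mat v ** word_mat (u @ w) :: ('g, 'n) cpoly^'n^'n) (word_mat v ** mat 1)"
    by (intro I.mat_eqv_mult I.mat_eqv_refl uw word_mat_in v I.mat_in_one)
  moreover have "I.mat_eqv (word_mat (v @ u) ** word_mat w :: ('g, 'n) cpoly^'n^'n) (mat 1 ** word_mat w)"
    by (intro I.mat_eqv_mult I.mat_eqv_refl vu word_mat_in w) (use u v in auto)
  moreover have "word_mat v ** word_mat (u @ w) = (word_mat (v @ u) ** word_mat w :: ('g, 'n) cpoly^'n^'n)"
    by (simp add: word_mat_append matrix_mul_assoc)
  ultimately show ?thesis
    using I.mat_eqv_trans[OF I.mat_eqv_sym] by (simp only: matrix_mul_lid matrix_mul_rid)
qed

lemma gen_mat_inverse:
  assumes "s \<in> S"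
  shows "I.mat_eqv (gen_mat s ** gen_mat_inv s :: ('g, 'n::finite) cpoly^'n^'n) (mat 1)"
    and "I.mat_eqv (gen_mat_inv s ** gen_mat s :: ('g, 'n::finite) cpoly^'n^'n) (mat 1)"
  using word_mat_one[of "[(s, False), (s, True)]"] word_mat_one[of "[(s, True), (s, False)]"] assms S_sub
  by (auto simp: word_mat_Cons word_val_def)

lemma det_inverse:
  assumes "s \<in> S"
  shows "I.eqv (Var (DetInv s) * det (gen_mat s :: ('g, 'n::finite) cpoly^'n^'n)) 1"
  using subsetD[OF relators_in] assms by (auto simp: I.eqv_def relators_def)

text \<open>Both are inverse to \<open>det (gen_mat s)\<close> modulo the relations. The inverse
  determinant is thereby the determinant of a word matrix, hence a trace polynomial.\<close>

lemma DetInv_eqv_det: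
  assumes s: "s \<in> S"
  shows "I.eqv (Var (DetInv s)) (det (gen_mat_inv s :: ('g, 'n::finite) cpoly^'n^'n))"
proof -
  let ?d = "Var (DetInv s) :: ('g, 'n) cpoly" and ?X = "gen_mat s :: ('g, 'n) cpoly^'n^'n"
    and ?Y = "gen_mat_inv s :: ('g, 'n) cpoly^'n^'n"
  have R: "?d \<in> Pol" "det ?X \<in> Pol" "det ?Y \<in> Pol"
    using s gen_mat_in gen_mat_inv_in by (auto intro!: vars_in_Var I.mat_in_det)
  have "I.eqv (det (?X ** ?Y)) (det (mat 1 :: ('g, 'n) cpoly^'n^'n))"
    by (intro I.mat_eqv_det gen_mat_inverse s I.mat_in_mult gen_mat_in gen_mat_inv_in I.mat_in_one)
  then have "I.eqv (det ?X * det ?Y) 1" by (simp add: det_mul)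
  then have "I.eqv (?d * (det ?X * det ?Y)) (?d * 1)"
    by (intro I.eqv_mult I.eqv_refl R I.R_one)
  moreover have "I.eqv (?d * det ?X * det ?Y) (1 * det ?Y)"
    by (intro I.eqv_mult I.eqv_refl R I.R_mult det_inverse s)
  ultimately show ?thesis using I.eqv_trans I.eqv_sym by (simp add: mult.assoc) blast
qed

section \<open>Conjugation\<close>

lemma const_mat_mult: "const_mat (A ** B) = const_mat A ** const_mat B"
  by (simp add: const_mat_def vec_eq_iff matrix_matrix_mult_def Const_sum Const_mult)

lemma const_mat_one: "const_mat (mat 1) = mat 1"
  by (auto simp: const_mat_def vec_eq_iff mat_def)

lemma const_mat_in: "I.mat_in (const_mat g)"
  by (simp add: I.mat_in_def const_mat_def vars_in_Const)

abbreviation conj_mat :: "complex^'n^'n \<Rightarrow> ('g, 'n::finite) cpoly^'n^'n \<Rightarrow> ('g, 'n) cpoly^'n^'n"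
  where "conj_mat g A \<equiv> const_mat (matrix_inv g) ** A ** const_mat g"

lemma conj_mat_mult:
  assumes "invertible (g :: complex^'n^'n)"
  shows "conj_mat g A ** conj_mat g B = conj_mat g ((A :: ('g, 'n::finite) cpoly^'n^'n) ** B)"
proof -
  have "const_mat g ** const_mat (matrix_inv g) = (mat 1 :: ('g, 'n) cpoly^'n^'n)"
    using matrix_inv_mult[OF assms] by (simp add: const_mat_mult[symmetric] const_mat_one)
  note c = this
  have "conj_mat g A ** conj_mat g B =
    const_mat (matrix_inv g) ** A ** (const_mat g ** const_mat (matrix_inv g)) ** (B ** const_mat g)"
    by (simp only: matrix_mul_assoc)
  also have "\<dots> = conj_mat g (A ** B)" unfolding c by (simp only: matrix_mul_rid matrix_mul_assoc)
  finally show ?thesis .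
qed

lemma conj_mat_one: "invertible g \<Longrightarrow> conj_mat g (mat 1) = mat 1"
  by (simp add: const_mat_mult[symmetric] matrix_inv_mult const_mat_one)

lemma conj_mat_in: "I.mat_in A \<Longrightarrow> I.mat_in (conj_mat g A)"
  by (intro I.mat_in_mult const_mat_in)

lemma conj_mat_cong:
  assumes "I.mat_eqv A B" "I.mat_in A" "I.mat_in B"
  shows "I.mat_eqv (conj_mat g A) (conj_mat g B)"
  by (intro I.mat_eqv_mult I.mat_eqv_refl assms const_mat_in I.mat_in_mult)

lemma det_conj_mat:
  assumes g: "invertible (g :: complex^'n^'n)"
  shows "det (conj_mat g (A :: ('g, 'n::finite) cpoly^'n^'n)) = det A"
proof -
  have "det (const_mat (matrix_inv g)) * det (const_mat g) = (1 :: ('g, 'n) cpoly)"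
    using matrix_inv_mult[OF g] by (simp add: det_mul[symmetric] const_mat_mult[symmetric] const_mat_one)
  moreover have "det (conj_mat g A) = (det (const_mat (matrix_inv g)) * det (const_mat g)) * det A"
    by (simp add: det_mul ac_simps)
  ultimately show ?thesis by simp
qed

lemma trace_conj_mat:
  assumes g: "invertible (g :: complex^'n^'n)"
  shows "trace (conj_mat g (A :: ('g, 'n::finite) cpoly^'n^'n)) = trace A"
proof -
  have "trace (conj_mat g A) = trace (const_mat g ** (const_mat (matrix_inv g) ** A))"
    by (rule trace_mul_sym)
  then show ?thesis
    using matrix_inv_mult[OF g] by (simp add: matrix_mul_assoc const_mat_mult[symmetric] const_mat_one)
qed

lemma conj_poly_simps [simp]:
  "conj_poly g (p + q) = conj_poly g p + conj_poly g q"
  "conj_poly g (p * q) = conj_poly g p * conj_poly g q"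
  "conj_poly g (p - q) = conj_poly g p - conj_poly g q"
  "conj_poly g (Const c) = Const c" "conj_poly g 0 = 0" "conj_poly g 1 = 1"
  "conj_poly g (Var (DetInv s)) = Var (DetInv s)"
  "conj_poly g (Var (Entry s i j)) = conj_mat g (gen_mat s) $ i $ j"
  by (simp_all add: conj_poly_def poly_subst_add poly_subst_mult poly_subst_diff)

lemma conj_poly_in:
  assumes "p \<in> Pol"
  shows "conj_poly g p \<in> Pol"
  using assms
proof (induction rule: vars_in_induct)
  case (Var x)
  then show ?case
    using conj_mat_in[OF gen_mat_in] by (cases x) (auto simp: I.mat_in_def intro!: vars_in_Var)
qed (auto intro: vars_in_Const vars_in_add vars_in_mult)

lemma map_conj_gen_mat: "map_matrix (conj_poly g) (gen_mat s) = conj_mat g (gen_mat s)"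
  by (simp add: vec_eq_iff gen_mat_def)

text \<open>Only a congruence: the left side is a left inverse of
  \<open>conj_mat g (gen_mat s)\<close> and the right side a right inverse, both modulo the
  relations.\<close>

lemma map_conj_gen_mat_inv:
  assumes s: "s \<in> S" and g: "invertible (g :: complex^'n^'n)"
  shows "I.mat_eqv (map_matrix (conj_poly g) (gen_mat_inv s :: ('g, 'n::finite) cpoly^'n^'n))
    (conj_mat g (gen_mat_inv s))"
proof -
  let ?X = "gen_mat s :: ('g, 'n) cpoly^'n^'n" and ?Y = "gen_mat_inv s :: ('g, 'n) cpoly^'n^'n"
    and ?d = "Var (DetInv s) :: ('g, 'n) cpoly"
  let ?Q = "map_matrix (conj_poly g) ?Y"
  have Q: "?Q $ i $ j = ?d * adjugate (conj_mat g ?X) $ i $ j" for i j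
  proof -
    have "map_matrix (conj_poly g) (adjugate ?X) = adjugate (conj_mat g ?X)"
      unfolding map_conj_gen_mat[symmetric] unfolding conj_poly_def by (rule map_matrix_subst_adjugate)
    then show ?thesis by (simp add: gen_mat_inv_def vec_eq_iff)
  qed
  have Qin: "I.mat_in ?Q"
    using gen_mat_inv_in[OF s] conj_poly_in by (auto simp: I.mat_in_def)
  have "(?Q ** conj_mat g ?X) $ i $ j = (?d * det ?X) * mat 1 $ i $ j" for i j
  proof -
    have "(?Q ** conj_mat g ?X) $ i $ j = ?d * (adjugate (conj_mat g ?X) ** conj_mat g ?X) $ i $ j"
      by (simp add: matrix_matrix_mult_def[of ?Q] matrix_matrix_mult_def[of "adjugate (conj_mat g ?X)"]
          Q sum_distrib_left mult.assoc del: nth_map_matrix)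
    also have "\<dots> = ?d * det ?X * mat 1 $ i $ j"
      by (simp add: adjugate_mult det_conj_mat[OF g]) (simp add: mat_def)
    finally show ?thesis .
  qed
  moreover have "I.eqv (?d * det ?X * mat 1 $ i $ j) (1 * mat 1 $ i $ j)" for i j :: 'n
    by (intro I.eqv_mult det_inverse s I.eqv_refl I.R_mult I.mat_in_det gen_mat_in vars_in_Var)
      (use s I.mat_in_one in \<open>auto simp: I.mat_in_def\<close>)
  ultimately have QX: "I.mat_eqv (?Q ** conj_mat g ?X) (mat 1)"
    by (simp add: I.mat_eqv_def)
  have XY: "I.mat_eqv (conj_mat g ?X ** conj_mat g ?Y) (mat 1)"
  proof -
    have "I.mat_eqv (conj_mat g (?X ** ?Y)) (conj_mat g (mat 1))"
      by (intro conj_mat_cong gen_mat_inverse s I.mat_in_mult gen_mat_in gen_mat_inv_in I.mat_in_one)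
    then show ?thesis by (simp only: conj_mat_mult[OF g] conj_mat_one[OF g])
  qed
  have a: "I.mat_eqv (?Q ** (conj_mat g ?X ** conj_mat g ?Y)) (?Q ** mat 1)"
    by (intro I.mat_eqv_mult I.mat_eqv_refl XY Qin I.mat_in_one)
  have "I.mat_eqv ((?Q ** conj_mat g ?X) ** conj_mat g ?Y) (mat 1 ** conj_mat g ?Y)"
    by (intro I.mat_eqv_mult I.mat_eqv_refl QX I.mat_in_mult Qin conj_mat_in gen_mat_in gen_mat_inv_in s
        const_mat_in)
  then have b': "I.mat_eqv (?Q ** (conj_mat g ?X ** conj_mat g ?Y)) (mat 1 ** conj_mat g ?Y)"
    by (simp only: matrix_mul_assoc)
  show ?thesis
    using I.mat_eqv_trans[OF I.mat_eqv_sym[OF a] b'] by (simp only: matrix_mul_rid matrix_mul_lid)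
qed

lemma map_conj_word_mat:
  assumes "word_over w" "invertible (g :: complex^'n^'n)"
  shows "I.mat_eqv (map_matrix (conj_poly g) (word_mat w :: ('g, 'n::finite) cpoly^'n^'n))
    (conj_mat g (word_mat w))"
  using assms(1)
proof (induction w)
  case Nil
  have "map_matrix (conj_poly g) (mat 1 :: ('g, 'n) cpoly^'n^'n) = mat 1"
    unfolding conj_poly_def by (rule map_matrix_subst_one)
  then show ?case by (simp add: conj_mat_one[OF assms(2)] del: matrix_mul_rid)
next
  case (Cons sb w)
  obtain s b where sb: "sb = (s, b)" by (cases sb)
  have s: "s \<in> S" and w: "word_over w" using Cons.prems by (auto simp: sb)
  let ?A = "if b then gen_mat_inv s else gen_mat s :: ('g, 'n) cpoly^'n^'n"
  have A_in: "I.mat_in ?A" by (cases b) (simp_all add: gen_mat_in[OF s] gen_mat_inv_in[OF s])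
  have "map_matrix (conj_poly g) (word_mat (sb # w)) =
    map_matrix (conj_poly g) ?A ** map_matrix (conj_poly g) (word_mat w)"
    unfolding sb word_mat_Cons conj_poly_def by (rule map_matrix_subst_mult)
  also have "I.mat_eqv \<dots> (conj_mat g ?A ** conj_mat g (word_mat w))"
  proof (rule I.mat_eqv_mult)
    show "I.mat_eqv (map_matrix (conj_poly g) ?A) (conj_mat g ?A)"
      using map_conj_gen_mat_inv[OF s assms(2)] map_conj_gen_mat[of g s] by simp
    show "I.mat_in (map_matrix (conj_poly g) ?A)"
      using A_in by (simp only: I.mat_in_def nth_map_matrix conj_poly_in simp_thms)
    show "I.mat_in (conj_mat g (word_mat w))" by (rule conj_mat_in[OF word_mat_in[OF w]])
  qed (rule Cons.IH[OF w])
  also have "conj_mat g ?A ** conj_mat g (word_mat w) = conj_mat g (word_mat (sb # w))"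
    by (simp add: conj_mat_mult[OF assms(2)] sb word_mat_Cons)
  finally show ?case .
qed

lemma conj_poly_rep_ideal:
  assumes g: "invertible (g :: complex^'n^'n)" and x: "x \<in> (rep_ideal \<Gamma> S :: ('g, 'n::finite) cpoly set)"
  shows "conj_poly g x \<in> rep_ideal \<Gamma> S"
proof -
  have "x \<in> {x \<in> Pol. conj_poly g x \<in> rep_ideal \<Gamma> S}"
  proof (rule rep_ideal_induct[OF x])
    show "relators \<subseteq> {x \<in> Pol. conj_poly g x \<in> (rep_ideal \<Gamma> S :: ('g, 'n) cpoly set)}"
    proof
      fix y :: "('g, 'n) cpoly" assume y: "y \<in> relators"
      then consider s where "s \<in> S" "y = Var (DetInv s) * det (gen_mat s :: ('g, 'n) cpoly^'n^'n) - 1"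
        | w i j where "word_over w" "word_val \<Gamma> w = \<one>"
          "y = (word_mat w :: ('g, 'n) cpoly^'n^'n) $ i $ j - mat 1 $ i $ j"
        unfolding relators_def by blast
      then have "conj_poly g y \<in> rep_ideal \<Gamma> S"
      proof cases
        case 1
        have "conj_poly g (det (gen_mat s :: ('g, 'n) cpoly^'n^'n)) = det (conj_mat g (gen_mat s))"
          unfolding map_conj_gen_mat[symmetric] unfolding conj_poly_def by (rule poly_subst_det)
        then show ?thesis
          using subsetD[OF relators_in y] by (simp add: 1 det_conj_mat[OF g])
      next
        case 2
        have "map_matrix (conj_poly g) (mat 1 :: ('g, 'n) cpoly^'n^'n) = mat 1"
          unfolding conj_poly_def by (rule map_matrix_subst_one)
        then have m: "conj_poly g ((mat 1 :: ('g, 'n) cpoly^'n^'n) $ i $ j) = mat 1 $ i $ j"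
          by (simp add: vec_eq_iff)
        have "I.mat_eqv (map_matrix (conj_poly g) (word_mat w :: ('g, 'n) cpoly^'n^'n)) (conj_mat g (word_mat w))"
          by (rule map_conj_word_mat[OF 2(1) g])
        also have "I.mat_eqv \<dots> (conj_mat g (mat 1))"
          by (intro conj_mat_cong word_mat_one 2 word_mat_in I.mat_in_one)
        also have "conj_mat g (mat 1) = mat 1" by (rule conj_mat_one[OF g])
        finally show ?thesis by (simp add: 2 m I.mat_eqv_def I.eqv_def)
      qed
      then show "y \<in> {x \<in> Pol. conj_poly g x \<in> rep_ideal \<Gamma> S}" using relators_sub y by blast
    qed
  qed (auto simp: vars_in_zero vars_in_add vars_in_mult I.I_zero conj_poly_in intro: I.I_add I.I_mult)
  then show ?thesis by simp
qed

lemma conj_poly_inverse: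
  assumes "invertible (g :: complex^'n^'n)"
  shows "conj_poly g (conj_poly (matrix_inv g) p) = (p :: ('g, 'n::finite) cpoly)"
proof (induction p rule: cpoly_induct)
  case (Var x)
  note gi = matrix_inv_mult[OF assms]
  have inv: "invertible (matrix_inv g)" unfolding invertible_def using gi by blast
  have mm: "matrix_inv (matrix_inv g) = g"
    using matrix_inv_mult[OF inv] gi by (metis matrix_mul_assoc matrix_mul_lid matrix_mul_rid)
  show ?case
  proof (cases x)
    case (Entry s i j)
    let ?X = "gen_mat s :: ('g, 'n) cpoly^'n^'n"
    have c: "map_matrix (conj_poly g) (const_mat h :: ('g, 'n) cpoly^'n^'n) = const_mat h" for h
      by (simp add: vec_eq_iff const_mat_def)
    have "map_matrix (conj_poly g) (conj_mat (matrix_inv g) ?X) = const_mat g ** conj_mat g ?X ** const_mat (matrix_inv g)"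
      using c unfolding mm conj_poly_def map_matrix_subst_mult
      by (simp add: map_conj_gen_mat[unfolded conj_poly_def])
    also have "\<dots> = const_mat (g ** matrix_inv g) ** ?X ** const_mat (g ** matrix_inv g)"
      by (simp only: const_mat_mult matrix_mul_assoc)
    also have "\<dots> = ?X" by (simp add: gi const_mat_one)
    finally have "conj_poly g (conj_mat (matrix_inv g) ?X $ i $ j) = ?X $ i $ j"
      by (metis nth_map_matrix)
    then show ?thesis by (simp add: Entry gen_mat_def)
  qed simp
qed simp_all

end

section \<open>Tensor powers\<close>

lemma sum_swap_pairs:
  "(\<Sum>a\<in>A. \<Sum>b\<in>B. \<Sum>c\<in>C. \<Sum>d\<in>D. g a b c d) = (\<Sum>c\<in>C. \<Sum>d\<in>D. \<Sum>a\<in>A. \<Sum>b\<in>B. g a b c d)"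
proof -
  have "(\<Sum>x\<in>A \<times> B. \<Sum>y\<in>C \<times> D. g (fst x) (snd x) (fst y) (snd y)) =
    (\<Sum>y\<in>C \<times> D. \<Sum>x\<in>A \<times> B. g (fst x) (snd x) (fst y) (snd y))"
    by (rule sum.swap)
  then show ?thesis by (simp add: sum.cartesian_product[symmetric] sum.cartesian_product' case_prod_unfold)
qed

lemma tensor_power_mult:
  fixes A B :: "complex^'n^'n"
  assumes "finite K"
  shows "(\<Sum>b\<in>Wd K. tensor_power K A a b * tensor_power K B b c) = tensor_power K (A ** B) a c"
proof -
  have "tensor_power K (A ** B) a c = (\<Prod>r\<in>K. \<Sum>l\<in>UNIV. A $ a r $ l * B $ l $ c r)"
    by (simp add: tensor_power_def matrix_matrix_mult_def)
  also have "\<dots> = (\<Sum>b\<in>Wd K. \<Prod>r\<in>K. A $ a r $ b r * B $ b r $ c r)"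
    using assms by (intro prod_sum_PiE) auto
  finally show ?thesis by (simp add: tensor_power_def prod.distrib)
qed

lemma tensor_power_one:
  assumes "finite K" "a \<in> Wd K" "b \<in> Wd K"
  shows "tensor_power K (mat 1 :: complex^'n^'n) a b = (if a = b then 1 else 0)"
proof (cases "a = b")
  case False
  then obtain r where "r \<in> K" "a r \<noteq> b r" using PiE_ext[OF assms(2,3)] by blast
  then show ?thesis using False assms(1) by (auto simp: tensor_power_def mat_def intro!: prod_zero)
qed (simp add: tensor_power_def mat_def)

definition adj_mat :: "complex^'n^'n \<Rightarrow> complex^'n^'n"
  where "adj_mat A = (\<chi> i j. cnj (A $ j $ i))"

lemma adj_mat_mult: "adj_mat (A ** B) = adj_mat B ** adj_mat A"
  by (simp add: adj_mat_def matrix_matrix_mult_def vec_eq_iff cnj_sum mult.commute)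

lemma adj_mat_one: "adj_mat (mat 1) = mat 1"
  by (auto simp: adj_mat_def mat_def vec_eq_iff)

lemma tensor_power_adj: "tensor_power K (adj_mat A) a b = cnj (tensor_power K A b a)"
  by (simp add: tensor_power_def adj_mat_def cnj_prod)

text \<open>
  The action of the pair \<open>(A, B)\<close>, where \<open>B\<close> stands for the inverse of \<open>A\<close>, on a family of
  tensors with slots \<open>K m\<close>.
\<close>

definition tensor_action :: "('m \<Rightarrow> 'k set) \<Rightarrow> complex^'n^'n \<Rightarrow> complex^'n^'n \<Rightarrow>
    ('m \<times> ('k \<Rightarrow> 'n::finite) \<times> ('k \<Rightarrow> 'n) \<Rightarrow> complex) \<Rightarrow> ('m \<times> ('k \<Rightarrow> 'n) \<times> ('k \<Rightarrow> 'n) \<Rightarrow> complex)"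
  where "tensor_action K A B w = (\<lambda>(m, i, j). \<Sum>i'\<in>Wd (K m). \<Sum>j'\<in>Wd (K m).
    w (m, i', j') * tensor_power (K m) B i' i * tensor_power (K m) A j j')"

lemma tensor_action_apply: "tensor_action K A B w (m, i, j) = (\<Sum>i'\<in>Wd (K m). \<Sum>j'\<in>Wd (K m).
    w (m, i', j') * tensor_power (K m) B i' i * tensor_power (K m) A j j')"
  by (simp add: tensor_action_def)

lemma tensor_action_add: "tensor_action K A B (\<lambda>x. u x + v x) = (\<lambda>x. tensor_action K A B u x + tensor_action K A B v x)"
  by (auto simp: tensor_action_def fun_eq_iff distrib_right sum.distrib)

lemma tensor_action_cmult: "tensor_action K A B (\<lambda>x. c * u x) = (\<lambda>x. c * tensor_action K A B u x)"
  by (auto simp: tensor_action_def fun_eq_iff sum_distrib_left mult.assoc)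

lemma tensor_action_diff: "tensor_action K A B (\<lambda>x. u x - v x) = (\<lambda>x. tensor_action K A B u x - tensor_action K A B v x)"
  by (auto simp: tensor_action_def fun_eq_iff left_diff_distrib sum_subtractf)

lemma tensor_action_mult:
  assumes fin: "\<And>m. finite (K m)"
  shows "tensor_action K A B (tensor_action K A' B' w) = tensor_action K (A ** A') (B' ** B) w"
proof (rule ext, clarify)
  fix m i j
  let ?T = "tensor_power (K m)" and ?W = "Wd (K m)"
  have "tensor_action K A B (tensor_action K A' B' w) (m, i, j) =
    (\<Sum>i'\<in>?W. \<Sum>j'\<in>?W. \<Sum>i''\<in>?W. \<Sum>j''\<in>?W.
      w (m, i'', j'') * (?T B' i'' i' * ?T B i' i) * (?T A j j' * ?T A' j' j''))"
    by (simp add: tensor_action_apply sum_distrib_left sum_distrib_right ac_simps)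
  also have "\<dots> = (\<Sum>i''\<in>?W. \<Sum>j''\<in>?W. \<Sum>i'\<in>?W. \<Sum>j'\<in>?W.
      w (m, i'', j'') * (?T B' i'' i' * ?T B i' i) * (?T A j j' * ?T A' j' j''))"
    by (rule sum_swap_pairs)
  also have "\<dots> = (\<Sum>i''\<in>?W. \<Sum>j''\<in>?W. w (m, i'', j'') *
      (\<Sum>i'\<in>?W. ?T B' i'' i' * ?T B i' i) * (\<Sum>j'\<in>?W. ?T A j j' * ?T A' j' j''))"
    by (simp add: sum_distrib_left sum_distrib_right ac_simps)
  also have "\<dots> = tensor_action K (A ** A') (B' ** B) w (m, i, j)"
    by (simp add: tensor_power_mult[OF fin] tensor_action_apply)
  finally show "tensor_action K A B (tensor_action K A' B' w) (m, i, j) =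
    tensor_action K (A ** A') (B' ** B) w (m, i, j)" .
qed

lemma tensor_action_adjoint:
  assumes fin: "finite M" "\<And>m. finite (K m)"
  defines "D \<equiv> (SIGMA m:M. Wd (K m) \<times> Wd (K m))"
  shows "(\<Sum>x\<in>D. tensor_action K A B w x * cnj (l x)) =
    (\<Sum>x\<in>D. w x * cnj (tensor_action K (adj_mat A) (adj_mat B) l x))"
proof -
  have D: "(\<Sum>x\<in>D. g x) = (\<Sum>m\<in>M. \<Sum>i\<in>Wd (K m). \<Sum>j\<in>Wd (K m). g (m, i, j))" for g :: "_ \<Rightarrow> complex"
  proof -
    have "(\<Sum>x\<in>D. g x) = (\<Sum>m\<in>M. \<Sum>p\<in>Wd (K m) \<times> Wd (K m). g (m, p))"
      unfolding D_def using fin by (subst sum.Sigma) auto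
    then show ?thesis by (simp add: sum.cartesian_product)
  qed
  show ?thesis unfolding D
  proof (rule sum.cong[OF refl])
    fix m
    let ?T = "tensor_power (K m)" and ?W = "Wd (K m)"
    have "(\<Sum>i\<in>?W. \<Sum>j\<in>?W. tensor_action K A B w (m, i, j) * cnj (l (m, i, j))) =
      (\<Sum>i\<in>?W. \<Sum>j\<in>?W. \<Sum>i'\<in>?W. \<Sum>j'\<in>?W. w (m, i', j') * (cnj (l (m, i, j)) * ?T B i' i * ?T A j j'))"
      by (simp add: tensor_action_apply sum_distrib_left sum_distrib_right ac_simps)
    also have "\<dots> = (\<Sum>i'\<in>?W. \<Sum>j'\<in>?W. \<Sum>i\<in>?W. \<Sum>j\<in>?W.
        w (m, i', j') * (cnj (l (m, i, j)) * ?T B i' i * ?T A j j'))"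
      by (rule sum_swap_pairs)
    also have "\<dots> = (\<Sum>i'\<in>?W. \<Sum>j'\<in>?W. w (m, i', j') *
        cnj (tensor_action K (adj_mat A) (adj_mat B) l (m, i', j')))"
      by (simp add: tensor_action_apply tensor_power_adj cnj_sum sum_distrib_left)
    finally show "(\<Sum>i\<in>?W. \<Sum>j\<in>?W. tensor_action K A B w (m, i, j) * cnj (l (m, i, j))) =
      (\<Sum>i\<in>?W. \<Sum>j\<in>?W. w (m, i, j) * cnj (tensor_action K (adj_mat A) (adj_mat B) l (m, i, j)))" .
  qed
qed

text \<open>Carrying the inverse along makes products and adjoints of group elements visibly group
  elements.\<close>

definition inverse_pair :: "complex^'n^'n \<Rightarrow> complex^'n^'n \<Rightarrow> bool"
  where "inverse_pair A B \<longleftrightarrow> A ** B = mat 1 \<and> B ** A = mat 1"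

lemma inverse_pair_mult: "inverse_pair A B \<Longrightarrow> inverse_pair A' B' \<Longrightarrow> inverse_pair (A ** A') (B' ** B)"
  unfolding inverse_pair_def by (metis matrix_mul_assoc matrix_mul_lid)

lemma inverse_pair_adj: "inverse_pair A B \<Longrightarrow> inverse_pair (adj_mat A) (adj_mat B)"
  unfolding inverse_pair_def by (metis adj_mat_mult adj_mat_one)

lemma inverse_pair_matrix_inv:
  assumes "inverse_pair A B"
  shows "invertible A" "matrix_inv A = B"
proof -
  show inv: "invertible A" using assms by (auto simp: invertible_def inverse_pair_def)
  show "matrix_inv A = B"
    using matrix_inv_mult[OF inv] assms unfolding inverse_pair_def
    by (metis matrix_mul_assoc matrix_mul_lid matrix_mul_rid)
qed

inductive_set orbit_span :: "('m \<Rightarrow> 'k set) \<Rightarrow> ('m \<times> ('k \<Rightarrow> 'n::finite) \<times> ('k \<Rightarrow> 'n) \<Rightarrow> complex) \<Rightarrow>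
    ('m \<times> ('k \<Rightarrow> 'n) \<times> ('k \<Rightarrow> 'n) \<Rightarrow> complex) set" for K w where
  orbit_span_zero: "(\<lambda>x. 0) \<in> orbit_span K w"
| orbit_span_diff: "inverse_pair A B \<Longrightarrow> (\<lambda>x. tensor_action K A B w x - w x) \<in> orbit_span K w"
| orbit_span_add: "u \<in> orbit_span K w \<Longrightarrow> v \<in> orbit_span K w \<Longrightarrow> (\<lambda>x. u x + v x) \<in> orbit_span K w"
| orbit_span_cmult: "u \<in> orbit_span K w \<Longrightarrow> (\<lambda>x. c * u x) \<in> orbit_span K w"

lemma orbit_span_minus:
  assumes "u \<in> orbit_span K w" "v \<in> orbit_span K w"
  shows "(\<lambda>x. u x - v x) \<in> orbit_span K w"
  using orbit_span_add[OF assms(1) orbit_span_cmult[OF assms(2), of "-1"]] by simp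

text \<open>For group elements \<open>g\<close> and \<open>h\<close> one has
  \<open>g (h w - w) = (g h w - w) - (g w - w)\<close>.\<close>

lemma tensor_action_orbit_span:
  assumes fin: "\<And>m. finite (K m)" and AB: "inverse_pair A B" and u: "u \<in> orbit_span K w"
  shows "tensor_action K A B u \<in> orbit_span K w"
  using u
proof induction
  case orbit_span_zero
  have "tensor_action K A B (\<lambda>x. 0) = (\<lambda>x. 0)" by (auto simp: tensor_action_def)
  then show ?case by (simp add: orbit_span.orbit_span_zero)
next
  case (orbit_span_diff A' B')
  have "tensor_action K A B (\<lambda>x. tensor_action K A' B' w x - w x) =
    (\<lambda>x. (tensor_action K (A ** A') (B' ** B) w x - w x) - (tensor_action K A B w x - w x))"
    by (simp add: tensor_action_diff tensor_action_mult[OF fin])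
  then show ?case
    using orbit_span_minus[OF orbit_span.orbit_span_diff[OF inverse_pair_mult[OF AB orbit_span_diff]]
        orbit_span.orbit_span_diff[OF AB]] by simp
qed (simp_all add: tensor_action_add tensor_action_cmult orbit_span_add orbit_span_cmult)

text \<open>
  Reductivity: the orthogonal projection of \<open>w\<close> onto the complement of the span of the differences
  in its orbit is fixed by the group, because the group is closed under adjoints.
\<close>

lemma ex_fixed_tensor:
  fixes w :: "'m \<times> ('k \<Rightarrow> 'n::finite) \<times> ('k \<Rightarrow> 'n) \<Rightarrow> complex"
  assumes fin: "finite M" "\<And>m. finite (K m)"
  defines "D \<equiv> (SIGMA m:M. Wd (K m) \<times> Wd (K m))"
  shows "\<exists>u \<in> orbit_span K w. \<forall>A B. inverse_pair A B \<longrightarrow>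
    (\<forall>x\<in>D. tensor_action K A B (\<lambda>x. w x - u x) x = w x - u x)"
proof -
  have finD: "finite D" unfolding D_def using fin by auto
  obtain u where u: "u \<in> orbit_span K w"
    and orth: "\<And>l. l \<in> orbit_span K w \<Longrightarrow> (\<Sum>x\<in>D. (w x - u x) * cnj (l x)) = 0"
    using orthogonal_projection[OF finD, of "orbit_span K w" w]
    by (auto intro: orbit_span_zero orbit_span_add orbit_span_cmult)
  have "tensor_action K A B (\<lambda>x. w x - u x) x = w x - u x" if AB: "inverse_pair A B" and x: "x \<in> D" for A B x
  proof -
    let ?v = "\<lambda>x. w x - u x"
    \<comment> \<open>The failure of the residue to be fixed. It lies in the orbit span, and moving
      the action to the other argument by \<open>tensor_action_adjoint\<close> keeps that argument
      in the span; so \<open>d\<close> is orthogonal to itself.\<close>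
    define d where "d x = tensor_action K A B ?v x - ?v x" for x
    have "(\<lambda>x. (tensor_action K A B w x - w x) - (tensor_action K A B u x - u x)) \<in> orbit_span K w"
      by (intro orbit_span_minus orbit_span_diff AB tensor_action_orbit_span[OF fin(2)] u)
    moreover have "d = (\<lambda>x. (tensor_action K A B w x - w x) - (tensor_action K A B u x - u x))"
      by (simp add: d_def tensor_action_diff fun_eq_iff)
    ultimately have d: "d \<in> orbit_span K w" by simp
    have "(\<Sum>x\<in>D. d x * cnj (d x)) =
      (\<Sum>x\<in>D. tensor_action K A B ?v x * cnj (d x)) - (\<Sum>x\<in>D. ?v x * cnj (d x))"
      by (simp add: sum_subtractf[symmetric] left_diff_distrib[symmetric] d_def[of x for x])
    also have "(\<Sum>x\<in>D. tensor_action K A B ?v x * cnj (d x)) =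
      (\<Sum>x\<in>D. ?v x * cnj (tensor_action K (adj_mat A) (adj_mat B) d x))"
      unfolding D_def by (rule tensor_action_adjoint[OF fin])
    also have "\<dots> = 0"
      by (rule orth[OF tensor_action_orbit_span[OF fin(2) inverse_pair_adj[OF AB] d]])
    also have "(\<Sum>x\<in>D. ?v x * cnj (d x)) = 0" by (rule orth[OF d])
    finally have "d x = 0" using sum_norm_square_zero[OF finD _ x] by simp
    then show ?thesis by (simp add: d_def)
  qed
  then show ?thesis using u by blast
qed

text \<open>Multiplication by the tensor power of \<open>B\<close> turns invariance under
  conjugation into commutation with that tensor power, the hypothesis of
  \<open>commutes_symmetrizedI\<close>.\<close>

lemma fixed_tensor_slot_span:
  fixes Z :: "('k \<Rightarrow> 'n::finite) \<Rightarrow> ('k \<Rightarrow> 'n) \<Rightarrow> complex"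
  assumes fin: "finite K"
    and fixd: "\<And>A B i j. inverse_pair A B \<Longrightarrow> i \<in> Wd K \<Longrightarrow> j \<in> Wd K \<Longrightarrow>
      (\<Sum>i'\<in>Wd K. \<Sum>j'\<in>Wd K. Z i' j' * tensor_power K B i' i * tensor_power K A j j') = Z i j"
  shows "Z \<in> slot_span K"
proof (rule first_fundamental_theorem_tensors[OF fin], rule commutes_symmetrizedI[OF fin])
  fix B :: "complex^'n^'n" and i j :: "'k \<Rightarrow> 'n"
  assume B: "invertible B" and W: "i \<in> Wd K" "j \<in> Wd K"
  let ?T = "tensor_power K"
  obtain A where A: "inverse_pair A B" using B by (auto simp: invertible_def inverse_pair_def)
  have "(\<Sum>a\<in>Wd K. ?T B j a * Z i a) =
    (\<Sum>a\<in>Wd K. ?T B j a * (\<Sum>i'\<in>Wd K. \<Sum>j'\<in>Wd K. Z i' j' * ?T B i' i * ?T A a j'))"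
    by (rule sum.cong[OF refl]) (simp add: fixd[OF A W(1)])
  also have "\<dots> = (\<Sum>a\<in>Wd K. \<Sum>i'\<in>Wd K. \<Sum>j'\<in>Wd K. Z i' j' * ?T B i' i * (?T B j a * ?T A a j'))"
    by (simp add: sum_distrib_left ac_simps)
  also have "\<dots> = (\<Sum>i'\<in>Wd K. \<Sum>j'\<in>Wd K. \<Sum>a\<in>Wd K. Z i' j' * ?T B i' i * (?T B j a * ?T A a j'))"
    by (subst sum.swap, subst (2) sum.swap) (rule refl)
  also have "\<dots> = (\<Sum>i'\<in>Wd K. \<Sum>j'\<in>Wd K. Z i' j' * ?T B i' i * ?T (B ** A) j j')"
    by (simp add: sum_distrib_left[symmetric] tensor_power_mult[OF fin])
  also have "\<dots> = (\<Sum>i'\<in>Wd K. \<Sum>j'\<in>Wd K. if j' = j then Z i' j' * ?T B i' i else 0)"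
    using A by (intro sum.cong refl) (auto simp: inverse_pair_def tensor_power_one[OF fin W(2)])
  also have "\<dots> = (\<Sum>i'\<in>Wd K. Z i' j * ?T B i' i)"
    using fin W(2) by (simp add: sum.delta)
  finally show "(\<Sum>a\<in>Wd K. ?T B j a * Z i a) = (\<Sum>a\<in>Wd K. Z a j * ?T B a i)" .
qed

section \<open>Trace polynomials\<close>

text \<open>The algebra generated by the traces of words. Products are built one trace at a time, so
  that an induction meets a single new trace, which can be rewritten as a centred trace plus a
  constant; general products are recovered in \<open>trace_polys_mult\<close>.\<close>

inductive_set trace_polys :: "'g set \<Rightarrow> 'n::finite itself \<Rightarrow> ('g, 'n) cpoly set" for S and t :: "'n itself" where
  trace_polys_Const: "Const c \<in> trace_polys S t"
| trace_polys_add: "p \<in> trace_polys S t \<Longrightarrow> q \<in> trace_polys S t \<Longrightarrow> p + q \<in> trace_polys S t"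
| trace_polys_trace: "p \<in> trace_polys S t \<Longrightarrow> set w \<subseteq> S \<times> UNIV \<Longrightarrow>
    p * trace (word_mat w :: ('g, 'n) cpoly^'n^'n) \<in> trace_polys S t"

lemma trace_polys_mult:
  assumes "p \<in> trace_polys S t" "q \<in> trace_polys S t"
  shows "p * q \<in> trace_polys S t"
  using assms(2)
proof induction
  case (trace_polys_Const c)
  show ?case using assms(1)
  proof induction
    case (trace_polys_Const d)
    then show ?case unfolding Const_mult[symmetric] by (rule trace_polys.trace_polys_Const)
  next
    case (trace_polys_add p q)
    then show ?case unfolding distrib_right by (intro trace_polys.trace_polys_add)
  next
    case (trace_polys_trace p w)
    then show ?case
      using trace_polys.trace_polys_trace[of "p * Const c" S t w] by (simp add: ac_simps)
  qed
next
  case (trace_polys_add q q')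
  then show ?case unfolding distrib_left by (intro trace_polys.trace_polys_add)
next
  case (trace_polys_trace q w)
  then show ?case unfolding mult.assoc[symmetric] by (intro trace_polys.trace_polys_trace)
qed

lemma trace_polys_sum: "(\<And>x. x \<in> A \<Longrightarrow> g x \<in> trace_polys S t) \<Longrightarrow> sum g A \<in> trace_polys S t"
  by (induction A rule: infinite_finite_induct)
    (simp_all add: trace_polys_add trace_polys_Const[of 0, simplified])

lemma trace_polys_word:
  "set w \<subseteq> S \<times> UNIV \<Longrightarrow> trace (word_mat w :: ('g, 'n::finite) cpoly^'n^'n) \<in> trace_polys S TYPE('n)"
  using trace_polys_trace[OF trace_polys_Const[of 1]] by simp

lemma perm_trace_trace_polys:
  assumes "finite K" "\<sigma> permutes K" "\<And>r. r \<in> K \<Longrightarrow> set (w r) \<subseteq> S \<times> UNIV"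
  shows "perm_trace K (\<lambda>r. word_mat (w r) :: ('g, 'n::finite) cpoly^'n^'n) \<sigma> \<in> trace_polys S TYPE('n)"
  using assms
proof (induction "card K" arbitrary: K \<sigma> w rule: less_induct)
  case less
  show ?case
  proof (cases "K = {}")
    case True
    then show ?thesis using trace_polys_Const[of 1 S "TYPE('n)"] by simp
  next
    case False
    then obtain p where p: "p \<in> K" by blast
    define q where "q = \<sigma> p"
    have q: "q \<in> K" using p less.prems(2) by (simp add: q_def permutes_in_image)
    have card: "card (K - {q}) < card K" using less.prems(1) q by (rule card_Diff1_less)
    show ?thesis
    proof (cases "p = q")
      case True
      then have fixd: "\<sigma> q = q" by (simp add: q_def)
      have \<sigma>: "\<sigma> permutes (K - {q})"
        by (rule permutes_superset[OF less.prems(2)]) (use fixd in auto)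
      have "perm_trace (K - {q}) (\<lambda>r. word_mat (w r) :: ('g, 'n) cpoly^'n^'n) \<sigma> \<in> trace_polys S TYPE('n)"
        by (rule less.hyps[OF card _ \<sigma>]) (use less.prems in auto)
      then show ?thesis
        unfolding perm_trace_fixed[OF less.prems(1) q fixd less.prems(2)]
        by (rule trace_polys_mult[OF trace_polys_word[OF less.prems(3)[OF q]]])
    next
      case False
      have "perm_trace K (\<lambda>r. word_mat (w r) :: ('g, 'n) cpoly^'n^'n) \<sigma> =
        perm_trace (K - {q}) ((\<lambda>r. word_mat (w r))(p := word_mat (w p) ** word_mat (w q)))
          (\<sigma> \<circ> Transposition.transpose p q)"
        by (rule perm_trace_contract[OF less.prems(1) p q_def[symmetric] False less.prems(2)])
      also have "(\<lambda>r. word_mat (w r))(p := word_mat (w p) ** word_mat (w q)) =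
        (\<lambda>r. word_mat ((w(p := w p @ w q)) r) :: ('g, 'n) cpoly^'n^'n)"
        by (auto simp: fun_eq_iff word_mat_append)
      also have "perm_trace (K - {q}) \<dots> (\<sigma> \<circ> Transposition.transpose p q) \<in> trace_polys S TYPE('n)"
        by (rule less.hyps[OF card _ permutes_contract[OF less.prems(2) q_def[symmetric] p]])
          (use less.prems p q in auto)
      finally show ?thesis .
    qed
  qed
qed

text \<open>\<open>sum_sign_perm_trace\<close> solved for the determinant by inverting a
  factorial.\<close>

lemma det_trace_polys:
  assumes "set w \<subseteq> S \<times> UNIV"
  shows "det (word_mat w :: ('g, 'n::finite) cpoly^'n^'n) \<in> trace_polys S TYPE('n)"
proof -
  let ?M = "word_mat w :: ('g, 'n) cpoly^'n^'n"
  have "of_int (sign \<sigma>) = (Const (of_int (sign \<sigma>)) :: ('g, 'n) cpoly)" for \<sigma> :: "'n \<Rightarrow> 'n"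
    by (simp add: Const_def)
  then have "(\<Sum>\<sigma> | \<sigma> permutes (UNIV :: 'n set). of_int (sign \<sigma>) * perm_trace UNIV (\<lambda>_. ?M) \<sigma>) \<in> trace_polys S TYPE('n)"
    by (auto intro!: trace_polys_sum trace_polys_mult trace_polys_Const perm_trace_trace_polys assms)
  then have "Const (1 / of_nat (fact CARD('n))) * (of_nat (fact CARD('n)) * det ?M) \<in> trace_polys S TYPE('n)"
    unfolding sum_sign_perm_trace by (rule trace_polys_mult[OF trace_polys_Const])
  also have "Const (1 / of_nat (fact CARD('n))) * (of_nat (fact CARD('n)) * det ?M) = det ?M"
    unfolding mult.assoc[symmetric] Const_of_nat[symmetric] Const_mult[symmetric]
    by (simp add: fact_nonzero)
  finally show ?thesis .
qed

section \<open>Invariants are trace polynomials\<close>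

lemma trace_polys_vars_in:
  assumes "p \<in> trace_polys S TYPE('n::finite)"
  shows "p \<in> vars_in (gen_vars S)"
  using assms
proof induction
  case (trace_polys_trace p w)
  then show ?case
    using subring_ideal.mat_in_trace[OF Pol_subring word_mat_in] by (intro vars_in_mult) auto
qed (auto intro: vars_in_Const vars_in_add)

lemma monomial_entry_monomial_nth:
  "monomial (entry_monomial L) =
    (\<Prod>r<length L. Var (Entry (fst (L ! r)) (fst (snd (L ! r))) (snd (snd (L ! r)))))"
  unfolding monomial_entry_monomial
  by (subst prod.list_conv_set_nth) (auto simp: atLeast0LessThan case_prod_unfold)

context representation_scheme
begin

definition trace_like :: "('g, 'n::finite) cpoly set"
  where "trace_like = {p \<in> Pol. \<exists>q\<in>trace_polys S TYPE('n). I.eqv p q}"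

lemma trace_likeI: "q \<in> trace_polys S TYPE('n::finite) \<Longrightarrow> q \<in> trace_like"
  unfolding trace_like_def using trace_polys_vars_in I.eqv_refl by blast

lemma trace_like_add: "p \<in> trace_like \<Longrightarrow> q \<in> trace_like \<Longrightarrow> p + q \<in> trace_like"
  unfolding trace_like_def using vars_in_add trace_polys_add I.eqv_add by blast

lemma trace_like_mult:
  fixes p q :: "('g, 'n::finite) cpoly"
  assumes "p \<in> trace_like" "q \<in> trace_like"
  shows "p * q \<in> trace_like"
proof -
  obtain p' q' where "p' \<in> trace_polys S TYPE('n)" "I.eqv p p'" "q' \<in> trace_polys S TYPE('n)" "I.eqv q q'"
    and pq: "p \<in> Pol" "q \<in> Pol"
    using assms unfolding trace_like_def by blast
  then have "I.eqv (p * q) (p' * q')" "p' * q' \<in> trace_polys S TYPE('n)"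
    using trace_polys_vars_in by (auto intro: I.eqv_mult trace_polys_mult)
  then show ?thesis unfolding trace_like_def using vars_in_mult[OF pq] by blast
qed

lemma trace_like_Const: "Const c \<in> trace_like"
  by (rule trace_likeI[OF trace_polys_Const])

lemma trace_like_sum: "(\<And>x. x \<in> A \<Longrightarrow> g x \<in> trace_like) \<Longrightarrow> sum g A \<in> trace_like"
  by (induction A rule: infinite_finite_induct)
    (simp_all add: trace_like_add trace_like_Const[of 0, simplified])

lemma trace_like_DetInv:
  assumes "s \<in> S"
  shows "(Var (DetInv s) :: ('g, 'n::finite) cpoly) \<in> trace_like"
proof -
  have "det (word_mat [(s, True)] :: ('g, 'n) cpoly^'n^'n) \<in> trace_polys S TYPE('n)"
    by (rule det_trace_polys) (use assms in auto)
  then have "det (gen_mat_inv s :: ('g, 'n) cpoly^'n^'n) \<in> trace_polys S TYPE('n)"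
    by (simp add: word_mat_Cons)
  then show ?thesis
    using DetInv_eqv_det[OF assms] assms by (auto simp: trace_like_def intro!: vars_in_Var)
qed

text \<open>\<open>e\<close> collects the inverse determinants, which conjugation fixes literally
  and which are trace polynomials modulo the relations. What remains is a monomial in matrix
  entries, to which tensors apply.\<close>

definition split_monomial :: "('g, 'n::finite) cpoly \<Rightarrow> ('g, 'n) cpoly \<Rightarrow> ('g \<times> 'n \<times> 'n) list \<Rightarrow> bool"
  where "split_monomial q e L \<longleftrightarrow> e \<in> trace_like \<and> (\<forall>g. conj_poly g e = e) \<and>
    set L \<subseteq> S \<times> UNIV \<and> q = e * monomial (entry_monomial L)"

lemma split_monomial_exists:
  fixes m :: "('g, 'n::finite) coord \<Rightarrow>\<^sub>0 nat"
  assumes "Poly_Mapping.keys m \<subseteq> gen_vars S"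
  shows "\<exists>e L. split_monomial (monomial m) e L"
proof -
  have one: "\<exists>e L. split_monomial (1 :: ('g, 'n) cpoly) e L"
    by (intro exI[of _ 1] exI[of _ "[]"])
      (use trace_like_Const[of 1] in \<open>simp add: split_monomial_def entry_monomial_def\<close>)
  have mult: "\<exists>e L. split_monomial (p * q) e L"
    if pq: "\<exists>e L. split_monomial p e L" "\<exists>e L. split_monomial q e L" for p q :: "('g, 'n) cpoly"
  proof -
    obtain e L e' L' where "split_monomial p e L" "split_monomial q e' L'" using pq by blast
    then have "split_monomial (p * q) (e * e') (L @ L')"
      by (auto simp: split_monomial_def trace_like_mult entry_monomial_append monomial_add ac_simps)
    then show ?thesis by blast
  qed
  have var: "\<exists>e L. split_monomial (Var x) e L" if x: "x \<in> gen_vars S" for x :: "('g, 'n) coord"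
  proof (cases x)
    case (Entry s i j)
    then have "split_monomial (Var x) 1 [(s, i, j)]"
      using x trace_like_Const[of 1] by (simp add: split_monomial_def monomial_entry_monomial)
    then show ?thesis by blast
  next
    case (DetInv s)
    then have "split_monomial (Var x) (Var x) []"
      using x trace_like_DetInv by (simp add: split_monomial_def entry_monomial_def)
    then show ?thesis by blast
  qed
  have power: "\<exists>e L. split_monomial (q ^ k) e L" if "\<exists>e L. split_monomial q e L"
    for q :: "('g, 'n) cpoly" and k
    using that by (induction k) (auto intro: one mult)
  have "\<exists>e L. split_monomial (\<Prod>x\<in>B. Var x ^ Poly_Mapping.lookup m x) e L" if "B \<subseteq> Poly_Mapping.keys m" for B
    using that
  proof (induction B rule: infinite_finite_induct)
    case (insert x B)
    have "\<exists>e L. split_monomial (Var x ^ Poly_Mapping.lookup m x) e L"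
      by (rule power[OF var]) (use insert.prems assms in auto)
    with insert show ?case by (simp add: mult)
  qed (simp_all add: one)
  then show ?thesis unfolding monomial_eq_prod_Var by blast
qed

text \<open>\<open>p\<close> is the image of a family \<open>w\<close> of tensors, one for each
  monomial, under an equivariant linear map \<open>\<mu>\<close>. As \<open>p\<close> is invariant
  modulo the ideal, \<open>\<mu>\<close> sends the orbit differences of \<open>w\<close> into the
  ideal. Hence \<open>w\<close> may be replaced by its residue modulo their span, which is invariant
  on the nose by \<open>ex_fixed_tensor\<close> and so lies in the span of the slot permutations. No
  invariant polynomial lifting \<open>p\<close> has to be known beforehand.\<close>

theorem first_fundamental_theorem:
  fixes p :: "('g, 'n::finite) cpoly"
  assumes p: "p \<in> Pol" and inv: "\<And>g :: complex^'n^'n. invertible g \<Longrightarrow> I.eqv (conj_poly g p) p"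
  shows "\<exists>q\<in>trace_polys S TYPE('n). I.eqv p q"
proof -
  let ?M = "Poly_Mapping.keys p"
  have "\<forall>m\<in>?M. \<exists>e L. split_monomial (monomial m) e L"
    using p by (intro ballI split_monomial_exists) (auto simp: vars_in_def)
  then obtain e L where eL: "\<And>m. m \<in> ?M \<Longrightarrow> split_monomial (monomial m) (e m) (L m)"
    by (meson bchoice)
  define K where "K m = {..<length (L m)}" for m
  define st where "st m r = fst (L m ! r)" for m r
  define mon :: "_ \<Rightarrow> _ \<Rightarrow> _ \<Rightarrow> ('g, 'n) cpoly"
    where "mon m i j = (\<Prod>r\<in>K m. Var (Entry (st m r) (i r) (j r)))" for m i j
  define \<mu> where "\<mu> w = (\<Sum>m\<in>?M. \<Sum>i\<in>Wd (K m). \<Sum>j\<in>Wd (K m). Const (w (m, i, j)) * (e m * mon m i j))"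
    for w :: "_ \<times> (nat \<Rightarrow> 'n) \<times> (nat \<Rightarrow> 'n) \<Rightarrow> complex"
  define a b where "a m = (\<lambda>r\<in>K m. fst (snd (L m ! r)))" and "b m = (\<lambda>r\<in>K m. snd (snd (L m ! r)))" for m
  define w where "w = (\<lambda>(m, i, j). if i = a m \<and> j = b m then Poly_Mapping.lookup p m else 0)"
  have finK: "finite (K m)" for m by (simp add: K_def)
  have stS: "st m r \<in> S" if "m \<in> ?M" "r \<in> K m" for m r
  proof -
    have "L m ! r \<in> S \<times> UNIV" using eL[OF that(1)] that(2) by (auto simp: split_monomial_def K_def)
    then show ?thesis by (auto simp: st_def mem_Times_iff)
  qed
  have mu_w: "\<mu> w = p"
  proof -
    have "(\<Sum>i\<in>Wd (K m). \<Sum>j\<in>Wd (K m). Const (w (m, i, j)) * (e m * mon m i j)) =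
      Const (Poly_Mapping.lookup p m) * monomial m" if m: "m \<in> ?M" for m
    proof -
      have ab: "a m \<in> Wd (K m)" "b m \<in> Wd (K m)" by (auto simp: a_def b_def)
      have "(\<Sum>i\<in>Wd (K m). \<Sum>j\<in>Wd (K m). Const (w (m, i, j)) * (e m * mon m i j)) =
        (\<Sum>i\<in>Wd (K m). if i = a m then \<Sum>j\<in>Wd (K m). if j = b m then
          Const (Poly_Mapping.lookup p m) * (e m * mon m i j) else 0 else 0)"
        by (intro sum.cong refl) (auto simp: w_def intro!: sum.cong sum.neutral)
      also have "\<dots> = Const (Poly_Mapping.lookup p m) * (e m * mon m (a m) (b m))"
        using finK ab by (simp add: sum.delta)
      also have "mon m (a m) (b m) = monomial (entry_monomial (L m))"
        unfolding mon_def monomial_entry_monomial_nth by (auto simp: K_def a_def b_def st_def intro!: prod.cong)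
      also have "e m * monomial (entry_monomial (L m)) = monomial m"
        using eL[OF m] by (simp add: split_monomial_def)
      finally show ?thesis .
    qed
    then show ?thesis unfolding \<mu>_def by (subst (3) cpoly_eq_sum_monomials) simp
  qed
  have mu_add: "\<mu> (\<lambda>x. u x + v x) = \<mu> u + \<mu> v" for u v
    by (simp add: \<mu>_def Const_add distrib_right sum.distrib)
  have mu_cmult: "\<mu> (\<lambda>x. c * u x) = Const c * \<mu> u" for c u
    by (simp add: \<mu>_def Const_mult sum_distrib_left mult.assoc)
  have mu_diff: "\<mu> (\<lambda>x. u x - v x) = \<mu> u - \<mu> v" for u v
    using mu_add[of u "\<lambda>x. (-1) * v x"] mu_cmult[of "-1" v] by (simp add: Const_uminus)
  have conj_mon: "conj_poly g (mon m i j) = (\<Sum>i'\<in>Wd (K m). \<Sum>j'\<in>Wd (K m).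
      Const (tensor_power (K m) (matrix_inv g) i i' * tensor_power (K m) g j' j) * mon m i' j')" for g m i j
  proof -
    have "conj_poly g (mon m i j) = (\<Prod>r\<in>K m. conj_mat g (gen_mat (st m r)) $ i r $ j r)"
      unfolding mon_def conj_poly_def poly_subst_prod by simp
    also have "\<dots> = (\<Prod>r\<in>K m. \<Sum>k\<in>UNIV. \<Sum>l\<in>UNIV.
        Const (matrix_inv g $ i r $ k) * Const (g $ l $ j r) * Var (Entry (st m r) k l))"
      by (rule prod.cong[OF refl], subst sum.swap)
        (simp add: matrix_matrix_mult_def const_mat_def gen_mat_def sum_distrib_left sum_distrib_right ac_simps)
    also have "\<dots> = (\<Sum>i'\<in>Wd (K m). \<Prod>r\<in>K m. \<Sum>l\<in>UNIV.
        Const (matrix_inv g $ i r $ i' r) * Const (g $ l $ j r) * Var (Entry (st m r) (i' r) l))"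
      using finK by (intro prod_sum_PiE) auto
    also have "\<dots> = (\<Sum>i'\<in>Wd (K m). \<Sum>j'\<in>Wd (K m). \<Prod>r\<in>K m.
        Const (matrix_inv g $ i r $ i' r) * Const (g $ j' r $ j r) * Var (Entry (st m r) (i' r) (j' r)))"
      using finK by (intro sum.cong refl prod_sum_PiE) auto
    finally show ?thesis
      by (simp add: prod.distrib tensor_power_def mon_def Const_mult Const_prod)
  qed
  have conj_mu: "conj_poly g (\<mu> u) = \<mu> (tensor_action K g (matrix_inv g) u)" for g u
  proof -
    have "conj_poly g (\<mu> u) = (\<Sum>m\<in>?M. \<Sum>i\<in>Wd (K m). \<Sum>j\<in>Wd (K m).
        Const (u (m, i, j)) * (conj_poly g (e m) * conj_poly g (mon m i j)))"
      by (simp add: \<mu>_def conj_poly_def poly_subst_sum poly_subst_mult)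
    also have "\<dots> = (\<Sum>m\<in>?M. \<Sum>i\<in>Wd (K m). \<Sum>j\<in>Wd (K m). \<Sum>i'\<in>Wd (K m). \<Sum>j'\<in>Wd (K m).
        Const (u (m, i, j) * tensor_power (K m) (matrix_inv g) i i' * tensor_power (K m) g j' j) *
        (e m * mon m i' j'))"
      by (rule sum.cong[OF refl])
        (use eL in \<open>simp add: split_monomial_def conj_mon sum_distrib_left Const_mult ac_simps\<close>)
    also have "\<dots> = (\<Sum>m\<in>?M. \<Sum>i'\<in>Wd (K m). \<Sum>j'\<in>Wd (K m). \<Sum>i\<in>Wd (K m). \<Sum>j\<in>Wd (K m).
        Const (u (m, i, j) * tensor_power (K m) (matrix_inv g) i i' * tensor_power (K m) g j' j) *
        (e m * mon m i' j'))"
      by (rule sum.cong[OF refl], rule sum_swap_pairs)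
    also have "\<dots> = \<mu> (tensor_action K g (matrix_inv g) u)"
      by (simp add: \<mu>_def tensor_action_apply Const_sum sum_distrib_right)
    finally show ?thesis .
  qed
  have span_ideal: "\<mu> u \<in> rep_ideal \<Gamma> S" if "u \<in> orbit_span K w" for u
    using that
  proof induction
    case orbit_span_zero
    then show ?case by (simp add: \<mu>_def I.I_zero)
  next
    case (orbit_span_diff A B)
    note AB = inverse_pair_matrix_inv[OF orbit_span_diff]
    have "\<mu> (\<lambda>x. tensor_action K A B w x - w x) = conj_poly A p - p"
      using conj_mu[of A w] by (simp add: mu_diff AB(2) mu_w)
    then show ?case using inv[OF AB(1)] by (simp add: I.eqv_def)
  qed (simp_all add: mu_add mu_cmult I.I_add I.I_mult vars_in_Const)
  obtain u where u: "u \<in> orbit_span K w" and fixd: "\<And>A B x. inverse_pair A B \<Longrightarrow>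
      x \<in> (SIGMA m:?M. Wd (K m) \<times> Wd (K m)) \<Longrightarrow>
      tensor_action K A B (\<lambda>x. w x - u x) x = w x - u x"
    using ex_fixed_tensor[of ?M K w] finK by auto
  define v where "v x = w x - u x" for x
  have "\<mu> v = p - \<mu> u" using mu_diff[of w u] by (simp add: v_def[abs_def] mu_w)
  then have "I.eqv p (\<mu> v)"
    using span_ideal[OF u] by (simp add: I.eqv_def)
  moreover have "\<mu> v \<in> trace_like"
    unfolding \<mu>_def
  proof (rule trace_like_sum)
    fix m assume m: "m \<in> ?M"
    have "(\<lambda>i j. v (m, i, j)) \<in> slot_span (K m)"
    proof (rule fixed_tensor_slot_span[OF finK])
      fix A B :: "complex^'n^'n" and i j :: "nat \<Rightarrow> 'n"
      assume "inverse_pair A B" "i \<in> Wd (K m)" "j \<in> Wd (K m)"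
      then show "(\<Sum>i'\<in>Wd (K m). \<Sum>j'\<in>Wd (K m).
          v (m, i', j') * tensor_power (K m) B i' i * tensor_power (K m) A j j') = v (m, i, j)"
        using fixd[of A B "(m, i, j)"] m by (simp add: tensor_action_apply v_def)
    qed
    then obtain x where x: "\<forall>i\<in>Wd (K m). \<forall>j\<in>Wd (K m).
        v (m, i, j) = (\<Sum>\<rho> | \<rho> permutes K m. if i \<circ> \<rho> = j then x \<rho> else 0)"
      unfolding slot_span_def by blast
    have "(\<Sum>i\<in>Wd (K m). \<Sum>j\<in>Wd (K m). Const (v (m, i, j)) * (e m * mon m i j)) =
      (\<Sum>i\<in>Wd (K m). \<Sum>\<rho> | \<rho> permutes K m. Const (x \<rho>) * (e m * mon m i (i \<circ> \<rho>)))"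
    proof (rule sum.cong[OF refl])
      fix i :: "nat \<Rightarrow> 'n" assume i: "i \<in> Wd (K m)"
      have "(\<Sum>j\<in>Wd (K m). Const (v (m, i, j)) * (e m * mon m i j)) =
        (\<Sum>j\<in>Wd (K m). \<Sum>\<rho> | \<rho> permutes K m. if j = i \<circ> \<rho> then Const (x \<rho>) * (e m * mon m i j) else 0)"
        by (rule sum.cong[OF refl]) (auto simp: x i Const_sum sum_distrib_right intro!: sum.cong)
      also have "\<dots> = (\<Sum>\<rho> | \<rho> permutes K m. \<Sum>j\<in>Wd (K m).
          if j = i \<circ> \<rho> then Const (x \<rho>) * (e m * mon m i j) else 0)"
        by (rule sum.swap)
      also have "\<dots> = (\<Sum>\<rho> | \<rho> permutes K m. Const (x \<rho>) * (e m * mon m i (i \<circ> \<rho>)))"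
      proof (rule sum.cong[OF refl])
        fix \<rho> assume "\<rho> \<in> {\<rho>. \<rho> permutes K m}"
        then have "i \<circ> \<rho> \<in> Wd (K m)" using Wd_comp[OF i] by simp
        then show "(\<Sum>j\<in>Wd (K m). if j = i \<circ> \<rho> then Const (x \<rho>) * (e m * mon m i j) else 0) =
          Const (x \<rho>) * (e m * mon m i (i \<circ> \<rho>))"
          using finK by (simp add: sum.delta)
      qed
      finally show "(\<Sum>j\<in>Wd (K m). Const (v (m, i, j)) * (e m * mon m i j)) =
        (\<Sum>\<rho> | \<rho> permutes K m. Const (x \<rho>) * (e m * mon m i (i \<circ> \<rho>)))" .
    qed
    \<comment> \<open>For a single slot permutation, the sum over all words is the trace along it of
      the generic matrices of the generators.\<close>
    also have "\<dots> = (\<Sum>\<rho> | \<rho> permutes K m. Const (x \<rho>) *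
        (e m * perm_trace (K m) (\<lambda>r. word_mat [(st m r, False)] :: ('g, 'n) cpoly^'n^'n) \<rho>))"
      by (subst sum.swap)
        (simp add: perm_trace_def mon_def sum_distrib_left word_mat_Cons gen_mat_def)
    also have "\<dots> \<in> trace_like"
    proof -
      have em: "e m \<in> trace_like" using eL[OF m] by (simp add: split_monomial_def)
      have "perm_trace (K m) (\<lambda>r. word_mat [(st m r, False)] :: ('g, 'n) cpoly^'n^'n) \<rho> \<in> trace_like"
        if "\<rho> permutes K m" for \<rho>
        by (rule trace_likeI, rule perm_trace_trace_polys[OF finK that]) (use stS[OF m] in auto)
      then show ?thesis by (intro trace_like_sum trace_like_mult trace_like_Const em) auto
    qed
    finally show "(\<Sum>i\<in>Wd (K m). \<Sum>j\<in>Wd (K m). Const (v (m, i, j)) * (e m * mon m i j)) \<in> trace_like" .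
  qed
  ultimately show ?thesis
    unfolding trace_like_def using I.eqv_trans by blast
qed

end

section \<open>The invariant ring, the maximal ideal and values of tangent vectors\<close>

section \<open>The ring of invariants\<close>

locale invariant_setting = representation_scheme \<Gamma> S
  for \<Gamma> :: "('g, 'z) monoid_scheme" (structure) and S :: "'g set" +
  fixes type_n :: "'n::finite itself"
begin

abbreviation PI :: "('g, 'n) cpoly set" where "PI \<equiv> rep_ideal \<Gamma> S"
abbreviation A :: "('g, 'n) cpoly set ring" where "A \<equiv> rep_algebra \<Gamma> S"
abbreviation B :: "('g, 'n) cpoly set ring" where "B \<equiv> invariant_ring \<Gamma> S"
abbreviation cl :: "('g, 'n) cpoly \<Rightarrow> ('g, 'n) cpoly set" where "cl \<equiv> rep_class \<Gamma> S"

lemma cl_conv: "cl p = {q. I.eqv q p}"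
proof -
  have "cl p = (\<lambda>h. h + p) ` PI" by (auto simp: rep_class_def a_r_coset_def')
  also have "\<dots> = {q. I.eqv q p}"
    by (auto simp: I.eqv_def image_iff) (metis diff_add_cancel)
  finally show ?thesis .
qed

lemma cl_eq_iff: "cl p = cl q \<longleftrightarrow> I.eqv p q"
proof
  assume "cl p = cl q"
  then show "I.eqv p q" unfolding cl_conv using I.eqv_refl by blast
next
  assume "I.eqv p q"
  then show "cl p = cl q" unfolding cl_conv using I.eqv_trans I.eqv_sym by blast
qed

lemma carrier_A: "carrier A = cl ` Pol"
  by (auto simp: rep_algebra_def FactRing_def A_RCOSETS_def' rep_class_def)

lemma A_mult: "p \<in> Pol \<Longrightarrow> q \<in> Pol \<Longrightarrow> cl p \<otimes>\<^bsub>A\<^esub> cl q = cl (p * q)"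
  using ideal.rcoset_mult_add[OF ideal_rep_ideal, of p q] by (simp add: rep_algebra_def FactRing_def rep_class_def)

lemma A_add: "p \<in> Pol \<Longrightarrow> q \<in> Pol \<Longrightarrow> cl p \<oplus>\<^bsub>A\<^esub> cl q = cl (p + q)"
  using abelian_subgroup.a_rcos_sum[OF abelian_subgroupI3[OF ideal.axioms(1)[OF ideal_rep_ideal]
      ring.is_abelian_group[OF cring.axioms(1)[OF cring_poly_ring]]], of p q]
  by (simp add: rep_algebra_def FactRing_def rep_class_def)

lemma A_zero: "\<zero>\<^bsub>A\<^esub> = cl 0"
  by (auto simp: rep_algebra_def FactRing_def rep_class_def a_r_coset_def')

lemma A_one: "\<one>\<^bsub>A\<^esub> = cl 1"
  by (simp add: rep_algebra_def FactRing_def rep_class_def)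

lemma conj_poly_eqv: "invertible (g :: complex^'n^'n) \<Longrightarrow> I.eqv p q \<Longrightarrow>
    I.eqv (conj_poly g p) (conj_poly g (q :: ('g, 'n) cpoly))"
  using conj_poly_rep_ideal[of g "p - q"] by (simp add: I.eqv_def)

lemma conj_poly_cl:
  assumes g: "invertible (g :: complex^'n^'n)"
  shows "conj_poly g ` cl p = cl (conj_poly g p)"
proof
  show "conj_poly g ` cl p \<subseteq> cl (conj_poly g p)"
    using conj_poly_eqv[OF g] by (auto simp: cl_conv)
  show "cl (conj_poly g p) \<subseteq> conj_poly g ` cl p"
  proof
    fix r assume r: "r \<in> cl (conj_poly g p)"
    let ?h = "matrix_inv g"
    have h: "invertible ?h" "matrix_inv ?h = g"
      using inverse_pair_matrix_inv[of ?h g] matrix_inv_mult[OF g] by (auto simp: inverse_pair_def)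
    have "I.eqv (conj_poly ?h r) (conj_poly ?h (conj_poly g p))"
      using r conj_poly_eqv[OF h(1)] by (auto simp: cl_conv)
    moreover have "conj_poly ?h (conj_poly g p) = p"
      using conj_poly_inverse[OF h(1)] by (simp add: h(2))
    ultimately have "conj_poly ?h r \<in> cl p" by (simp add: cl_conv)
    then show "r \<in> conj_poly g ` cl p"
      by (intro image_eqI[of _ _ "conj_poly ?h r"]) (simp_all add: conj_poly_inverse[OF g])
  qed
qed

text \<open>Invariance is only modulo the relations, so members need not be invariant polynomials;
  they are exactly the polynomials whose classes form the invariant ring
  (\<open>carrier_B\<close>).\<close>

definition Inv :: "('g, 'n) cpoly set"
  where "Inv = {p \<in> Pol. \<forall>g :: complex^'n^'n. invertible g \<longrightarrow> I.eqv (conj_poly g p) p}"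

lemma Inv_Pol: "p \<in> Inv \<Longrightarrow> p \<in> Pol"
  by (simp add: Inv_def)

lemma Inv_Const: "Const c \<in> Inv"
  by (simp add: Inv_def vars_in_Const)

lemma Inv_0: "0 \<in> Inv" and Inv_1: "1 \<in> Inv"
  using Inv_Const[of 0] Inv_Const[of 1] by simp_all

lemma Inv_add: "p \<in> Inv \<Longrightarrow> q \<in> Inv \<Longrightarrow> p + q \<in> Inv"
  by (auto simp: Inv_def vars_in_add intro: I.eqv_add)

lemma Inv_mult: "p \<in> Inv \<Longrightarrow> q \<in> Inv \<Longrightarrow> p * q \<in> Inv"
  by (auto simp: Inv_def vars_in_mult conj_poly_in intro!: I.eqv_mult)

lemma Inv_diff: "p \<in> Inv \<Longrightarrow> q \<in> Inv \<Longrightarrow> p - q \<in> Inv"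
  using Inv_add[OF _ Inv_mult[OF Inv_Const[of "-1"]], of p q] by (simp add: Const_uminus)

lemma Inv_trace:
  assumes "word_over w"
  shows "trace (word_mat w :: ('g, 'n) cpoly^'n^'n) \<in> Inv"
proof -
  let ?W = "word_mat w :: ('g, 'n) cpoly^'n^'n"
  have "I.eqv (conj_poly g (trace ?W)) (trace ?W)" if g: "invertible g" for g :: "complex^'n^'n"
  proof -
    have "conj_poly g (trace ?W) = trace (map_matrix (conj_poly g) ?W)"
      unfolding conj_poly_def by (rule poly_subst_trace)
    also have "I.eqv \<dots> (trace (conj_mat g ?W))"
      by (rule I.mat_eqv_trace[OF map_conj_word_mat[OF assms g]])
    finally show ?thesis by (simp add: trace_conj_mat[OF g])
  qed
  then show ?thesis using I.mat_in_trace[OF word_mat_in[OF assms]] by (simp add: Inv_def)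
qed

lemma carrier_B: "carrier B = cl ` Inv"
proof -
  have "a \<in> carrier B \<longleftrightarrow> (\<exists>p\<in>Pol. a = cl p \<and> (\<forall>g :: complex^'n^'n. invertible g \<longrightarrow> conj_poly g ` cl p = cl p))" for a
    by (auto simp: invariant_ring_def carrier_A)
  then show ?thesis by (auto simp: Inv_def conj_poly_cl cl_eq_iff)
qed

lemma B_ops:
  "x \<otimes>\<^bsub>B\<^esub> y = x \<otimes>\<^bsub>A\<^esub> y" "x \<oplus>\<^bsub>B\<^esub> y = x \<oplus>\<^bsub>A\<^esub> y" "\<zero>\<^bsub>B\<^esub> = cl 0" "\<one>\<^bsub>B\<^esub> = cl 1"
  by (simp_all add: invariant_ring_def A_zero A_one)

lemma B_mult: "p \<in> Inv \<Longrightarrow> q \<in> Inv \<Longrightarrow> cl p \<otimes>\<^bsub>B\<^esub> cl q = cl (p * q)"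
  by (simp add: B_ops A_mult Inv_Pol)

lemma B_add: "p \<in> Inv \<Longrightarrow> q \<in> Inv \<Longrightarrow> cl p \<oplus>\<^bsub>B\<^esub> cl q = cl (p + q)"
  by (simp add: B_ops A_add Inv_Pol)

lemma cl_in_B: "p \<in> Inv \<Longrightarrow> cl p \<in> carrier B"
  by (simp add: carrier_B)

lemma B_cases:
  assumes "a \<in> carrier B"
  obtains p where "p \<in> Inv" "a = cl p"
  using assms by (auto simp: carrier_B)

lemma cring_B: "cring B"
proof (rule cringI)
  show "abelian_group B"
  proof (rule abelian_groupI)
    fix x assume "x \<in> carrier B"
    then obtain p where p: "p \<in> Inv" "x = cl p" by (rule B_cases)
    have "cl (0 - p) \<oplus>\<^bsub>B\<^esub> x = \<zero>\<^bsub>B\<^esub>"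
      unfolding p(2) B_add[OF Inv_diff[OF Inv_0 p(1)] p(1)] by (simp add: B_ops)
    then show "\<exists>y\<in>carrier B. y \<oplus>\<^bsub>B\<^esub> x = \<zero>\<^bsub>B\<^esub>"
      using cl_in_B[OF Inv_diff[OF Inv_0 p(1)]] by blast
  qed (auto elim!: B_cases simp: B_add Inv_add Inv_0 cl_in_B B_ops(3) ac_simps)
  show "Group.comm_monoid B"
    by (rule comm_monoidI)
      (auto elim!: B_cases simp: B_mult Inv_mult Inv_1 cl_in_B B_ops(4) ac_simps)
qed (auto elim!: B_cases simp: B_mult B_add Inv_mult Inv_add distrib_right)

sublocale B: cring B by (rule cring_B)

lemma B_diff:
  assumes "p \<in> Inv" "q \<in> Inv"
  shows "cl p \<ominus>\<^bsub>B\<^esub> cl q = cl (p - q)"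
proof -
  have m: "0 - q \<in> Inv" by (rule Inv_diff[OF Inv_0 assms(2)])
  have "\<ominus>\<^bsub>B\<^esub> cl q = cl (0 - q)"
    by (rule B.minus_equality) (use B_add[OF m assms(2)] m assms cl_in_B B_ops in auto)
  then show ?thesis using B_add[OF assms(1) m] by (simp add: a_minus_def)
qed

definition wtr :: "('g \<times> bool) list \<Rightarrow> ('g, 'n) cpoly"
  where "wtr w = trace (word_mat w :: ('g, 'n) cpoly^'n^'n) - Const (of_nat CARD('n))"

lemma wtr_Inv: "word_over w \<Longrightarrow> wtr w \<in> Inv"
  unfolding wtr_def by (intro Inv_diff Inv_trace Inv_Const)

abbreviation ct :: "'g \<Rightarrow> ('g, 'n) cpoly set" where "ct \<equiv> centred_trace \<Gamma> S"

lemma ct_word: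
  assumes "word_over w"
  shows "ct (word_val \<Gamma> w) = cl (wtr w)"
proof -
  let ?v = "word_of (word_val \<Gamma> w)"
  have v: "word_over ?v" "word_val \<Gamma> ?v = word_val \<Gamma> w"
    using word_of word_val_closed[OF word_over_carrier[OF assms]] by auto
  have "ct (word_val \<Gamma> w) = cl (wtr ?v)"
    unfolding centred_trace_def trace_fun_def word_of_def[symmetric] wtr_def
    by (rule B_diff[OF Inv_trace[OF v(1)] Inv_Const])
  also have "\<dots> = cl (wtr w)"
    unfolding cl_eq_iff wtr_def
    by (intro I.eqv_diff I.eqv_refl I.mat_eqv_trace word_mat_cong v assms)
  finally show ?thesis .
qed

lemma ct_cases:
  assumes "\<gamma> \<in> carrier \<Gamma>"
  obtains w where "word_over w" "\<gamma> = word_val \<Gamma> w" "ct \<gamma> = cl (wtr w)"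
  using word_exists[OF assms] ct_word by metis

lemma ct_in_B: "\<gamma> \<in> carrier \<Gamma> \<Longrightarrow> ct \<gamma> \<in> carrier B"
  by (metis ct_cases wtr_Inv cl_in_B)

abbreviation mm :: "('g, 'n) cpoly set set" where "mm \<equiv> trivial_ideal \<Gamma> S"
abbreviation mm2 :: "('g, 'n) cpoly set set" where "mm2 \<equiv> trivial_ideal_sq \<Gamma> S"
abbreviation sq :: "('g, 'n) cpoly set \<Rightarrow> ('g, 'n) cpoly set set" where "sq \<equiv> square_class \<Gamma> S"

lemma ct_sub: "{ct \<gamma> |\<gamma>. \<gamma> \<in> carrier \<Gamma>} \<subseteq> carrier B"
  using ct_in_B by auto

lemma ideal_mm: "ideal mm B"
  unfolding trivial_ideal_def by (rule B.genideal_ideal[OF ct_sub])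

lemma ideal_mm2: "ideal mm2 B"
  unfolding trivial_ideal_sq_def by (rule B.ideal_prod_is_ideal[OF ideal_mm ideal_mm])

lemma ct_mm: "\<gamma> \<in> carrier \<Gamma> \<Longrightarrow> ct \<gamma> \<in> mm"
  unfolding trivial_ideal_def using B.genideal_self[OF ct_sub] by blast

lemma mm_minimal:
  assumes "ideal J B" "\<And>\<gamma>. \<gamma> \<in> carrier \<Gamma> \<Longrightarrow> ct \<gamma> \<in> J"
  shows "mm \<subseteq> J"
  unfolding trivial_ideal_def by (rule B.genideal_minimal[OF assms(1)]) (use assms(2) in auto)

lemma mm_sub: "a \<in> mm \<Longrightarrow> a \<in> carrier B"
  by (rule ideal.Icarr[OF ideal_mm])

lemma mm_mult: "a \<in> carrier B \<Longrightarrow> b \<in> mm \<Longrightarrow> a \<otimes>\<^bsub>B\<^esub> b \<in> mm"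
  by (rule ideal.I_l_closed[OF ideal_mm])

lemma mm_add: "a \<in> mm \<Longrightarrow> b \<in> mm \<Longrightarrow> a \<oplus>\<^bsub>B\<^esub> b \<in> mm"
  by (rule additive_subgroup.a_closed[OF ideal.axioms(1)[OF ideal_mm]])

lemma mm_zero: "\<zero>\<^bsub>B\<^esub> \<in> mm"
  by (rule additive_subgroup.zero_closed[OF ideal.axioms(1)[OF ideal_mm]])

lemma mm2_prod: "a \<in> mm \<Longrightarrow> b \<in> mm \<Longrightarrow> a \<otimes>\<^bsub>B\<^esub> b \<in> mm2"
  unfolding trivial_ideal_sq_def by (rule ideal_prod.prod)

lemma sq_add:
  "a \<in> carrier B \<Longrightarrow> b \<in> carrier B \<Longrightarrow> sq a \<oplus>\<^bsub>square_quotient \<Gamma> S\<^esub> sq b = sq (a \<oplus>\<^bsub>B\<^esub> b)"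
  using ring_hom_add[OF ideal.rcos_ring_hom[OF ideal_mm2], of a b]
  by (simp add: square_class_def square_quotient_def)

lemma sq_mult:
  "a \<in> carrier B \<Longrightarrow> b \<in> carrier B \<Longrightarrow> sq a \<otimes>\<^bsub>square_quotient \<Gamma> S\<^esub> sq b = sq (a \<otimes>\<^bsub>B\<^esub> b)"
  using ring_hom_mult[OF ideal.rcos_ring_hom[OF ideal_mm2], of a b]
  by (simp add: square_class_def square_quotient_def)

lemma sq_eq_iff:
  "a \<in> carrier B \<Longrightarrow> b \<in> carrier B \<Longrightarrow> sq a = sq b \<longleftrightarrow> a \<ominus>\<^bsub>B\<^esub> b \<in> mm2"
  using B.quotient_eq_iff_same_a_r_cos[OF ideal_mm2, of a b] by (simp add: square_class_def)

lemma sq_mm2: "a \<in> mm2 \<Longrightarrow> sq a = sq \<zero>\<^bsub>B\<^esub>"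
  using sq_eq_iff[of a "\<zero>\<^bsub>B\<^esub>"] ideal.Icarr[OF ideal_mm2] by (simp add: a_minus_def)

lemma cotangent_scale_sq:
  "a \<in> carrier B \<Longrightarrow> cotangent_scale \<Gamma> S c (sq a) = sq (cl (Const c) \<otimes>\<^bsub>B\<^esub> a)"
  unfolding cotangent_scale_def by (rule sq_mult[OF cl_in_B[OF Inv_Const]])

lemma trace_polys_Inv:
  assumes "q \<in> trace_polys S TYPE('n)"
  shows "q \<in> Inv"
  using assms by induction (auto intro: Inv_Const Inv_add Inv_mult Inv_trace)

lemma B_trace_poly:
  assumes "a \<in> carrier B"
  obtains q where "q \<in> trace_polys S TYPE('n)" "a = cl q"
proof -
  obtain p where p: "p \<in> Inv" "a = cl p" using assms by (rule B_cases)
  then obtain q where "q \<in> trace_polys S TYPE('n)" "I.eqv p q"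
    using first_fundamental_theorem[of p] by (auto simp: Inv_def)
  then show thesis using that p(2) cl_eq_iff by blast
qed

section \<open>Tangent vectors\<close>

abbreviation Tan :: "(('g, 'n) cpoly set set \<Rightarrow> complex) set" where "Tan \<equiv> tangent_space \<Gamma> S"

context
  fixes v assumes v: "v \<in> Tan"
begin

definition val :: "('g, 'n) cpoly set \<Rightarrow> complex"
  where "val a = v (sq a)"

lemma cotangent: "a \<in> mm \<Longrightarrow> sq a \<in> cotangent_space \<Gamma> S"
  by (simp add: cotangent_space_def)

lemma val_add:
  assumes "a \<in> mm" "b \<in> mm"
  shows "val (a \<oplus>\<^bsub>B\<^esub> b) = val a + val b"
proof -
  have "v (sq a \<oplus>\<^bsub>square_quotient \<Gamma> S\<^esub> sq b) = v (sq a) + v (sq b)"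
    using v cotangent[OF assms(1)] cotangent[OF assms(2)] by (simp add: tangent_space_def)
  then show ?thesis
    unfolding val_def by (simp only: sq_add[OF mm_sub[OF assms(1)] mm_sub[OF assms(2)]])
qed

lemma val_scale:
  assumes "a \<in> mm"
  shows "val (cl (Const c) \<otimes>\<^bsub>B\<^esub> a) = c * val a"
proof -
  have "v (cotangent_scale \<Gamma> S c (sq a)) = c * v (sq a)"
    using v cotangent[OF assms] by (simp add: tangent_space_def)
  then show ?thesis unfolding val_def by (simp only: cotangent_scale_sq[OF mm_sub[OF assms]])
qed

lemma val_zero: "val \<zero>\<^bsub>B\<^esub> = 0"
  using val_add[OF mm_zero mm_zero] by simp

lemma val_prod: "a \<in> mm \<Longrightarrow> b \<in> mm \<Longrightarrow> val (a \<otimes>\<^bsub>B\<^esub> b) = 0"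
  using sq_mm2[OF mm2_prod, of a b] val_zero by (simp add: val_def)

text \<open>
  By the first fundamental theorem, multiplication by an invariant acts on \<open>m / m\<^sup>2\<close> as a scalar.
\<close>

lemma val_trace_poly:
  assumes "q \<in> trace_polys S TYPE('n)"
  shows "\<exists>c. \<forall>a\<in>mm. val (cl q \<otimes>\<^bsub>B\<^esub> a) = c * val a"
  using assms
proof induction
  case (trace_polys_Const c)
  then show ?case using val_scale by blast
next
  case (trace_polys_add p q)
  then obtain c d where cd: "\<forall>a\<in>mm. val (cl p \<otimes>\<^bsub>B\<^esub> a) = c * val a" "\<forall>a\<in>mm. val (cl q \<otimes>\<^bsub>B\<^esub> a) = d * val a"
    by blast
  have "val (cl (p + q) \<otimes>\<^bsub>B\<^esub> a) = (c + d) * val a" if a: "a \<in> mm" for a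
  proof -
    have pq: "cl p \<in> carrier B" "cl q \<in> carrier B" "cl (p + q) = cl p \<oplus>\<^bsub>B\<^esub> cl q"
      using trace_polys_add.hyps trace_polys_Inv by (auto simp: B_add cl_in_B)
    then have "cl (p + q) \<otimes>\<^bsub>B\<^esub> a = cl p \<otimes>\<^bsub>B\<^esub> a \<oplus>\<^bsub>B\<^esub> cl q \<otimes>\<^bsub>B\<^esub> a"
      using mm_sub[OF a] by (simp add: B.l_distr)
    then show ?thesis using cd a pq by (simp add: val_add mm_mult distrib_right)
  qed
  then show ?case by blast
next
  case (trace_polys_trace p w)
  let ?n = "of_nat CARD('n) :: complex"
  obtain c where c: "\<forall>a\<in>mm. val (cl p \<otimes>\<^bsub>B\<^esub> a) = c * val a" using trace_polys_trace.IH by blast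
  have p: "p \<in> Inv" "cl p \<in> carrier B" using trace_polys_Inv trace_polys_trace.hyps cl_in_B by auto
  have w: "wtr w \<in> Inv" "cl (wtr w) \<in> mm"
    using wtr_Inv[OF trace_polys_trace.hyps(2)] ct_word[OF trace_polys_trace.hyps(2)]
      ct_mm[OF word_val_closed[OF word_over_carrier[OF trace_polys_trace.hyps(2)]]] by auto
  have "val (cl (p * trace (word_mat w :: ('g, 'n) cpoly^'n^'n)) \<otimes>\<^bsub>B\<^esub> a) = (?n * c) * val a" if a: "a \<in> mm" for a
  proof -
    have pa: "cl p \<otimes>\<^bsub>B\<^esub> a \<in> mm" using mm_mult p a by blast
    \<comment> \<open>The trace of a word is its centred trace plus \<open>n\<close>. The first part
      multiplies \<open>m\<close> into \<open>m\<^sup>2\<close> and contributes nothing; the second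
      scales by \<open>n\<close>.\<close>
    have "cl (p * trace (word_mat w :: ('g, 'n) cpoly^'n^'n)) = cl p \<otimes>\<^bsub>B\<^esub> (cl (wtr w) \<oplus>\<^bsub>B\<^esub> cl (Const ?n))"
      using p(1) w(1) by (simp add: B_add B_mult Inv_Const Inv_add) (simp add: wtr_def)
    then have "cl (p * trace (word_mat w :: ('g, 'n) cpoly^'n^'n)) \<otimes>\<^bsub>B\<^esub> a =
      cl (wtr w) \<otimes>\<^bsub>B\<^esub> (cl p \<otimes>\<^bsub>B\<^esub> a) \<oplus>\<^bsub>B\<^esub> cl (Const ?n) \<otimes>\<^bsub>B\<^esub> (cl p \<otimes>\<^bsub>B\<^esub> a)"
      using p(2) mm_sub[OF w(2)] mm_sub[OF a] cl_in_B[OF Inv_Const[of ?n]]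
      by (simp add: B.l_distr B.r_distr B.m_ac)
    moreover have "cl (wtr w) \<otimes>\<^bsub>B\<^esub> (cl p \<otimes>\<^bsub>B\<^esub> a) \<in> mm" "cl (Const ?n) \<otimes>\<^bsub>B\<^esub> (cl p \<otimes>\<^bsub>B\<^esub> a) \<in> mm"
      using mm_mult mm_sub w(2) pa cl_in_B[OF Inv_Const[of ?n]] by blast+
    ultimately show ?thesis
      using c a by (simp add: val_add val_prod[OF w(2) pa] val_scale[OF pa] mult.assoc)
  qed
  then show ?case by blast
qed

end

text \<open>The elements of \<open>m\<close> at which the difference vanishes form an ideal, because
  invariants act on its values by scalars (\<open>val_trace_poly\<close>). This ideal contains the
  generators of \<open>m\<close>.\<close>

lemma tangent_eqI:
  assumes v: "v \<in> Tan" and u: "u \<in> Tan"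
    and eq: "\<And>\<gamma>. \<gamma> \<in> carrier \<Gamma> \<Longrightarrow> v (sq (ct \<gamma>)) = u (sq (ct \<gamma>))"
  shows "v = u"
proof -
  define d where "d x = v x - u x" for x
  have d: "d \<in> Tan" using v u by (auto simp: d_def tangent_space_def algebra_simps)
  let ?J = "{a \<in> mm. val d a = 0}"
  have "ideal ?J B"
  proof (rule B.idealI_closed)
    show "?J \<subseteq> carrier B" using mm_sub by auto
    show "\<zero>\<^bsub>B\<^esub> \<in> ?J" using mm_zero val_zero[OF d] by simp
    show "a \<oplus>\<^bsub>B\<^esub> b \<in> ?J" if "a \<in> ?J" "b \<in> ?J" for a b
      using that by (simp add: mm_add val_add[OF d])
    show "x \<otimes>\<^bsub>B\<^esub> a \<in> ?J" if x: "x \<in> carrier B" and a: "a \<in> ?J" for a x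
    proof -
      obtain q where q: "q \<in> trace_polys S TYPE('n)" "x = cl q" using x by (rule B_trace_poly)
      obtain c where "\<forall>a\<in>mm. val d (cl q \<otimes>\<^bsub>B\<^esub> a) = c * val d a" using val_trace_poly[OF d q(1)] by blast
      then show ?thesis using a mm_mult[OF x] q(2) by simp
    qed
  qed
  then have "mm \<subseteq> ?J"
    by (rule mm_minimal) (use eq ct_mm in \<open>simp add: val_def[OF d] d_def\<close>)
  then have "d x = 0" if "x \<in> cotangent_space \<Gamma> S" for x
    using that by (auto simp: cotangent_space_def val_def[OF d])
  moreover have "d x = 0" if "x \<notin> cotangent_space \<Gamma> S" for x
    using d that by (simp add: tangent_space_def)
  ultimately have "d x = 0" for x by blast
  then show ?thesis by (auto simp: d_def fun_eq_iff)
qed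

end

section \<open>From a central solution to a tangent vector\<close>

context invariant_setting
begin

text \<open>The functional \<open>lam\<close>, substitution followed by \<open>Psi\<close>, kills
  the ideal of relations and so descends to classes. On classes of invariants it is controlled by
  products of centred traces: it gives \<open>f\<close> on single ones and zero on longer products,
  so it vanishes on \<open>m\<^sup>2\<close>.\<close>

lemma tangent_of_solution:
  assumes f: "f \<in> central_solutions \<Gamma> CARD('n)"
  shows "\<exists>v\<in>Tan. \<forall>\<gamma>\<in>carrier \<Gamma>. v (sq (ct \<gamma>)) = f \<gamma>"
proof -
  interpret F: central_solution \<Gamma> f "CARD('n)" by unfold_locales (rule f)
  note n = refl[of "CARD('n)"]
  define lam :: "('g, 'n) cpoly \<Rightarrow> complex" where "lam p = F.Psi (F.lift p)" for p
  have lam_add: "lam (p + q) = lam p + lam q" for p q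
    by (simp add: lam_def poly_subst_add F.Psi_add)
  have lam_scale: "lam (Const c * p) = c * lam p" for c p
    by (simp add: lam_def poly_subst_mult F.Psi_cmult)
  \<comment> \<open>The relators are the congruences already established for \<open>unip\<close>;
    their multiples follow because \<open>ann\<close> absorbs the images of all polynomials.\<close>
  have lift_ideal: "F.lift x \<in> F.ann" if "x \<in> PI" for x
  proof -
    have "x \<in> {x. F.lift x \<in> F.ann}"
    proof (rule rep_ideal_induct[OF that])
      show "relators \<subseteq> {x :: ('g, 'n) cpoly. F.lift x \<in> F.ann}"
      proof
        fix y :: "('g, 'n) cpoly" assume "y \<in> relators"
        then consider s where "s \<in> S" "y = Var (DetInv s) * det (gen_mat s :: ('g, 'n) cpoly^'n^'n) - 1"
          | w i j where "word_over w" "word_val \<Gamma> w = \<one>"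
            "y = (word_mat w :: ('g, 'n) cpoly^'n^'n) $ i $ j - mat 1 $ i $ j"
          unfolding relators_def by blast
        then have "F.lift y \<in> F.ann"
        proof cases
          case 1
          have "F.lift (det (gen_mat s :: ('g, 'n) cpoly^'n^'n)) = det (F.unip s)"
            unfolding poly_subst_det F.lift_gen_mat[OF n] ..
          then show ?thesis
            using F.det_unip_inv[OF n, of s] 1 S_sub
            by (auto simp: poly_subst_diff poly_subst_mult F.lift_coord_def F.ann.eqv_def)
        next
          case 2
          have "F.ann.mat_eqv (map_matrix F.lift (word_mat w :: ('g, 'n) cpoly^'n^'n)) (F.unip \<one>)"
            using F.lift_word_mat[OF n word_over_carrier[OF 2(1)]] 2(2) by simp
          then have "F.ann.mat_eqv (map_matrix F.lift (word_mat w :: ('g, 'n) cpoly^'n^'n)) (mat 1)"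
            using F.ann.mat_eqv_trans F.unip_one[OF n] by blast
          moreover have "F.lift ((mat 1 :: ('g, 'n) cpoly^'n^'n) $ i $ j) = mat 1 $ i $ j"
            by (simp add: mat_def)
          ultimately show ?thesis
            by (simp add: 2(3) poly_subst_diff F.ann.mat_eqv_def F.ann.eqv_def)
        qed
        then show "y \<in> {x. F.lift x \<in> F.ann}" by simp
      qed
    qed (auto simp: poly_subst_add poly_subst_mult F.ann.I_zero F.lift_in intro: F.ann.I_add F.ann.I_mult)
    then show ?thesis by simp
  qed
  have lam_eqv: "lam p = lam q" if "I.eqv p q" for p q
  proof -
    have "lam (p - q) = 0"
      unfolding lam_def by (rule F.Psi_ann[OF lift_ideal]) (use that in \<open>simp add: I.eqv_def\<close>)
    then show ?thesis by (simp add: lam_def poly_subst_diff F.Psi_diff)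
  qed
  have lam_prod: "lam (\<Prod>r<k. wtr (w r)) = (if k = 1 then f (word_val \<Gamma> (w 0)) else 0)"
    if "\<And>r. r < k \<Longrightarrow> word_over (w r)" for k and w :: "nat \<Rightarrow> _"
    unfolding lam_def wtr_def by (rule F.Psi_lift_traces[OF n]) (use that word_over_carrier in blast)
  \<comment> \<open>Each trace in \<open>q\<close> is a centred trace plus a constant, and the
    centred part merely lengthens a product that already has at least two factors.\<close>
  have lam_higher: "lam (q * (\<Prod>r<k. wtr (w r))) = 0"
    if "q \<in> trace_polys S TYPE('n)" "k \<ge> 2" "\<And>r. r < k \<Longrightarrow> word_over (w r)"
    for q k and w :: "nat \<Rightarrow> _"
    using that
  proof (induction arbitrary: k w)
    case (trace_polys_Const c)
    then show ?case using lam_prod[of k w] by (simp add: lam_scale)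
  next
    case (trace_polys_add p q)
    then show ?case by (simp add: distrib_right lam_add)
  next
    case (trace_polys_trace p u)
    let ?w = "w(k := u)"
    have "p * trace (word_mat u :: ('g, 'n) cpoly^'n^'n) * (\<Prod>r<k. wtr (w r)) =
      p * (\<Prod>r<Suc k. wtr (?w r)) + Const (of_nat CARD('n)) * (p * (\<Prod>r<k. wtr (w r)))"
      by (simp add: wtr_def[of u] algebra_simps)
    moreover have "lam (p * (\<Prod>r<Suc k. wtr (?w r))) = 0"
    proof (rule trace_polys_trace.IH)
      show "word_over (?w r)" if "r < Suc k" for r
        using trace_polys_trace.prems(2)[of r] trace_polys_trace.hyps(2) that by (cases "r = k") simp_all
    qed (use trace_polys_trace.prems(1) in simp)
    moreover have "lam (p * (\<Prod>r<k. wtr (w r))) = 0"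
      by (rule trace_polys_trace.IH[OF trace_polys_trace.prems])
    ultimately show ?case by (simp only: lam_add lam_scale) simp
  qed
  define Lam where "Lam a = lam (SOME p. a = cl p)" for a
  have Lam_cl: "Lam (cl p) = lam p" for p
  proof -
    have "cl p = cl (SOME q. cl p = cl q)" by (rule someI) (rule refl)
    then show ?thesis unfolding Lam_def cl_eq_iff by (rule lam_eqv[symmetric])
  qed
  have Lam_add: "Lam (a \<oplus>\<^bsub>B\<^esub> b) = Lam a + Lam b" if "a \<in> carrier B" "b \<in> carrier B" for a b
    using that by (auto elim!: B_cases simp: B_add Lam_cl lam_add)
  have Lam_zero: "Lam \<zero>\<^bsub>B\<^esub> = 0" using Lam_cl[of 0] by (simp add: B_ops lam_def)
  have Lam_scale: "Lam (cl (Const c) \<otimes>\<^bsub>B\<^esub> a) = c * Lam a" if "a \<in> carrier B" for c a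
    using that by (auto elim!: B_cases simp: B_mult Inv_Const Lam_cl lam_scale)
  have Lam_ct: "Lam (ct \<gamma>) = f \<gamma>" if g: "\<gamma> \<in> carrier \<Gamma>" for \<gamma>
  proof -
    obtain w where w: "word_over w" "\<gamma> = word_val \<Gamma> w" "ct \<gamma> = cl (wtr w)" using g by (rule ct_cases)
    then show ?thesis using lam_prod[of 1 "\<lambda>_. w"] by (simp add: Lam_cl)
  qed
  have Lam_ct2: "Lam (b \<otimes>\<^bsub>B\<^esub> ct \<gamma> \<otimes>\<^bsub>B\<^esub> ct \<delta>) = 0"
    if b: "b \<in> carrier B" and g: "\<gamma> \<in> carrier \<Gamma>" and d: "\<delta> \<in> carrier \<Gamma>" for b \<gamma> \<delta>
  proof -
    obtain q where q: "q \<in> trace_polys S TYPE('n)" "b = cl q" using b by (rule B_trace_poly)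
    obtain u where u: "word_over u" "ct \<gamma> = cl (wtr u)" using g by (rule ct_cases)
    obtain w where w: "word_over w" "ct \<delta> = cl (wtr w)" using d by (rule ct_cases)
    have "b \<otimes>\<^bsub>B\<^esub> ct \<gamma> \<otimes>\<^bsub>B\<^esub> ct \<delta> = cl (q * (\<Prod>r<(2::nat). wtr (if r = 0 then u else w)))"
      using trace_polys_Inv[OF q(1)] wtr_Inv[OF u(1)] wtr_Inv[OF w(1)]
      by (simp add: q u w B_mult Inv_mult numeral_2_eq_2 mult.assoc)
    then show ?thesis
      using lam_higher[OF q(1), of 2 "\<lambda>r. if r = 0 then u else w"] u w by (simp add: Lam_cl)
  qed
  \<comment> \<open>Passage from generators to all of \<open>m\<close>, here for the second factor
    and in \<open>Lam_prod\<close> for the first. The free factor \<open>b\<close> is what makes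
    \<open>?J\<close> an ideal.\<close>
  have ct_mm': "Lam (b \<otimes>\<^bsub>B\<^esub> ct \<gamma> \<otimes>\<^bsub>B\<^esub> y) = 0"
    if "b \<in> carrier B" "\<gamma> \<in> carrier \<Gamma>" "y \<in> mm" for b \<gamma> y
  proof -
    let ?J = "{y \<in> carrier B. \<forall>b\<in>carrier B. \<forall>\<gamma>\<in>carrier \<Gamma>. Lam (b \<otimes>\<^bsub>B\<^esub> ct \<gamma> \<otimes>\<^bsub>B\<^esub> y) = 0}"
    have "ideal ?J B"
    proof (rule B.idealI_closed)
      show "\<zero>\<^bsub>B\<^esub> \<in> ?J" using ct_in_B by (simp add: Lam_zero)
      show "y \<oplus>\<^bsub>B\<^esub> z \<in> ?J" if "y \<in> ?J" "z \<in> ?J" for y z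
        using that ct_in_B by (simp add: B.r_distr Lam_add)
      show "x \<otimes>\<^bsub>B\<^esub> y \<in> ?J" if x: "x \<in> carrier B" and y: "y \<in> ?J" for x y
      proof -
        have "Lam (b \<otimes>\<^bsub>B\<^esub> ct \<gamma> \<otimes>\<^bsub>B\<^esub> (x \<otimes>\<^bsub>B\<^esub> y)) = 0" if "b \<in> carrier B" "\<gamma> \<in> carrier \<Gamma>" for b \<gamma>
        proof -
          have "b \<otimes>\<^bsub>B\<^esub> ct \<gamma> \<otimes>\<^bsub>B\<^esub> (x \<otimes>\<^bsub>B\<^esub> y) = (b \<otimes>\<^bsub>B\<^esub> x) \<otimes>\<^bsub>B\<^esub> ct \<gamma> \<otimes>\<^bsub>B\<^esub> y"
            using that x y ct_in_B by (simp add: B.m_ac)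
          then show ?thesis using y that x by simp
        qed
        then show ?thesis using x y by simp
      qed
    qed auto
    then have "mm \<subseteq> ?J"
      by (rule mm_minimal) (use ct_in_B Lam_ct2 in simp)
    then show ?thesis using that by blast
  qed
  have Lam_prod: "Lam (x \<otimes>\<^bsub>B\<^esub> y) = 0" if "x \<in> mm" "y \<in> mm" for x y
  proof -
    let ?J = "{x \<in> carrier B. \<forall>y\<in>mm. Lam (x \<otimes>\<^bsub>B\<^esub> y) = 0}"
    have "ideal ?J B"
    proof (rule B.idealI_closed)
      show "\<zero>\<^bsub>B\<^esub> \<in> ?J" using mm_sub by (simp add: Lam_zero)
      show "x \<oplus>\<^bsub>B\<^esub> z \<in> ?J" if "x \<in> ?J" "z \<in> ?J" for x z
        using that mm_sub by (simp add: B.l_distr Lam_add)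
      show "b \<otimes>\<^bsub>B\<^esub> x \<in> ?J" if b: "b \<in> carrier B" and x: "x \<in> ?J" for x b
      proof -
        have "Lam (b \<otimes>\<^bsub>B\<^esub> x \<otimes>\<^bsub>B\<^esub> y) = 0" if y: "y \<in> mm" for y
        proof -
          have "b \<otimes>\<^bsub>B\<^esub> x \<otimes>\<^bsub>B\<^esub> y = x \<otimes>\<^bsub>B\<^esub> (b \<otimes>\<^bsub>B\<^esub> y)" using b x mm_sub[OF y] by (simp add: B.m_ac)
          then show ?thesis using x mm_mult[OF b y] by simp
        qed
        then show ?thesis using b x by simp
      qed
    qed auto
    moreover have "ct \<gamma> \<in> ?J" if "\<gamma> \<in> carrier \<Gamma>" for \<gamma>
      using ct_mm'[OF B.one_closed that] ct_in_B[OF that] by simp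
    ultimately have "mm \<subseteq> ?J" by (rule mm_minimal)
    then show ?thesis using that by blast
  qed
  have Lam_mm2: "Lam x = 0" if "x \<in> mm2" for x
  proof -
    have "x \<in> carrier B \<and> Lam x = 0"
      using that unfolding trivial_ideal_sq_def
      by induction (auto simp: Lam_prod Lam_add mm_sub)
    then show ?thesis by simp
  qed
  \<comment> \<open>The representative is immaterial, since two of them differ by an element of
    \<open>m\<^sup>2\<close>, where \<open>Lam\<close> vanishes.\<close>
  define v where "v x = (if x \<in> cotangent_space \<Gamma> S then Lam (SOME a. a \<in> mm \<and> x = sq a) else 0)" for x
  have v_sq: "v (sq a) = Lam a" if a: "a \<in> mm" for a
  proof -
    define b where "b = (SOME b. b \<in> mm \<and> sq a = sq b)"
    have b: "b \<in> mm" "sq a = sq b"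
      using someI_ex[of "\<lambda>b. b \<in> mm \<and> sq a = sq b"] a by (auto simp: b_def)
    have "a \<ominus>\<^bsub>B\<^esub> b \<in> mm2" using b(2) sq_eq_iff[OF mm_sub[OF a] mm_sub[OF b(1)]] by simp
    then have "Lam (a \<ominus>\<^bsub>B\<^esub> b) = 0" by (rule Lam_mm2)
    moreover have "a = (a \<ominus>\<^bsub>B\<^esub> b) \<oplus>\<^bsub>B\<^esub> b"
      using mm_sub[OF a] mm_sub[OF b(1)] by (simp add: a_minus_def B.a_assoc B.l_neg)
    ultimately have "Lam a = Lam b"
      using Lam_add[of "a \<ominus>\<^bsub>B\<^esub> b" b] mm_sub[OF a] mm_sub[OF b(1)] by simp
    moreover have "sq a \<in> cotangent_space \<Gamma> S" using a by (simp add: cotangent_space_def)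
    ultimately show ?thesis by (simp add: v_def b_def)
  qed
  have "v \<in> Tan"
    unfolding tangent_space_def
  proof (intro CollectI conjI ballI allI impI)
    fix x y :: "('g, 'n) cpoly set set" assume "x \<in> cotangent_space \<Gamma> S" "y \<in> cotangent_space \<Gamma> S"
    then obtain a b where ab: "a \<in> mm" "b \<in> mm" "x = sq a" "y = sq b" by (auto simp: cotangent_space_def)
    then show "v (x \<oplus>\<^bsub>square_quotient \<Gamma> S\<^esub> y) = v x + v y"
      by (simp add: sq_add mm_sub v_sq mm_add Lam_add)
  next
    fix c and x :: "('g, 'n) cpoly set set" assume "x \<in> cotangent_space \<Gamma> S"
    then obtain a where a: "a \<in> mm" "x = sq a" by (auto simp: cotangent_space_def)
    then show "v (cotangent_scale \<Gamma> S c x) = c * v x"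
      using mm_mult[OF cl_in_B[OF Inv_Const[of c]] a(1)]
      by (simp add: cotangent_scale_sq mm_sub v_sq Lam_scale)
  qed (simp add: v_def)
  moreover have "v (sq (ct \<gamma>)) = f \<gamma>" if "\<gamma> \<in> carrier \<Gamma>" for \<gamma>
    by (simp add: v_sq ct_mm that Lam_ct)
  ultimately show ?thesis by blast
qed

section \<open>From a tangent vector to a central solution\<close>

definition umat :: "'g \<Rightarrow> ('g, 'n) cpoly^'n^'n"
  where "umat \<gamma> = word_mat (word_of \<gamma>) - mat 1"

definition uprod :: "'g list \<Rightarrow> ('g, 'n) cpoly^'n^'n"
  where "uprod ls = foldr (\<lambda>\<gamma> M. umat \<gamma> ** M) ls (mat 1)"

lemma uprod_simps [simp]: "uprod [] = mat 1" "uprod (\<gamma> # ls) = umat \<gamma> ** uprod ls"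
  by (simp_all add: uprod_def)

lemma uprod_append: "uprod (xs @ ys) = uprod xs ** uprod ys"
  by (induction xs) (simp_all add: matrix_mul_assoc)

lemma matrix_diff_distribs:
  fixes P Q R :: "('g, 'n) cpoly^'n^'n"
  shows "P ** (Q - R) = P ** Q - P ** R" "(Q - R) ** P = Q ** P - R ** P"
  by (simp_all add: matrix_matrix_mult_def vec_eq_iff sum_subtractf right_diff_distrib left_diff_distrib)

lemma trace_diff: "trace (P - Q) = trace P - trace (Q :: ('g, 'n) cpoly^'n^'n)"
  by (simp add: trace_def sum_subtractf)

context
  fixes v assumes v: "v \<in> Tan"
begin

definition tfun :: "'g \<Rightarrow> complex"
  where "tfun \<gamma> = (if \<gamma> \<in> carrier \<Gamma> then v (sq (ct \<gamma>)) else 0)"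

definition MM :: "('g, 'n) cpoly set"
  where "MM = {p \<in> Inv. cl p \<in> mm}"

definition pval :: "('g, 'n) cpoly \<Rightarrow> complex"
  where "pval p = v (sq (cl p))"

lemma MM_wtr: "word_over w \<Longrightarrow> wtr w \<in> MM"
  using wtr_Inv ct_mm[OF word_val_closed[OF word_over_carrier]] ct_word by (simp add: MM_def)

lemma pval_wtr: "word_over w \<Longrightarrow> pval (wtr w) = tfun (word_val \<Gamma> w)"
  using word_val_closed[OF word_over_carrier] by (simp add: pval_def tfun_def ct_word)

lemma MM_add: "p \<in> MM \<Longrightarrow> q \<in> MM \<Longrightarrow> p + q \<in> MM"
  using mm_add[of "cl p" "cl q"] by (simp add: MM_def Inv_add B_add)

lemma MM_mult: "p \<in> Inv \<Longrightarrow> q \<in> MM \<Longrightarrow> p * q \<in> MM"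
  using mm_mult[of "cl p" "cl q"] by (simp add: MM_def Inv_mult B_mult cl_in_B)

lemma MM_zero: "0 \<in> MM"
  using mm_zero by (simp add: MM_def Inv_0 B_ops)

lemma pval_add: "p \<in> MM \<Longrightarrow> q \<in> MM \<Longrightarrow> pval (p + q) = pval p + pval q"
  using val_add[OF v, of "cl p" "cl q"] by (simp add: MM_def pval_def val_def[OF v] B_add)

lemma pval_scale: "p \<in> MM \<Longrightarrow> pval (Const c * p) = c * pval p"
  using val_scale[OF v, of "cl p" c] by (simp add: MM_def pval_def val_def[OF v] B_mult Inv_Const)

lemma pval_mult: "p \<in> MM \<Longrightarrow> q \<in> MM \<Longrightarrow> pval (p * q) = 0"
  using val_prod[OF v, of "cl p" "cl q"] by (simp add: MM_def pval_def val_def[OF v] B_mult)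

lemma MM_diff: "p \<in> MM \<Longrightarrow> q \<in> MM \<Longrightarrow> p - q \<in> MM"
  using MM_add[OF _ MM_mult[OF Inv_Const[of "-1"]], of p q] by (simp add: Const_uminus)

lemma pval_diff: "p \<in> MM \<Longrightarrow> q \<in> MM \<Longrightarrow> pval (p - q) = pval p - pval q"
  using pval_add[OF _ MM_mult[OF Inv_Const[of "-1"]], of p q] pval_scale[of q "-1"]
  by (simp add: Const_uminus)

lemma pval_zero: "pval 0 = 0"
  using pval_scale[OF MM_zero, of 0] by simp

lemma pval_sum: "(\<And>x. x \<in> X' \<Longrightarrow> g x \<in> MM) \<Longrightarrow> sum g X' \<in> MM \<and> pval (sum g X') = (\<Sum>x\<in>X'. pval (g x))"
  by (induction X' rule: infinite_finite_induct) (simp_all add: MM_zero pval_zero MM_add pval_add)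

lemma tfun_one: "tfun \<one> = 0"
  using pval_wtr[of "[]"] pval_zero by (simp add: word_val_def wtr_def trace_mat_one Const_of_nat)

lemma tfun_central: "central_function \<Gamma> tfun"
  unfolding central_function_def
proof (intro ballI)
  fix \<gamma> \<delta> assume g: "\<gamma> \<in> carrier \<Gamma>" and d: "\<delta> \<in> carrier \<Gamma>"
  note w = word_of[OF g] word_of[OF d] word_of[OF inv_closed[OF d]]
  let ?a = "word_of \<delta> @ (word_of \<gamma> @ word_of (inv \<delta>))"
  let ?b = "(word_of \<gamma> @ word_of (inv \<delta>)) @ word_of \<delta>"
  have o: "word_over ?a" "word_over ?b" using w by auto
  have "word_val \<Gamma> ?a = \<delta> \<otimes> (\<gamma> \<otimes> inv \<delta>)" "word_val \<Gamma> ?b = \<gamma> \<otimes> inv \<delta> \<otimes> \<delta>"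
    using w word_over_carrier g d by (simp_all add: word_val_append m_assoc)
  then have vals: "word_val \<Gamma> ?a = \<delta> \<otimes> \<gamma> \<otimes> inv \<delta>" "word_val \<Gamma> ?b = \<gamma>"
    using g d by (simp_all add: m_assoc)
  have "wtr ?a = wtr ?b"
    unfolding wtr_def word_mat_append[of "word_of \<delta>"] word_mat_append[of _ "word_of \<delta>"]
    by (simp only: trace_mul_sym[of "word_mat (word_of \<delta>)"])
  then show "tfun (\<delta> \<otimes> \<gamma> \<otimes> inv \<delta>) = tfun \<gamma>"
    using pval_wtr[OF o(1)] pval_wtr[OF o(2)] by (simp only: vals)
qed

text \<open>The prefix \<open>u\<close> lets the induction expand one factor
  \<open>\<rho>(x) - 1\<close> at a time: its two terms extend \<open>u\<close> by a word for
  \<open>x\<close> or leave it unchanged. Only the empty product needs the constant \<open>n\<close>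
  subtracted; with at least one factor the constants of the two terms cancel, and the trace itself
  lies in \<open>m\<close>.\<close>

lemma pval_uprod_aux:
  assumes "word_over u" "set ls \<subseteq> carrier \<Gamma>"
  defines "P \<equiv> \<lambda>u ls. trace (word_mat u ** uprod ls) - (if ls = [] then Const (of_nat CARD('n)) else 0)"
  shows "P u ls \<in> MM \<and> pval (P u ls) = alt_sum (\<lambda>ys. tfun (word_val \<Gamma> u \<otimes> foldr (\<otimes>) ys \<one>)) ls"
  using assms(1,2)
proof (induction ls arbitrary: u)
  case Nil
  have "P u [] = wtr u" by (simp add: P_def wtr_def)
  then show ?case
    using MM_wtr pval_wtr Nil word_val_closed[OF word_over_carrier[OF Nil(1)]] by simp
next
  case (Cons x ls)
  have x: "x \<in> carrier \<Gamma>" and ls: "set ls \<subseteq> carrier \<Gamma>" using Cons.prems by auto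
  have ux: "word_over (u @ word_of x)" using Cons.prems(1) word_of[OF x] by auto
  have vux: "word_val \<Gamma> (u @ word_of x) = word_val \<Gamma> u \<otimes> x"
    using word_of[OF x] Cons.prems(1) word_over_carrier by (simp add: word_val_append)
  have P: "P u (x # ls) = P (u @ word_of x) ls - P u ls"
    by (simp add: P_def umat_def matrix_diff_distribs trace_diff word_mat_append matrix_mul_assoc)
  have "alt_sum (\<lambda>ys. tfun (word_val \<Gamma> (u @ word_of x) \<otimes> foldr (\<otimes>) ys \<one>)) ls =
    alt_sum (\<lambda>ys. tfun (word_val \<Gamma> u \<otimes> foldr (\<otimes>) (x # ys) \<one>)) ls"
  proof (rule alt_sum_cong)
    fix ys assume "set ys \<subseteq> set ls"
    then have "foldr (\<otimes>) ys \<one> \<in> carrier \<Gamma>" using ls by (intro foldr_mult_closed) auto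
    then show "tfun (word_val \<Gamma> (u @ word_of x) \<otimes> foldr (\<otimes>) ys \<one>) =
      tfun (word_val \<Gamma> u \<otimes> foldr (\<otimes>) (x # ys) \<one>)"
      using word_val_closed[OF word_over_carrier[OF Cons.prems(1)]] x by (simp add: vux m_assoc)
  qed
  then show ?case
    using Cons.IH[OF ux ls] Cons.IH[OF Cons.prems(1) ls] unfolding P
    by (simp add: MM_diff pval_diff)
qed

lemma pval_uprod:
  assumes "set ls \<subseteq> carrier \<Gamma>" "ls \<noteq> []"
  shows "trace (uprod ls) \<in> MM" "pval (trace (uprod ls)) = aug_form \<Gamma> tfun ls"
proof -
  have "alt_sum (\<lambda>ys. tfun (\<one> \<otimes> foldr (\<otimes>) ys \<one>)) ls = aug_form \<Gamma> tfun ls"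
    unfolding aug_form_def using assms(1)
    by (auto intro!: alt_sum_cong simp: foldr_mult_closed subset_trans)
  then show "trace (uprod ls) \<in> MM" "pval (trace (uprod ls)) = aug_form \<Gamma> tfun ls"
    using pval_uprod_aux[of "[]" ls] assms by (simp_all add: word_val_def)
qed

interpretation T: trace_form "aug_form \<Gamma> tfun"
  by (rule trace_form_aug_form[OF tfun_central])

text \<open>Modulo \<open>m\<^sup>2\<close>, only full cycles contribute to the trace of a permutation.\<close>

lemma pval_perm_trace:
  fixes K :: "nat set"
  assumes "finite K" "K \<noteq> {}" "\<sigma> permutes K" "\<And>r. r \<in> K \<Longrightarrow> set (w r) \<subseteq> carrier \<Gamma> \<and> w r \<noteq> []"
  shows "perm_trace K (\<lambda>r. uprod (w r)) \<sigma> \<in> MM \<and>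
    pval (perm_trace K (\<lambda>r. uprod (w r)) \<sigma>) = T.cyc_val K w \<sigma>"
  using assms
proof (induction "card K" arbitrary: K \<sigma> w rule: less_induct)
  case less
  obtain p where p: "p \<in> K" using less.prems(2) by blast
  define q where "q = \<sigma> p"
  have q: "q \<in> K" using p less.prems(3) by (simp add: q_def permutes_in_image)
  have card: "card (K - {q}) < card K" using less.prems(1) q by (rule card_Diff1_less)
  have uq: "trace (uprod (w q)) \<in> MM" "pval (trace (uprod (w q))) = aug_form \<Gamma> tfun (w q)"
    using pval_uprod less.prems(4)[OF q] by auto
  show ?case
  proof (cases "p = q")
    case True
    then have fixd: "\<sigma> q = q" by (simp add: q_def)
    have eq: "perm_trace K (\<lambda>r. uprod (w r)) \<sigma> =
        trace (uprod (w q)) * perm_trace (K - {q}) (\<lambda>r. uprod (w r)) \<sigma>"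
      by (rule perm_trace_fixed[OF less.prems(1) q fixd less.prems(3)])
    show ?thesis
    proof (cases "K = {q}")
      case True
      then show ?thesis using eq uq T.cyc_val_single[of \<sigma> q w] fixd by simp
    next
      case False
      have \<sigma>: "\<sigma> permutes (K - {q})"
        by (rule permutes_superset[OF less.prems(3)]) (use fixd in auto)
      have M: "perm_trace (K - {q}) (\<lambda>r. uprod (w r)) \<sigma> \<in> MM"
        using less.hyps[OF card _ _ \<sigma>, of w] less.prems q False by auto
      moreover have "trace (uprod (w q)) \<in> Inv" using uq(1) by (simp add: MM_def)
      ultimately show ?thesis
        using uq(1) MM_mult pval_mult T.cyc_val_fixed[of \<sigma> q K, OF fixd q False] by (simp add: eq)
    qed
  next
    case False
    let ?w = "w(p := w p @ w q)"
    have "perm_trace K (\<lambda>r. uprod (w r)) \<sigma> =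
      perm_trace (K - {q}) ((\<lambda>r. uprod (w r))(p := uprod (w p) ** uprod (w q)))
        (\<sigma> \<circ> Transposition.transpose p q)"
      by (rule perm_trace_contract[OF less.prems(1) p q_def[symmetric] False less.prems(3)])
    also have "(\<lambda>r. uprod (w r))(p := uprod (w p) ** uprod (w q)) = (\<lambda>r. uprod (?w r))"
      by (auto simp: fun_eq_iff uprod_append)
    finally have eq: "perm_trace K (\<lambda>r. uprod (w r)) \<sigma> =
      perm_trace (K - {q}) (\<lambda>r. uprod (?w r)) (\<sigma> \<circ> Transposition.transpose p q)" .
    have "perm_trace (K - {q}) (\<lambda>r. uprod (?w r)) (\<sigma> \<circ> Transposition.transpose p q) \<in> MM \<and>
      pval (perm_trace (K - {q}) (\<lambda>r. uprod (?w r)) (\<sigma> \<circ> Transposition.transpose p q)) =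
      T.cyc_val (K - {q}) ?w (\<sigma> \<circ> Transposition.transpose p q)"
      by (rule less.hyps[OF card _ _ permutes_contract[OF less.prems(3) q_def[symmetric] p]])
        (use less.prems p q False in auto)
    then show ?thesis
      unfolding eq using T.cyc_val_contract[of \<sigma> p q K w, OF q_def[symmetric] False p q] by simp
  qed
qed

lemma tfun_solution: "tfun \<in> central_solutions \<Gamma> CARD('n)"
proof -
  let ?n = "CARD('n)" and ?K = "{0..CARD('n)}"
  have "central_sum \<Gamma> ?n tfun \<gamma> = 0" if \<gamma>: "\<And>i. i \<le> ?n \<Longrightarrow> \<gamma> i \<in> carrier \<Gamma>" for \<gamma>
  proof -
    let ?w = "\<lambda>r. [\<gamma> r]"
    have pt: "perm_trace ?K (\<lambda>r. uprod (?w r)) \<sigma> \<in> MM"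
      "pval (perm_trace ?K (\<lambda>r. uprod (?w r)) \<sigma>) = T.cyc_val ?K ?w \<sigma>" if "\<sigma> permutes ?K" for \<sigma>
      using pval_perm_trace[OF _ _ that, of ?w] \<gamma> by auto
    have sgn_Const: "of_int (sign \<sigma>) = (Const (of_int (sign \<sigma>)) :: ('g, 'n) cpoly)" for \<sigma> :: "nat \<Rightarrow> nat"
      by (simp add: Const_def)
    have "0 = pval (\<Sum>\<sigma> | \<sigma> permutes ?K. of_int (sign \<sigma>) * perm_trace ?K (\<lambda>r. uprod (?w r)) \<sigma>)"
      by (subst perm_trace_alternating) (simp_all add: pval_zero)
    also have "\<dots> = (\<Sum>\<sigma> | \<sigma> permutes ?K. pval (of_int (sign \<sigma>) * perm_trace ?K (\<lambda>r. uprod (?w r)) \<sigma>))"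
      unfolding sgn_Const by (rule conjunct2[OF pval_sum]) (intro MM_mult Inv_Const pt(1), simp)
    also have "\<dots> = (\<Sum>\<sigma> | \<sigma> permutes ?K. of_int (sign \<sigma>) * T.cyc_val ?K ?w \<sigma>)"
      by (rule sum.cong[OF refl]) (simp only: sgn_Const pval_scale pt mem_Collect_eq)
    finally have "(\<Sum>ls\<in>permutations_of_set ?K. aug_form \<Gamma> tfun (concat (map ?w ls))) = 0"
      using T.sum_sign_cyc_val[of ?K ?w] by simp
    moreover have "concat (map ?w ls) = map \<gamma> ls" for ls by (induction ls) auto
    ultimately have "(\<Sum>ls\<in>permutations_of_set ?K. aug_form \<Gamma> tfun (map \<gamma> ls)) = 0" by simp
    \<comment> \<open>The term \<open>k = 0\<close>, absent from the equation, is
      \<open>tfun \<one>\<close> and vanishes, so the symmetrized sum is a nonzero multiple of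
      \<open>central_sum\<close>.\<close>
    then show ?thesis
      by (subst (asm) sum_aug_form_permutations[OF \<gamma>]) (simp_all add: tfun_one del: fact_Suc)
  qed
  then show ?thesis
    using tfun_central by (simp add: central_solutions_def central_sum_def tfun_def)
qed

end

end

section \<open>Linearity of the equation and the isomorphism\<close>

lemma central_solutions_iff:
  "f \<in> central_solutions \<Gamma> n \<longleftrightarrow> central_function \<Gamma> f \<and>
    (\<forall>\<gamma>. (\<forall>i\<le>n. \<gamma> i \<in> carrier \<Gamma>) \<longrightarrow> central_sum \<Gamma> n f \<gamma> = 0) \<and> (\<forall>\<gamma>. \<gamma> \<notin> carrier \<Gamma> \<longrightarrow> f \<gamma> = 0)"
  by (simp add: central_solutions_def central_sum_def)

lemma central_sum_add:
  "central_sum \<Gamma> n (\<lambda>x. f x + g x) \<gamma> = central_sum \<Gamma> n f \<gamma> + central_sum \<Gamma> n g \<gamma>"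
  by (simp only: central_sum_def distrib_left sum.distrib)

lemma central_sum_cmult: "central_sum \<Gamma> n (\<lambda>x. c * f x) \<gamma> = c * central_sum \<Gamma> n f \<gamma>"
  by (simp only: central_sum_def mult.left_commute[of _ c] sum_distrib_left)

lemma central_sum_zero: "central_sum \<Gamma> n (\<lambda>x. 0) \<gamma> = 0"
  by (simp only: central_sum_def mult_zero_right sum.neutral_const)

theorem corollary1p8:
  fixes \<Gamma> :: "('g, 'z) monoid_scheme" and S :: "'g set"
  assumes "group \<Gamma>"
    and "finite S" and "S \<subseteq> carrier \<Gamma>" and "generate \<Gamma> S = carrier \<Gamma>"
  shows "linear_iso_betw
    (\<lambda>(v :: ('g, 'n::finite) cpoly set set \<Rightarrow> complex) \<gamma>.
       if \<gamma> \<in> carrier \<Gamma> then v (square_class \<Gamma> S (centred_trace \<Gamma> S \<gamma>)) else 0)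
    (tangent_space \<Gamma> S)
    (central_solutions \<Gamma> CARD('n))"
proof -
  interpret group \<Gamma> by fact
  interpret invariant_setting \<Gamma> S "TYPE('n)" by unfold_locales (use assms in auto)
  let ?\<Phi> = "\<lambda>(v :: ('g, 'n) cpoly set set \<Rightarrow> complex) \<gamma>.
    if \<gamma> \<in> carrier \<Gamma> then v (square_class \<Gamma> S (centred_trace \<Gamma> S \<gamma>)) else 0"
  have tan: "function_space Tan"
    by (auto simp: function_space_def tangent_space_def algebra_simps)
  have sol: "function_space (central_solutions \<Gamma> CARD('n))"
    by (auto simp: function_space_def central_solutions_iff central_function_def central_sum_add
        central_sum_cmult central_sum_zero)
  have "bij_betw ?\<Phi> Tan (central_solutions \<Gamma> CARD('n))"
  proof (rule bij_betw_imageI)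
    show "inj_on ?\<Phi> Tan"
      by (rule inj_onI, rule tangent_eqI) (auto dest: fun_cong split: if_splits)
    show "?\<Phi> ` Tan = central_solutions \<Gamma> CARD('n)"
    proof (intro equalityI subsetI)
      fix f assume "f \<in> ?\<Phi> ` Tan"
      then obtain v where "v \<in> Tan" "f = tfun v" by (auto simp: tfun_def fun_eq_iff)
      then show "f \<in> central_solutions \<Gamma> CARD('n)" using tfun_solution by simp
    next
      fix f assume f: "f \<in> central_solutions \<Gamma> CARD('n)"
      then obtain v where v: "v \<in> Tan" "\<forall>\<gamma>\<in>carrier \<Gamma>. v (sq (ct \<gamma>)) = f \<gamma>"
        using tangent_of_solution by blast
      have "f = ?\<Phi> v" using f v(2) by (auto simp: fun_eq_iff central_solutions_def)
      then show "f \<in> ?\<Phi> ` Tan" using v(1) by blast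
    qed
  qed
  with tan sol show ?thesis by (auto simp: linear_iso_betw_def fun_eq_iff)
qed

end
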